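(* Let $L>0$ and $\mathbb{T}^2=\mathbb{R}^2/(L\mathbb{Z})^2$. Let (scalar) initial data $\phi_0\in L^2(\mathbb{T}^2)$ be given, and let $T>0$, $\epsilon>0$ be fixed. Suppose $\boldsymbol{\eta}^\epsilon:\mathbb{R}^2\to\mathbb{R}^2$ is bounded and Lipschitz continuous with Lipschitz constant $1$. Then weak solutions on $[0,T]$ of the scalar calmed Kuramoto-Sivashinsky equation $$\partial_t\phi+\tfrac12(\boldsymbol{\eta}^\epsilon(\nabla\phi)\cdot\nabla)\phi+\triangle\phi+\triangle^2\phi=0,\qquad \phi(\mathbf{x},0)=\phi_0(\mathbf{x}),$$ with periodic boundary conditions on $\mathbb{T}^2$ exist, are unique, and depend continuously on the initial data (in $L^2(\mathbb{T}^2)$) in $L^\infty(0,T;L^2(\mathbb{T}^2))\cap L^2(0,T;H^2(\mathbb{T}^2))$.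
   Context: Functions are real, scalar-valued and periodic. Given $\phi_0\in L^2(\mathbb{T}^2)$ and $T>0$, a weak solution of the scalar calmed equation on $[0,T]$ is a function $\phi\in L^2([0,T];H^2(\mathbb{T}^2))\cap C([0,T];L^2(\mathbb{T}^2))$ with $\partial_t\phi\in L^2(0,T;H^{-2}(\mathbb{T}^2))$ such that the equation holds in the sense of $L^2(0,T;H^{-2}(\mathbb{T}^2))$ and the initial condition holds in the sense of $C([0,T];L^2(\mathbb{T}^2))$. Here $(\boldsymbol{\eta}^\epsilon(\nabla\phi)\cdot\nabla)\phi=\boldsymbol{\eta}^\epsilon(\nabla\phi)\cdot\nabla\phi$. *)

theory Defs
  imports "HOL-Analysis.Analysis" "HOL-Probability.Essential_Supremum"
begin

text \<open>
  Functions on the torus of side \<open>L\<close> are \<open>L\<close>-periodic functions on \<open>real^2\<close>, integrated over the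
  fundamental cell. Elements of \<open>L\<^sup>2\<close>, \<open>H\<^sup>m\<close> are represented by functions, so equality in
  these spaces is almost-everywhere equality.
\<close>

definition periodic :: "real \<Rightarrow> (real^2 \<Rightarrow> real) \<Rightarrow> bool" where
  "periodic L u \<longleftrightarrow> (\<forall>x i. u (x + L *\<^sub>R axis i 1) = u x)"

definition torus :: "real \<Rightarrow> (real^2) measure" where
  "torus L = lebesgue_on (cbox 0 (\<chi> i. L))"

definition L2 :: "real \<Rightarrow> (real^2 \<Rightarrow> real) set" where
  "L2 L = {u. periodic L u \<and> u \<in> borel_measurable (torus L) \<and> integrable (torus L) (\<lambda>x. (u x)\<^sup>2)}"

definition L2_inner :: "real \<Rightarrow> (real^2 \<Rightarrow> real) \<Rightarrow> (real^2 \<Rightarrow> real) \<Rightarrow> real" where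
  "L2_inner L u v = (\<integral>x. u x * v x \<partial>torus L)"

definition L2_norm :: "real \<Rightarrow> (real^2 \<Rightarrow> real) \<Rightarrow> real" where
  "L2_norm L u = sqrt (L2_inner L u u)"

definition partial :: "2 \<Rightarrow> (real^2 \<Rightarrow> real) \<Rightarrow> real^2 \<Rightarrow> real" where
  "partial i f = (\<lambda>x. frechet_derivative f (at x) (axis i 1))"

text \<open>A function is \<open>C\<^sup>\<infinity>\<close> iff all its iterated partial derivatives, in any order, are
  differentiable everywhere.\<close>

definition smooth :: "(real^2 \<Rightarrow> real) \<Rightarrow> bool" where
  "smooth f \<longleftrightarrow> (\<forall>is x. foldr partial is f differentiable (at x))"

definition mpartial :: "nat \<times> nat \<Rightarrow> (real^2 \<Rightarrow> real) \<Rightarrow> real^2 \<Rightarrow> real" where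
  "mpartial \<alpha> f = (partial 1 ^^ fst \<alpha>) ((partial 2 ^^ snd \<alpha>) f)"

definition has_weak_deriv :: "real \<Rightarrow> nat \<times> nat \<Rightarrow> (real^2 \<Rightarrow> real) \<Rightarrow> (real^2 \<Rightarrow> real) \<Rightarrow> bool" where
  "has_weak_deriv L \<alpha> u w \<longleftrightarrow>
     (\<forall>\<psi>. periodic L \<psi> \<and> smooth \<psi> \<longrightarrow>
        L2_inner L u (mpartial \<alpha> \<psi>) = (-1) ^ (fst \<alpha> + snd \<alpha>) * L2_inner L w \<psi>)"

definition multi_indices :: "nat \<Rightarrow> (nat \<times> nat) set" where
  "multi_indices m = {\<alpha>. fst \<alpha> + snd \<alpha> \<le> m}"

definition Hm :: "real \<Rightarrow> nat \<Rightarrow> (real^2 \<Rightarrow> real) set" where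
  "Hm L m = {u \<in> L2 L. \<forall>\<alpha> \<in> multi_indices m. \<exists>w \<in> L2 L. has_weak_deriv L \<alpha> u w}"

text \<open>Weak derivatives are unique up to null sets; \<open>weak_deriv\<close> picks a representative and is
  meaningful only if a weak derivative in \<open>L\<^sup>2\<close> exists.\<close>

definition weak_deriv :: "real \<Rightarrow> nat \<times> nat \<Rightarrow> (real^2 \<Rightarrow> real) \<Rightarrow> real^2 \<Rightarrow> real" where
  "weak_deriv L \<alpha> u = (SOME w. w \<in> L2 L \<and> has_weak_deriv L \<alpha> u w)"

definition Hm_norm :: "real \<Rightarrow> nat \<Rightarrow> (real^2 \<Rightarrow> real) \<Rightarrow> real" where
  "Hm_norm L m u = sqrt (\<Sum>\<alpha>\<in>multi_indices m. (L2_norm L (weak_deriv L \<alpha> u))\<^sup>2)"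

definition grad :: "real \<Rightarrow> (real^2 \<Rightarrow> real) \<Rightarrow> real^2 \<Rightarrow> real^2" where
  "grad L u x = vector [weak_deriv L (1, 0) u x, weak_deriv L (0, 1) u x]"

definition laplacian :: "real \<Rightarrow> (real^2 \<Rightarrow> real) \<Rightarrow> real^2 \<Rightarrow> real" where
  "laplacian L u x = weak_deriv L (2, 0) u x + weak_deriv L (0, 2) u x"

text \<open>\<open>H\<^sup>-\<^sup>2\<close> is the dual of \<open>H\<^sup>2\<close>. A functional is represented by a function on all of
  \<open>real^2 \<Rightarrow> real\<close>, of which only the values on \<open>H\<^sup>2\<close> matter.\<close>

definition Hneg2 :: "real \<Rightarrow> ((real^2 \<Rightarrow> real) \<Rightarrow> real) set" where
  "Hneg2 L = {F.
     (\<forall>u \<in> Hm L 2. \<forall>v \<in> Hm L 2. \<forall>a b. F (\<lambda>x. a * u x + b * v x) = a * F u + b * F v) \<and>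
     (\<exists>C. \<forall>v \<in> Hm L 2. \<bar>F v\<bar> \<le> C * Hm_norm L 2 v)}"

definition Hneg2_norm :: "real \<Rightarrow> ((real^2 \<Rightarrow> real) \<Rightarrow> real) \<Rightarrow> real" where
  "Hneg2_norm L F = (SUP v \<in> {v \<in> Hm L 2. Hm_norm L 2 v \<le> 1}. \<bar>F v\<bar>)"

text \<open>The value space is a set \<open>X\<close> of real functions with a (semi)norm \<open>N\<close>; this covers
  \<open>H\<^sup>2\<close> and \<open>L\<^sup>2\<close> (functions on \<open>real^2\<close>) as well as \<open>H\<^sup>-\<^sup>2\<close> (functionals).\<close>

definition strongly_measurable ::
  "real \<Rightarrow> ('a \<Rightarrow> real) set \<Rightarrow> (('a \<Rightarrow> real) \<Rightarrow> real) \<Rightarrow> (real \<Rightarrow> 'a \<Rightarrow> real) \<Rightarrow> bool" where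
  "strongly_measurable T X N u \<longleftrightarrow>
     (\<exists>s :: nat \<Rightarrow> real \<Rightarrow> 'a \<Rightarrow> real.
        (\<forall>n. simple_function (lebesgue_on {0..T}) (s n) \<and> (\<forall>t\<in>{0..T}. s n t \<in> X)) \<and>
        (AE t in lebesgue_on {0..T}. (\<lambda>n. N (\<lambda>x. s n t x - u t x)) \<longlonglongrightarrow> 0))"

definition bochner_L2_norm_sq ::
  "real \<Rightarrow> (('a \<Rightarrow> real) \<Rightarrow> real) \<Rightarrow> (real \<Rightarrow> 'a \<Rightarrow> real) \<Rightarrow> ennreal" where
  "bochner_L2_norm_sq T N u = (\<integral>\<^sup>+ t. ennreal ((N (u t))\<^sup>2) \<partial>lebesgue_on {0..T})"

definition bochner_L2 ::
  "real \<Rightarrow> ('a \<Rightarrow> real) set \<Rightarrow> (('a \<Rightarrow> real) \<Rightarrow> real) \<Rightarrow> (real \<Rightarrow> 'a \<Rightarrow> real) set" where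
  "bochner_L2 T X N = {u. (AE t in lebesgue_on {0..T}. u t \<in> X) \<and>
     strongly_measurable T X N u \<and> bochner_L2_norm_sq T N u < \<infinity>}"

definition bochner_Linf_norm ::
  "real \<Rightarrow> (('a \<Rightarrow> real) \<Rightarrow> real) \<Rightarrow> (real \<Rightarrow> 'a \<Rightarrow> real) \<Rightarrow> ereal" where
  "bochner_Linf_norm T N u = esssup (lebesgue_on {0..T}) (\<lambda>t. ereal (N (u t)))"

definition continuous_in_time ::
  "real \<Rightarrow> ('a \<Rightarrow> real) set \<Rightarrow> (('a \<Rightarrow> real) \<Rightarrow> real) \<Rightarrow> (real \<Rightarrow> 'a \<Rightarrow> real) set" where
  "continuous_in_time T X N = {u. (\<forall>t\<in>{0..T}. u t \<in> X) \<and>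
     (\<forall>t\<in>{0..T}. ((\<lambda>s. N (\<lambda>x. u s x - u t x)) \<longlongrightarrow> 0) (at t within {0..T}))}"

definition time_test :: "real \<Rightarrow> (real \<Rightarrow> real) set" where
  "time_test T = {\<theta>. (\<forall>n t. (deriv ^^ n) \<theta> differentiable (at t)) \<and>
     compact (closure {t. \<theta> t \<noteq> 0}) \<and> closure {t. \<theta> t \<noteq> 0} \<subseteq> {0<..<T}}"

text \<open>\<open>g = \<partial>\<^sub>t u\<close> as \<open>H\<^sup>-\<^sup>2\<close>-valued distributions on \<open>(0,T)\<close>, where \<open>L\<^sup>2\<close> is embedded in
  \<open>H\<^sup>-\<^sup>2\<close> by the \<open>L\<^sup>2\<close> inner product. The identity of Bochner integrals
  \<open>\<integral> \<theta>' u dt = - \<integral> \<theta> g dt\<close> in \<open>H\<^sup>-\<^sup>2\<close> is evaluated at each \<open>v\<close> in \<open>H\<^sup>2\<close>.\<close>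

definition has_time_deriv ::
  "real \<Rightarrow> real \<Rightarrow> (real \<Rightarrow> real^2 \<Rightarrow> real) \<Rightarrow> (real \<Rightarrow> (real^2 \<Rightarrow> real) \<Rightarrow> real) \<Rightarrow> bool" where
  "has_time_deriv L T u g \<longleftrightarrow>
     (\<forall>\<theta> \<in> time_test T. \<forall>v \<in> Hm L 2.
        (\<integral>t. deriv \<theta> t * L2_inner L (u t) v \<partial>lebesgue_on {0..T}) =
        - (\<integral>t. \<theta> t * g t v \<partial>lebesgue_on {0..T}))"

text \<open>The \<open>H\<^sup>-\<^sup>2\<close> functional \<open>\<triangle>\<^sup>2 u\<close> for \<open>u\<close> in \<open>H\<^sup>2\<close>.\<close>

definition bilaplacian :: "real \<Rightarrow> (real^2 \<Rightarrow> real) \<Rightarrow> (real^2 \<Rightarrow> real) \<Rightarrow> real" where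
  "bilaplacian L u v = L2_inner L (laplacian L u) (laplacian L v)"

definition calmed_nonlinearity ::
  "real \<Rightarrow> (real^2 \<Rightarrow> real^2) \<Rightarrow> (real^2 \<Rightarrow> real) \<Rightarrow> real^2 \<Rightarrow> real" where
  "calmed_nonlinearity L \<eta> u x = \<eta> (grad L u x) \<bullet> grad L u x"

definition weak_solution ::
  "real \<Rightarrow> real \<Rightarrow> (real^2 \<Rightarrow> real^2) \<Rightarrow> (real^2 \<Rightarrow> real) \<Rightarrow> (real \<Rightarrow> real^2 \<Rightarrow> real) \<Rightarrow> bool" where
  "weak_solution L T \<eta> \<phi>0 \<phi> \<longleftrightarrow>
     \<phi> \<in> bochner_L2 T (Hm L 2) (Hm_norm L 2) \<and>
     \<phi> \<in> continuous_in_time T (L2 L) (L2_norm L) \<and>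
     (\<exists>\<phi>t. \<phi>t \<in> bochner_L2 T (Hneg2 L) (Hneg2_norm L) \<and>
        has_time_deriv L T \<phi> \<phi>t \<and>
        (AE t in lebesgue_on {0..T}. \<forall>v \<in> Hm L 2.
           \<phi>t t v + 1/2 * L2_inner L (calmed_nonlinearity L \<eta> (\<phi> t)) v
             + L2_inner L (laplacian L (\<phi> t)) v + bilaplacian L (\<phi> t) v = 0)) \<and>
     (AE x in torus L. \<phi> 0 x = \<phi>0 x)"

end

theory Submission
  imports Defs
begin

text \<open>In the Hartley basis the equation becomes \<open>a\<^sub>k' = \<lambda>\<^sub>k a\<^sub>k - \<lambda>\<^sub>k\<^sup>2 a\<^sub>k - 1/2 N(a)\<^sub>k\<close> for the coefficients,
  where \<open>N(a)\<close> are the coefficients of \<open>\<eta>(\<nabla>\<phi>) \<cdot> \<nabla>\<phi>\<close>. Because \<open>\<eta>\<close> is bounded and Lipschitz, and because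
  \<open>H\<^sup>2\<close> embeds into \<open>L\<^sup>\<infinity>\<close> in dimension two, the difference of two paths \<open>a\<close>, \<open>b\<close> satisfies an
  energy inequality in which the nonlinear term is absorbed by \<open>\<parallel>\<Delta>(a - b)\<parallel>\<^sup>2\<close> up to
  \<open>C (1 + \<parallel>\<nabla>b\<parallel>\<^sup>4) \<parallel>a - b\<parallel>\<^sup>2\<close>, an integrable multiple of \<open>\<parallel>a - b\<parallel>\<^sup>2\<close>. Gronwall's inequality then gives
  uniqueness and continuous dependence; applied to two Galerkin approximations, up to a truncation error
  that vanishes as the first omitted eigenvalue grows, it makes the Galerkin sequence Cauchy and so gives existence.\<close>

section \<open>Square-integrable functions\<close>

text \<open>A weak solution has only an H^-2-valued distributional time derivative, so its norm
  cannot be differentiated directly. Testing with one Hartley function at a time leaves scalar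
  identities: by du Bois-Reymond each coefficient is an indefinite integral, its square obeys a
  product rule, finitely many modes are summed, and only then does the cutoff tend to infinity. The
  nonlinear difference is split as \<eta>(p).(p - q) + (\<eta>(p) - \<eta>(q)).q, so that the weight
  in the estimate involves the gradient of one path b alone. Interpolation bounds norm(grad b)^4 by
  norm(b)^2 norm(Lap b)^2, which is integrable in time along paths bounded in L^2 and square
  integrable in H^2. The Gronwall constant thus depends on no path other than b, and stays fixed
  while the data of the other solution vary. For the Galerkin systems the same weight makes the
  right-hand side only locally Lipschitz; hence a cutoff of the coefficients, which a growth bound
  independent of the cutoff level shows to be inactive.\<close>

definition sq_integrable :: "'a measure \<Rightarrow> ('a \<Rightarrow> real) set" where
  "sq_integrable M = {u \<in> borel_measurable M. integrable M (\<lambda>x. (u x)\<^sup>2)}"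

lemma sq_integrable_mult:
  assumes "u \<in> sq_integrable M" "v \<in> sq_integrable M"
  shows "integrable M (\<lambda>x. u x * v x)"
proof (rule Bochner_Integration.integrable_bound)
  show "integrable M (\<lambda>x. (u x)\<^sup>2 + (v x)\<^sup>2)"
    using assms by (auto simp: sq_integrable_def)
  show "(\<lambda>x. u x * v x) \<in> borel_measurable M"
    using assms by (auto simp: sq_integrable_def)
  have "\<bar>a * b\<bar> \<le> a\<^sup>2 + b\<^sup>2" for a b :: real
    using sum_squares_bound[of a b] sum_squares_bound[of a "-b"] by (auto simp: abs_if)
  then show "AE x in M. norm (u x * v x) \<le> norm ((u x)\<^sup>2 + (v x)\<^sup>2)"
    by auto
qed

lemma sq_integrable_add:
  assumes "u \<in> sq_integrable M" "v \<in> sq_integrable M"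
  shows "(\<lambda>x. u x + v x) \<in> sq_integrable M"
proof -
  have "integrable M (\<lambda>x. (u x)\<^sup>2 + (v x)\<^sup>2 + 2 * (u x * v x))"
    using assms sq_integrable_mult[OF assms] by (auto simp: sq_integrable_def)
  then show ?thesis
    using assms by (auto simp: sq_integrable_def power2_sum algebra_simps)
qed

lemma sq_integrable_cmult:
  assumes "u \<in> sq_integrable M"
  shows "(\<lambda>x. c * u x) \<in> sq_integrable M"
  using assms by (auto simp: sq_integrable_def power_mult_distrib)

lemma sq_integrable_diff:
  assumes "u \<in> sq_integrable M" "v \<in> sq_integrable M"
  shows "(\<lambda>x. u x - v x) \<in> sq_integrable M"
  using sq_integrable_add[OF assms(1) sq_integrable_cmult[OF assms(2), of "-1"]] by simp

lemma sq_integrable_bound: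
  assumes "v \<in> sq_integrable M" "u \<in> borel_measurable M" "AE x in M. \<bar>u x\<bar> \<le> \<bar>v x\<bar>"
  shows "u \<in> sq_integrable M"
proof -
  have "integrable M (\<lambda>x. (u x)\<^sup>2)"
  proof (rule Bochner_Integration.integrable_bound)
    show "integrable M (\<lambda>x. (v x)\<^sup>2)"
      using assms by (auto simp: sq_integrable_def)
    show "(\<lambda>x. (u x)\<^sup>2) \<in> borel_measurable M"
      using assms by auto
    show "AE x in M. norm ((u x)\<^sup>2) \<le> norm ((v x)\<^sup>2)"
      using assms(3) by (auto elim!: eventually_mono simp: abs_le_square_iff)
  qed
  then show ?thesis
    using assms by (auto simp: sq_integrable_def)
qed

text \<open>The quadratic polynomial \<open>s \<mapsto> a + 2 s b + s\<^sup>2 c\<close>, the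
  integral of \<open>(u + s v)\<^sup>2\<close>, is nonnegative; evaluating it at its minimum
  \<open>s = -b/c\<close> gives the claim.\<close>

lemma sq_integrable_Cauchy_Schwarz:
  assumes "u \<in> sq_integrable M" "v \<in> sq_integrable M"
  shows "(\<integral>x. u x * v x \<partial>M)\<^sup>2 \<le> (\<integral>x. (u x)\<^sup>2 \<partial>M) * (\<integral>x. (v x)\<^sup>2 \<partial>M)"
proof -
  define a b c where "a = (\<integral>x. (u x)\<^sup>2 \<partial>M)" and "b = (\<integral>x. u x * v x \<partial>M)"
    and "c = (\<integral>x. (v x)\<^sup>2 \<partial>M)"
  have q: "0 \<le> a + 2 * s * b + s\<^sup>2 * c" for s
  proof -
    have "0 \<le> (\<integral>x. (u x + s * v x)\<^sup>2 \<partial>M)" by simp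
    also have "(\<lambda>x. (u x + s * v x)\<^sup>2) = (\<lambda>x. (u x)\<^sup>2 + 2 * s * (u x * v x) + s\<^sup>2 * (v x)\<^sup>2)"
      by (simp add: fun_eq_iff power2_eq_square algebra_simps)
    also have "(\<integral>x. (u x)\<^sup>2 + 2 * s * (u x * v x) + s\<^sup>2 * (v x)\<^sup>2 \<partial>M) = a + 2 * s * b + s\<^sup>2 * c"
      using assms sq_integrable_mult[OF assms] by (simp add: a_def b_def c_def sq_integrable_def)
    finally show ?thesis .
  qed
  have "c \<ge> 0" "a \<ge> 0" by (auto simp: c_def a_def)
  show "b\<^sup>2 \<le> a * c"
  proof (cases "c = 0")
    case True
    have "b = 0"
    proof (rule ccontr)
      assume "b \<noteq> 0"
      \<comment> \<open>With \<open>c = 0\<close> the polynomial is affine in \<open>s\<close>; a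
        nonzero slope would let it take the value -1, and this \<open>s\<close> is where it
        does.\<close>
      have "0 \<le> a + 2 * (- (a + 1) / (2 * b)) * b" using q[of "- (a + 1) / (2 * b)"] True by simp
      also have "\<dots> = -1" using \<open>b \<noteq> 0\<close> by (simp add: field_simps)
      finally show False by simp
    qed
    then show ?thesis using True by simp
  next
    case False
    then have c: "c > 0" using \<open>c \<ge> 0\<close> by simp
    have "0 \<le> a + 2 * (-b/c) * b + (-b/c)\<^sup>2 * c" by (rule q)
    also have "\<dots> = a - b\<^sup>2 / c" using c by (simp add: field_simps power2_eq_square)
    finally show ?thesis using c by (simp add: field_simps)
  qed
qed

text \<open>Completeness of L^2. The limit is given explicitly as the pointwise limit of a
  subsequence, because pointwise properties such as periodicity then pass to it at once. On a finite
  measure space L^2-Cauchy implies L^1-Cauchy, which supplies the a.e. convergent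
  subsequence.\<close>

lemma L2_limit_exists:
  fixes s :: "nat \<Rightarrow> 'a \<Rightarrow> real"
  assumes "finite_measure M" and s: "\<And>n. s n \<in> sq_integrable M"
    and cauchy: "\<And>e. e > 0 \<Longrightarrow> \<exists>N. \<forall>i\<ge>N. \<forall>j\<ge>N. (\<integral>x. (s i x - s j x)\<^sup>2 \<partial>M) < e"
  obtains r where "strict_mono r" "(\<lambda>x. lim (\<lambda>i. s (r i) x)) \<in> sq_integrable M"
    "(\<lambda>n. \<integral>x. (s n x - lim (\<lambda>i. s (r i) x))\<^sup>2 \<partial>M) \<longlonglongrightarrow> 0"
proof -
  interpret finite_measure M by fact
  have one: "(\<lambda>x. 1) \<in> sq_integrable M" by (simp add: sq_integrable_def)
  have sm[measurable]: "s n \<in> borel_measurable M" for n using s by (simp add: sq_integrable_def)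
  have int: "integrable M u" if "u \<in> sq_integrable M" for u
    using sq_integrable_mult[OF that one] by simp
  have L1: "\<exists>N. \<forall>i\<ge>N. \<forall>j\<ge>N. (LINT x|M. norm (s i x - s j x)) < e" if "e > 0" for e
  proof -
    define m where "m = measure M (space M) + 1"
    have m: "m > 0" by (simp add: m_def add_nonneg_pos)
    obtain N where N: "\<forall>i\<ge>N. \<forall>j\<ge>N. (\<integral>x. (s i x - s j x)\<^sup>2 \<partial>M) < e\<^sup>2 / m"
      using cauchy[of "e\<^sup>2 / m"] \<open>e > 0\<close> m by auto
    have "(LINT x|M. norm (s i x - s j x)) < e" if ij: "i \<ge> N" "j \<ge> N" for i j
    proof -
      have d: "(\<lambda>x. \<bar>s i x - s j x\<bar>) \<in> sq_integrable M"
        by (rule sq_integrable_bound[OF sq_integrable_diff[OF s[of i] s[of j]]]) auto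
      have "(LINT x|M. norm (s i x - s j x))\<^sup>2 \<le> (\<integral>x. (s i x - s j x)\<^sup>2 \<partial>M) * measure M (space M)"
        using sq_integrable_Cauchy_Schwarz[OF d one] by simp
      also have "\<dots> \<le> (\<integral>x. (s i x - s j x)\<^sup>2 \<partial>M) * m"
        by (intro mult_left_mono) (auto simp: m_def)
      also have "\<dots> < (e\<^sup>2 / m) * m"
        using N ij m by (intro mult_strict_right_mono) auto
      finally have "(LINT x|M. norm (s i x - s j x))\<^sup>2 < e\<^sup>2" using m by simp
      then show ?thesis using \<open>e > 0\<close> by (simp add: power_less_imp_less_base)
    qed
    then show ?thesis by blast
  qed
  obtain r where r: "strict_mono r" "AE x in M. Cauchy (\<lambda>i. s (r i) x)"
    using cauchy_L1_AE_cauchy_subseq[of M s, OF int[OF s] L1] by metis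
  define u where "u x = lim (\<lambda>i. s (r i) x)" for x
  have um[measurable]: "u \<in> borel_measurable M"
    unfolding u_def by measurable
  have conv: "AE x in M. (\<lambda>i. s (r i) x) \<longlonglongrightarrow> u x"
    using r(2) by eventually_elim (simp add: u_def Cauchy_convergent_iff convergent_LIMSEQ_iff)
  \<comment> \<open>Fatou's lemma in the second index with \<open>m\<close> fixed: from index
    \<open>N\<close> on also \<open>r i \<ge> N\<close>, so the Cauchy bound survives the limit
    along the subsequence.\<close>
  have fatou: "(\<integral>\<^sup>+x. ennreal ((s m x - u x)\<^sup>2) \<partial>M) \<le> ennreal e"
    if N: "\<forall>i\<ge>N. \<forall>j\<ge>N. (\<integral>x. (s i x - s j x)\<^sup>2 \<partial>M) < e" and m: "m \<ge> N" for m N e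
  proof -
    have "(\<integral>\<^sup>+x. ennreal ((s m x - u x)\<^sup>2) \<partial>M)
        = (\<integral>\<^sup>+x. liminf (\<lambda>i. ennreal ((s m x - s (r i) x)\<^sup>2)) \<partial>M)"
    proof (rule nn_integral_cong_AE)
      show "AE x in M. ennreal ((s m x - u x)\<^sup>2) = liminf (\<lambda>i. ennreal ((s m x - s (r i) x)\<^sup>2))"
        using conv
      proof eventually_elim
        case (elim x)
        have "(\<lambda>i. ennreal ((s m x - s (r i) x)\<^sup>2)) \<longlonglongrightarrow> ennreal ((s m x - u x)\<^sup>2)"
          by (intro tendsto_intros elim)
        then show ?case using lim_imp_Liminf trivial_limit_sequentially by metis
      qed
    qed
    also have "\<dots> \<le> liminf (\<lambda>i. \<integral>\<^sup>+x. ennreal ((s m x - s (r i) x)\<^sup>2) \<partial>M)"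
      by (rule nn_integral_liminf) measurable
    also have "\<dots> \<le> ennreal e"
    proof (rule Liminf_le, rule trivial_limit_sequentially)
      show "\<forall>\<^sub>F i in sequentially. (\<integral>\<^sup>+x. ennreal ((s m x - s (r i) x)\<^sup>2) \<partial>M) \<le> ennreal e"
      proof (rule eventually_sequentiallyI[of N])
        fix i assume "N \<le> i"
        then have "N \<le> r i" using seq_suble[OF r(1)] le_trans by blast
        have "integrable M (\<lambda>x. (s m x - s (r i) x)\<^sup>2)"
          using sq_integrable_diff[OF s s] by (auto simp: sq_integrable_def)
        then have "(\<integral>\<^sup>+x. ennreal ((s m x - s (r i) x)\<^sup>2) \<partial>M) = ennreal (\<integral>x. (s m x - s (r i) x)\<^sup>2 \<partial>M)"
          by (intro nn_integral_eq_integral) auto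
        also have "\<dots> \<le> ennreal e" using N m \<open>N \<le> r i\<close> by (intro ennreal_leI) (auto intro: less_imp_le)
        finally show "(\<integral>\<^sup>+x. ennreal ((s m x - s (r i) x)\<^sup>2) \<partial>M) \<le> ennreal e" .
      qed
    qed
    finally show ?thesis .
  qed
  have d: "(\<lambda>x. s m x - u x) \<in> sq_integrable M \<and> (\<integral>x. (s m x - u x)\<^sup>2 \<partial>M) \<le> e"
    if N: "\<forall>i\<ge>N. \<forall>j\<ge>N. (\<integral>x. (s i x - s j x)\<^sup>2 \<partial>M) < e" and m: "m \<ge> N" for m N e
  proof -
    have e: "e > 0" using N[rule_format, of N N] by simp
    have "integrable M (\<lambda>x. (s m x - u x)\<^sup>2)"
      by (rule integrableI_bounded)
        (use fatou[OF N m] in \<open>auto intro: le_less_trans\<close>)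
    moreover from this have "ennreal (\<integral>x. (s m x - u x)\<^sup>2 \<partial>M) \<le> ennreal e"
      using fatou[OF N m] by (simp add: nn_integral_eq_integral)
    ultimately show ?thesis using e by (simp add: sq_integrable_def)
  qed
  obtain N where N: "\<forall>i\<ge>N. \<forall>j\<ge>N. (\<integral>x. (s i x - s j x)\<^sup>2 \<partial>M) < 1"
    using cauchy[of 1] by auto
  have "(\<lambda>x. s N x - (s N x - u x)) \<in> sq_integrable M"
    by (rule sq_integrable_diff[OF s conjunct1[OF d[OF N order_refl]]])
  then have "u \<in> sq_integrable M" by simp
  moreover have "(\<lambda>n. \<integral>x. (s n x - u x)\<^sup>2 \<partial>M) \<longlonglongrightarrow> 0"
  proof (rule LIMSEQ_I)
    fix e :: real assume "e > 0"
    then obtain N where N: "\<forall>i\<ge>N. \<forall>j\<ge>N. (\<integral>x. (s i x - s j x)\<^sup>2 \<partial>M) < e/2"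
      using cauchy[of "e/2"] by auto
    have "norm ((\<integral>x. (s n x - u x)\<^sup>2 \<partial>M) - 0) < e" if "n \<ge> N" for n
      using d[OF N that] \<open>e > 0\<close> by simp
    then show "\<exists>N. \<forall>n\<ge>N. norm ((\<integral>x. (s n x - u x)\<^sup>2 \<partial>M) - 0) < e" by blast
  qed
  ultimately show thesis using that[OF r(1)] unfolding u_def by blast
qed

section \<open>The torus and its Hartley basis\<close>

lemma two_cases: "(i::2) = 1 \<or> i = 2" using exhaust_2 by auto

lemma partial_eqI: "(f has_derivative D) (at x) \<Longrightarrow> partial i f x = D (axis i 1)"
  unfolding partial_def using frechet_derivative_at by metis

lemma smooth_imp_differentiable: "smooth f \<Longrightarrow> f differentiable (at x)"
  unfolding smooth_def by (metis foldr.simps(1) id_apply)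

lemma smooth_partial: "smooth f \<Longrightarrow> smooth (partial i f)"
  unfolding smooth_def
proof (intro allI)
  fix "is" x assume *: "\<forall>is x. foldr partial is f differentiable at x"
  show "foldr partial is (partial i f) differentiable at x"
    using *[rule_format, of "is @ [i]"] by simp
qed

lemma smooth_continuous_on: "smooth f \<Longrightarrow> continuous_on S f"
  using smooth_imp_differentiable differentiable_imp_continuous_within
  by (metis continuous_at_imp_continuous_on)

lemma smooth_has_derivative:
  assumes "smooth f"
  shows "(f has_derivative frechet_derivative f (at x)) (at x)"
  using smooth_imp_differentiable[OF assms] frechet_derivative_works by blast

lemma periodic_partial:
  assumes "periodic L f" "smooth f"
  shows "periodic L (partial i f)"
  unfolding periodic_def
proof (intro allI)
  fix x :: "real^2" and j :: 2
  let ?c = "L *\<^sub>R axis j (1::real)"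
  have "f \<circ> (\<lambda>y. y + ?c) = f" using assms(1) by (auto simp: periodic_def o_def)
  moreover have "(f \<circ> (\<lambda>y. y + ?c) has_derivative frechet_derivative f (at (x + ?c)) \<circ> (\<lambda>h. h)) (at x)"
    by (rule diff_chain_at) (auto intro!: derivative_eq_intros smooth_has_derivative[OF assms(2)])
  ultimately have "(f has_derivative frechet_derivative f (at (x + ?c)) \<circ> (\<lambda>h. h)) (at x)" by simp
  then show "partial i f (x + ?c) = partial i f x"
    using frechet_derivative_at by (fastforce simp: partial_def o_def)
qed

locale torus_side =
  fixes L :: real
  assumes L_pos: "L > 0"
begin

definition corner :: "real^2" where "corner = (\<chi> i. L)"

abbreviation cell :: "(real^2) set" where "cell \<equiv> cbox 0 corner"

lemma torus_eq: "torus L = lebesgue_on cell"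
  by (simp add: torus_def corner_def)

lemma space_torus: "space (torus L) = cell"
  by (simp add: torus_eq)

lemma finite_measure_torus: "finite_measure (torus L)"
  unfolding torus_eq by (rule finite_measure_lebesgue_on) simp

lemma continuous_measurable_torus: "continuous_on cell f \<Longrightarrow> f \<in> borel_measurable (torus L)"
  for f :: "real^2 \<Rightarrow> real"
  unfolding torus_eq by (rule continuous_imp_measurable_on_sets_lebesgue) auto

lemma continuous_integrable_torus: "continuous_on cell f \<Longrightarrow> integrable (torus L) f"
  for f :: "real^2 \<Rightarrow> real"
  unfolding torus_eq by (rule continuous_imp_integrable)

lemma integral_torus: "continuous_on cell f \<Longrightarrow> (\<integral>x. f x \<partial>torus L) = integral cell f"
  for f :: "real^2 \<Rightarrow> real"
  using continuous_integrable_torus[of f] unfolding torus_eq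
  by (simp add: lebesgue_integral_eq_integral)

lemma L2_iff: "u \<in> L2 L \<longleftrightarrow> periodic L u \<and> u \<in> sq_integrable (torus L)"
  by (auto simp: L2_def sq_integrable_def)

lemma L2_sq: "u \<in> L2 L \<Longrightarrow> u \<in> sq_integrable (torus L)"
  by (simp add: L2_iff)

lemma L2_add: "u \<in> L2 L \<Longrightarrow> v \<in> L2 L \<Longrightarrow> (\<lambda>x. u x + v x) \<in> L2 L"
  by (auto simp: L2_iff sq_integrable_add periodic_def)

lemma L2_diff: "u \<in> L2 L \<Longrightarrow> v \<in> L2 L \<Longrightarrow> (\<lambda>x. u x - v x) \<in> L2 L"
  by (auto simp: L2_iff sq_integrable_diff periodic_def)

lemma L2_cmult: "u \<in> L2 L \<Longrightarrow> (\<lambda>x. c * u x) \<in> L2 L"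
  by (auto simp: L2_iff sq_integrable_cmult periodic_def)

lemma L2_zero: "(\<lambda>x. 0) \<in> L2 L"
  by (auto simp: L2_iff sq_integrable_def periodic_def)

lemma L2_sum: "(\<And>k. k \<in> K \<Longrightarrow> f k \<in> L2 L) \<Longrightarrow> (\<lambda>x. \<Sum>k\<in>K. f k x) \<in> L2 L"
  by (induction K rule: infinite_finite_induct) (auto intro!: L2_zero L2_add)

lemma L2_continuous:
  assumes "periodic L u" "continuous_on UNIV u"
  shows "u \<in> L2 L"
proof -
  have c: "continuous_on cell u" using assms(2) continuous_on_subset by blast
  then have "continuous_on cell (\<lambda>x. (u x)\<^sup>2)" by (intro continuous_intros)
  with c show ?thesis
    using assms(1) continuous_integrable_torus continuous_measurable_torus
    by (auto simp: L2_iff sq_integrable_def)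
qed

lemma L2_mult_integrable: "u \<in> L2 L \<Longrightarrow> v \<in> L2 L \<Longrightarrow> integrable (torus L) (\<lambda>x. u x * v x)"
  by (simp add: L2_iff sq_integrable_mult)

lemma L2_inner_commute: "L2_inner L u v = L2_inner L v u"
  by (simp add: L2_inner_def mult.commute)

lemma L2_inner_add_left:
  assumes "u \<in> L2 L" "v \<in> L2 L" "w \<in> L2 L"
  shows "L2_inner L (\<lambda>x. u x + v x) w = L2_inner L u w + L2_inner L v w"
  using assms by (simp add: L2_inner_def distrib_right L2_mult_integrable)

lemma L2_inner_diff_left:
  assumes "u \<in> L2 L" "v \<in> L2 L" "w \<in> L2 L"
  shows "L2_inner L (\<lambda>x. u x - v x) w = L2_inner L u w - L2_inner L v w"
  using assms by (simp add: L2_inner_def left_diff_distrib L2_mult_integrable)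

lemma L2_inner_cmult_left: "L2_inner L (\<lambda>x. c * u x) w = c * L2_inner L u w"
  by (simp add: L2_inner_def mult.assoc)

lemma L2_inner_sum_left:
  assumes "\<And>k. k \<in> K \<Longrightarrow> f k \<in> L2 L" "w \<in> L2 L"
  shows "L2_inner L (\<lambda>x. \<Sum>k\<in>K. f k x) w = (\<Sum>k\<in>K. L2_inner L (f k) w)"
  using assms
proof (induction K rule: infinite_finite_induct)
  case (insert k K)
  then show ?case by (simp add: L2_inner_add_left L2_sum)
qed (auto simp: L2_inner_def)

lemma L2_norm_sq: "(L2_norm L u)\<^sup>2 = L2_inner L u u"
  by (simp add: L2_norm_def L2_inner_def)

lemma L2_inner_self: "L2_inner L u u = (\<integral>x. (u x)\<^sup>2 \<partial>torus L)"
  by (simp add: L2_inner_def power2_eq_square)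

lemma L2_norm_nonneg: "0 \<le> L2_norm L u"
  by (simp add: L2_norm_def L2_inner_def)

lemma L2_Cauchy_Schwarz:
  assumes "u \<in> L2 L" "v \<in> L2 L"
  shows "\<bar>L2_inner L u v\<bar> \<le> L2_norm L u * L2_norm L v"
proof -
  have "(L2_inner L u v)\<^sup>2 \<le> (L2_norm L u * L2_norm L v)\<^sup>2"
    using sq_integrable_Cauchy_Schwarz[OF L2_sq L2_sq, OF assms]
    unfolding power_mult_distrib L2_norm_sq L2_inner_self unfolding L2_inner_def .
  then show ?thesis
    by (metis L2_norm_nonneg mult_nonneg_nonneg abs_le_square_iff abs_of_nonneg)
qed

lemma L2_inner_cong_AE:
  assumes "AE x in torus L. u x = u' x" "u \<in> borel_measurable (torus L)" "u' \<in> borel_measurable (torus L)"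
    "v \<in> borel_measurable (torus L)"
  shows "L2_inner L u v = L2_inner L u' v"
  unfolding L2_inner_def using assms
  by (intro integral_cong_AE) auto

section \<open>Integration by parts on the torus\<close>

lemma integral_shift_axis:
  fixes g :: "real^2 \<Rightarrow> real"
  assumes per: "periodic L g" and cont: "continuous_on UNIV g" and h: "0 \<le> h" "h \<le> L"
  shows "integral cell (\<lambda>x. g (x + h *\<^sub>R axis i 1)) = integral cell g"
proof -
  let ?e = "axis i (1::real) :: real^2"
  have eB: "?e \<in> Basis" by (simp add: axis_in_Basis_iff)
  have dot: "x \<bullet> ?e = x $ i" for x :: "real^2" by (simp add: inner_axis)
  have int: "g integrable_on cbox a b" for a b
    using cont continuous_on_subset integrable_continuous by blast
  let ?big = "cbox 0 (corner + h *\<^sub>R ?e)"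
  have cj: "(corner + h *\<^sub>R ?e) $ j = (if j = i then L + h else L)" for j
    by (auto simp: corner_def axis_def)
  have c0: "corner $ j = L" for j by (simp add: corner_def)
  have he: "(h *\<^sub>R ?e) $ j = (if j = i then h else 0)" for j by (auto simp: axis_def)
  have Le: "(L *\<^sub>R ?e) $ j = (if j = i then L else 0)" for j by (auto simp: axis_def)
  \<comment> \<open>The cell, lengthened by \<open>h\<close> along axis \<open>i\<close>, is cut
    once at height \<open>h\<close> and once at height \<open>L\<close>. The first cut leaves the
    shifted cell and a bottom slab, the second the cell and a top slab; periodicity gives both slabs
    the same integral.\<close>
  have A: "integral ?big g = integral (?big \<inter> {x. x \<bullet> ?e \<le> h}) g + integral (?big \<inter> {x. x \<bullet> ?e \<ge> h}) g"
    by (rule integral_split[OF int eB])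
  have B: "integral ?big g = integral (?big \<inter> {x. x \<bullet> ?e \<le> L}) g + integral (?big \<inter> {x. x \<bullet> ?e \<ge> L}) g"
    by (rule integral_split[OF int eB])
  define lo :: "real^2" where "lo = (\<chi> j. if j = i then h else L)"
  have lo: "lo $ j = (if j = i then h else L)" for j by (simp add: lo_def)
  have s1: "?big \<inter> {x. x \<bullet> ?e \<le> h} = cbox 0 lo"
  proof (rule set_eqI)
    fix x :: "real^2"
    show "x \<in> ?big \<inter> {x. x \<bullet> ?e \<le> h} \<longleftrightarrow> x \<in> cbox 0 lo"
      unfolding Int_iff mem_box_cart mem_Collect_eq dot cj lo forall_2 zero_index
      using h L_pos two_cases[of i] by (elim disjE) (simp_all, linarith+)
  qed
  have s2: "?big \<inter> {x. x \<bullet> ?e \<ge> h} = cbox (0 + h *\<^sub>R ?e) (corner + h *\<^sub>R ?e)"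
  proof (rule set_eqI)
    fix x :: "real^2"
    show "x \<in> ?big \<inter> {x. x \<bullet> ?e \<ge> h} \<longleftrightarrow> x \<in> cbox (0 + h *\<^sub>R ?e) (corner + h *\<^sub>R ?e)"
      unfolding Int_iff mem_box_cart mem_Collect_eq dot cj he add_0 forall_2 zero_index
      using h L_pos two_cases[of i] by (elim disjE) (simp_all, linarith+)
  qed
  have s3: "?big \<inter> {x. x \<bullet> ?e \<le> L} = cell"
  proof (rule set_eqI)
    fix x :: "real^2"
    show "x \<in> ?big \<inter> {x. x \<bullet> ?e \<le> L} \<longleftrightarrow> x \<in> cell"
      unfolding Int_iff mem_box_cart mem_Collect_eq dot cj c0 forall_2 zero_index
      using h L_pos two_cases[of i] by (elim disjE) (simp_all, linarith+)
  qed
  have s4: "?big \<inter> {x. x \<bullet> ?e \<ge> L} = cbox (0 + L *\<^sub>R ?e) (lo + L *\<^sub>R ?e)"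
  proof (rule set_eqI)
    fix x :: "real^2"
    have lol: "(lo + L *\<^sub>R ?e) $ j = (if j = i then L + h else L)" for j by (auto simp: lo axis_def)
    show "x \<in> ?big \<inter> {x. x \<bullet> ?e \<ge> L} \<longleftrightarrow> x \<in> cbox (0 + L *\<^sub>R ?e) (lo + L *\<^sub>R ?e)"
      unfolding Int_iff mem_box_cart mem_Collect_eq dot cj lol add_0 Le forall_2 zero_index
      using h L_pos two_cases[of i] by (elim disjE) auto
  qed
  have perL: "g \<circ> (+) (L *\<^sub>R ?e) = g"
    using per by (auto simp: periodic_def o_def add.commute)
  have "integral (cbox (0 + L *\<^sub>R ?e) (lo + L *\<^sub>R ?e)) g = integral (cbox 0 lo) g"
    using integral_shift_cbox_plus[of 0 lo g "L *\<^sub>R ?e"] by (simp add: perL)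
  moreover have "integral (cbox (0 + h *\<^sub>R ?e) (corner + h *\<^sub>R ?e)) g
      = integral cell (\<lambda>x. g (x + h *\<^sub>R axis i 1))"
    using integral_shift_cbox_plus[of 0 corner g "h *\<^sub>R ?e"] by (simp add: o_def add.commute)
  ultimately show ?thesis using A B unfolding s1 s2 s3 s4 by simp
qed

text \<open>The integral of the translate of \<open>g\<close> by \<open>h\<close> along axis
  \<open>i\<close> does not depend on \<open>h\<close>; its derivative at \<open>h = 0\<close>,
  taken under the integral sign, is the integral of \<open>partial i g\<close>.\<close>

lemma integral_partial_zero:
  fixes g :: "real^2 \<Rightarrow> real"
  assumes per: "periodic L g" and diff: "\<And>x. g differentiable (at x)"
    and cont: "continuous_on UNIV (partial i g)"
  shows "(\<integral>x. partial i g x \<partial>torus L) = 0"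
proof -
  let ?e = "axis i (1::real) :: real^2"
  have contg: "continuous_on UNIV g"
    using diff by (simp add: continuous_at_imp_continuous_on differentiable_imp_continuous_within)
  define J where "J h = integral cell (\<lambda>x. g (x + h *\<^sub>R ?e))" for h
  have Jpos: "J h = J 0" if "0 \<le> h" "h \<le> L" for h
    using integral_shift_axis[OF per contg that] by (simp add: J_def)
  \<comment> \<open>Negative shifts are needed for a two-sided derivative at 0; they follow by
    shifting the already translated function forward again.\<close>
  have Jneg: "J (-h) = J 0" if h: "0 \<le> h" "h \<le> L" for h
  proof -
    have "integral cell (\<lambda>x. (\<lambda>y. g (y + (-h) *\<^sub>R ?e)) (x + h *\<^sub>R ?e)) = integral cell (\<lambda>y. g (y + (-h) *\<^sub>R ?e))"
    proof (rule integral_shift_axis[OF _ _ h])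
      show "periodic L (\<lambda>y. g (y + (-h) *\<^sub>R ?e))"
        using per unfolding periodic_def
        by (metis (no_types, lifting) add.assoc add.commute)
      show "continuous_on UNIV (\<lambda>y. g (y + - h *\<^sub>R axis i 1))"
        by (intro continuous_on_compose2[OF contg] continuous_intros) auto
    qed
    then show ?thesis by (simp add: J_def)
  qed
  have Jc: "J h = J 0" if "\<bar>h\<bar> < L" for h
    using Jpos[of h] Jneg[of "-h"] that by (cases "h \<ge> 0") auto
  have D1: "(J has_field_derivative integral cell (\<lambda>x. partial i g (x + 0 *\<^sub>R ?e))) (at 0 within UNIV)"
    unfolding J_def
  proof (rule leibniz_rule_field_derivative[where fx = "\<lambda>h x. partial i g (x + h *\<^sub>R ?e)"])
    fix h :: real and t :: "real^2"
    have "(g has_derivative frechet_derivative g (at (t + h *\<^sub>R ?e))) (at (t + h *\<^sub>R ?e))"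
      using diff frechet_derivative_works by blast
    moreover have "((\<lambda>s. t + s *\<^sub>R ?e) has_derivative (\<lambda>s. s *\<^sub>R ?e)) (at h)"
      by (auto intro!: derivative_eq_intros)
    ultimately have *: "(g \<circ> (\<lambda>s. t + s *\<^sub>R ?e) has_derivative
        frechet_derivative g (at (t + h *\<^sub>R ?e)) \<circ> (\<lambda>s. s *\<^sub>R ?e)) (at h)"
      by (intro diff_chain_at)
    have "linear (frechet_derivative g (at (t + h *\<^sub>R ?e)))"
      using diff linear_frechet_derivative by blast
    then have "frechet_derivative g (at (t + h *\<^sub>R ?e)) \<circ> (\<lambda>s. s *\<^sub>R ?e)
        = (\<lambda>s. partial i g (t + h *\<^sub>R ?e) * s)"
      by (auto simp: o_def partial_def linear_cmul)
    with * show "((\<lambda>s. g (t + s *\<^sub>R ?e)) has_field_derivative partial i g (t + h *\<^sub>R ?e)) (at h within UNIV)"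
      by (simp add: has_field_derivative_def o_def)
  next
    show "(\<lambda>x. g (x + h *\<^sub>R ?e)) integrable_on cell" for h
      by (intro integrable_continuous continuous_on_compose2[OF contg] continuous_intros) auto
    show "continuous_on (UNIV \<times> cell) (\<lambda>(h, t). partial i g (t + h *\<^sub>R ?e))"
      unfolding split_beta
      by (intro continuous_on_compose2[OF cont] continuous_intros) auto
  qed auto
  have D2: "(J has_field_derivative 0) (at 0)"
  proof (rule has_field_derivative_transform_within[where d = L])
    show "((\<lambda>_. J 0) has_field_derivative 0) (at 0)" by simp
    show "J 0 = J h" if "dist h 0 < L" for h
      by (rule Jc[symmetric]) (use that in simp)
  qed (use L_pos in auto)
  have "integral cell (\<lambda>x. partial i g (x + 0 *\<^sub>R ?e)) = 0"
    by (rule DERIV_unique[OF D1 D2])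
  then have "integral cell (partial i g) = 0" by simp
  moreover have "continuous_on cell (partial i g)" using cont continuous_on_subset by blast
  ultimately show ?thesis by (simp add: integral_torus)
qed

lemma L2_smooth: "periodic L u \<Longrightarrow> smooth u \<Longrightarrow> u \<in> L2 L"
  by (simp add: L2_continuous smooth_continuous_on)

lemma L2_inner_partial:
  assumes "periodic L f" "smooth f" "periodic L g" "smooth g"
  shows "L2_inner L (partial i f) g = - L2_inner L f (partial i g)"
proof -
  have d: "((\<lambda>x. f x * g x) has_derivative
      (\<lambda>h. f x * frechet_derivative g (at x) h + frechet_derivative f (at x) h * g x)) (at x)" for x
    by (intro has_derivative_mult smooth_has_derivative assms)
  have p: "partial i (\<lambda>x. f x * g x) = (\<lambda>x. f x * partial i g x + partial i f x * g x)"
    unfolding partial_eqI[OF d] by (simp add: partial_def)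
  have L2s: "f \<in> L2 L" "g \<in> L2 L" "partial i f \<in> L2 L" "partial i g \<in> L2 L"
    using assms by (auto intro!: L2_smooth periodic_partial smooth_partial)
  have "(\<integral>x. partial i (\<lambda>x. f x * g x) x \<partial>torus L) = 0"
  proof (rule integral_partial_zero)
    show "periodic L (\<lambda>x. f x * g x)" using assms by (auto simp: periodic_def)
    show "(\<lambda>x. f x * g x) differentiable (at x)" for x using d unfolding differentiable_def by blast
    show "continuous_on UNIV (partial i (\<lambda>x. f x * g x))"
      unfolding p using assms by (intro continuous_intros smooth_continuous_on smooth_partial)
  qed
  then show ?thesis
    unfolding p using L2s by (simp add: L2_inner_def L2_mult_integrable)
qed

section \<open>The Hartley functions and their orthonormality\<close>

definition freq :: real where "freq = 2 * pi / L"

lemma freq_pos: "freq > 0" using L_pos by (simp add: freq_def)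

definition idx :: "2 \<Rightarrow> int \<times> int \<Rightarrow> real" where
  "idx i k = (if i = 1 then of_int (fst k) else of_int (snd k))"

definition phase :: "int \<times> int \<Rightarrow> real^2 \<Rightarrow> real" where
  "phase k x = freq * (of_int (fst k) * x $ 1 + of_int (snd k) * x $ 2)"

text \<open>The functions \<open>cos + sin\<close> (Hartley's \<open>cas\<close>) form a real orthonormal basis indexed
  by the full lattice in which \<open>\<partial>\<^sub>i\<close> maps \<open>hart k\<close> to a multiple of \<open>hart (-k)\<close>.\<close>

definition hart :: "int \<times> int \<Rightarrow> real^2 \<Rightarrow> real" where
  "hart k x = (cos (phase k x) + sin (phase k x)) / L"

lemma idx_minus: "idx i (- k) = - idx i k" by (simp add: idx_def)

lemma phase_minus: "phase (- k) x = - phase k x" by (simp add: phase_def algebra_simps)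
lemma phase_add: "phase (k + l) x = phase k x + phase l x" by (simp add: phase_def algebra_simps)
lemma phase_diff: "phase (k - l) x = phase k x - phase l x" by (simp add: phase_def algebra_simps)

lemma phase_shift: "phase k (x + L *\<^sub>R axis i 1) = phase k x + 2 * pi * idx i k"
proof -
  have "freq * L = 2 * pi" using L_pos by (simp add: freq_def)
  then have "freq * (c * L) = 2 * pi * c" for c by (metis mult.assoc mult.commute)
  then show ?thesis using two_cases[of i]
    by (auto simp: phase_def idx_def axis_def distrib_left)
qed

lemma hart_periodic: "periodic L (hart k)"
proof -
  have "\<exists>m. idx i k = of_int m" for i by (auto simp: idx_def)
  then have "cos (phase k x + 2 * pi * idx i k) = cos (phase k x)"
    "sin (phase k x + 2 * pi * idx i k) = sin (phase k x)" for x i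
    by (metis cos_int_2pin sin_int_2pin cos_add sin_add mult.right_neutral mult_zero_right diff_zero
        add.right_neutral)+
  then show ?thesis by (simp add: periodic_def hart_def phase_shift)
qed

lemma phase_has_derivative: "(phase k has_derivative phase k) (at x)"
proof (rule bounded_linear_imp_has_derivative)
  have "bounded_linear (\<lambda>x. freq * (of_int (fst k) * x $ 1 + of_int (snd k) * x $ 2))"
    by (intro bounded_linear_const_mult bounded_linear_add bounded_linear_vec_nth)
  then show "bounded_linear (phase k)" unfolding phase_def .
qed

lemma hart_has_derivative:
  "(hart k has_derivative (\<lambda>h. hart (-k) x * phase k h)) (at x)"
proof -
  have "((\<lambda>x. (cos (phase k x) + sin (phase k x)) / L) has_derivative
      (\<lambda>h. (- (phase k h * sin (phase k x)) + phase k h * cos (phase k x)) / L)) (at x)"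
    using L_pos by (auto intro!: derivative_eq_intros phase_has_derivative)
  then show ?thesis unfolding hart_def phase_minus by (simp add: algebra_simps diff_divide_distrib)
qed

lemma partial_hart: "partial i (hart k) = (\<lambda>x. freq * idx i k * hart (-k) x)"
  using partial_eqI[OF hart_has_derivative] two_cases[of i]
  by (auto simp: fun_eq_iff phase_def idx_def axis_def)

lemma hart_smooth: "smooth (hart k)"
proof -
  have p: "partial i (\<lambda>x. c * hart k x) = (\<lambda>x. c * freq * idx i k * hart (-k) x)" for i c k
  proof
    fix x
    have "((\<lambda>x. c * hart k x) has_derivative (\<lambda>h. c * (hart (-k) x * phase k h))) (at x)"
      by (intro has_derivative_mult_right hart_has_derivative)
    from partial_eqI[OF this] show "partial i (\<lambda>x. c * hart k x) x = c * freq * idx i k * hart (-k) x"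
      using two_cases[of i] by (auto simp: phase_def idx_def axis_def)
  qed
  \<comment> \<open>Scalar multiples of Hartley functions are closed under \<open>partial\<close>,
    so the induction is over the list with constant and index existentially quantified.\<close>
  have "\<exists>c l. foldr partial is (hart k) = (\<lambda>x. c * hart l x)" for "is"
  proof (induction "is")
    case Nil
    show ?case by (rule exI[of _ 1], rule exI[of _ k]) simp
  next
    case (Cons i "is")
    then obtain c l where "foldr partial is (hart k) = (\<lambda>x. c * hart l x)" by blast
    then have "foldr partial (i # is) (hart k) = (\<lambda>x. (c * freq * idx i l) * hart (-l) x)"
      using p[of i c l] by simp
    then show ?case by blast
  qed
  moreover have "(\<lambda>x. c * hart l x) differentiable (at x)" for c l x
    using has_derivative_mult_right[OF hart_has_derivative[of l x], of c] unfolding differentiable_def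
    by blast
  ultimately show ?thesis unfolding smooth_def by metis
qed

lemma hart_L2: "hart k \<in> L2 L"
  by (simp add: L2_smooth hart_periodic hart_smooth)

lemma hart_continuous: "continuous_on S (hart k)"
  by (simp add: hart_smooth smooth_continuous_on)

lemma hart_bound: "\<bar>hart k x\<bar> \<le> 2 / L"
proof -
  have "\<bar>cos (phase k x) + sin (phase k x)\<bar> \<le> 2"
    using abs_cos_le_one[of "phase k x"] abs_sin_le_one[of "phase k x"] by linarith
  then show ?thesis using L_pos by (simp add: hart_def abs_divide divide_right_mono)
qed

lemma measure_torus: "measure (torus L) cell = L\<^sup>2"
proof -
  have "measure (torus L) cell = measure lborel cell"
    unfolding torus_eq by (simp add: measure_restrict_space)
  also have "\<dots> = L\<^sup>2"
    using L_pos by (simp add: content_cbox_cart interval_eq_empty_cart corner_def not_less power2_eq_square)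
  finally show ?thesis .
qed

text \<open>For \<open>k \<noteq> 0\<close> some component of the frequency is nonzero, and then
  \<open>hart k\<close> is a multiple of a partial derivative of \<open>hart (-k)\<close>, whose
  integral vanishes.\<close>

lemma integral_hart: "(\<integral>x. hart k x \<partial>torus L) = (if k = 0 then L else 0)"
proof (cases "k = 0")
  case True
  then have "hart k = (\<lambda>x. 1 / L)" by (auto simp: hart_def phase_def fun_eq_iff)
  then show ?thesis using True L_pos measure_torus by (simp add: space_torus power2_eq_square)
next
  case False
  then have "fst k \<noteq> 0 \<or> snd k \<noteq> 0" by (auto simp: prod_eq_iff)
  then have "idx 1 k \<noteq> 0 \<or> idx 2 k \<noteq> 0" by (simp add: idx_def)
  then obtain i where i: "idx i k \<noteq> 0" by blast
  have "(\<integral>x. partial i (hart (-k)) x \<partial>torus L) = 0"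
    by (intro integral_partial_zero hart_periodic smooth_imp_differentiable hart_smooth
        smooth_continuous_on smooth_partial)
  then show ?thesis using False i freq_pos by (simp add: partial_hart idx_minus)
qed

text \<open>The product of two \<open>cas\<close> functions is \<open>cos\<close> of the phase
  difference plus \<open>sin\<close> of the phase sum; each of these is recovered from a Hartley
  function and its reflection. The formula yields both orthonormality and closure of the span under
  products.\<close>

lemma hart_mult:
  "hart k x * hart l x =
    (hart (k - l) x + hart (l - k) x + hart (k + l) x - hart (- (k + l)) x) / (2 * L)"
proof -
  have "- l - k = - (k + l)" by simp
  have "hart k x * hart l x = (cos (phase k x - phase l x) + sin (phase k x + phase l x)) / L\<^sup>2"
    by (simp add: hart_def cos_diff sin_add power2_eq_square field_simps)
  then have "2 * L * (hart k x * hart l x)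
      = 2 * cos (phase k x - phase l x) / L + 2 * sin (phase k x + phase l x) / L"
    using L_pos by (simp add: power2_eq_square field_simps)
  moreover have "hart (k - l) x + hart (l - k) x = 2 * cos (phase k x - phase l x) / L"
    using cos_minus[of "phase k x - phase l x"] sin_minus[of "phase k x - phase l x"]
    by (simp add: hart_def phase_diff add_divide_distrib diff_divide_distrib)
  moreover have "hart (k + l) x - hart (- (k + l)) x = 2 * sin (phase k x + phase l x) / L"
    unfolding hart_def phase_minus phase_add cos_minus sin_minus
    by (simp add: diff_divide_distrib[symmetric])
  ultimately have "hart (k - l) x + hart (l - k) x + hart (k + l) x - hart (- (k + l)) x
      = 2 * L * (hart k x * hart l x)"
    by linarith
  then show ?thesis using L_pos by simp
qed

lemma hart_integrable: "integrable (torus L) (hart k)"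
  by (simp add: continuous_integrable_torus hart_continuous)

lemma hart_orthonormal: "L2_inner L (hart k) (hart l) = (if k = l then 1 else 0)"
proof -
  \<comment> \<open>Only index 0 contributes to the integral, so the terms with \<open>k + l\<close>
    and \<open>- (k + l)\<close> cancel in every case.\<close>
  have "k + l = 0 \<longleftrightarrow> - (k + l) = 0" by (metis neg_equal_0_iff_equal)
  then have "L2_inner L (hart k) (hart l) =
      ((if k - l = 0 then L else 0) + (if l - k = 0 then L else 0)) / (2 * L)"
    unfolding L2_inner_def hart_mult by (simp add: hart_integrable integral_hart)
  then show ?thesis using L_pos by auto
qed

end

section \<open>Completeness of the Hartley basis\<close>

context torus_side
begin

text \<open>The linear span of the Hartley functions, given by closure rules so that the algebra
  property and orthogonality are proved by induction.\<close>

inductive trig :: "(real^2 \<Rightarrow> real) \<Rightarrow> bool" where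
  trig_hart: "trig (hart k)"
| trig_add: "trig f \<Longrightarrow> trig g \<Longrightarrow> trig (\<lambda>x. f x + g x)"
| trig_cmult: "trig f \<Longrightarrow> trig (\<lambda>x. c * f x)"

lemma trig_hart_mult: "trig g \<Longrightarrow> trig (\<lambda>x. hart k x * g x)"
proof (induction rule: trig.induct)
  case (trig_hart l)
  have "trig (\<lambda>x. 1 / (2 * L) * (hart (k - l) x + (hart (l - k) x + (hart (k + l) x + (-1) * hart (- (k + l)) x))))"
    by (intro trig_cmult trig_add trig.trig_hart)
  moreover have "(\<lambda>x. 1 / (2 * L) * (hart (k - l) x + (hart (l - k) x + (hart (k + l) x + (-1) * hart (- (k + l)) x))))
    = (\<lambda>x. hart k x * hart l x)"
    unfolding hart_mult by (simp add: fun_eq_iff)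
  ultimately show ?case by simp
next
  case (trig_add f g)
  then have "trig (\<lambda>x. hart k x * f x + hart k x * g x)" by (intro trig.trig_add)
  then show ?case by (simp add: distrib_left)
next
  case (trig_cmult f c)
  then have "trig (\<lambda>x. c * (hart k x * f x))" by (intro trig.trig_cmult)
  then show ?case by (simp add: mult.left_commute)
qed

lemma trig_mult: "trig f \<Longrightarrow> trig g \<Longrightarrow> trig (\<lambda>x. f x * g x)"
proof (induction rule: trig.induct)
  case (trig_hart k)
  then show ?case by (rule trig_hart_mult)
next
  case (trig_add f f')
  then have "trig (\<lambda>x. f x * g x + f' x * g x)" by (intro trig.trig_add)
  then show ?case by (simp add: distrib_right)
next
  case (trig_cmult f c)
  then have "trig (\<lambda>x. c * (f x * g x))" by (intro trig.trig_cmult)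
  then show ?case by (simp add: mult.assoc)
qed

lemma trig_const: "trig (\<lambda>_. c)"
proof -
  have "trig (\<lambda>x. (c * L) * hart 0 x)" by (intro trig_cmult trig_hart)
  then show ?thesis using L_pos by (simp add: hart_def phase_def)
qed

lemma trig_cos: "trig (\<lambda>x. cos (phase k x))"
proof -
  have "trig (\<lambda>x. (L / 2) * (hart k x + hart (-k) x))" by (intro trig_cmult trig_add trig_hart)
  then show ?thesis using L_pos by (simp add: hart_def phase_minus add_divide_distrib[symmetric])
qed

lemma trig_sin: "trig (\<lambda>x. sin (phase k x))"
proof -
  have "trig (\<lambda>x. (L / 2) * (hart k x + (-1) * hart (-k) x))" by (intro trig_cmult trig_add trig_hart)
  moreover have "(\<lambda>x. (L / 2) * (hart k x + (-1) * hart (-k) x)) = (\<lambda>x. sin (phase k x))"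
    using L_pos by (simp add: fun_eq_iff hart_def phase_minus field_simps)
  ultimately show ?thesis by simp
qed

text \<open>Periodic functions cannot separate opposite faces of the closed cell. Stone-Weierstrass
  is therefore applied on the product of two circles, the compact space onto which
  \<open>circ\<close> wraps the cell.\<close>

definition circ :: "real^2 \<Rightarrow> complex \<times> complex" where
  "circ x = (cis (freq * x $ 1), cis (freq * x $ 2))"

definition circles :: "(complex \<times> complex) set" where
  "circles = sphere 0 1 \<times> sphere 0 1"

lemma circ_in: "circ x \<in> circles" by (simp add: circ_def circles_def)

lemma continuous_circ: "continuous_on S circ"
  unfolding circ_def by (intro continuous_intros)

lemma compact_circles: "compact circles"
  unfolding circles_def by (intro compact_Times compact_sphere)

text \<open>Equal points on the circle differ by a multiple of \<open>L\<close>; since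
  \<open>b\<close> is interior, \<open>\<bar>a - b\<bar> < L\<close> and the multiple is 0. For two
  endpoints 0 and \<open>L\<close> this would fail.\<close>

lemma cis_freq_inj:
  assumes "cis (freq * a) = cis (freq * b)" "0 \<le> a" "a \<le> L" "0 < b" "b < L"
  shows "a = b"
proof -
  have "sin (freq * a) = sin (freq * b) \<and> cos (freq * a) = cos (freq * b)"
    using assms(1) by (simp add: complex_eq_iff)
  then obtain n :: int where n: "freq * a = freq * b + 2 * pi * n"
    using sin_cos_eq_iff by blast
  have "2 * pi = freq * L" using L_pos by (simp add: freq_def)
  then have "freq * a = freq * (b + L * n)" using n by (simp add: algebra_simps)
  then have ab: "a - b = L * n" using freq_pos by simp
  have "L * \<bar>real_of_int n\<bar> < L * 1"
  proof -
    have "\<bar>a - b\<bar> < L" using assms by (auto simp: abs_if)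
    then show ?thesis using L_pos by (simp add: ab abs_mult)
  qed
  then have "n = 0" using L_pos by simp
  then show ?thesis using ab by simp
qed

lemma circ_inj:
  assumes "x \<in> cell" "y \<in> box 0 corner" "circ x = circ y"
  shows "x = y"
proof -
  have "x $ i = y $ i" for i
  proof (rule cis_freq_inj)
    show "cis (freq * x $ i) = cis (freq * y $ i)"
      using assms(3) two_cases[of i] by (auto simp: circ_def)
  qed (use assms(1,2) in \<open>auto simp: mem_box_cart corner_def\<close>)
  then show ?thesis by (simp add: vec_eq_iff)
qed

lemma orthogonal_trig:
  assumes f: "integrable (torus L) f" and orth: "\<And>k. (\<integral>x. f x * hart k x \<partial>torus L) = 0"
    and "trig p"
  shows "integrable (torus L) (\<lambda>x. f x * p x) \<and> (\<integral>x. f x * p x \<partial>torus L) = 0"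
  using \<open>trig p\<close>
proof (induction rule: trig.induct)
  case (trig_hart k)
  have "integrable (torus L) (\<lambda>x. f x * hart k x)"
  proof (rule Bochner_Integration.integrable_bound)
    show "integrable (torus L) (\<lambda>x. 2 / L * f x)" using f by simp
    show "(\<lambda>x. f x * hart k x) \<in> borel_measurable (torus L)"
      using f hart_L2[of k] by (auto simp: L2_def)
    have "\<bar>f x * hart k x\<bar> \<le> \<bar>2 / L * f x\<bar>" for x
      using hart_bound[of k x] L_pos mult_right_mono[of "\<bar>hart k x\<bar>" "2/L" "\<bar>f x\<bar>"]
      by (simp add: abs_mult mult.commute)
    then show "AE x in torus L. norm (f x * hart k x) \<le> norm (2 / L * f x)" by simp
  qed
  with orth show ?case by blast
next
  case (trig_add g h)
  then show ?case by (simp add: distrib_left)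
next
  case (trig_cmult g c)
  then show ?case by (simp add: mult.left_commute)
qed

text \<open>Stone-Weierstrass approximates \<open>F\<close> uniformly by functions whose pullback is
  a trigonometric polynomial, and against these the integral of \<open>f\<close> vanishes. Uniform
  approximation suffices because \<open>f\<close> is integrable.\<close>

lemma orthogonal_continuous:
  fixes F :: "complex \<times> complex \<Rightarrow> real"
  assumes f: "integrable (torus L) f" and orth: "\<And>k. (\<integral>x. f x * hart k x \<partial>torus L) = 0"
    and F: "continuous_on circles F"
  shows "(\<integral>x. f x * F (circ x) \<partial>torus L) = 0"
proof -
  let ?R = "{F. continuous_on circles F \<and> trig (\<lambda>x. F (circ x))}"
  interpret function_ring_on ?R circles
  proof
    fix x y :: "complex \<times> complex" assume xy: "x \<in> circles" "y \<in> circles" "x \<noteq> y"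
    have k1: "(\<lambda>x. Re (fst (circ x))) = (\<lambda>x. cos (phase (1, 0) x))"
      "(\<lambda>x. Im (fst (circ x))) = (\<lambda>x. sin (phase (1, 0) x))"
      "(\<lambda>x. Re (snd (circ x))) = (\<lambda>x. cos (phase (0, 1) x))"
      "(\<lambda>x. Im (snd (circ x))) = (\<lambda>x. sin (phase (0, 1) x))"
      by (auto simp: circ_def phase_def)
    have mem: "(\<lambda>z. Re (fst z)) \<in> ?R" "(\<lambda>z. Im (fst z)) \<in> ?R" "(\<lambda>z. Re (snd z)) \<in> ?R" "(\<lambda>z. Im (snd z)) \<in> ?R"
      by (simp_all add: k1 trig_cos trig_sin) (intro continuous_intros)+
    have "Re (fst x) \<noteq> Re (fst y) \<or> Im (fst x) \<noteq> Im (fst y) \<or> Re (snd x) \<noteq> Re (snd y) \<or> Im (snd x) \<noteq> Im (snd y)"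
      using xy(3) by (auto simp: prod_eq_iff complex_eq_iff)
    then show "\<exists>f\<in>?R. f x \<noteq> f y"
      by (elim disjE) (erule bexI[OF _ mem(1)] bexI[OF _ mem(2)] bexI[OF _ mem(3)] bexI[OF _ mem(4)])+
  qed (auto simp: compact_circles trig_const intro!: continuous_intros trig_mult trig_add)
  have Fc: "continuous_on cell (\<lambda>x. F (circ x))"
    by (rule continuous_on_compose2[OF F continuous_circ]) (auto simp: circ_in)
  obtain B where B: "\<And>y. y \<in> circles \<Longrightarrow> \<bar>F y\<bar> \<le> B"
    using compact_imp_bounded[OF compact_continuous_image[OF F compact_circles]]
    by (auto simp: bounded_iff)
  have Fm: "(\<lambda>x. F (circ x)) \<in> borel_measurable (torus L)"
    by (rule continuous_measurable_torus[OF Fc])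
  have fm: "f \<in> borel_measurable (torus L)" using f by auto
  have Fi: "integrable (torus L) (\<lambda>x. f x * F (circ x))"
  proof (rule Bochner_Integration.integrable_bound)
    show "integrable (torus L) (\<lambda>x. B * f x)" using f by simp
    have "\<bar>f x * F (circ x)\<bar> \<le> \<bar>B * f x\<bar>" for x
      using B[OF circ_in[of x]] mult_right_mono[of "\<bar>F (circ x)\<bar>" "\<bar>B\<bar>" "\<bar>f x\<bar>"]
      by (simp add: abs_mult mult.commute)
    then show "AE x in torus L. norm (f x * F (circ x)) \<le> norm (B * f x)" by simp
  qed (use Fm fm in simp)
  have "\<bar>\<integral>x. f x * F (circ x) \<partial>torus L\<bar> \<le> e * (\<integral>x. \<bar>f x\<bar> \<partial>torus L)" if "e > 0" for e
  proof -
    obtain G where G: "G \<in> ?R" "\<forall>x\<in>circles. \<bar>F x - G x\<bar> < e"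
      using Stone_Weierstrass_basic[OF F \<open>e > 0\<close>] by auto
    have Gi: "integrable (torus L) (\<lambda>x. f x * G (circ x))" "(\<integral>x. f x * G (circ x) \<partial>torus L) = 0"
      using orthogonal_trig[OF f orth, of "\<lambda>x. G (circ x)"] G(1) by auto
    have "(\<integral>x. f x * F (circ x) \<partial>torus L) = (\<integral>x. f x * F (circ x) - f x * G (circ x) \<partial>torus L)"
      using Fi Gi by simp
    also have "\<bar>\<dots>\<bar> \<le> (\<integral>x. e * \<bar>f x\<bar> \<partial>torus L)"
    proof (rule order_trans[OF integral_abs_bound], rule integral_mono)
      show "\<bar>f x * F (circ x) - f x * G (circ x)\<bar> \<le> e * \<bar>f x\<bar>" for x
      proof -
        have "\<bar>f x * F (circ x) - f x * G (circ x)\<bar> = \<bar>F (circ x) - G (circ x)\<bar> * \<bar>f x\<bar>"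
          by (simp add: right_diff_distrib[symmetric] abs_mult)
        also have "\<dots> \<le> e * \<bar>f x\<bar>" using G(2) circ_in[of x] by (intro mult_right_mono) auto
        finally show ?thesis .
      qed
    qed (use Fi Gi f in auto)
    finally show ?thesis by simp
  qed
  then have *: "\<bar>\<integral>x. f x * F (circ x) \<partial>torus L\<bar> \<le> e * (\<integral>x. \<bar>f x\<bar> \<partial>torus L)" if "e > 0" for e
    using that by blast
  have "\<bar>\<integral>x. f x * F (circ x) \<partial>torus L\<bar> \<le> 0 + e" if "e > 0" for e
  proof -
    define c where "c = (\<integral>x. \<bar>f x\<bar> \<partial>torus L) + 1"
    have c: "c > 0" unfolding c_def by (simp add: add_nonneg_pos)
    have "\<bar>\<integral>x. f x * F (circ x) \<partial>torus L\<bar> \<le> e / c * (\<integral>x. \<bar>f x\<bar> \<partial>torus L)"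
      by (rule *) (use c that in simp)
    also have "\<dots> \<le> e / c * c" using c that by (intro mult_left_mono) (simp_all add: c_def)
    finally show ?thesis using c by simp
  qed
  then have "\<bar>\<integral>x. f x * F (circ x) \<partial>torus L\<bar> \<le> 0" by (rule field_le_epsilon)
  then show ?thesis by simp
qed

lemma sets_torusI:
  assumes "K \<in> sets lebesgue" "K \<subseteq> box 0 corner"
  shows "K \<in> sets (torus L)"
proof -
  have "K \<subseteq> cell" using assms(2) box_subset_cbox by (rule order_trans)
  then show ?thesis using assms(1) by (simp add: torus_eq sets_restrict_space_iff)
qed

lemma orthogonal_compact:
  assumes f: "integrable (torus L) f" and orth: "\<And>k. (\<integral>x. f x * hart k x \<partial>torus L) = 0"
    and K: "compact K" "K \<subseteq> box 0 corner" 
  shows "(\<integral>x. f x * indicat_real K x \<partial>torus L) = 0"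
proof (cases "K = {}")
  case False
  let ?A = "circ ` K"
  have clA: "closed ?A" "?A \<noteq> {}"
    using K False by (auto intro!: compact_imp_closed compact_continuous_image continuous_circ)
  define F where "F n y = max 0 (1 - real n * infdist y ?A)" for n y
  have "(\<lambda>n. \<integral>x. f x * F n (circ x) \<partial>torus L) \<longlonglongrightarrow> (\<integral>x. f x * indicat_real K x \<partial>torus L)"
  proof (rule integral_dominated_convergence[where w = "\<lambda>x. \<bar>f x\<bar>"])
    have fm: "f \<in> borel_measurable (torus L)" using f by auto
    have "continuous_on cell (\<lambda>x. F n (circ x))" for n
      unfolding F_def by (intro continuous_intros continuous_circ)
    then show "(\<lambda>x. f x * F n (circ x)) \<in> borel_measurable (torus L)" for n
      by (intro borel_measurable_times fm continuous_measurable_torus)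
    have "K \<in> sets (torus L)"
      using compact_imp_closed[OF K(1)] K(2) by (intro sets_torusI) (auto intro: sets_completionI_sets)
    then show "(\<lambda>x. f x * indicat_real K x) \<in> borel_measurable (torus L)"
      using fm by simp
    show "integrable (torus L) (\<lambda>x. \<bar>f x\<bar>)" using f by simp
    show "AE x in torus L. norm (f x * F n (circ x)) \<le> \<bar>f x\<bar>" for n
    proof (rule AE_I2)
      fix x
      have "0 \<le> F n (circ x)" "F n (circ x) \<le> 1"
        by (auto simp: F_def infdist_nonneg)
      then show "norm (f x * F n (circ x)) \<le> \<bar>f x\<bar>"
        by (simp add: abs_mult mult_left_le)
    qed
    show "AE x in torus L. (\<lambda>n. f x * F n (circ x)) \<longlonglongrightarrow> f x * indicat_real K x"
    proof (rule AE_I2)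
      fix x assume "x \<in> space (torus L)"
      then have x: "x \<in> cell" by (simp add: space_torus)
      have "(\<lambda>n. F n (circ x)) \<longlonglongrightarrow> indicat_real K x"
      proof (cases "x \<in> K")
        case True
        then have "infdist (circ x) ?A = 0" by (simp add: infdist_zero)
        then show ?thesis using True by (simp add: F_def)
      next
        case False
        then have "circ x \<notin> ?A" using circ_inj[OF x] K(2) by blast
        then have d: "infdist (circ x) ?A > 0"
          using clA in_closed_iff_infdist_zero infdist_nonneg by (metis less_eq_real_def)
        obtain N where N: "1 < real N * infdist (circ x) ?A"
          using reals_Archimedean3[OF d] by blast
        have "F n (circ x) = 0" if "n \<ge> N" for n
        proof -
          have "real N * infdist (circ x) ?A \<le> real n * infdist (circ x) ?A"
            using that d by (intro mult_right_mono) auto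
          then show ?thesis using N by (simp add: F_def)
        qed
        then have "\<forall>\<^sub>F n in sequentially. F n (circ x) = 0"
          by (auto simp: eventually_sequentially)
        then show ?thesis using False by (simp add: tendsto_eventually)
      qed
      then show "(\<lambda>n. f x * F n (circ x)) \<longlonglongrightarrow> f x * indicat_real K x"
        by (intro tendsto_mult tendsto_const)
    qed
  qed
  moreover have "(\<integral>x. f x * F n (circ x) \<partial>torus L) = 0" for n
    unfolding F_def by (intro orthogonal_continuous f orth continuous_intros)
  ultimately have "(\<lambda>n. 0) \<longlonglongrightarrow> (\<integral>x. f x * indicat_real K x \<partial>torus L)" by simp
  then show ?thesis using LIMSEQ_unique[OF _ tendsto_const] by blast
qed simp

text \<open>Inner regularity: a closed \<open>T\<close> inside the positivity set exhausts it up to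
  measure \<open>e\<close>. It is compact, so \<open>f\<close> integrates to 0 over it, and
  positivity of \<open>f\<close> there makes \<open>T\<close> null.\<close>

lemma orthogonal_imp_null_pos:
  assumes f: "integrable (torus L) f" and orth: "\<And>k. (\<integral>x. f x * hart k x \<partial>torus L) = 0"
  shows "{x \<in> box 0 corner. f x > 0} \<in> null_sets lebesgue"
proof -
  let ?P = "{x \<in> box 0 corner. f x > 0}"
  have "f \<in> borel_measurable (torus L)" using f by auto
  then have "{x \<in> space (torus L). f x > 0} \<in> sets (torus L)" by measurable
  then have "{x \<in> cell. f x > 0} \<in> sets lebesgue"
    unfolding space_torus torus_eq by (simp add: sets_restrict_space_iff)
  then have "{x \<in> cell. f x > 0} \<inter> box 0 corner \<in> sets lebesgue" by auto
  moreover have "{x \<in> cell. f x > 0} \<inter> box 0 corner = ?P"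
    using box_subset_cbox by blast
  ultimately have P: "?P \<in> sets lebesgue" by simp
  have "emeasure lebesgue ?P \<le> 0 + ennreal e" if "e > 0" for e
  proof -
    obtain T where T: "closed T" "T \<subseteq> ?P" "?P - T \<in> lmeasurable"
      "emeasure lebesgue (?P - T) < ennreal e"
      by (rule sets_lebesgue_inner_closed[OF P \<open>e > 0\<close>])
    have "bounded T" by (rule bounded_subset[OF bounded_box[of 0 corner]]) (use T(2) in auto)
    then have K: "compact T" "T \<subseteq> box 0 corner" using T by (auto simp: compact_eq_bounded_closed)
    have Tl: "T \<in> sets lebesgue" using T(1) by auto
    then have Tt: "T \<in> sets (torus L)" using K(2) by (rule sets_torusI)
    have pos: "0 < f x" if "x \<in> T" for x using T(2) that by auto
    have i: "integrable (torus L) (\<lambda>x. f x * indicat_real T x)"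
      using integrable_real_mult_indicator[OF Tt f] by (simp add: mult.commute)
    have "AE x in torus L. f x * indicat_real T x = 0"
      using orthogonal_compact[OF f orth K] pos
      by (subst integral_nonneg_eq_0_iff_AE[OF i, symmetric]) (auto simp: indicator_def less_imp_le)
    then have "AE x in torus L. x \<notin> T"
    proof eventually_elim
      case (elim x)
      then show ?case using pos[of x] by (auto simp: indicator_def)
    qed
    moreover have "T \<inter> space (torus L) = T" using sets.sets_into_space[OF Tt] by blast
    ultimately have "emeasure (torus L) T = 0"
      using AE_iff_measurable[OF Tt, of "\<lambda>x. x \<notin> T"] sets.sets_into_space[OF Tt] by auto
    then have "emeasure lebesgue T = 0"
      using Tt unfolding torus_eq by (simp add: emeasure_restrict_space sets.sets_into_space sets_restrict_space_iff)
    moreover have "emeasure lebesgue ?P \<le> emeasure lebesgue (?P - T) + emeasure lebesgue T"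
    proof -
      have "?P = (?P - T) \<union> T" using T(2) by blast
      then show ?thesis using emeasure_subadditive[of "?P - T" lebesgue T] P Tl by auto
    qed
    ultimately show ?thesis using T(4) by simp
  qed
  then have "emeasure lebesgue ?P \<le> 0" by (rule ennreal_le_epsilon)
  then show ?thesis using P by (simp add: null_sets_def)
qed

text \<open>Completeness of the basis, already in L^1: the previous lemma applies to
  \<open>f\<close> and to \<open>-f\<close>, and the boundary of the cell is a null set.\<close>

lemma AE_zero_if_orthogonal:
  assumes f: "integrable (torus L) f" and orth: "\<And>k. (\<integral>x. f x * hart k x \<partial>torus L) = 0"
  shows "AE x in torus L. f x = 0"
proof -
  let ?N = "{x \<in> box 0 corner. f x > 0} \<union> {x \<in> box 0 corner. - f x > 0} \<union> (cell - box 0 corner)"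
  have "cell - box 0 corner \<in> null_sets lebesgue"
    using negligible_frontier_interval negligible_iff_null_sets by blast
  moreover have "{x \<in> box 0 corner. - f x > 0} \<in> null_sets lebesgue"
    by (rule orthogonal_imp_null_pos) (use f orth in auto)
  ultimately have N: "?N \<in> null_sets lebesgue"
    using orthogonal_imp_null_pos[OF f orth] by (intro null_sets.Un)
  show ?thesis unfolding torus_eq
    by (subst AE_restrict_space_iff)
      (use N in \<open>auto intro!: AE_I'[OF N] simp: linorder_neq_iff\<close>)
qed

section \<open>Hartley coefficients\<close>

text \<open>Square cutoffs are symmetric under \<open>k \<mapsto> -k\<close>. Differentiation pairs
  \<open>k\<close> with \<open>-k\<close>, so truncated sums can be integrated by parts
  exactly.\<close>

definition modes :: "nat \<Rightarrow> (int \<times> int) set" where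
  "modes n = {- int n..int n} \<times> {- int n..int n}"

definition hat :: "(real^2 \<Rightarrow> real) \<Rightarrow> int \<times> int \<Rightarrow> real" where
  "hat u k = L2_inner L u (hart k)"

definition tpoly :: "(int \<times> int) set \<Rightarrow> (int \<times> int \<Rightarrow> real) \<Rightarrow> real^2 \<Rightarrow> real" where
  "tpoly K a x = (\<Sum>k\<in>K. a k * hart k x)"

lemma finite_modes: "finite (modes n)" by (simp add: modes_def)

lemma modes_mono: "m \<le> n \<Longrightarrow> modes m \<subseteq> modes n" by (auto simp: modes_def)

lemma uminus_modes: "- k \<in> modes n \<longleftrightarrow> k \<in> modes n" by (cases k) (auto simp: modes_def)

lemma sum_modes_uminus: "(\<Sum>k\<in>modes n. f (- k)) = (\<Sum>k\<in>modes n. f k)"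
  by (rule sum.reindex_bij_witness[of _ uminus uminus]) (auto simp: uminus_modes)

lemma finite_subset_modes:
  assumes "finite K"
  shows "\<exists>n. K \<subseteq> modes n"
proof -
  have "\<exists>n. k \<in> modes n" for k
    by (rule exI[of _ "nat (max \<bar>fst k\<bar> \<bar>snd k\<bar>)"]) (cases k, auto simp: modes_def)
  then obtain N where N: "\<And>k. k \<in> modes (N k)" by metis
  have "K \<subseteq> modes (Max (N ` K))"
  proof
    fix k assume "k \<in> K"
    then have "N k \<le> Max (N ` K)" using assms by simp
    then show "k \<in> modes (Max (N ` K))" using N modes_mono by blast
  qed
  then show ?thesis by blast
qed

lemma in_some_modes: "\<exists>n. k \<in> modes n"
  using finite_subset_modes[of "{k}"] by auto

lemma hat_add: "u \<in> L2 L \<Longrightarrow> v \<in> L2 L \<Longrightarrow> hat (\<lambda>x. u x + v x) k = hat u k + hat v k"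
  by (simp add: hat_def L2_inner_add_left hart_L2)

lemma hat_diff: "u \<in> L2 L \<Longrightarrow> v \<in> L2 L \<Longrightarrow> hat (\<lambda>x. u x - v x) k = hat u k - hat v k"
  by (simp add: hat_def L2_inner_diff_left hart_L2)

lemma hat_cmult: "hat (\<lambda>x. c * u x) k = c * hat u k"
  by (simp add: hat_def L2_inner_cmult_left)

lemma tpoly_L2: "tpoly K a \<in> L2 L"
  unfolding tpoly_def[abs_def] by (intro L2_sum L2_cmult hart_L2)

lemma hat_tpoly: "finite K \<Longrightarrow> hat (tpoly K a) l = (if l \<in> K then a l else 0)"
proof -
  assume K: "finite K"
  have "hat (tpoly K a) l = (\<Sum>k\<in>K. a k * (if k = l then 1 else 0))"
    unfolding hat_def tpoly_def[abs_def]
    by (subst L2_inner_sum_left) (auto simp: L2_cmult hart_L2 L2_inner_cmult_left hart_orthonormal)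
  also have "\<dots> = (\<Sum>k\<in>K. if k = l then a k else 0)" by (intro sum.cong) auto
  also have "\<dots> = (if l \<in> K then a l else 0)" using K by simp
  finally show ?thesis .
qed

lemma inner_tpoly: "u \<in> L2 L \<Longrightarrow> L2_inner L u (tpoly K a) = (\<Sum>k\<in>K. a k * hat u k)"
  unfolding tpoly_def[abs_def]
  by (subst L2_inner_commute, subst L2_inner_sum_left)
    (auto simp: L2_cmult hart_L2 L2_inner_cmult_left hat_def L2_inner_commute)

lemma inner_tpoly_self: "finite K \<Longrightarrow> L2_inner L (tpoly K a) (tpoly K a) = (\<Sum>k\<in>K. (a k)\<^sup>2)"
  by (simp add: inner_tpoly tpoly_L2 hat_tpoly power2_eq_square)

lemma inner_diff_self:
  assumes "u \<in> L2 L" "v \<in> L2 L"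
  shows "L2_inner L (\<lambda>x. u x - v x) (\<lambda>x. u x - v x) = L2_inner L u u - 2 * L2_inner L u v + L2_inner L v v"
proof -
  have d: "(\<lambda>x. u x - v x) \<in> L2 L" using assms by (rule L2_diff)
  have "L2_inner L (\<lambda>x. u x - v x) (\<lambda>x. u x - v x)
      = L2_inner L (\<lambda>x. u x - v x) u - L2_inner L (\<lambda>x. u x - v x) v"
    using assms d L2_inner_commute L2_inner_diff_left by metis
  then show ?thesis using assms by (simp add: L2_inner_diff_left L2_inner_commute[of v u])
qed

lemma inner_add_self:
  assumes "u \<in> L2 L" "v \<in> L2 L"
  shows "L2_inner L (\<lambda>x. u x + v x) (\<lambda>x. u x + v x) = L2_inner L u u + 2 * L2_inner L u v + L2_inner L v v"
  using inner_diff_self[OF assms(1) L2_cmult[OF assms(2), of "-1"]]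
  by (simp add: L2_inner_def)

lemma dist_tpoly:
  assumes "u \<in> L2 L" "finite K"
  shows "L2_inner L (\<lambda>x. u x - tpoly K (hat u) x) (\<lambda>x. u x - tpoly K (hat u) x)
    = L2_inner L u u - (\<Sum>k\<in>K. (hat u k)\<^sup>2)"
proof -
  have "L2_inner L u (tpoly K (hat u)) = (\<Sum>k\<in>K. (hat u k)\<^sup>2)"
    using assms by (simp add: inner_tpoly power2_eq_square)
  then show ?thesis using assms by (simp add: inner_diff_self tpoly_L2 inner_tpoly_self)
qed

lemma inner_self_nonneg: "0 \<le> L2_inner L u u"
  by (simp add: L2_inner_def)

section \<open>Bessel, Riesz-Fischer and Parseval\<close>

lemma Bessel: "u \<in> L2 L \<Longrightarrow> finite K \<Longrightarrow> (\<Sum>k\<in>K. (hat u k)\<^sup>2) \<le> L2_inner L u u"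
  using dist_tpoly[of u K] inner_self_nonneg[of "\<lambda>x. u x - tpoly K (hat u) x"] by simp

text \<open>The squared L^2 distance of two partial sums is the difference of the corresponding sums
  of squares, and those increase and are bounded. The coefficients of the limit come from Bessel's
  inequality for the error at the single mode \<open>k\<close>.\<close>

lemma Riesz_Fischer:
  assumes bd: "\<And>n. (\<Sum>k\<in>modes n. (a k)\<^sup>2) \<le> C"
  obtains u where "u \<in> L2 L" "hat u = a"
    "(\<lambda>n. L2_inner L (\<lambda>x. u x - tpoly (modes n) a x) (\<lambda>x. u x - tpoly (modes n) a x)) \<longlonglongrightarrow> 0"
proof -
  let ?S = "\<lambda>n. \<Sum>k\<in>modes n. (a k)\<^sup>2"
  let ?s = "\<lambda>n. tpoly (modes n) a"
  have mono: "incseq ?S"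
    by (intro monoI sum_mono2 finite_modes modes_mono) auto
  have "convergent ?S"
    using incseq_convergent[OF mono, of C] bd unfolding convergent_def by blast
  then have cauchyS: "Cauchy ?S" by (simp add: Cauchy_convergent_iff)
  have diff: "(\<integral>x. (?s i x - ?s j x)\<^sup>2 \<partial>torus L) = \<bar>?S i - ?S j\<bar>" for i j
  proof -
    have *: "(\<integral>x. (?s i x - ?s j x)\<^sup>2 \<partial>torus L) = ?S i - ?S j" if "j \<le> i" for i j
    proof -
      have "(\<integral>x. (?s i x - ?s j x)\<^sup>2 \<partial>torus L)
          = L2_inner L (\<lambda>x. ?s i x - ?s j x) (\<lambda>x. ?s i x - ?s j x)"
        by (simp add: L2_inner_self)
      also have "\<dots> = ?S i - 2 * (\<Sum>k\<in>modes j. a k * hat (?s i) k) + ?S j"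
        unfolding inner_diff_self[OF tpoly_L2 tpoly_L2] inner_tpoly_self[OF finite_modes]
        unfolding inner_tpoly[OF tpoly_L2] ..
      also have "(\<Sum>k\<in>modes j. a k * hat (?s i) k) = ?S j"
        using modes_mono[OF that] by (intro sum.cong) (auto simp: hat_tpoly finite_modes power2_eq_square)
      finally show ?thesis by simp
    qed
    show ?thesis
    proof (cases "j \<le> i")
      case True
      then have "?S j \<le> ?S i" using mono by (rule incseqD[rotated])
      then show ?thesis using *[OF True] by simp
    next
      case False
      then have "i \<le> j" by simp
      then have "?S i \<le> ?S j" using mono by (rule incseqD[rotated])
      then show ?thesis using *[OF \<open>i \<le> j\<close>] by (simp add: power2_commute)
    qed
  qed
  obtain r where r: "strict_mono r" "(\<lambda>x. lim (\<lambda>i. ?s (r i) x)) \<in> sq_integrable (torus L)"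
    "(\<lambda>n. \<integral>x. (?s n x - lim (\<lambda>i. ?s (r i) x))\<^sup>2 \<partial>torus L) \<longlonglongrightarrow> 0"
  proof (rule L2_limit_exists[OF finite_measure_torus, of ?s])
    show "?s n \<in> sq_integrable (torus L)" for n using tpoly_L2 by (simp add: L2_iff)
    show "\<exists>N. \<forall>i\<ge>N. \<forall>j\<ge>N. (\<integral>x. (?s i x - ?s j x)\<^sup>2 \<partial>torus L) < e" if "e > 0" for e
      using CauchyD[OF cauchyS that] unfolding diff by simp
  qed
  define u where "u x = lim (\<lambda>i. ?s (r i) x)" for x
  have "periodic L (?s n)" for n using tpoly_L2[of "modes n" a] by (simp add: L2_iff)
  then have "periodic L u" by (simp add: periodic_def u_def)
  then have u: "u \<in> L2 L" using r(2) by (simp add: L2_iff u_def[abs_def])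
  have conv: "(\<lambda>n. L2_inner L (\<lambda>x. u x - ?s n x) (\<lambda>x. u x - ?s n x)) \<longlonglongrightarrow> 0"
    using r(3) unfolding u_def[symmetric] L2_inner_self by (simp add: power2_commute)
  have "hat u k = a k" for k
  proof -
    obtain m where m: "k \<in> modes m" using in_some_modes by blast
    have "(hat u k - a k)\<^sup>2 \<le> L2_inner L (\<lambda>x. u x - ?s n x) (\<lambda>x. u x - ?s n x)" if "n \<ge> m" for n
    proof -
      have "hat (\<lambda>x. u x - ?s n x) k = hat u k - a k"
        using m modes_mono[OF that] by (auto simp: hat_diff[OF u tpoly_L2] hat_tpoly finite_modes)
      then show ?thesis using Bessel[of "\<lambda>x. u x - ?s n x" "{k}"] u by (simp add: L2_diff tpoly_L2)
    qed
    then have "(hat u k - a k)\<^sup>2 \<le> 0"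
      by (intro LIMSEQ_le_const[OF conv]) auto
    then show ?thesis by simp
  qed
  then show thesis using u conv that by blast
qed

lemma AE_eq_if_hat_eq:
  assumes "u \<in> L2 L" "v \<in> L2 L" "hat u = hat v"
  shows "AE x in torus L. u x = v x"
proof -
  have d: "(\<lambda>x. u x - v x) \<in> L2 L" using assms L2_diff by blast
  have one: "(\<lambda>x. 1) \<in> L2 L" by (intro L2_continuous) (auto simp: periodic_def)
  have "AE x in torus L. u x - v x = 0"
  proof (rule AE_zero_if_orthogonal)
    show "integrable (torus L) (\<lambda>x. u x - v x)" using L2_mult_integrable[OF d one] by simp
    show "(\<integral>x. (u x - v x) * hart k x \<partial>torus L) = 0" for k
      using hat_diff[OF assms(1,2), of k] assms(3) by (simp add: hat_def L2_inner_def)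
  qed
  then show ?thesis by simp
qed

text \<open>Riesz-Fischer builds some \<open>v\<close> with the coefficients of \<open>u\<close> for
  which the identity holds; completeness gives \<open>v = u\<close> almost everywhere.\<close>

lemma Parseval_self:
  assumes u: "u \<in> L2 L"
  shows "(\<lambda>n. \<Sum>k\<in>modes n. (hat u k)\<^sup>2) \<longlonglongrightarrow> L2_inner L u u"
proof -
  obtain v where v: "v \<in> L2 L" "hat v = hat u"
    "(\<lambda>n. L2_inner L (\<lambda>x. v x - tpoly (modes n) (hat u) x) (\<lambda>x. v x - tpoly (modes n) (hat u) x)) \<longlonglongrightarrow> 0"
    by (rule Riesz_Fischer[of "hat u", OF Bessel[OF u finite_modes]])
  have ae: "AE x in torus L. (v x)\<^sup>2 = (u x)\<^sup>2"
    using AE_eq_if_hat_eq[OF v(1) u v(2)] by eventually_elim simp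
  have m: "u \<in> borel_measurable (torus L)" "v \<in> borel_measurable (torus L)"
    using u v(1) by (simp_all add: L2_def)
  have "L2_inner L v v = L2_inner L u u"
    unfolding L2_inner_self by (rule integral_cong_AE[OF _ _ ae]) (intro borel_measurable_power m)+
  moreover have "L2_inner L (\<lambda>x. v x - tpoly (modes n) (hat u) x) (\<lambda>x. v x - tpoly (modes n) (hat u) x)
      = L2_inner L v v - (\<Sum>k\<in>modes n. (hat u k)\<^sup>2)" for n
    using dist_tpoly[OF v(1) finite_modes] unfolding v(2) .
  ultimately have "(\<lambda>n. L2_inner L u u - (\<Sum>k\<in>modes n. (hat u k)\<^sup>2)) \<longlonglongrightarrow> 0"
    using v(3) by (simp only:)
  from tendsto_diff[OF tendsto_const[of "L2_inner L u u"] this] show ?thesis by simp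
qed

text \<open>Polarization of \<open>Parseval_self\<close>.\<close>

lemma Parseval:
  assumes u: "u \<in> L2 L" and v: "v \<in> L2 L"
  shows "(\<lambda>n. \<Sum>k\<in>modes n. hat u k * hat v k) \<longlonglongrightarrow> L2_inner L u v"
proof -
  let ?p = "\<lambda>x. u x + v x" and ?m = "\<lambda>x. u x - v x"
  have "(\<lambda>n. ((\<Sum>k\<in>modes n. (hat ?p k)\<^sup>2) - (\<Sum>k\<in>modes n. (hat ?m k)\<^sup>2)) / 4)
      \<longlonglongrightarrow> (L2_inner L ?p ?p - L2_inner L ?m ?m) / 4"
    by (intro tendsto_intros Parseval_self L2_add L2_diff u v) simp
  moreover have "(\<Sum>k\<in>modes n. (hat ?p k)\<^sup>2) - (\<Sum>k\<in>modes n. (hat ?m k)\<^sup>2)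
      = 4 * (\<Sum>k\<in>modes n. hat u k * hat v k)" for n
    unfolding sum_subtractf[symmetric] sum_distrib_left hat_add[OF u v] hat_diff[OF u v]
    by (intro sum.cong) (auto simp: power2_eq_square algebra_simps)
  moreover have "(L2_inner L ?p ?p - L2_inner L ?m ?m) / 4 = L2_inner L u v"
    by (simp add: inner_add_self[OF u v] inner_diff_self[OF u v])
  ultimately show ?thesis by simp
qed

end

section \<open>Weighted coefficient norms\<close>

context torus_side
begin

text \<open>Weighted square sums of coefficients replace Sobolev norms: weight 1 is the L^2 norm
  squared, \<open>lam\<close> that of the gradient, \<open>(lam k)\<^sup>2\<close> that of the
  Laplacian, and \<open>1 + (lam k)\<^sup>2\<close> an equivalent H^2 norm squared.\<close>

definition wpart :: "(int \<times> int \<Rightarrow> real) \<Rightarrow> (int \<times> int \<Rightarrow> real) \<Rightarrow> nat \<Rightarrow> real" where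
  "wpart w a n = (\<Sum>k\<in>modes n. w k * (a k)\<^sup>2)"

definition wfin :: "(int \<times> int \<Rightarrow> real) \<Rightarrow> (int \<times> int \<Rightarrow> real) \<Rightarrow> bool" where
  "wfin w a \<longleftrightarrow> (\<exists>C. \<forall>n. wpart w a n \<le> C)"

text \<open>Meaningful only if \<open>wfin w a\<close> and \<open>w\<close> is nonnegative.\<close>

definition wsq :: "(int \<times> int \<Rightarrow> real) \<Rightarrow> (int \<times> int \<Rightarrow> real) \<Rightarrow> real" where
  "wsq w a = lim (wpart w a)"

lemma wpart_nonneg: "(\<And>k. 0 \<le> w k) \<Longrightarrow> 0 \<le> wpart w a n"
  unfolding wpart_def by (intro sum_nonneg mult_nonneg_nonneg) auto

lemma wpart_incseq: "(\<And>k. 0 \<le> w k) \<Longrightarrow> incseq (wpart w a)"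
  unfolding wpart_def by (intro monoI sum_mono2 finite_modes modes_mono) auto

lemma wsq_lim:
  assumes "\<And>k. 0 \<le> w k" "wfin w a"
  shows "wpart w a \<longlonglongrightarrow> wsq w a"
proof -
  have inc: "incseq (wpart w a)" by (rule wpart_incseq) (rule assms)
  obtain C where "\<forall>n. wpart w a n \<le> C" using assms(2) unfolding wfin_def by blast
  then have "convergent (wpart w a)" using incseq_convergent[OF inc] unfolding convergent_def by blast
  then show ?thesis by (simp add: wsq_def convergent_LIMSEQ_iff)
qed

lemma wpart_le_wsq:
  assumes "\<And>k. 0 \<le> w k" "wfin w a"
  shows "wpart w a n \<le> wsq w a"
  by (rule incseq_le[OF wpart_incseq[OF assms(1)] wsq_lim[OF assms]])

lemma wsq_nonneg:
  assumes "\<And>k. 0 \<le> w k" "wfin w a"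
  shows "0 \<le> wsq w a"
  using order_trans[OF wpart_nonneg wpart_le_wsq, OF assms(1) assms] .

lemma wfinI: "(\<And>n. wpart w a n \<le> C) \<Longrightarrow> wfin w a"
  unfolding wfin_def by blast

lemma wsq_le:
  assumes "\<And>k. 0 \<le> w k" "\<And>n. wpart w a n \<le> C"
  shows "wsq w a \<le> C"
  by (rule LIMSEQ_le_const2[OF wsq_lim[OF assms(1) wfinI[of w a C, OF assms(2)]]]) (use assms(2) in auto)

lemma wpart_mono: "(\<And>k. w k \<le> c * v k) \<Longrightarrow> wpart w a n \<le> c * wpart v a n"
  unfolding wpart_def sum_distrib_left mult.assoc[symmetric]
  by (intro sum_mono mult_right_mono) auto

lemma wfin_mono:
  assumes "\<And>k. w k \<le> c * v k" "c \<ge> 0" "\<And>k. 0 \<le> v k" "wfin v a"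
  shows "wfin w a"
proof (rule wfinI)
  fix n
  have "wpart w a n \<le> c * wpart v a n" using assms(1) by (rule wpart_mono)
  also have "\<dots> \<le> c * wsq v a" using assms by (intro mult_left_mono wpart_le_wsq)
  finally show "wpart w a n \<le> c * wsq v a" .
qed

lemma wsq_mono:
  assumes "\<And>k. w k \<le> c * v k" "c \<ge> 0" "\<And>k. 0 \<le> w k" "\<And>k. 0 \<le> v k" "wfin v a"
  shows "wsq w a \<le> c * wsq v a"
proof (rule wsq_le[OF assms(3)])
  fix n
  have "wpart w a n \<le> c * wpart v a n" using assms(1) by (rule wpart_mono)
  also have "\<dots> \<le> c * wsq v a" using assms by (intro mult_left_mono wpart_le_wsq)
  finally show "wpart w a n \<le> c * wsq v a" .
qed

lemma wsq_add_weight: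
  assumes "\<And>k. 0 \<le> w k" "\<And>k. 0 \<le> v k" "wfin w a" "wfin v a"
  shows "wfin (\<lambda>k. w k + v k) a" "wsq (\<lambda>k. w k + v k) a = wsq w a + wsq v a"
proof -
  have e: "wpart (\<lambda>k. w k + v k) a = (\<lambda>n. wpart w a n + wpart v a n)"
    by (simp add: wpart_def fun_eq_iff distrib_right sum.distrib)
  have "wpart (\<lambda>k. w k + v k) a \<longlonglongrightarrow> wsq w a + wsq v a"
    unfolding e by (intro tendsto_add wsq_lim assms)
  then show "wsq (\<lambda>k. w k + v k) a = wsq w a + wsq v a" unfolding wsq_def by (rule limI)
  show "wfin (\<lambda>k. w k + v k) a"
    by (rule wfinI[of _ _ "wsq w a + wsq v a"], unfold e) (intro add_mono wpart_le_wsq assms)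
qed

lemma wfin_diff:
  assumes "\<And>k. 0 \<le> w k" "wfin w a" "wfin w b"
  shows "wfin w (\<lambda>k. a k - b k)" "wsq w (\<lambda>k. a k - b k) \<le> 2 * wsq w a + 2 * wsq w b"
proof -
  have *: "wpart w (\<lambda>k. a k - b k) n \<le> 2 * wsq w a + 2 * wsq w b" for n
  proof -
    have i: "(x - y)\<^sup>2 \<le> 2 * x\<^sup>2 + 2 * y\<^sup>2" for x y :: real
      using zero_le_power2[of "x + y"] by (simp add: power2_sum power2_diff)
    have "wpart w (\<lambda>k. a k - b k) n \<le> (\<Sum>k\<in>modes n. w k * (2 * (a k)\<^sup>2 + 2 * (b k)\<^sup>2))"
      unfolding wpart_def by (intro sum_mono mult_left_mono assms i)
    also have "\<dots> = 2 * wpart w a n + 2 * wpart w b n"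
      by (simp add: wpart_def sum_distrib_left sum.distrib algebra_simps)
    also have "\<dots> \<le> 2 * wsq w a + 2 * wsq w b"
      using wpart_le_wsq[OF assms(1,2), of n] wpart_le_wsq[OF assms(1,3), of n] by linarith
    finally show ?thesis .
  qed
  show "wfin w (\<lambda>k. a k - b k)" by (rule wfinI[OF *])
  show "wsq w (\<lambda>k. a k - b k) \<le> 2 * wsq w a + 2 * wsq w b" by (rule wsq_le[OF assms(1) *])
qed

lemma wpart_cmult: "wpart w (\<lambda>k. c * a k) n = c\<^sup>2 * wpart w a n"
  by (simp add: wpart_def power_mult_distrib sum_distrib_left algebra_simps)

lemma wfin_cmult:
  assumes "\<And>k. 0 \<le> w k" "wfin w a"
  shows "wfin w (\<lambda>k. c * a k)"
  using assms wpart_le_wsq[OF assms]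
  by (intro wfinI[of _ _ "c\<^sup>2 * wsq w a"]) (simp add: wpart_cmult mult_left_mono)

lemma wfin_add:
  assumes "\<And>k. 0 \<le> w k" "wfin w a" "wfin w b"
  shows "wfin w (\<lambda>k. a k + b k)"
  using wfin_diff(1)[OF assms(1,2) wfin_cmult[OF assms(1,3), of "-1"]] by simp

text \<open>The eigenvalue of the negative Laplacian on \<open>hart k\<close>.\<close>

definition lam :: "int \<times> int \<Rightarrow> real" where
  "lam k = freq\<^sup>2 * ((idx 1 k)\<^sup>2 + (idx 2 k)\<^sup>2)"

abbreviation "one_w \<equiv> (\<lambda>k::int \<times> int. 1::real)"
abbreviation "lam_w \<equiv> (\<lambda>k. lam k)"
abbreviation "lam2_w \<equiv> (\<lambda>k. (lam k)\<^sup>2)"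
abbreviation "h2_w \<equiv> (\<lambda>k. 1 + (lam k)\<^sup>2)"

lemma lam_nonneg: "0 \<le> lam k" by (simp add: lam_def)

lemma lam_le: "lam k \<le> (1 + (lam k)\<^sup>2) / 2"
  using zero_le_power2[of "1 - lam k"] by (simp add: power2_diff)

lemma h2_fin:
  assumes "wfin h2_w a"
  shows "wfin one_w a" "wfin lam_w a" "wfin lam2_w a"
    "wsq h2_w a = wsq one_w a + wsq lam2_w a"
proof -
  show 1: "wfin one_w a" by (rule wfin_mono[where c = 1 and v = h2_w]) (use assms in auto)
  show "wfin lam_w a"
    by (rule wfin_mono[where c = "1/2" and v = h2_w]) (use assms lam_le in auto)
  show 2: "wfin lam2_w a" by (rule wfin_mono[where c = 1 and v = h2_w]) (use assms in auto)
  show "wsq h2_w a = wsq one_w a + wsq lam2_w a"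
    by (rule wsq_add_weight(2)) (use 1 2 in auto)
qed

text \<open>Cauchy-Schwarz for the products \<open>a k * (lam k * a k)\<close>. In the limit it is
  norm(grad u)^4 <= norm(u)^2 norm(Lap u)^2, the source of the time integrability of the Gronwall
  weight.\<close>

lemma wpart_interp: "(wpart lam_w a n)\<^sup>2 \<le> wpart one_w a n * wpart lam2_w a n"
proof -
  have "wpart lam_w a n = (\<Sum>k\<in>modes n. a k * (lam k * a k))"
    by (simp add: wpart_def power2_eq_square algebra_simps)
  then have "(wpart lam_w a n)\<^sup>2 \<le> (\<Sum>k\<in>modes n. (a k)\<^sup>2) * (\<Sum>k\<in>modes n. (lam k * a k)\<^sup>2)"
    by (simp only: Cauchy_Schwarz_ineq_sum)
  then show ?thesis by (simp add: wpart_def power_mult_distrib)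
qed

lemma wsq_interp:
  assumes "wfin h2_w a"
  shows "(wsq lam_w a)\<^sup>2 \<le> wsq one_w a * wsq lam2_w a"
proof (rule LIMSEQ_le)
  show "(\<lambda>n. (wpart lam_w a n)\<^sup>2) \<longlonglongrightarrow> (wsq lam_w a)\<^sup>2"
    by (intro tendsto_intros wsq_lim h2_fin assms lam_nonneg)
  show "(\<lambda>n. wpart one_w a n * wpart lam2_w a n) \<longlonglongrightarrow> wsq one_w a * wsq lam2_w a"
    by (intro tendsto_intros wsq_lim h2_fin assms) auto
qed (use wpart_interp in auto)

lemma wsq_one_hat:
  assumes "u \<in> L2 L"
  shows "wfin one_w (hat u)" "wsq one_w (hat u) = L2_inner L u u"
proof -
  show "wfin one_w (hat u)"
    using Bessel[OF assms finite_modes] by (intro wfinI) (auto simp: wpart_def)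
  have "wpart one_w (hat u) = (\<lambda>n. \<Sum>k\<in>modes n. (hat u k)\<^sup>2)" by (auto simp: wpart_def)
  then show "wsq one_w (hat u) = L2_inner L u u"
    unfolding wsq_def using Parseval_self[OF assms] by (simp add: limI)
qed

subsection \<open>Sobolev embedding of \<open>H\<^sup>2\<close> for trigonometric polynomials\<close>

text \<open>The bound is strengthened to a telescoping one, with equality at \<open>n = 0\<close>:
  the two new terms add at most \<open>4 / ((n+1)(n+2))\<close>, the increment of
  \<open>-4/(n+1)\<close>.\<close>

lemma sum_inverse_squares_int: "(\<Sum>i\<in>{- int n..int n}. 1 / (1 + (real_of_int i)\<^sup>2)) \<le> 5 - 4 / (real n + 1)"
proof (induction n)
  case (Suc n)
  have e: "{- int (Suc n)..int (Suc n)} = insert (- int (Suc n)) (insert (int (Suc n)) {- int n..int n})"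
    by auto
  have m: "1 / (1 + (real n + 1)\<^sup>2) \<le> 2 / ((real n + 1) * (real n + 2))"
    by (simp add: divide_simps power2_eq_square) (simp add: algebra_simps)
  have t: "4 / ((real n + 1) * (real n + 2)) = 4 / (real n + 1) - 4 / (real n + 2)"
    by (simp add: field_simps)
  have "(\<Sum>i\<in>{- int (Suc n)..int (Suc n)}. 1 / (1 + (real_of_int i)\<^sup>2))
      = 2 * (1 / (1 + (real n + 1)\<^sup>2)) + (\<Sum>i\<in>{- int n..int n}. 1 / (1 + (real_of_int i)\<^sup>2))"
    unfolding e by (simp add: power2_eq_square algebra_simps)
  also have "\<dots> \<le> 2 * (2 / ((real n + 1) * (real n + 2))) + (5 - 4 / (real n + 1))"
    using m Suc by linarith
  also have "\<dots> = 5 - 4 / (real (Suc n) + 1)"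
    using t by (simp add: algebra_simps)
  finally show ?case .
qed simp

text \<open>\<open>2 / L\<close> bounds a Hartley function, and \<open>50 = 2 * 5 * 5\<close>: a
  factor 2 from splitting the weight into a product, a factor 5 from each one-dimensional
  sum.\<close>

definition embed_const :: real where
  "embed_const = (2 / L)\<^sup>2 * (50 / min 1 (freq ^ 4))"

lemma embed_const_pos: "embed_const > 0"
  using L_pos freq_pos by (simp add: embed_const_def)

text \<open>\<open>1 + (lam k)\<^sup>2\<close> dominates, up to a constant, the product
  \<open>(1 + p)(1 + q)\<close> of one-dimensional weights, so the double sum factorizes. This is
  where dimension two enters.\<close>

lemma sum_inverse_h2: "(\<Sum>k\<in>modes n. 1 / (1 + (lam k)\<^sup>2)) \<le> 50 / min 1 (freq ^ 4)"
proof -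
  define c where "c = min 1 (freq ^ 4)"
  have c: "0 < c" "c \<le> 1" "c \<le> freq ^ 4" using freq_pos by (auto simp: c_def)
  let ?g = "\<lambda>i::int. 1 / (1 + (real_of_int i)\<^sup>2)"
  have pt: "1 / (1 + (lam k)\<^sup>2) \<le> 2 / c * (?g (fst k) * ?g (snd k))" for k
  proof -
    define p q where "p = (real_of_int (fst k))\<^sup>2" and "q = (real_of_int (snd k))\<^sup>2"
    have pq: "p \<ge> 0" "q \<ge> 0" by (auto simp: p_def q_def)
    have l: "(lam k)\<^sup>2 = freq ^ 4 * (p + q)\<^sup>2"
      by (simp add: lam_def idx_def p_def q_def power_mult_distrib)
    have "(1 + p) * (1 + q) \<le> 2 * (1 + (p + q)\<^sup>2)"
    proof -
      have "p * q \<le> (p + q)\<^sup>2" using pq by (simp add: power2_eq_square algebra_simps)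
      moreover have "p + q \<le> 1 + (p + q)\<^sup>2"
      proof -
        have "0 \<le> (p + q - 1/2)\<^sup>2" by simp
        then show ?thesis by (simp add: power2_diff power_divide)
      qed
      moreover have "(1 + p) * (1 + q) = 1 + (p + q) + p * q" by (simp add: algebra_simps)
      moreover have "z \<le> 2 * (1 + s)" if "x \<le> s" "y \<le> 1 + s" "z = 1 + y + x" for x y z s :: real
        using that by simp
      ultimately show ?thesis by blast
    qed
    then have "c * ((1 + p) * (1 + q)) \<le> 2 * (c + c * (p + q)\<^sup>2)"
      using mult_left_mono[of _ _ c] c(1) by (fastforce simp: algebra_simps)
    also have "\<dots> \<le> 2 * (1 + (lam k)\<^sup>2)"
      unfolding l using c mult_right_mono[OF c(3), of "(p + q)\<^sup>2"] by simp
    finally have *: "c * ((1 + p) * (1 + q)) \<le> 2 * (1 + (lam k)\<^sup>2)" .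
    have "0 < (1 + p) * (1 + q)" using pq by (simp add: add_pos_nonneg)
    moreover have "0 < 1 + (lam k)\<^sup>2" by (simp add: add_pos_nonneg)
    ultimately have "1 / (1 + (lam k)\<^sup>2) \<le> 2 / (c * ((1 + p) * (1 + q)))"
      using * c(1) by (simp add: divide_simps mult_pos_pos)
    then show ?thesis by (simp add: p_def q_def)
  qed
  have s5: "(\<Sum>i\<in>{- int n..int n}. ?g i) \<le> 5"
    using sum_inverse_squares_int[of n] by (rule order_trans) simp
  have s0: "0 \<le> (\<Sum>i\<in>{- int n..int n}. ?g i)" by (intro sum_nonneg) auto
  have "(\<Sum>k\<in>modes n. 1 / (1 + (lam k)\<^sup>2)) \<le> (\<Sum>k\<in>modes n. 2 / c * (?g (fst k) * ?g (snd k)))"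
    by (intro sum_mono pt)
  also have "\<dots> = 2 / c * ((\<Sum>i\<in>{- int n..int n}. ?g i) * (\<Sum>i\<in>{- int n..int n}. ?g i))"
  proof -
    have "(\<Sum>i\<in>{- int n..int n}. ?g i) * (\<Sum>i\<in>{- int n..int n}. ?g i)
        = (\<Sum>k\<in>modes n. ?g (fst k) * ?g (snd k))"
      unfolding sum_product sum.cartesian_product modes_def by (simp only: case_prod_unfold)
    then show ?thesis by (simp only: sum_distrib_left)
  qed
  also have "\<dots> \<le> 2 / c * (5 * 5)"
    using c by (intro mult_left_mono mult_mono s5 s0) auto
  finally show ?thesis by (simp add: c_def)
qed

text \<open>Cauchy-Schwarz after multiplying and dividing by
  \<open>sqrt (1 + (lam k)\<^sup>2)\<close>. The constant does not depend on \<open>n\<close>.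
  Polynomials suffice because the energy estimate tests with truncated sums only.\<close>

lemma tpoly_sup_bound: "(tpoly (modes n) a x)\<^sup>2 \<le> embed_const * wpart h2_w a n"
proof -
  let ?r = "\<lambda>k. sqrt (1 + (lam k)\<^sup>2)"
  have r: "?r k > 0" "(?r k)\<^sup>2 = 1 + (lam k)\<^sup>2" for k
    by (auto simp: add_pos_nonneg)
  have "\<bar>tpoly (modes n) a x\<bar> \<le> (\<Sum>k\<in>modes n. \<bar>a k\<bar> * (2 / L))"
    unfolding tpoly_def
    by (rule order_trans[OF sum_abs], unfold abs_mult)
      (intro sum_mono mult_left_mono hart_bound abs_ge_zero)
  also have "\<dots> = (2 / L) * (\<Sum>k\<in>modes n. \<bar>a k\<bar>)" by (simp add: sum_distrib_left mult.commute)
  finally have "\<bar>tpoly (modes n) a x\<bar>\<^sup>2 \<le> ((2 / L) * (\<Sum>k\<in>modes n. \<bar>a k\<bar>))\<^sup>2"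
    by (rule power_mono) simp
  then have "(tpoly (modes n) a x)\<^sup>2 \<le> ((2 / L) * (\<Sum>k\<in>modes n. \<bar>a k\<bar>))\<^sup>2"
    by (simp only: power2_abs)
  also have "\<dots> = (2 / L)\<^sup>2 * (\<Sum>k\<in>modes n. (1 / ?r k) * (?r k * \<bar>a k\<bar>))\<^sup>2"
  proof -
    have "(\<Sum>k\<in>modes n. (1 / ?r k) * (?r k * \<bar>a k\<bar>)) = (\<Sum>k\<in>modes n. \<bar>a k\<bar>)"
      by (intro sum.cong refl) (use r(1) in \<open>simp add: less_imp_neq[symmetric]\<close>)
    then show ?thesis by (simp only: power_mult_distrib)
  qed
  also have "\<dots> \<le> (2 / L)\<^sup>2 * ((\<Sum>k\<in>modes n. (1 / ?r k)\<^sup>2) * (\<Sum>k\<in>modes n. (?r k * \<bar>a k\<bar>)\<^sup>2))"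
    by (intro mult_left_mono Cauchy_Schwarz_ineq_sum) auto
  also have "(\<Sum>k\<in>modes n. (1 / ?r k)\<^sup>2) = (\<Sum>k\<in>modes n. 1 / (1 + (lam k)\<^sup>2))"
    by (simp only: power_divide r(2) power_one)
  also have "(\<Sum>k\<in>modes n. (?r k * \<bar>a k\<bar>)\<^sup>2) = wpart h2_w a n"
    unfolding wpart_def by (simp only: power_mult_distrib r(2) power2_abs)
  also have "(2 / L)\<^sup>2 * ((\<Sum>k\<in>modes n. 1 / (1 + (lam k)\<^sup>2)) * wpart h2_w a n)
      \<le> (2 / L)\<^sup>2 * ((50 / min 1 (freq ^ 4)) * wpart h2_w a n)"
    by (intro mult_left_mono mult_right_mono sum_inverse_h2 wpart_nonneg) auto
  finally show ?thesis by (simp add: embed_const_def mult.assoc)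
qed

section \<open>Weak derivatives in terms of coefficients\<close>

text \<open>The action of the i-th derivative on coefficients. Integrating by parts moves it onto
  \<open>hart k\<close>, which becomes a multiple of \<open>hart (-k)\<close>: hence the sign and
  the reflected index.\<close>

definition Dc :: "2 \<Rightarrow> (int \<times> int \<Rightarrow> real) \<Rightarrow> int \<times> int \<Rightarrow> real" where
  "Dc i a k = - freq * idx i k * a (- k)"

definition Dm :: "nat \<times> nat \<Rightarrow> (int \<times> int \<Rightarrow> real) \<Rightarrow> int \<times> int \<Rightarrow> real" where
  "Dm \<alpha> a = (Dc 1 ^^ fst \<alpha>) ((Dc 2 ^^ snd \<alpha>) a)"

lemma hat_partial:
  assumes "periodic L \<psi>" "smooth \<psi>"
  shows "hat (partial i \<psi>) = Dc i (hat \<psi>)"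
proof
  fix k
  have "hat (partial i \<psi>) k = - L2_inner L \<psi> (\<lambda>x. freq * idx i k * hart (- k) x)"
    unfolding hat_def partial_hart[symmetric]
    by (intro L2_inner_partial assms hart_periodic hart_smooth)
  also have "\<dots> = Dc i (hat \<psi>) k"
    unfolding Dc_def hat_def by (subst (1 2) L2_inner_commute) (simp add: L2_inner_cmult_left)
  finally show "hat (partial i \<psi>) k = Dc i (hat \<psi>) k" .
qed

lemma smooth_periodic_iter:
  assumes "periodic L \<psi>" "smooth \<psi>"
  shows "periodic L ((partial i ^^ n) \<psi>) \<and> smooth ((partial i ^^ n) \<psi>)
    \<and> hat ((partial i ^^ n) \<psi>) = (Dc i ^^ n) (hat \<psi>)"
  by (induction n) (auto simp: assms periodic_partial smooth_partial hat_partial)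

lemma hat_mpartial:
  assumes "periodic L \<psi>" "smooth \<psi>"
  shows "mpartial \<alpha> \<psi> \<in> L2 L" "hat (mpartial \<alpha> \<psi>) = Dm \<alpha> (hat \<psi>)"
  using smooth_periodic_iter[OF assms, of "snd \<alpha>" 2]
    smooth_periodic_iter[of "(partial 2 ^^ snd \<alpha>) \<psi>" "fst \<alpha>" 1]
  by (auto simp: mpartial_def Dm_def intro: L2_smooth)

text \<open>Summation by parts: \<open>Dc i\<close> is skew-symmetric on symmetric cutoffs, by
  reindexing with \<open>k \<mapsto> -k\<close>.\<close>

lemma sum_Dc: "(\<Sum>k\<in>modes n. a k * Dc i b k) = - (\<Sum>k\<in>modes n. Dc i a k * b k)"
proof -
  have "(\<Sum>k\<in>modes n. a k * Dc i b k) = (\<Sum>k\<in>modes n. a (- k) * Dc i b (- k))"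
    by (rule sum_modes_uminus[symmetric])
  also have "\<dots> = (\<Sum>k\<in>modes n. - (Dc i a k * b k))"
    by (intro sum.cong) (auto simp: Dc_def idx_minus)
  finally show ?thesis by (simp add: sum_negf)
qed

lemma sum_Dc_iter: "(\<Sum>k\<in>modes n. a k * (Dc i ^^ m) b k) = (-1) ^ m * (\<Sum>k\<in>modes n. (Dc i ^^ m) a k * b k)"
proof (induction m arbitrary: a)
  case (Suc m)
  have "(\<Sum>k\<in>modes n. a k * (Dc i ^^ Suc m) b k) = - (\<Sum>k\<in>modes n. Dc i a k * (Dc i ^^ m) b k)"
    by (simp add: sum_Dc)
  also have "\<dots> = (-1) ^ Suc m * (\<Sum>k\<in>modes n. (Dc i ^^ m) (Dc i a) k * b k)"
    by (simp add: Suc)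
  also have "(Dc i ^^ m) (Dc i a) = (Dc i ^^ Suc m) a"
    by (metis funpow_swap1 funpow.simps(2) o_apply)
  finally show ?case .
qed simp

lemma Dc_commute: "Dc 1 (Dc 2 a) = Dc 2 (Dc 1 a)"
  by (simp add: Dc_def fun_eq_iff idx_minus)

lemma Dc_iter_commute: "(Dc 1 ^^ m) ((Dc 2 ^^ n) a) = (Dc 2 ^^ n) ((Dc 1 ^^ m) a)"
proof -
  have 1: "Dc 1 ((Dc 2 ^^ n) a) = (Dc 2 ^^ n) (Dc 1 a)" for n a
    by (induction n) (auto simp: Dc_commute)
  show ?thesis by (induction m) (auto simp: 1)
qed

lemma sum_Dm: "(\<Sum>k\<in>modes n. a k * Dm \<alpha> b k) = (-1) ^ (fst \<alpha> + snd \<alpha>) * (\<Sum>k\<in>modes n. Dm \<alpha> a k * b k)"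
  unfolding Dm_def sum_Dc_iter[of _ _ 1] sum_Dc_iter[of _ _ 2]
  by (simp add: Dc_iter_commute power_add)

lemma hat_hart: "hat (hart k) l = (if l = k then 1 else 0)"
  by (auto simp: hat_def hart_orthonormal)

lemma sum_hat_hart:
  assumes "k \<in> modes n"
  shows "(\<Sum>l\<in>modes n. a l * hat (hart k) l) = a k"
  using assms finite_modes[of n] by (simp add: hat_hart if_distrib cong: if_cong)

text \<open>Replaces testing against all smooth functions by an identity of coefficients. One
  direction tests with \<open>hart k\<close>, itself smooth and periodic; the other sums the
  coefficient identity by Parseval.\<close>

lemma has_weak_deriv_iff:
  assumes u: "u \<in> L2 L" and w: "w \<in> L2 L"
  shows "has_weak_deriv L \<alpha> u w \<longleftrightarrow> hat w = Dm \<alpha> (hat u)"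
proof -
  let ?s = "(-1::real) ^ (fst \<alpha> + snd \<alpha>)"
  have ss: "?s * ?s = 1" by (simp add: power_mult_distrib[symmetric])
  have lim: "(\<lambda>n. \<Sum>k\<in>modes n. Dm \<alpha> (hat u) k * hat \<psi> k) \<longlonglongrightarrow> ?s * L2_inner L u (mpartial \<alpha> \<psi>)"
    if \<psi>: "periodic L \<psi>" "smooth \<psi>" for \<psi>
  proof -
    have "(\<lambda>n. ?s * (\<Sum>k\<in>modes n. hat u k * hat (mpartial \<alpha> \<psi>) k)) \<longlonglongrightarrow> ?s * L2_inner L u (mpartial \<alpha> \<psi>)"
      by (intro tendsto_mult tendsto_const Parseval u hat_mpartial \<psi>)
    moreover have "?s * (\<Sum>k\<in>modes n. hat u k * hat (mpartial \<alpha> \<psi>) k) = (\<Sum>k\<in>modes n. Dm \<alpha> (hat u) k * hat \<psi> k)" for n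
      unfolding hat_mpartial(2)[OF \<psi>] sum_Dm using ss by (simp only: mult.assoc[symmetric] mult_1_left)
    ultimately show ?thesis by simp
  qed
  show ?thesis
  proof
    assume h: "has_weak_deriv L \<alpha> u w"
    show "hat w = Dm \<alpha> (hat u)"
    proof
      fix k
      have "L2_inner L u (mpartial \<alpha> (hart k)) = ?s * hat w k"
        using h hart_periodic hart_smooth unfolding has_weak_deriv_def hat_def by blast
      then have "?s * L2_inner L u (mpartial \<alpha> (hart k)) = hat w k"
        using ss by (simp only: mult.assoc[symmetric] mult_1_left)
      then have l: "(\<lambda>n. \<Sum>l\<in>modes n. Dm \<alpha> (hat u) l * hat (hart k) l) \<longlonglongrightarrow> hat w k"
        using lim[OF hart_periodic hart_smooth, of k] by simp
      obtain m where m: "k \<in> modes m" using in_some_modes by blast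
      have "\<forall>\<^sub>F n in sequentially. (\<Sum>l\<in>modes n. Dm \<alpha> (hat u) l * hat (hart k) l) = Dm \<alpha> (hat u) k"
        by (rule eventually_sequentiallyI[of m]) (use m modes_mono sum_hat_hart in blast)
      then have "(\<lambda>n. \<Sum>l\<in>modes n. Dm \<alpha> (hat u) l * hat (hart k) l) \<longlonglongrightarrow> Dm \<alpha> (hat u) k"
        by (rule tendsto_eventually)
      from LIMSEQ_unique[OF l this] show "hat w k = Dm \<alpha> (hat u) k" .
    qed
  next
    assume h: "hat w = Dm \<alpha> (hat u)"
    show "has_weak_deriv L \<alpha> u w"
      unfolding has_weak_deriv_def
    proof (intro allI impI, elim conjE)
      fix \<psi> assume \<psi>: "periodic L \<psi>" "smooth \<psi>"
      have "(\<lambda>n. \<Sum>k\<in>modes n. Dm \<alpha> (hat u) k * hat \<psi> k) \<longlonglongrightarrow> L2_inner L w \<psi>"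
        using Parseval[OF w L2_smooth[OF \<psi>]] unfolding h .
      from LIMSEQ_unique[OF this lim[OF \<psi>]]
      have "L2_inner L w \<psi> = ?s * L2_inner L u (mpartial \<alpha> \<psi>)" .
      then show "L2_inner L u (mpartial \<alpha> \<psi>) = ?s * L2_inner L w \<psi>"
        using ss by (simp only: mult.assoc[symmetric] mult_1_left)
    qed
  qed
qed

lemma weak_deriv_ex_iff:
  assumes u: "u \<in> L2 L"
  shows "(\<exists>w \<in> L2 L. has_weak_deriv L \<alpha> u w) \<longleftrightarrow> wfin one_w (Dm \<alpha> (hat u))"
proof
  assume "\<exists>w \<in> L2 L. has_weak_deriv L \<alpha> u w"
  then obtain w where w: "w \<in> L2 L" "hat w = Dm \<alpha> (hat u)"
    using has_weak_deriv_iff[OF u] by blast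
  show "wfin one_w (Dm \<alpha> (hat u))" using wsq_one_hat(1)[OF w(1)] unfolding w(2) .
next
  assume "wfin one_w (Dm \<alpha> (hat u))"
  then obtain C where "\<And>n. (\<Sum>k\<in>modes n. (Dm \<alpha> (hat u) k)\<^sup>2) \<le> C"
    unfolding wfin_def wpart_def by auto
  then obtain w where "w \<in> L2 L" "hat w = Dm \<alpha> (hat u)" by (rule Riesz_Fischer)
  then show "\<exists>w \<in> L2 L. has_weak_deriv L \<alpha> u w" using has_weak_deriv_iff[OF u] by blast
qed

lemma weak_deriv:
  assumes u: "u \<in> L2 L" and f: "wfin one_w (Dm \<alpha> (hat u))"
  shows "weak_deriv L \<alpha> u \<in> L2 L" "hat (weak_deriv L \<alpha> u) = Dm \<alpha> (hat u)"
proof -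
  have "\<exists>w. w \<in> L2 L \<and> has_weak_deriv L \<alpha> u w" using weak_deriv_ex_iff[OF u] f by blast
  from someI_ex[OF this] have "weak_deriv L \<alpha> u \<in> L2 L" "has_weak_deriv L \<alpha> u (weak_deriv L \<alpha> u)"
    unfolding weak_deriv_def by auto
  then show "weak_deriv L \<alpha> u \<in> L2 L" "hat (weak_deriv L \<alpha> u) = Dm \<alpha> (hat u)"
    using has_weak_deriv_iff[OF u] by auto
qed

text \<open>The squared Fourier multiplier of the derivative of order \<open>\<alpha>\<close>, that
  is, the weight with which this derivative has its L^2 norm.\<close>

definition Dw :: "nat \<times> nat \<Rightarrow> int \<times> int \<Rightarrow> real" where
  "Dw \<alpha> k = freq ^ (2 * (fst \<alpha> + snd \<alpha>)) * (idx 1 k) ^ (2 * fst \<alpha>) * (idx 2 k) ^ (2 * snd \<alpha>)"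

lemma Dw_nonneg: "0 \<le> Dw \<alpha> k"
  unfolding Dw_def power_mult using freq_pos by (intro mult_nonneg_nonneg) auto

lemma wpart_Dc:
  assumes "\<And>k. v (- k) = v k"
  shows "wpart v (Dc i a) n = wpart (\<lambda>k. freq\<^sup>2 * (idx i k)\<^sup>2 * v k) a n"
proof -
  have "wpart v (Dc i a) n = (\<Sum>k\<in>modes n. v (- k) * (Dc i a (- k))\<^sup>2)"
    unfolding wpart_def by (rule sum_modes_uminus[symmetric])
  also have "\<dots> = wpart (\<lambda>k. freq\<^sup>2 * (idx i k)\<^sup>2 * v k) a n"
    unfolding wpart_def
    by (intro sum.cong) (auto simp: assms Dc_def idx_minus power_mult_distrib algebra_simps)
  finally show ?thesis .
qed

text \<open>Each derivative reflects the index, so the weight has to be even; multiplying it by the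
  squared multiplier keeps it even, which is why the induction generalizes over
  \<open>v\<close>.\<close>

lemma wpart_Dc_iter:
  assumes "\<And>k. v (- k) = v k"
  shows "wpart v ((Dc i ^^ m) a) n = wpart (\<lambda>k. freq ^ (2 * m) * (idx i k) ^ (2 * m) * v k) a n"
  using assms
proof (induction m arbitrary: v)
  case (Suc m)
  have "wpart v ((Dc i ^^ Suc m) a) n = wpart (\<lambda>k. freq\<^sup>2 * (idx i k)\<^sup>2 * v k) ((Dc i ^^ m) a) n"
    using wpart_Dc[of v i "(Dc i ^^ m) a" n, OF Suc.prems] by simp
  also have "\<dots> = wpart (\<lambda>k. freq ^ (2 * m) * idx i k ^ (2 * m) * (freq\<^sup>2 * (idx i k)\<^sup>2 * v k)) a n"
    by (rule Suc.IH) (simp add: idx_minus Suc.prems)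
  also have "(\<lambda>k. freq ^ (2 * m) * idx i k ^ (2 * m) * (freq\<^sup>2 * (idx i k)\<^sup>2 * v k))
      = (\<lambda>k. freq ^ (2 * Suc m) * idx i k ^ (2 * Suc m) * v k)"
    by (simp add: fun_eq_iff power2_eq_square algebra_simps)
  finally show ?case .
qed simp

lemma wpart_Dm: "wpart one_w (Dm \<alpha> a) = wpart (Dw \<alpha>) a"
proof
  fix n
  have "wpart one_w (Dm \<alpha> a) n = wpart (\<lambda>k. freq ^ (2 * fst \<alpha>) * idx 1 k ^ (2 * fst \<alpha>) * 1) ((Dc 2 ^^ snd \<alpha>) a) n"
    unfolding Dm_def by (rule wpart_Dc_iter) simp
  also have "\<dots> = wpart (\<lambda>k. freq ^ (2 * snd \<alpha>) * idx 2 k ^ (2 * snd \<alpha>) * (freq ^ (2 * fst \<alpha>) * idx 1 k ^ (2 * fst \<alpha>) * 1)) a n"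
    by (rule wpart_Dc_iter) (simp add: idx_minus power_mult)
  also have "\<dots> = wpart (Dw \<alpha>) a n"
    by (rule arg_cong[where f = "\<lambda>w. wpart w a n"])
      (simp add: fun_eq_iff Dw_def power_add distrib_left algebra_simps)
  finally show "wpart one_w (Dm \<alpha> a) n = wpart (Dw \<alpha>) a n" .
qed

lemma wfin_Dm: "wfin one_w (Dm \<alpha> a) \<longleftrightarrow> wfin (Dw \<alpha>) a"
  by (simp add: wfin_def wpart_Dm)

lemma wsq_Dm: "wsq one_w (Dm \<alpha> a) = wsq (Dw \<alpha>) a"
  by (simp add: wsq_def wpart_Dm)

lemma multi_indices_2: "multi_indices 2 = {(0,0),(1,0),(0,1),(2,0),(1,1),(0,2)}"
proof (rule set_eqI)
  fix \<alpha> :: "nat \<times> nat"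
  have "fst \<alpha> + snd \<alpha> \<le> 2 \<longleftrightarrow> (fst \<alpha> = 0 \<and> snd \<alpha> = 0) \<or> (fst \<alpha> = 1 \<and> snd \<alpha> = 0) \<or> (fst \<alpha> = 0 \<and> snd \<alpha> = 1)
     \<or> (fst \<alpha> = 2 \<and> snd \<alpha> = 0) \<or> (fst \<alpha> = 1 \<and> snd \<alpha> = 1) \<or> (fst \<alpha> = 0 \<and> snd \<alpha> = 2)" by arith
  then show "\<alpha> \<in> multi_indices 2 \<longleftrightarrow> \<alpha> \<in> {(0,0),(1,0),(0,1),(2,0),(1,1),(0,2)}"
    by (cases \<alpha>) (auto simp: multi_indices_def)
qed

lemma Dw_values:
  "Dw (0,0) k = 1" "Dw (1,0) k = freq\<^sup>2 * (idx 1 k)\<^sup>2" "Dw (0,1) k = freq\<^sup>2 * (idx 2 k)\<^sup>2"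
  "Dw (2,0) k = (freq\<^sup>2 * (idx 1 k)\<^sup>2)\<^sup>2" "Dw (0,2) k = (freq\<^sup>2 * (idx 2 k)\<^sup>2)\<^sup>2"
  "Dw (1,1) k = (freq\<^sup>2 * (idx 1 k)\<^sup>2) * (freq\<^sup>2 * (idx 2 k)\<^sup>2)"
  by (simp_all add: Dw_def power_mult_distrib power_mult[symmetric] eval_nat_numeral)

lemma lam_Dw: "lam k = Dw (1,0) k + Dw (0,1) k"
  unfolding lam_def Dw_values by (rule distrib_left)

text \<open>With \<open>p\<close>, \<open>q\<close> the squared multipliers of the two first
  derivatives, \<open>lam k = p + q\<close>, and the six weights are 1, p, q, p^2, pq and
  q^2.\<close>

lemma Dw_le:
  assumes "\<alpha> \<in> multi_indices 2"
  shows "Dw \<alpha> k \<le> 1 * (1 + (lam k)\<^sup>2)"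
proof -
  define p q where "p = freq\<^sup>2 * (idx 1 k)\<^sup>2" and "q = freq\<^sup>2 * (idx 2 k)\<^sup>2"
  have pq: "p \<ge> 0" "q \<ge> 0" by (auto simp: p_def q_def)
  have l: "lam k = p + q" unfolding lam_Dw Dw_values p_def q_def ..
  have "p + q \<le> 1 + (p + q)\<^sup>2" 
  proof -
    have "y \<le> 1 + s" if "y \<le> (1 + s) / 2" "0 \<le> s" for y s :: real using that by simp
    then show ?thesis using lam_le[of k] zero_le_power2[of "p + q"] unfolding l by blast
  qed
  moreover have "p\<^sup>2 \<le> 1 + (p + q)\<^sup>2" "q\<^sup>2 \<le> 1 + (p + q)\<^sup>2"
    by (rule add_increasing[OF zero_le_one], use pq in \<open>auto intro!: power_mono\<close>)+
  moreover have "p * q \<le> 1 + (p + q)\<^sup>2"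
    by (rule add_increasing[OF zero_le_one]) (use pq in \<open>simp add: power2_eq_square algebra_simps\<close>)
  moreover have "1 \<le> 1 + (p + q)\<^sup>2" by simp
  moreover from \<open>p + q \<le> 1 + (p + q)\<^sup>2\<close> have "p \<le> 1 + (p + q)\<^sup>2" "q \<le> 1 + (p + q)\<^sup>2"
    by (rule order_trans[rotated], use pq in simp)+
  ultimately show ?thesis
    using assms unfolding multi_indices_2 l by (auto simp only: Dw_values p_def[symmetric] q_def[symmetric] mult_1_left insert_iff empty_iff)
qed

lemma h2_le_Dw: "1 + (lam k)\<^sup>2 \<le> Dw (0,0) k + 2 * (Dw (2,0) k + Dw (0,2) k)"
proof -
  have "1 + (a + b)\<^sup>2 \<le> 1 + 2 * (a\<^sup>2 + b\<^sup>2)" for a b :: real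
    using sum_squares_bound[of a b] by (simp add: power2_sum)
  then show ?thesis unfolding lam_Dw Dw_values .
qed

text \<open>By \<open>Dw_le\<close> and \<open>h2_le_Dw\<close> the single weight
  \<open>h2_w\<close> is comparable to the sum of all weights of order at most two: the pure second
  derivatives control the rest.\<close>

lemma Hm2_iff: "u \<in> Hm L 2 \<longleftrightarrow> u \<in> L2 L \<and> wfin h2_w (hat u)"
proof -
  have "(\<forall>\<alpha>\<in>multi_indices 2. \<exists>w\<in>L2 L. has_weak_deriv L \<alpha> u w) \<longleftrightarrow> wfin h2_w (hat u)" if u: "u \<in> L2 L"
  proof -
    have "(\<forall>\<alpha>\<in>multi_indices 2. wfin (Dw \<alpha>) (hat u)) \<longleftrightarrow> wfin h2_w (hat u)"
    proof
      assume *: "\<forall>\<alpha>\<in>multi_indices 2. wfin (Dw \<alpha>) (hat u)"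
      have "wfin (\<lambda>k. Dw (2,0) k + Dw (0,2) k) (hat u)"
        by (rule wsq_add_weight) (use * Dw_nonneg in \<open>auto simp: multi_indices_2\<close>)
      then have "wfin (\<lambda>k. Dw (0,0) k + (Dw (2,0) k + Dw (0,2) k)) (hat u)"
        by (intro wsq_add_weight) (use * Dw_nonneg in \<open>auto simp: multi_indices_2\<close>)
      then show "wfin h2_w (hat u)"
      proof (rule wfin_mono[where c = 2, rotated 3])
        fix k show "1 + (lam k)\<^sup>2 \<le> 2 * (Dw (0,0) k + (Dw (2,0) k + Dw (0,2) k))"
          using h2_le_Dw[of k] Dw_nonneg[of "(0,0)" k] by (simp add: algebra_simps)
        show "0 \<le> Dw (0,0) k + (Dw (2,0) k + Dw (0,2) k)" by (intro add_nonneg_nonneg Dw_nonneg)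
      qed simp
    next
      assume "wfin h2_w (hat u)"
      then show "\<forall>\<alpha>\<in>multi_indices 2. wfin (Dw \<alpha>) (hat u)"
        using wfin_mono[OF Dw_le, where a = "hat u"] by simp
    qed
    then show ?thesis using weak_deriv_ex_iff[OF u] wfin_Dm by simp
  qed
  then show ?thesis unfolding Hm_def by blast
qed

lemma Hm2_L2: "u \<in> Hm L 2 \<Longrightarrow> u \<in> L2 L" by (simp add: Hm2_iff)
lemma Hm2_fin: "u \<in> Hm L 2 \<Longrightarrow> wfin h2_w (hat u)" by (simp add: Hm2_iff)

lemma Hm2_Dw_fin: "u \<in> Hm L 2 \<Longrightarrow> \<alpha> \<in> multi_indices 2 \<Longrightarrow> wfin (Dw \<alpha>) (hat u)"
  using wfin_mono[OF Dw_le, where a = "hat u"] Hm2_fin by simp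

lemma Hm2_weak_deriv:
  assumes "u \<in> Hm L 2" "\<alpha> \<in> multi_indices 2"
  shows "weak_deriv L \<alpha> u \<in> L2 L" "hat (weak_deriv L \<alpha> u) = Dm \<alpha> (hat u)"
    "L2_inner L (weak_deriv L \<alpha> u) (weak_deriv L \<alpha> u) = wsq (Dw \<alpha>) (hat u)"
proof -
  have f: "wfin one_w (Dm \<alpha> (hat u))" using Hm2_Dw_fin[OF assms] wfin_Dm by simp
  show 1: "weak_deriv L \<alpha> u \<in> L2 L" and 2: "hat (weak_deriv L \<alpha> u) = Dm \<alpha> (hat u)"
    using weak_deriv[OF Hm2_L2[OF assms(1)] f] by auto
  show "L2_inner L (weak_deriv L \<alpha> u) (weak_deriv L \<alpha> u) = wsq (Dw \<alpha>) (hat u)"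
    using wsq_one_hat(2)[OF 1] unfolding 2 wsq_Dm by simp
qed

lemma Hm2_norm_sq:
  assumes "u \<in> Hm L 2"
  shows "(Hm_norm L 2 u)\<^sup>2 = (\<Sum>\<alpha>\<in>multi_indices 2. wsq (Dw \<alpha>) (hat u))"
proof -
  have "(\<Sum>\<alpha>\<in>multi_indices 2. (L2_norm L (weak_deriv L \<alpha> u))\<^sup>2) = (\<Sum>\<alpha>\<in>multi_indices 2. wsq (Dw \<alpha>) (hat u))"
    by (intro sum.cong) (auto simp: L2_norm_sq Hm2_weak_deriv(3)[OF assms])
  moreover have "(Hm_norm L 2 u)\<^sup>2 = (\<Sum>\<alpha>\<in>multi_indices 2. (L2_norm L (weak_deriv L \<alpha> u))\<^sup>2)"
    unfolding Hm_norm_def by (intro real_sqrt_pow2 sum_nonneg) auto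
  ultimately show ?thesis by simp
qed

text \<open>6 counts the multi-indices of order at most two; the 2 is the one in
  \<open>h2_le_Dw\<close>.\<close>

lemma Hm2_norm_bounds:
  assumes u: "u \<in> Hm L 2"
  shows "(Hm_norm L 2 u)\<^sup>2 \<le> 6 * wsq h2_w (hat u)" "wsq h2_w (hat u) \<le> 2 * (Hm_norm L 2 u)\<^sup>2"
proof -
  have f: "wfin (Dw \<alpha>) (hat u)" "0 \<le> wsq (Dw \<alpha>) (hat u)" if "\<alpha> \<in> multi_indices 2" for \<alpha>
    using Hm2_Dw_fin[OF u that] wsq_nonneg Dw_nonneg by auto
  have "(\<Sum>\<alpha>\<in>multi_indices 2. wsq (Dw \<alpha>) (hat u)) \<le> (\<Sum>\<alpha>\<in>multi_indices 2. 1 * wsq h2_w (hat u))"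
    by (intro sum_mono wsq_mono Dw_le Hm2_fin u Dw_nonneg) auto
  then show "(Hm_norm L 2 u)\<^sup>2 \<le> 6 * wsq h2_w (hat u)"
    unfolding Hm2_norm_sq[OF u] by (simp add: multi_indices_2)
  have m: "(0,0) \<in> multi_indices 2" "(2,0) \<in> multi_indices 2" "(0,2) \<in> multi_indices 2"
    by (auto simp: multi_indices_2)
  have a1: "wfin (\<lambda>k. Dw (2,0) k + Dw (0,2) k) (hat u)"
    "wsq (\<lambda>k. Dw (2,0) k + Dw (0,2) k) (hat u) = wsq (Dw (2,0)) (hat u) + wsq (Dw (0,2)) (hat u)"
    by (rule wsq_add_weight; use Dw_nonneg f m in blast)+
  have a2: "wfin (\<lambda>k. Dw (0,0) k + (Dw (2,0) k + Dw (0,2) k)) (hat u)"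
    "wsq (\<lambda>k. Dw (0,0) k + (Dw (2,0) k + Dw (0,2) k)) (hat u)
      = wsq (Dw (0,0)) (hat u) + wsq (\<lambda>k. Dw (2,0) k + Dw (0,2) k) (hat u)"
    by (rule wsq_add_weight; use Dw_nonneg f m a1 add_nonneg_nonneg in blast)+
  have "wsq h2_w (hat u) \<le> 2 * wsq (\<lambda>k. Dw (0,0) k + (Dw (2,0) k + Dw (0,2) k)) (hat u)"
  proof (rule wsq_mono)
    fix k
    show "1 + (lam k)\<^sup>2 \<le> 2 * (Dw (0,0) k + (Dw (2,0) k + Dw (0,2) k))"
      using h2_le_Dw[of k] Dw_nonneg[of "(0,0)" k] by (simp add: algebra_simps)
    show "0 \<le> Dw (0,0) k + (Dw (2,0) k + Dw (0,2) k)" by (intro add_nonneg_nonneg Dw_nonneg)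
  qed (use a2 in auto)
  also have "\<dots> \<le> 2 * (\<Sum>\<alpha>\<in>multi_indices 2. wsq (Dw \<alpha>) (hat u))"
    unfolding a1 a2 using f(2) by (simp add: multi_indices_2)
  finally show "wsq h2_w (hat u) \<le> 2 * (Hm_norm L 2 u)\<^sup>2" unfolding Hm2_norm_sq[OF u] .
qed

lemma laplacian_Hm2:
  assumes u: "u \<in> Hm L 2"
  shows "laplacian L u \<in> L2 L" "hat (laplacian L u) k = - lam k * hat u k"
proof -
  have m: "(2,0) \<in> multi_indices 2" "(0,2) \<in> multi_indices 2" by (auto simp: multi_indices_2)
  show "laplacian L u \<in> L2 L"
    unfolding laplacian_def[abs_def] by (intro L2_add Hm2_weak_deriv u m)
  have "hat (laplacian L u) k = Dm (2,0) (hat u) k + Dm (0,2) (hat u) k"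
    unfolding laplacian_def[abs_def] by (simp add: hat_add Hm2_weak_deriv[OF u] m)
  then show "hat (laplacian L u) k = - lam k * hat u k"
    by (simp add: Dm_def Dc_def eval_nat_numeral idx_minus lam_def power2_eq_square algebra_simps)
qed

lemma Hm2_diff:
  assumes "u \<in> Hm L 2" "v \<in> Hm L 2"
  shows "(\<lambda>x. u x - v x) \<in> Hm L 2"
proof -
  have "hat (\<lambda>x. u x - v x) = (\<lambda>k. hat u k - hat v k)"
    using hat_diff[OF Hm2_L2 Hm2_L2, OF assms] by auto
  moreover have "wfin h2_w (\<lambda>k. hat u k - hat v k)" by (rule wfin_diff(1)) (use assms Hm2_fin in auto)
  ultimately show ?thesis using assms by (simp add: Hm2_iff L2_diff)
qed

lemma Hm2_lincomb:
  assumes "u \<in> Hm L 2" "v \<in> Hm L 2"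
  shows "(\<lambda>x. a * u x + b * v x) \<in> Hm L 2"
proof -
  have "hat (\<lambda>x. a * u x + b * v x) = (\<lambda>k. a * hat u k + b * hat v k)"
    using assms by (auto simp: hat_add[OF L2_cmult L2_cmult] Hm2_L2 hat_cmult)
  moreover have "wfin h2_w (\<lambda>k. a * hat u k + b * hat v k)"
    by (intro wfin_add wfin_cmult) (use assms Hm2_fin in auto)
  ultimately show ?thesis using assms by (simp add: Hm2_iff L2_add L2_cmult)
qed

lemma wpart_finite_support:
  assumes "finite K" "\<And>k. k \<notin> K \<Longrightarrow> a k = 0" "\<And>k. 0 \<le> w k"
  shows "wpart w a n \<le> (\<Sum>k\<in>K. w k * (a k)\<^sup>2)"
proof -
  have "wpart w a n = (\<Sum>k\<in>modes n \<inter> K. w k * (a k)\<^sup>2)"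
    unfolding wpart_def using assms(2) finite_modes by (intro sum.mono_neutral_right) auto
  also have "\<dots> \<le> (\<Sum>k\<in>K. w k * (a k)\<^sup>2)"
    by (intro sum_mono2) (use assms in auto)
  finally show ?thesis .
qed

lemma tpoly_Hm2:
  assumes "finite K"
  shows "tpoly K a \<in> Hm L 2"
proof -
  have "wfin h2_w (hat (tpoly K a))"
    by (rule wfinI, rule wpart_finite_support[OF assms]) (use assms in \<open>auto simp: hat_tpoly\<close>)
  then show ?thesis by (simp add: Hm2_iff tpoly_L2)
qed

lemma hart_Hm2: "hart k \<in> Hm L 2"
proof -
  have "tpoly {k} (\<lambda>_. 1) = hart k" by (simp add: tpoly_def fun_eq_iff)
  then show ?thesis using tpoly_Hm2[of "{k}" "\<lambda>_. 1"] by simp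
qed

lemma grad_components:
  "grad L u x $ 1 = weak_deriv L (1, 0) u x" "grad L u x $ 2 = weak_deriv L (0, 1) u x"
  by (simp_all add: grad_def vector_2)

lemma norm_grad_sq: "(norm (grad L u x))\<^sup>2 = (weak_deriv L (1, 0) u x)\<^sup>2 + (weak_deriv L (0, 1) u x)\<^sup>2"
  by (simp add: norm_vec_def L2_set_def UNIV_2 grad_components sum_nonneg)

lemma AE_eq_hat: 
  assumes "u \<in> L2 L" "v \<in> L2 L" "AE x in torus L. u x = v x"
  shows "hat u = hat v"
  using assms hart_L2 unfolding hat_def fun_eq_iff
  by (intro allI L2_inner_cong_AE) (auto simp: L2_def)

end

section \<open>The calmed nonlinearity\<close>

locale calmed = torus_side +
  fixes \<eta> :: "real^2 \<Rightarrow> real^2" and Mb :: real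
  assumes eta_bound: "norm (\<eta> p) \<le> Mb"
    and eta_lipschitz: "norm (\<eta> p - \<eta> q) \<le> norm (p - q)"
begin

abbreviation nl :: "(real^2 \<Rightarrow> real) \<Rightarrow> real^2 \<Rightarrow> real" where
  "nl \<equiv> calmed_nonlinearity L \<eta>"

lemma Mb_nonneg: "0 \<le> Mb"
  using order_trans[OF norm_ge_zero eta_bound] .

lemma flux_bound: "\<bar>\<eta> p \<bullet> p\<bar> \<le> Mb * norm p"
  by (rule order_trans[OF Cauchy_Schwarz_ineq2 mult_right_mono[OF eta_bound norm_ge_zero]])

text \<open>Writing the difference as \<eta>(p).(p - q) + (\<eta>(p) - \<eta>(q)).q uses boundedness
  on the first part and the Lipschitz condition on the second. Only \<open>q\<close> enters the
  factor; this asymmetry lets one fixed solution determine the Gronwall weight.\<close>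

lemma flux_diff: "\<bar>\<eta> p \<bullet> p - \<eta> q \<bullet> q\<bar> \<le> (Mb + norm q) * norm (p - q)"
proof -
  have "\<eta> p \<bullet> p - \<eta> q \<bullet> q = \<eta> p \<bullet> (p - q) + (\<eta> p - \<eta> q) \<bullet> q"
    by (simp add: inner_diff_left inner_diff_right)
  then have "\<bar>\<eta> p \<bullet> p - \<eta> q \<bullet> q\<bar> \<le> norm (\<eta> p) * norm (p - q) + norm (\<eta> p - \<eta> q) * norm q"
    using Cauchy_Schwarz_ineq2[of "\<eta> p" "p - q"] Cauchy_Schwarz_ineq2[of "\<eta> p - \<eta> q" q] by linarith
  also have "\<dots> \<le> Mb * norm (p - q) + norm (p - q) * norm q"
    by (intro add_mono mult_right_mono eta_bound eta_lipschitz norm_ge_zero)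
  finally show ?thesis by (simp add: algebra_simps)
qed

lemma eta_continuous: "continuous_on UNIV \<eta>"
  unfolding continuous_on_iff dist_norm using eta_lipschitz le_less_trans by metis

lemma mi_grad: "(1,0) \<in> multi_indices 2" "(0,1) \<in> multi_indices 2"
  by (auto simp: multi_indices_2)

lemma grad_measurable:
  assumes "u \<in> Hm L 2"
  shows "grad L u \<in> borel_measurable (torus L)"
proof -
  have m: "weak_deriv L (1,0) u \<in> borel_measurable (torus L)" "weak_deriv L (0,1) u \<in> borel_measurable (torus L)"
    using Hm2_weak_deriv(1)[OF assms] mi_grad unfolding L2_def by blast+
  have "(\<lambda>x. grad L u x \<bullet> axis i 1) \<in> borel_measurable (torus L)" for i
    using m two_cases[of i] by (auto simp: inner_axis grad_components)
  then show ?thesis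
    by (subst borel_measurable_euclidean_space) (auto simp: Basis_vec_def)
qed

lemma grad_periodic:
  assumes "u \<in> Hm L 2"
  shows "grad L u (x + L *\<^sub>R axis i 1) = grad L u x"
  using Hm2_weak_deriv(1)[OF assms] mi_grad unfolding L2_def periodic_def grad_def by simp

lemma norm_grad_L2:
  assumes u: "u \<in> Hm L 2"
  shows "(\<lambda>x. norm (grad L u x)) \<in> L2 L"
    "(\<integral>x. (norm (grad L u x))\<^sup>2 \<partial>torus L) = wsq lam_w (hat u)"
proof -
  note w = Hm2_weak_deriv[OF u mi_grad(1)] Hm2_weak_deriv[OF u mi_grad(2)]
  have i: "integrable (torus L) (\<lambda>x. (weak_deriv L (1,0) u x)\<^sup>2)" "integrable (torus L) (\<lambda>x. (weak_deriv L (0,1) u x)\<^sup>2)"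
    using w by (auto simp: L2_def)
  show "(\<lambda>x. norm (grad L u x)) \<in> L2 L"
    unfolding L2_iff sq_integrable_def periodic_def
    using i grad_measurable[OF u] by (auto simp: grad_periodic[OF u] norm_grad_sq)
  have "(\<integral>x. (norm (grad L u x))\<^sup>2 \<partial>torus L) = wsq (Dw (1,0)) (hat u) + wsq (Dw (0,1)) (hat u)"
    unfolding norm_grad_sq using i w(3,6) by (simp add: L2_inner_self)
  also have "\<dots> = wsq (\<lambda>k. Dw (1,0) k + Dw (0,1) k) (hat u)"
    by (rule wsq_add_weight(2)[symmetric]) (use Dw_nonneg Hm2_Dw_fin[OF u] mi_grad in auto)
  also have "\<dots> = wsq lam_w (hat u)" by (simp only: lam_Dw)
  finally show "(\<integral>x. (norm (grad L u x))\<^sup>2 \<partial>torus L) = wsq lam_w (hat u)" .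
qed

lemma nl_L2:
  assumes u: "u \<in> Hm L 2"
  shows "nl u \<in> L2 L" "L2_inner L (nl u) (nl u) \<le> Mb\<^sup>2 * wsq lam_w (hat u)"
proof -
  have "\<eta> \<in> borel_measurable borel" by (rule borel_measurable_continuous_onI[OF eta_continuous])
  from measurable_compose[OF grad_measurable[OF u] this]
  have m: "nl u \<in> borel_measurable (torus L)"
    unfolding calmed_nonlinearity_def[abs_def] by (intro borel_measurable_inner grad_measurable u) simp
  have b: "\<bar>nl u x\<bar> \<le> \<bar>Mb * norm (grad L u x)\<bar>" for x
    unfolding calmed_nonlinearity_def by (rule order_trans[OF flux_bound abs_ge_self])
  have s: "nl u \<in> sq_integrable (torus L)"
    by (rule sq_integrable_bound[OF sq_integrable_cmult[OF L2_sq[OF norm_grad_L2(1)[OF u]], of Mb] m])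
      (use b in auto)
  moreover have "periodic L (nl u)" by (simp add: periodic_def calmed_nonlinearity_def grad_periodic[OF u])
  ultimately show "nl u \<in> L2 L" by (simp add: L2_iff)
  have g: "integrable (torus L) (\<lambda>x. (norm (grad L u x))\<^sup>2)" using norm_grad_L2(1)[OF u] by (simp add: L2_def)
  have "(\<integral>x. (nl u x)\<^sup>2 \<partial>torus L) \<le> (\<integral>x. Mb\<^sup>2 * (norm (grad L u x))\<^sup>2 \<partial>torus L)"
  proof (rule integral_mono)
    show "integrable (torus L) (\<lambda>x. (nl u x)\<^sup>2)" using s by (simp add: sq_integrable_def)
    show "(nl u x)\<^sup>2 \<le> Mb\<^sup>2 * (norm (grad L u x))\<^sup>2" for x
      using b[of x] unfolding abs_le_square_iff by (simp add: power_mult_distrib)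
  qed (use g in simp)
  then show "L2_inner L (nl u) (nl u) \<le> Mb\<^sup>2 * wsq lam_w (hat u)"
    using norm_grad_L2(2)[OF u] by (simp add: L2_inner_self)
qed

text \<open>\<open>weak_deriv\<close> selects a representative separately for each function, so
  linearity holds only almost everywhere, through equality of coefficients.\<close>

lemma grad_diff_AE:
  assumes u: "u \<in> Hm L 2" and v: "v \<in> Hm L 2"
  shows "AE x in torus L. grad L (\<lambda>x. u x - v x) x = grad L u x - grad L v x"
proof -
  note d = Hm2_diff[OF u v]
  have h: "hat (\<lambda>x. u x - v x) = (\<lambda>k. hat u k - hat v k)"
    using hat_diff[OF Hm2_L2 Hm2_L2, OF u v] by auto
  have "AE x in torus L. weak_deriv L \<alpha> (\<lambda>x. u x - v x) x = weak_deriv L \<alpha> u x - weak_deriv L \<alpha> v x"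
    if a: "\<alpha> \<in> {(1,0),(0,1)}" for \<alpha>
  proof -
    have m: "\<alpha> \<in> multi_indices 2" using a mi_grad by auto
    note wu = Hm2_weak_deriv[OF u m] and wv = Hm2_weak_deriv[OF v m] and wd = Hm2_weak_deriv[OF d m]
    have lin: "Dm \<alpha> (\<lambda>k. hat u k - hat v k) = (\<lambda>k. Dm \<alpha> (hat u) k - Dm \<alpha> (hat v) k)"
      using a by (auto simp: Dm_def Dc_def fun_eq_iff right_diff_distrib)
    show ?thesis
    proof (rule AE_eq_if_hat_eq[OF wd(1) L2_diff[OF wu(1) wv(1)]])
      show "hat (weak_deriv L \<alpha> (\<lambda>x. u x - v x)) = hat (\<lambda>x. weak_deriv L \<alpha> u x - weak_deriv L \<alpha> v x)"
        unfolding wd(2) h lin by (rule ext) (simp add: hat_diff[OF wu(1) wv(1)] wu(2) wv(2))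
    qed
  qed
  then have "AE x in torus L. weak_deriv L (1,0) (\<lambda>x. u x - v x) x = weak_deriv L (1,0) u x - weak_deriv L (1,0) v x"
    "AE x in torus L. weak_deriv L (0,1) (\<lambda>x. u x - v x) x = weak_deriv L (0,1) u x - weak_deriv L (0,1) v x"
    by blast+
  then show ?thesis
  proof eventually_elim
    case (elim x)
    then show ?case by (simp only: vec_eq_iff forall_2 grad_components vector_minus_component)
  qed
qed

text \<open>By \<open>flux_diff\<close> the integrand is at most
  \<open>Mb + \<bar>grad v\<bar>\<close> times the gradient of the difference times
  \<open>\<bar>z\<bar>\<close>. The first two factors are merely in L^2, so Cauchy-Schwarz uses both
  up and \<open>z\<close> has to be bounded.\<close>

lemma nl_diff_bounded:
  assumes u: "u \<in> Hm L 2" and v: "v \<in> Hm L 2" and z: "z \<in> L2 L" and B: "\<And>x. (z x)\<^sup>2 \<le> B"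
  shows "(L2_inner L (\<lambda>x. nl u x - nl v x) z)\<^sup>2
    \<le> 2 * B * (Mb\<^sup>2 * L\<^sup>2 + wsq lam_w (hat v)) * wsq lam_w (\<lambda>k. hat u k - hat v k)"
proof -
  let ?d = "\<lambda>x. u x - v x"
  let ?f = "\<lambda>x. sqrt B * (Mb + norm (grad L v x))"
  let ?g = "\<lambda>x. norm (grad L ?d x)"
  have B0: "0 \<le> B" using order_trans[OF zero_le_power2 B] .
  note d = Hm2_diff[OF u v]
  have c: "(\<lambda>x. Mb) \<in> L2 L" by (intro L2_continuous) (auto simp: periodic_def)
  have V: "(\<lambda>x. norm (grad L v x)) \<in> L2 L" by (rule norm_grad_L2(1)[OF v])
  have f: "?f \<in> L2 L" by (intro L2_cmult L2_add c V)
  have g: "?g \<in> L2 L" by (rule norm_grad_L2(1)[OF d])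
  have n: "(\<lambda>x. nl u x - nl v x) \<in> L2 L" by (intro L2_diff nl_L2 u v)
  have zb: "\<bar>z x\<bar> \<le> sqrt B" for x using B[of x] by (simp add: real_le_rsqrt real_sqrt_le_iff[of "(z x)\<^sup>2" B, symmetric] del: real_sqrt_le_iff)
  have "\<bar>L2_inner L (\<lambda>x. nl u x - nl v x) z\<bar> \<le> (\<integral>x. ?f x * ?g x \<partial>torus L)"
    unfolding L2_inner_def
  proof (rule order_trans[OF integral_abs_bound], rule integral_mono_AE)
    show "integrable (torus L) (\<lambda>x. \<bar>(nl u x - nl v x) * z x\<bar>)" using L2_mult_integrable[OF n z] by simp
    show "integrable (torus L) (\<lambda>x. ?f x * ?g x)" by (rule L2_mult_integrable[OF f g])
    show "AE x in torus L. \<bar>(nl u x - nl v x) * z x\<bar> \<le> ?f x * ?g x"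
      using grad_diff_AE[OF u v]
    proof eventually_elim
      case (elim x)
      have "\<bar>nl u x - nl v x\<bar> \<le> (Mb + norm (grad L v x)) * ?g x"
        unfolding calmed_nonlinearity_def elim by (rule flux_diff)
      then have "\<bar>nl u x - nl v x\<bar> * \<bar>z x\<bar> \<le> ((Mb + norm (grad L v x)) * ?g x) * sqrt B"
        using Mb_nonneg by (intro mult_mono zb mult_nonneg_nonneg add_nonneg_nonneg) auto
      then show ?case by (simp add: abs_mult mult.commute mult.left_commute)
    qed
  qed
  then have "\<bar>L2_inner L (\<lambda>x. nl u x - nl v x) z\<bar>\<^sup>2 \<le> (\<integral>x. ?f x * ?g x \<partial>torus L)\<^sup>2"
    by (rule power_mono) simp
  then have "(L2_inner L (\<lambda>x. nl u x - nl v x) z)\<^sup>2 \<le> (\<integral>x. ?f x * ?g x \<partial>torus L)\<^sup>2"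
    by (simp only: power2_abs)
  also have "\<dots> \<le> (\<integral>x. (?f x)\<^sup>2 \<partial>torus L) * (\<integral>x. (?g x)\<^sup>2 \<partial>torus L)"
    by (rule sq_integrable_Cauchy_Schwarz[OF L2_sq[OF f] L2_sq[OF g]])
  also have "(\<integral>x. (?g x)\<^sup>2 \<partial>torus L) = wsq lam_w (\<lambda>k. hat u k - hat v k)"
  proof -
    have "hat ?d = (\<lambda>k. hat u k - hat v k)" using hat_diff[OF Hm2_L2 Hm2_L2, OF u v] by auto
    then show ?thesis using norm_grad_L2(2)[OF d] by simp
  qed
  also have "(\<integral>x. (?f x)\<^sup>2 \<partial>torus L) * wsq lam_w (\<lambda>k. hat u k - hat v k)
      \<le> (2 * B * (Mb\<^sup>2 * L\<^sup>2 + wsq lam_w (hat v))) * wsq lam_w (\<lambda>k. hat u k - hat v k)"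
  proof (rule mult_right_mono)
    show "0 \<le> wsq lam_w (\<lambda>k. hat u k - hat v k)"
    proof (rule wsq_nonneg[OF lam_nonneg])
      show "wfin lam_w (\<lambda>k. hat u k - hat v k)"
        by (rule wfin_diff(1)[OF lam_nonneg]) (use h2_fin(2) Hm2_fin u v in auto)
    qed
    have gi: "integrable (torus L) (\<lambda>x. (norm (grad L v x))\<^sup>2)" using V by (simp add: L2_def)
    have ci: "integrable (torus L) (\<lambda>x. Mb\<^sup>2)" using c by (simp add: L2_def)
    have "(\<integral>x. (?f x)\<^sup>2 \<partial>torus L) \<le> (\<integral>x. 2 * B * (Mb\<^sup>2 + (norm (grad L v x))\<^sup>2) \<partial>torus L)"
    proof (rule integral_mono)
      show "integrable (torus L) (\<lambda>x. (?f x)\<^sup>2)" using f by (simp add: L2_def)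
      show "integrable (torus L) (\<lambda>x. 2 * B * (Mb\<^sup>2 + (norm (grad L v x))\<^sup>2))" using gi ci by simp
      fix x
      have "(Mb + norm (grad L v x))\<^sup>2 \<le> 2 * (Mb\<^sup>2 + (norm (grad L v x))\<^sup>2)"
        using sum_squares_bound[of Mb "norm (grad L v x)"] by (simp add: power2_sum)
      then have "B * (Mb + norm (grad L v x))\<^sup>2 \<le> B * (2 * (Mb\<^sup>2 + (norm (grad L v x))\<^sup>2))"
        using B0 by (rule mult_left_mono)
      then show "(?f x)\<^sup>2 \<le> 2 * B * (Mb\<^sup>2 + (norm (grad L v x))\<^sup>2)"
        unfolding power_mult_distrib real_sqrt_pow2[OF B0] by (simp only: mult.left_commute mult.assoc)
    qed
    also have "\<dots> = 2 * B * (Mb\<^sup>2 * L\<^sup>2 + wsq lam_w (hat v))"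
      using gi ci norm_grad_L2(2)[OF v] measure_torus by (simp add: space_torus mult.commute)
    finally show "(\<integral>x. (?f x)\<^sup>2 \<partial>torus L) \<le> 2 * B * (Mb\<^sup>2 * L\<^sup>2 + wsq lam_w (hat v))" .
  qed
  finally show ?thesis .
qed

definition nl_const :: real where "nl_const = 2 * embed_const"

lemma nl_const_pos: "nl_const > 0" using embed_const_pos by (simp add: nl_const_def)

text \<open>Affine in the squared gradient norm of \<open>b\<close>; its square is therefore of the
  size of norm(grad b)^4.\<close>

definition nl_weight :: "(int \<times> int \<Rightarrow> real) \<Rightarrow> real" where
  "nl_weight b = nl_const * (Mb\<^sup>2 * L\<^sup>2 + wsq lam_w b)"

text \<open>The test function is the trigonometric polynomial with coefficients \<open>c\<close>,
  whose sup norm is paid for by its H^2 norm. This bounds the nonlinear difference as a functional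
  on H^2.\<close>

lemma nl_hat_diff:
  assumes u: "u \<in> Hm L 2" and v: "v \<in> Hm L 2"
  shows "(\<Sum>k\<in>modes n. c k * (hat (nl u) k - hat (nl v) k))\<^sup>2
    \<le> nl_weight (hat v) * wsq lam_w (\<lambda>k. hat u k - hat v k) * wpart h2_w c n"
proof -
  have "L2_inner L (\<lambda>x. nl u x - nl v x) (tpoly (modes n) c) = (\<Sum>k\<in>modes n. c k * (hat (nl u) k - hat (nl v) k))"
    by (simp add: inner_tpoly L2_diff nl_L2 u v hat_diff)
  then show ?thesis
    using nl_diff_bounded[OF u v tpoly_L2, of "modes n" c "embed_const * wpart h2_w c n"] tpoly_sup_bound[of n c]
    by (simp add: nl_weight_def nl_const_def mult.assoc mult.left_commute mult.commute distrib_left)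
qed

text \<open>Meaningful only if some function in \<open>L\<^sup>2\<close> has the coefficients \<open>a\<close>.\<close>

definition synth :: "(int \<times> int \<Rightarrow> real) \<Rightarrow> real^2 \<Rightarrow> real" where
  "synth a = (SOME u. u \<in> L2 L \<and> hat u = a)"

lemma synth:
  assumes "wfin one_w a"
  shows "synth a \<in> L2 L" "hat (synth a) = a"
proof -
  obtain C where "\<And>n. (\<Sum>k\<in>modes n. (a k)\<^sup>2) \<le> C"
    using assms unfolding wfin_def wpart_def by auto
  then obtain u where "u \<in> L2 L \<and> hat u = a" using Riesz_Fischer[of a C] by blast
  from someI[of "\<lambda>u. u \<in> L2 L \<and> hat u = a", OF this] show "synth a \<in> L2 L" "hat (synth a) = a"
    by (auto simp: synth_def)
qed

lemma synth_Hm2: "wfin h2_w a \<Longrightarrow> synth a \<in> Hm L 2 \<and> hat (synth a) = a"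
  using synth[of a] h2_fin(1)[of a] by (simp add: Hm2_iff)

text \<open>The nonlinearity as a map on coefficient sequences; \<open>hat_nl\<close> shows that the
  representative chosen by \<open>synth\<close> is immaterial.\<close>

definition NL :: "(int \<times> int \<Rightarrow> real) \<Rightarrow> int \<times> int \<Rightarrow> real" where
  "NL a = hat (nl (synth a))"

lemma wpart_zero: "wpart w (\<lambda>k. 0) n = 0" by (simp add: wpart_def)

lemma wfin_zero: "wfin w (\<lambda>k. 0)" by (rule wfinI[of _ _ 0]) (simp add: wpart_zero)

lemma wsq_zero: "wsq w (\<lambda>k. 0) = 0"
  unfolding wsq_def wpart_zero[abs_def] by (simp add: wpart_zero fun_eq_iff limI)

lemma NL_diff:
  assumes "wfin h2_w a" "wfin h2_w b"
  shows "(\<Sum>k\<in>modes n. c k * (NL a k - NL b k))\<^sup>2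
    \<le> nl_weight b * wsq lam_w (\<lambda>k. a k - b k) * wpart h2_w c n"
  using nl_hat_diff[of "synth a" "synth b"] synth_Hm2[OF assms(1)] synth_Hm2[OF assms(2)]
  by (simp add: NL_def)

text \<open>\<open>NL_diff\<close> tested with the sequence that is 1 at \<open>k\<close> and 0
  elsewhere.\<close>

lemma NL_diff_coeff:
  assumes "wfin h2_w a" "wfin h2_w b"
  shows "(NL a k - NL b k)\<^sup>2 \<le> nl_weight b * wsq lam_w (\<lambda>k. a k - b k) * (1 + (lam k)\<^sup>2)"
proof -
  obtain n where n: "k \<in> modes n" using in_some_modes by blast
  let ?c = "\<lambda>l. if l = k then 1 else 0 :: real"
  have "(\<Sum>l\<in>modes n. ?c l * (NL a l - NL b l)) = NL a k - NL b k"
    using n finite_modes[of n] by (simp add: if_distrib if_distribR cong: if_cong)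
  moreover have "wpart h2_w ?c n = 1 + (lam k)\<^sup>2"
    unfolding wpart_def using n finite_modes[of n] by (simp add: if_distrib if_distribR cong: if_cong)
  ultimately show ?thesis using NL_diff[OF assms, of ?c n] by simp
qed

text \<open>The difference estimate applied to two functions with equal coefficients contains the
  factor \<open>wsq lam_w\<close> of the zero sequence, which is 0.\<close>

lemma hat_nl:
  assumes u: "u \<in> Hm L 2"
  shows "hat (nl u) = NL (hat u)"
proof
  fix k
  have s: "synth (hat u) \<in> Hm L 2" "hat (synth (hat u)) = hat u"
    using synth_Hm2[OF Hm2_fin[OF u]] by auto
  obtain n where n: "k \<in> modes n" using in_some_modes by blast
  let ?c = "\<lambda>l. if l = k then 1 else 0 :: real"
  have "(\<Sum>l\<in>modes n. ?c l * (hat (nl u) l - NL (hat u) l)) = hat (nl u) k - NL (hat u) k"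
    using n finite_modes[of n] by (simp add: if_distrib if_distribR cong: if_cong)
  moreover have "(\<Sum>l\<in>modes n. ?c l * (hat (nl u) l - NL (hat u) l))\<^sup>2 \<le> 0"
    using nl_hat_diff[OF u s(1), of ?c n] by (simp add: NL_def s(2) wsq_zero)
  ultimately show "hat (nl u) k = NL (hat u) k" by simp
qed

lemma NL_bound:
  assumes "wfin h2_w a"
  shows "(\<Sum>k\<in>modes n. (NL a k)\<^sup>2) \<le> Mb\<^sup>2 * wsq lam_w a"
  using Bessel[OF nl_L2(1) finite_modes, of "synth a" n] nl_L2(2)[of "synth a"] synth_Hm2[OF assms]
  by (simp add: NL_def)

lemma NL_coeff_bound:
  assumes "wfin h2_w a"
  shows "(NL a k)\<^sup>2 \<le> Mb\<^sup>2 * wsq lam_w a"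
proof -
  obtain n where n: "k \<in> modes n" using in_some_modes by blast
  have "(NL a k)\<^sup>2 \<le> (\<Sum>k\<in>modes n. (NL a k)\<^sup>2)"
    using n finite_modes by (intro member_le_sum) auto
  then show ?thesis using NL_bound[OF assms, of n] by simp
qed

lemma NL_zero: "NL (\<lambda>k. 0) k = 0"
  using NL_coeff_bound[OF wfin_zero, of k] by (simp add: wsq_zero)

end

section \<open>Indefinite integrals on a time interval\<close>

text \<open>A substitute for "zero derivative implies constant" that avoids almost-everywhere
  differentiation: on a fine uniform partition the increments of \<open>D\<close> are at most
  \<open>e\<close> times those of \<open>G\<close>, and the latter telescope.\<close>

lemma telescope_small_increments:
  fixes D G :: "real \<Rightarrow> real"
  assumes t: "0 \<le> t"
    and small: "\<And>e. e > 0 \<Longrightarrow> \<exists>d>0. \<forall>s r. 0 \<le> s \<and> s \<le> r \<and> r \<le> t \<and> r - s < d \<longrightarrow> \<bar>D r - D s\<bar> \<le> e * (G r - G s)"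
  shows "D t = D 0"
proof -
  have *: "\<bar>D t - D 0\<bar> \<le> e * (G t - G 0)" if e: "e > 0" for e
  proof -
    obtain d where d: "d > 0" "\<And>s r. 0 \<le> s \<Longrightarrow> s \<le> r \<Longrightarrow> r \<le> t \<Longrightarrow> r - s < d \<Longrightarrow> \<bar>D r - D s\<bar> \<le> e * (G r - G s)"
      using small[OF e] by blast
    obtain n :: nat where n: "t / d < real n" using reals_Archimedean2 by blast
    have n0: "n > 0" using n t d(1) by (cases n) (auto simp: field_simps)
    have tn: "t / real n < d" using n n0 d(1) by (simp add: field_simps)
    define r where "r i = real i * (t / real n)" for i
    have rn: "r n = t" "r 0 = 0" using n0 by (auto simp: r_def)
    have rs: "r (Suc i) = r i + t / real n" for i by (simp add: r_def distrib_right add_divide_distrib)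
    have tn0: "0 \<le> t / real n" using t by simp
    have r: "0 \<le> r i" "r i \<le> r (Suc i)" "r (Suc i) - r i < d" for i
      using tn tn0 by (simp_all add: rs) (simp add: r_def t)
    have rt: "r (Suc i) \<le> t" if "i < n" for i
    proof -
      have "r (Suc i) \<le> r n" unfolding r_def using that t by (intro mult_right_mono) auto
      then show ?thesis by (simp add: rn)
    qed
    have "\<bar>D t - D 0\<bar> = \<bar>\<Sum>i<n. D (r (Suc i)) - D (r i)\<bar>"
      using sum_lessThan_telescope[of "\<lambda>i. D (r i)" n] by (simp add: rn)
    also have "\<dots> \<le> (\<Sum>i<n. \<bar>D (r (Suc i)) - D (r i)\<bar>)" by (rule sum_abs)
    also have "\<dots> \<le> (\<Sum>i<n. e * (G (r (Suc i)) - G (r i)))"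
      using r rt by (intro sum_mono d(2)) auto
    also have "\<dots> = e * (G t - G 0)"
      using sum_lessThan_telescope[of "\<lambda>i. G (r i)" n] by (simp add: rn sum_distrib_left[symmetric])
    finally show ?thesis .
  qed
  have "\<bar>D t - D 0\<bar> \<le> 0 + e" if e: "e > 0" for e
  proof -
    define c where "c = \<bar>G t - G 0\<bar> + 1"
    have c: "c > 0" "G t - G 0 \<le> c" by (auto simp: c_def)
    have "\<bar>D t - D 0\<bar> \<le> (e / c) * (G t - G 0)" by (rule *) (use e c in simp)
    also have "\<dots> \<le> (e / c) * c" using e c by (intro mult_left_mono) auto
    finally show ?thesis using c by simp
  qed
  then have "\<bar>D t - D 0\<bar> \<le> 0" by (rule field_le_epsilon)
  then show ?thesis by simp
qed

locale time_interval =
  fixes T :: real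
  assumes T_pos: "T > 0"
begin

abbreviation tM :: "real measure" where "tM \<equiv> lebesgue_on {0..T}"

text \<open>The indefinite integral, with the upper limit placed in an indicator under one fixed
  measure. Half-open intervals make increments additive without overlap, and dominated convergence
  applies in \<open>t\<close> and in the integrand alike.\<close>

definition TI :: "(real \<Rightarrow> real) \<Rightarrow> real \<Rightarrow> real" where
  "TI f t = (\<integral>s. f s * indicat_real {0<..t} s \<partial>tM)"

lemma ind_measurable: "indicat_real {a<..b} \<in> borel_measurable tM"
  by (intro measurable_restrict_space1 borel_measurable_indicator) (auto intro: sets_completionI_sets)

lemma integrable_ind:
  assumes "integrable tM f"
  shows "integrable tM (\<lambda>s. f s * indicat_real {a<..b} s)"
proof (rule Bochner_Integration.integrable_bound[OF assms])
  show "(\<lambda>s. f s * indicat_real {a<..b} s) \<in> borel_measurable tM"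
    using assms by (intro borel_measurable_times ind_measurable) auto
qed (auto simp: indicator_def)

lemma integrable_continuous_tM: "continuous_on {0..T} f \<Longrightarrow> integrable tM f" for f :: "real \<Rightarrow> real"
  by (rule continuous_imp_integrable_real)

lemma measurable_continuous_tM: "continuous_on {0..T} f \<Longrightarrow> f \<in> borel_measurable tM" for f :: "real \<Rightarrow> real"
  using integrable_continuous_tM by blast

lemma AE_tM_neq: "AE s in tM. s \<noteq> c"
proof -
  have "{c} \<in> null_sets lebesgue" by simp
  then have "AE s in lebesgue. s \<noteq> c" by (rule AE_I') auto
  then show ?thesis by (subst AE_restrict_space_iff) auto
qed

lemma TI_0: "TI f 0 = 0" by (simp add: TI_def)

lemma TI_diff:
  assumes f: "integrable tM f" and st: "0 \<le> s" "s \<le> t"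
  shows "TI f t - TI f s = (\<integral>q. f q * indicat_real {s<..t} q \<partial>tM)"
proof -
  have "TI f t - TI f s = (\<integral>q. f q * indicat_real {0<..t} q - f q * indicat_real {0<..s} q \<partial>tM)"
    unfolding TI_def by (intro Bochner_Integration.integral_diff[symmetric] integrable_ind f)
  also have "\<dots> = (\<integral>q. f q * indicat_real {s<..t} q \<partial>tM)"
    by (intro Bochner_Integration.integral_cong refl) (use st in \<open>auto simp: indicator_def\<close>)
  finally show ?thesis .
qed

lemma TI_T: assumes f: "integrable tM f" shows "TI f T = (\<integral>s. f s \<partial>tM)"
  unfolding TI_def
proof (rule integral_cong_AE)
  show "AE s in tM. f s * indicat_real {0<..T} s = f s"
    using AE_tM_neq[of 0] AE_space by eventually_elim (auto simp: indicator_def)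
  show "(\<lambda>s. f s * indicat_real {0<..T} s) \<in> borel_measurable tM"
    using integrable_ind[OF f] by auto
  show "f \<in> borel_measurable tM" using f by auto
qed

lemma TI_mono_AE:
  assumes "integrable tM f" "integrable tM g" "AE s in tM. f s \<le> g s"
  shows "TI f t \<le> TI g t"
  unfolding TI_def
proof (rule integral_mono_AE[OF integrable_ind integrable_ind, OF assms(1,2)])
  show "AE s in tM. f s * indicat_real {0<..t} s \<le> g s * indicat_real {0<..t} s"
    using assms(3) by eventually_elim (auto simp: indicator_def)
qed

lemma TI_add: "integrable tM f \<Longrightarrow> integrable tM g \<Longrightarrow> TI (\<lambda>s. f s + g s) t = TI f t + TI g t"
  unfolding TI_def distrib_right by (intro Bochner_Integration.integral_add integrable_ind)

lemma TI_diff_fun: "integrable tM f \<Longrightarrow> integrable tM g \<Longrightarrow> TI (\<lambda>s. f s - g s) t = TI f t - TI g t"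
  unfolding TI_def left_diff_distrib by (intro Bochner_Integration.integral_diff integrable_ind)

lemma TI_cmult: "TI (\<lambda>s. c * f s) t = c * TI f t"
  unfolding TI_def by (simp add: mult.assoc)

lemma TI_sum:
  assumes "\<And>k. k \<in> K \<Longrightarrow> integrable tM (f k)"
  shows "TI (\<lambda>s. \<Sum>k\<in>K. f k s) t = (\<Sum>k\<in>K. TI (f k) t)"
  unfolding TI_def sum_distrib_right by (intro Bochner_Integration.integral_sum integrable_ind assms)

lemma TI_mono_time:
  assumes f: "integrable tM f" "AE s in tM. 0 \<le> f s" and st: "0 \<le> s" "s \<le> t"
  shows "TI f s \<le> TI f t"
proof -
  have "0 \<le> (\<integral>q. f q * indicat_real {s<..t} q \<partial>tM)"
    by (rule integral_nonneg_AE) (use f(2) in \<open>auto elim!: eventually_mono simp: indicator_def\<close>)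
  then show ?thesis using TI_diff[OF f(1) st] by simp
qed

lemma TI_nonneg: "integrable tM f \<Longrightarrow> AE s in tM. 0 \<le> f s \<Longrightarrow> 0 \<le> t \<Longrightarrow> 0 \<le> TI f t"
  using TI_mono_time[of f 0 t] by (simp add: TI_0)

lemma TI_le_total:
  assumes f: "integrable tM f" "AE s in tM. 0 \<le> f s" and t: "t \<in> {0..T}"
  shows "TI f t \<le> (\<integral>s. f s \<partial>tM)"
  using TI_mono_time[OF f, of t T] t TI_T[OF f(1)] by simp

lemma TI_dominated:
  assumes lim: "AE s in tM. (\<lambda>n. f n s) \<longlonglongrightarrow> g s" and bd: "\<And>n. AE s in tM. \<bar>f n s\<bar> \<le> w s"
    and m: "\<And>n. f n \<in> borel_measurable tM" "g \<in> borel_measurable tM" and w: "integrable tM w"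
  shows "(\<lambda>n. TI (f n) t) \<longlonglongrightarrow> TI g t"
  unfolding TI_def
proof (rule integral_dominated_convergence[where w = w])
  show "AE s in tM. (\<lambda>n. f n s * indicat_real {0<..t} s) \<longlonglongrightarrow> g s * indicat_real {0<..t} s"
    using lim by eventually_elim (intro tendsto_intros)
  show "AE s in tM. norm (f n s * indicat_real {0<..t} s) \<le> w s" for n
    using bd[of n] by eventually_elim (auto simp: indicator_def)
qed (use m w in \<open>auto intro!: borel_measurable_times ind_measurable\<close>)

lemma TI_abs_diff:
  assumes f: "integrable tM f" and st: "0 \<le> s" "s \<le> t"
  shows "\<bar>TI f t - TI f s\<bar> \<le> TI (\<lambda>q. \<bar>f q\<bar>) t - TI (\<lambda>q. \<bar>f q\<bar>) s"
proof -
  have fa: "integrable tM (\<lambda>q. \<bar>f q\<bar>)" using f by simp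
  have "\<bar>\<integral>q. f q * indicat_real {s<..t} q \<partial>tM\<bar> \<le> (\<integral>q. \<bar>f q * indicat_real {s<..t} q\<bar> \<partial>tM)"
    by (rule integral_abs_bound)
  also have "\<dots> = (\<integral>q. \<bar>f q\<bar> * indicat_real {s<..t} q \<partial>tM)" by (simp add: abs_mult)
  finally show ?thesis using TI_diff[OF f st] TI_diff[OF fa st] by simp
qed

lemma TI_continuous:
  assumes f: "integrable tM f"
  shows "continuous_on {0..T} (TI f)"
  unfolding continuous_on_sequentially
proof (intro allI ballI impI, elim conjE)
  fix x and a assume "\<forall>n. x n \<in> {0..T}" and x: "x \<longlonglongrightarrow> a"
  show "(TI f \<circ> x) \<longlonglongrightarrow> TI f a"
    unfolding TI_def o_def
  proof (rule integral_dominated_convergence[where w = "\<lambda>s. \<bar>f s\<bar>"])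
    show "AE s in tM. (\<lambda>i. f s * indicat_real {0<..x i} s) \<longlonglongrightarrow> f s * indicat_real {0<..a} s"
      using AE_tM_neq[of a]
    proof eventually_elim
      case (elim s)
      have "\<forall>\<^sub>F i in sequentially. indicat_real {0<..x i} s = indicat_real {0<..a} s"
      proof (cases "s < a")
        case True
        then show ?thesis using order_tendstoD(1)[OF x True]
          by (auto elim!: eventually_mono simp: indicator_def)
      next
        case False
        then have "a < s" using elim by simp
        then show ?thesis using order_tendstoD(2)[OF x \<open>a < s\<close>]
          by (auto elim!: eventually_mono simp: indicator_def)
      qed
      then have "(\<lambda>i. indicat_real {0<..x i} s) \<longlonglongrightarrow> indicat_real {0<..a} s" by (rule tendsto_eventually)
      then show ?case by (intro tendsto_intros)
    qed
    show "AE s in tM. norm (f s * indicat_real {0<..x n} s) \<le> \<bar>f s\<bar>" for n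
      by (auto simp: indicator_def)
  qed (use f in \<open>auto intro!: borel_measurable_times ind_measurable\<close>)
qed

lemma integrable_mult_continuous:
  fixes g :: "real \<Rightarrow> real"
  assumes f: "integrable tM f" and g: "continuous_on {0..T} g"
  shows "integrable tM (\<lambda>s. f s * g s)"
proof -
  obtain C where C: "\<forall>s\<in>{0..T}. \<bar>g s\<bar> \<le> C"
    using compact_imp_bounded[OF compact_continuous_image[OF g compact_Icc]] by (auto simp: bounded_iff)
  show ?thesis
  proof (rule Bochner_Integration.integrable_bound)
    show "integrable tM (\<lambda>s. C * f s)" using f by simp
    show "(\<lambda>s. f s * g s) \<in> borel_measurable tM"
      using f measurable_continuous_tM[OF g] by (intro borel_measurable_times) auto
    show "AE s in tM. norm (f s * g s) \<le> norm (C * f s)"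
    proof (rule AE_I2)
      fix s assume "s \<in> space tM"
      then have "\<bar>g s\<bar> \<le> \<bar>C\<bar>" using C by (auto intro: order_trans[OF _ abs_ge_self])
      then have "\<bar>f s\<bar> * \<bar>g s\<bar> \<le> \<bar>f s\<bar> * \<bar>C\<bar>" by (rule mult_left_mono) simp
      then show "norm (f s * g s) \<le> norm (C * f s)" by (simp add: abs_mult mult.commute)
    qed
  qed
qed

section \<open>Product rule and Gronwall inequality for indefinite integrals\<close>

lemma abs_cont_continuous:
  assumes "integrable tM g" "\<And>t. t \<in> {0..T} \<Longrightarrow> x t = x0 + TI g t"
  shows "continuous_on {0..T} x"
proof -
  have "continuous_on {0..T} (\<lambda>t. x0 + TI g t)" by (intro continuous_intros TI_continuous assms)
  then show ?thesis by (rule continuous_on_eq) (simp add: assms(2))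
qed

text \<open>The difference \<open>D\<close> of the two sides has increments
  \<open>\<integral> g q * ((x r - x q) + (x s - x q))\<close> over \<open>(s, r]\<close>. Uniform
  continuity of \<open>x\<close> makes the bracket at most \<open>e\<close>, so \<open>D\<close> is
  constant by \<open>telescope_small_increments\<close>.\<close>

lemma abs_cont_square:
  assumes g: "integrable tM g" and x: "\<And>t. t \<in> {0..T} \<Longrightarrow> x t = x0 + TI g t" and t: "t \<in> {0..T}"
  shows "(x t)\<^sup>2 = x0\<^sup>2 + 2 * TI (\<lambda>s. g s * x s) t"
proof -
  have cx: "continuous_on {0..T} x" by (rule abs_cont_continuous[OF g x])
  have gx: "integrable tM (\<lambda>s. g s * x s)" by (rule integrable_mult_continuous[OF g cx])
  have ga: "integrable tM (\<lambda>s. \<bar>g s\<bar>)" using g by simp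
  define D where "D r = (x r)\<^sup>2 - 2 * TI (\<lambda>s. g s * x s) r" for r
  have "D t = D 0"
  proof (rule telescope_small_increments[where G = "TI (\<lambda>s. \<bar>g s\<bar>)"])
    show "0 \<le> t" using t by simp
    fix e :: real assume e: "e > 0"
    have "uniformly_continuous_on {0..T} x" by (rule compact_uniformly_continuous[OF cx compact_Icc])
    then obtain d where d: "d > 0" "\<And>s r. s \<in> {0..T} \<Longrightarrow> r \<in> {0..T} \<Longrightarrow> \<bar>r - s\<bar> < d \<Longrightarrow> \<bar>x r - x s\<bar> < e / 2"
      unfolding uniformly_continuous_on_def dist_real_def using e
      by (metis half_gt_zero_iff)
    have "\<bar>D r - D s\<bar> \<le> e * (TI (\<lambda>s. \<bar>g s\<bar>) r - TI (\<lambda>s. \<bar>g s\<bar>) s)"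
      if sr: "0 \<le> s" "s \<le> r" "r \<le> t" "r - s < d" for s r
    proof -
      have mem: "s \<in> {0..T}" "r \<in> {0..T}" using sr t by auto
      let ?i = "indicat_real {s<..r}"
      have "x r - x s = (\<integral>q. g q * ?i q \<partial>tM)"
        using x mem TI_diff[OF g sr(1,2)] by simp
      then have "(x r)\<^sup>2 - (x s)\<^sup>2 = (x r + x s) * (\<integral>q. g q * ?i q \<partial>tM)"
        by (simp add: power2_eq_square algebra_simps)
      moreover have "TI (\<lambda>s. g s * x s) r - TI (\<lambda>s. g s * x s) s = (\<integral>q. g q * x q * ?i q \<partial>tM)"
        by (rule TI_diff[OF gx sr(1,2)])
      ultimately have "D r - D s = (x r + x s) * (\<integral>q. g q * ?i q \<partial>tM) - 2 * (\<integral>q. g q * x q * ?i q \<partial>tM)"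
        by (simp add: D_def)
      also have "\<dots> = (\<integral>q. (x r + x s) * (g q * ?i q) - 2 * (g q * x q * ?i q) \<partial>tM)"
        using integrable_ind[OF g] integrable_ind[OF gx] by simp
      finally have "\<bar>D r - D s\<bar> \<le> (\<integral>q. \<bar>(x r + x s) * (g q * ?i q) - 2 * (g q * x q * ?i q)\<bar> \<partial>tM)"
        using integral_abs_bound by simp
      also have "\<dots> \<le> (\<integral>q. e * (\<bar>g q\<bar> * ?i q) \<partial>tM)"
      proof (rule integral_mono_AE)
        show "integrable tM (\<lambda>q. \<bar>(x r + x s) * (g q * ?i q) - 2 * (g q * x q * ?i q)\<bar>)"
          using integrable_ind[OF g] integrable_ind[OF gx] by (intro integrable_abs Bochner_Integration.integrable_diff) auto
        show "integrable tM (\<lambda>q. e * (\<bar>g q\<bar> * ?i q))" using integrable_ind[OF ga] by simp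
        show "AE q in tM. \<bar>(x r + x s) * (g q * ?i q) - 2 * (g q * x q * ?i q)\<bar> \<le> e * (\<bar>g q\<bar> * ?i q)"
        proof (rule AE_I2)
          fix q assume "q \<in> space tM"
          then have q: "q \<in> {0..T}" by simp
          show "\<bar>(x r + x s) * (g q * ?i q) - 2 * (g q * x q * ?i q)\<bar> \<le> e * (\<bar>g q\<bar> * ?i q)"
          proof (cases "q \<in> {s<..r}")
            case True
            then have "\<bar>r - q\<bar> < d" "\<bar>s - q\<bar> < d" using sr by auto
            then have "\<bar>x r - x q\<bar> < e / 2" "\<bar>x s - x q\<bar> < e / 2" using d(2)[OF q] mem by auto
            then have "\<bar>(x r - x q) + (x s - x q)\<bar> \<le> e" by linarith
            then have "\<bar>g q\<bar> * \<bar>(x r - x q) + (x s - x q)\<bar> \<le> \<bar>g q\<bar> * e" by (rule mult_left_mono) simp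
            moreover have "(x r + x s) * g q - 2 * (g q * x q) = g q * ((x r - x q) + (x s - x q))"
              by (simp add: algebra_simps)
            ultimately show ?thesis using True by (simp add: abs_mult mult.commute)
          qed simp
        qed
      qed
      also have "\<dots> = e * (TI (\<lambda>s. \<bar>g s\<bar>) r - TI (\<lambda>s. \<bar>g s\<bar>) s)"
        using TI_diff[OF ga sr(1,2)] by simp
      finally show ?thesis .
    qed
    then show "\<exists>d>0. \<forall>s r. 0 \<le> s \<and> s \<le> r \<and> r \<le> t \<and> r - s < d \<longrightarrow>
        \<bar>D r - D s\<bar> \<le> e * (TI (\<lambda>s. \<bar>g s\<bar>) r - TI (\<lambda>s. \<bar>g s\<bar>) s)"
      using d(1) by blast
  qed
  moreover have "x 0 = x0" using x[of 0] T_pos by (simp add: TI_0)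
  ultimately show ?thesis by (simp add: D_def TI_0)
qed

text \<open>Polarization: the square rule for \<open>x + y\<close> and for
  \<open>x - y\<close>.\<close>

lemma abs_cont_product:
  assumes f: "integrable tM f" and x: "\<And>t. t \<in> {0..T} \<Longrightarrow> x t = x0 + TI f t"
    and g: "integrable tM g" and y: "\<And>t. t \<in> {0..T} \<Longrightarrow> y t = y0 + TI g t" and t: "t \<in> {0..T}"
  shows "x t * y t = x0 * y0 + TI (\<lambda>s. f s * y s + g s * x s) t"
proof -
  have cx: "continuous_on {0..T} x" by (rule abs_cont_continuous[OF f x])
  have cy: "continuous_on {0..T} y" by (rule abs_cont_continuous[OF g y])
  have "(x t + y t)\<^sup>2 = (x0 + y0)\<^sup>2 + 2 * TI (\<lambda>s. (f s + g s) * (x s + y s)) t"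
    by (rule abs_cont_square[OF _ _ t]) (use f g x y in \<open>auto simp: TI_add\<close>)
  moreover have "(x t - y t)\<^sup>2 = (x0 - y0)\<^sup>2 + 2 * TI (\<lambda>s. (f s - g s) * (x s - y s)) t"
    by (rule abs_cont_square[OF _ _ t]) (use f g x y in \<open>auto simp: TI_diff_fun\<close>)
  moreover have "TI (\<lambda>s. (f s + g s) * (x s + y s)) t - TI (\<lambda>s. (f s - g s) * (x s - y s)) t
      = TI (\<lambda>s. (f s + g s) * (x s + y s) - (f s - g s) * (x s - y s)) t"
    using f g cx cy
    by (intro TI_diff_fun[symmetric] integrable_mult_continuous continuous_intros
        Bochner_Integration.integrable_add Bochner_Integration.integrable_diff)
  moreover have "TI (\<lambda>s. (f s + g s) * (x s + y s) - (f s - g s) * (x s - y s)) t = 2 * TI (\<lambda>s. f s * y s + g s * x s) t"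
  proof -
    have "(\<lambda>s. (f s + g s) * (x s + y s) - (f s - g s) * (x s - y s)) = (\<lambda>s. 2 * (f s * y s + g s * x s))"
      by (simp add: fun_eq_iff algebra_simps)
    then show ?thesis by (simp only: TI_cmult)
  qed
  ultimately have "(x t + y t)\<^sup>2 - (x t - y t)\<^sup>2 = (x0 + y0)\<^sup>2 - (x0 - y0)\<^sup>2 + 4 * TI (\<lambda>s. f s * y s + g s * x s) t"
    by linarith
  then show ?thesis by (simp add: power2_sum power2_diff)
qed

text \<open>On every stretch of time over which \<open>b\<close> has integral at most \<open>1/2\<close>, the bound at most doubles.\<close>

lemma gronwall_doubling:
  assumes b: "integrable tM b" "AE s in tM. 0 \<le> b s" and bf: "integrable tM (\<lambda>s. b s * f s)"
    and f0: "\<And>t. t \<in> {0..T} \<Longrightarrow> 0 \<le> f t"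
    and f: "\<And>t. t \<in> {0..T} \<Longrightarrow> f t \<le> A + TI (\<lambda>s. b s * f s) t" and A: "0 \<le> A"
    and N: "(\<integral>s. b s \<partial>tM) \<le> real N / 2" and t: "t \<in> {0..T}"
  shows "f t \<le> 2 ^ N * A"
proof -
  define S where "S t = A + TI (\<lambda>s. b s * f s) t" for t
  have bf0: "AE s in tM. 0 \<le> b s * f s"
    using b(2) AE_space by eventually_elim (use f0 in \<open>auto intro!: mult_nonneg_nonneg\<close>)
  have Smono: "S s \<le> S t" if "0 \<le> s" "s \<le> t" for s t
    using TI_mono_time[OF bf bf0 that] by (simp add: S_def)
  \<comment> \<open>\<open>S\<close> is monotone and dominates \<open>f\<close>, so the integrand on
    \<open>(s, t]\<close> is at most \<open>b q * S t\<close>; an integral of \<open>b\<close> up to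
    1/2 gives \<open>S t - S s \<le> S t / 2\<close>.\<close>
  have double: "S t \<le> 2 * S s" if st: "0 \<le> s" "s \<le> t" "t \<le> T" and h: "TI b t - TI b s \<le> 1 / 2" for s t
  proof -
    have "S t - S s = (\<integral>q. (b q * f q) * indicat_real {s<..t} q \<partial>tM)"
      using TI_diff[OF bf st(1,2)] by (simp add: S_def)
    also have "\<dots> \<le> (\<integral>q. S t * (b q * indicat_real {s<..t} q) \<partial>tM)"
    proof (rule integral_mono_AE[OF integrable_ind[OF bf]])
      show "integrable tM (\<lambda>q. S t * (b q * indicat_real {s<..t} q))" using integrable_ind[OF b(1)] by simp
      show "AE q in tM. b q * f q * indicat_real {s<..t} q \<le> S t * (b q * indicat_real {s<..t} q)"
        using b(2) AE_space
      proof eventually_elim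
        case (elim q)
        show ?case
        proof (cases "q \<in> {s<..t}")
          case True
          have "f q \<le> S q" using f elim by (simp add: S_def)
          also have "\<dots> \<le> S t" using True st(1) by (intro Smono) auto
          finally have "b q * f q \<le> b q * S t" using elim(1) by (rule mult_left_mono)
          then show ?thesis using True by (simp add: mult.commute)
        qed simp
      qed
    qed
    also have "\<dots> = S t * (TI b t - TI b s)" using TI_diff[OF b(1) st(1,2)] by simp
    also have "\<dots> \<le> S t * (1 / 2)"
    proof (rule mult_left_mono[OF h])
      have "0 \<le> S 0" using A by (simp add: S_def TI_0)
      also have "\<dots> \<le> S t" using st by (intro Smono) auto
      finally show "0 \<le> S t" .
    qed
    finally show ?thesis by simp
  qed
  have "S t \<le> 2 ^ n * A" if "t \<in> {0..T}" "TI b t \<le> real n / 2" for n t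
    using that
  proof (induction n arbitrary: t)
    case 0
    \<comment> \<open>With no mass of \<open>b\<close> on \<open>(0, t]\<close> the same comparison
      gives no growth at all, so the induction starts with the factor \<open>2 ^ 0\<close>.\<close>
    then have "TI b t = 0" using TI_nonneg[OF b, of t] by simp
    have "S t - S 0 = (\<integral>q. (b q * f q) * indicat_real {0<..t} q \<partial>tM)"
      using TI_diff[OF bf, of 0 t] 0 by (simp add: S_def)
    also have "\<dots> \<le> (\<integral>q. S t * (b q * indicat_real {0<..t} q) \<partial>tM)"
    proof (rule integral_mono_AE[OF integrable_ind[OF bf]])
      show "integrable tM (\<lambda>q. S t * (b q * indicat_real {0<..t} q))" using integrable_ind[OF b(1)] by simp
      show "AE q in tM. b q * f q * indicat_real {0<..t} q \<le> S t * (b q * indicat_real {0<..t} q)"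
        using b(2) AE_space
      proof eventually_elim
        case (elim q)
        show ?case
        proof (cases "q \<in> {0<..t}")
          case True
          have "f q \<le> S q" using f elim by (simp add: S_def)
          also have "\<dots> \<le> S t" using True by (intro Smono) auto
          finally have "b q * f q \<le> b q * S t" using elim(1) by (rule mult_left_mono)
          then show ?thesis using True by (simp add: mult.commute)
        qed simp
      qed
    qed
    also have "\<dots> = S t * TI b t" by (simp add: TI_def)
    finally show ?case using \<open>TI b t = 0\<close> by (simp add: S_def TI_0)
  next
    case (Suc n)
    show ?case
    proof (cases "TI b t \<le> real n / 2")
      case True
      have "S t \<le> 2 ^ n * A" by (rule Suc.IH[OF Suc.prems(1) True])
      also have "\<dots> \<le> 2 ^ Suc n * A" using A by simp
      finally show ?thesis .
    next
      case False
      have "continuous_on {0..t} (TI b)"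
        by (rule continuous_on_subset[OF TI_continuous[OF b(1)]]) (use Suc.prems in auto)
      \<comment> \<open>The intermediate value theorem finds the last division point: up to
        \<open>s\<close> the induction hypothesis applies, and after it the remaining integral of
        \<open>b\<close> is at most 1/2.\<close>
      then obtain s where s: "0 \<le> s" "s \<le> t" "TI b s = real n / 2"
        using IVT'[of "TI b" 0 "real n / 2" t] False Suc.prems by (auto simp: TI_0)
      have "S t \<le> 2 * S s" by (rule double) (use s Suc.prems in \<open>auto simp: add_divide_distrib\<close>)
      also have "S s \<le> 2 ^ n * A" by (rule Suc.IH) (use s Suc.prems in auto)
      finally show ?thesis by simp
    qed
  qed
  moreover have "TI b t \<le> real N / 2" using TI_le_total[OF b t] N by simp
  ultimately have "S t \<le> 2 ^ N * A" using t by blast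
  then show ?thesis using f[OF t] by (simp add: S_def)
qed

text \<open>Lebesgue measure is complete. This is what makes objects measurable that are known only
  almost everywhere, such as the nonlinearity along a path.\<close>

lemma measurable_lebesgue_on_AE_eq:
  fixes f g :: "real \<Rightarrow> real"
  assumes "f \<in> borel_measurable tM" "AE s in tM. f s = g s"
  shows "g \<in> borel_measurable tM"
proof -
  have c: "complete_measure tM"
    by standard (auto simp: null_sets_restrict_space sets_restrict_space_iff
        intro: complete_measure.complete[OF completion.complete_measure_axioms])
  show ?thesis
  proof (rule measurableI)
    fix A :: "real set" assume "A \<in> sets borel"
    then have f: "f -` A \<inter> space tM \<in> sets tM" using assms(1) by (rule measurable_sets[rotated])
    show "g -` A \<inter> space tM \<in> sets tM"
    proof (rule complete_measure.in_sets_AE[OF c _ f])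
      show "AE x in tM. (x \<in> f -` A \<inter> space tM) = (x \<in> g -` A \<inter> space tM)"
        using assms(2) by eventually_elim auto
    qed auto
  qed simp
qed

end

section \<open>Paths of coefficients and the energy estimate\<close>

context torus_side
begin

lemma lam_le_h2: "lam k \<le> 1 * (1 + (lam k)\<^sup>2)"
proof -
  have half: "y \<le> 1 * s" if "y \<le> s / 2" "0 \<le> s" for y s :: real using that by simp
  show ?thesis by (rule half[OF lam_le]) simp
qed

definition trunc :: "nat \<Rightarrow> (int \<times> int \<Rightarrow> real) \<Rightarrow> int \<times> int \<Rightarrow> real" where
  "trunc n a k = (if k \<in> modes n then a k else 0)"

lemma wpart_supported:
  assumes "\<And>k. k \<notin> modes n \<Longrightarrow> a k = 0" "n \<le> m"
  shows "wpart w a m = wpart w a n"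
  unfolding wpart_def using assms modes_mono[OF assms(2)] finite_modes
  by (intro sum.mono_neutral_right) auto

lemma wpart_supported_le:
  assumes "\<And>k. k \<notin> modes n \<Longrightarrow> a k = 0" "\<And>k. 0 \<le> w k"
  shows "wpart w a m \<le> wpart w a n"
proof (cases "n \<le> m")
  case True
  then show ?thesis using wpart_supported[OF assms(1) True] by simp
next
  case False
  then show ?thesis using incseqD[OF wpart_incseq[OF assms(2)]] by simp
qed

lemma wsq_supported:
  assumes "\<And>k. k \<notin> modes n \<Longrightarrow> a k = 0"
  shows "wfin w a" "wsq w a = wpart w a n"
proof -
  have ev: "\<forall>\<^sub>F m in sequentially. wpart w a m = wpart w a n"
    by (rule eventually_sequentiallyI[of n]) (rule wpart_supported[OF assms])
  have l: "wpart w a \<longlonglongrightarrow> wpart w a n" by (rule tendsto_eventually[OF ev])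
  then show "wsq w a = wpart w a n" unfolding wsq_def by (rule limI)
  have "Bseq (wpart w a)" using l convergent_imp_Bseq convergentI by blast
  then obtain C where "\<forall>m. norm (wpart w a m) \<le> C" unfolding Bseq_def by blast
  then show "wfin w a" by (intro wfinI[of w a C]) (simp add: abs_le_iff)
qed

lemma wpart_tail:
  assumes "n \<le> m"
  shows "wpart w (\<lambda>k. a k - trunc n a k) m = wpart w a m - wpart w a n"
proof -
  have "wpart w a n = (\<Sum>k\<in>modes m. w k * (trunc n a k)\<^sup>2)"
    unfolding wpart_def using modes_mono[OF assms] finite_modes
    by (intro sum.mono_neutral_cong_left) (auto simp: trunc_def)
  then show ?thesis
    unfolding wpart_def by (simp add: sum_subtractf[symmetric]) (intro sum.cong, auto simp: trunc_def)
qed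

lemma wsq_tail:
  assumes "\<And>k. 0 \<le> w k" "wfin w a"
  shows "wsq w (\<lambda>k. a k - trunc n a k) = wsq w a - wpart w a n"
proof -
  have "(\<lambda>m. wpart w a m - wpart w a n) \<longlonglongrightarrow> wsq w a - wpart w a n"
    by (intro tendsto_intros wsq_lim assms)
  then have "wpart w (\<lambda>k. a k - trunc n a k) \<longlonglongrightarrow> wsq w a - wpart w a n"
    by (rule Lim_transform_eventually)
      (auto simp: eventually_sequentially wpart_tail intro!: exI[of _ n])
  then show ?thesis unfolding wsq_def by (rule limI)
qed

lemma trunc_supported: "k \<notin> modes n \<Longrightarrow> trunc n a k = 0" by (simp add: trunc_def)

lemma wfin_trunc: "wfin w (trunc n a)" by (rule wsq_supported(1)[OF trunc_supported])

lemma wsq_uminus: "wsq w (\<lambda>k. a k - b k) = wsq w (\<lambda>k. b k - a k)"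
proof -
  have "wpart w (\<lambda>k. a k - b k) = wpart w (\<lambda>k. b k - a k)"
    by (simp add: fun_eq_iff wpart_def power2_commute)
  then show ?thesis by (simp add: wsq_def)
qed

lemma wsq_tail_tendsto:
  assumes "\<And>k. 0 \<le> w k" "wfin w a"
  shows "(\<lambda>n. wsq w (\<lambda>k. trunc n a k - a k)) \<longlonglongrightarrow> 0"
proof -
  have "(\<lambda>n. wsq w a - wpart w a n) \<longlonglongrightarrow> wsq w a - wsq w a"
    by (intro tendsto_intros wsq_lim assms)
  then show ?thesis unfolding wsq_uminus[of w "trunc _ a"] wsq_tail[OF assms] by simp
qed

end

locale calmed_time = calmed + time_interval
begin

definition coeff_cont :: "(real \<Rightarrow> int \<times> int \<Rightarrow> real) \<Rightarrow> bool" where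
  "coeff_cont a \<longleftrightarrow> (\<forall>k. continuous_on {0..T} (\<lambda>t. a t k))"

lemma coeff_contD: "coeff_cont a \<Longrightarrow> continuous_on {0..T} (\<lambda>t. a t k)"
  unfolding coeff_cont_def by blast

text \<open>The coefficient form of bounded in L^2 and square integrable in H^2. Continuity of each
  coefficient makes every partial sum continuous in time, so the weighted norms are measurable as
  limits, without any Bochner measurability.\<close>

definition Hpath :: "(real \<Rightarrow> int \<times> int \<Rightarrow> real) \<Rightarrow> bool" where
  "Hpath a \<longleftrightarrow> coeff_cont a \<and> (\<exists>C. \<forall>t\<in>{0..T}. \<forall>n. wpart one_w (a t) n \<le> C)
    \<and> (AE t in tM. wfin h2_w (a t)) \<and> integrable tM (\<lambda>t. wsq lam2_w (a t))"

lemma wpart_continuous: "coeff_cont a \<Longrightarrow> continuous_on {0..T} (\<lambda>t. wpart w (a t) n)"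
  unfolding wpart_def coeff_cont_def by (intro continuous_intros) auto

lemma wpart_measurable: "coeff_cont a \<Longrightarrow> (\<lambda>t. wpart w (a t) n) \<in> borel_measurable tM"
  by (intro measurable_continuous_tM wpart_continuous)

lemma wsq_measurable: "coeff_cont a \<Longrightarrow> (\<lambda>t. wsq w (a t)) \<in> borel_measurable tM"
  unfolding wsq_def by (intro borel_measurable_lim_metric wpart_measurable)

lemma coeff_cont_diff: "coeff_cont a \<Longrightarrow> coeff_cont b \<Longrightarrow> coeff_cont (\<lambda>t k. a t k - b t k)"
  unfolding coeff_cont_def by (auto intro!: continuous_intros)

lemma Hpath_cont: "Hpath a \<Longrightarrow> coeff_cont a" by (simp add: Hpath_def)
lemma Hpath_AE: "Hpath a \<Longrightarrow> AE t in tM. wfin h2_w (a t)" by (simp add: Hpath_def)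
lemma Hpath_int: "Hpath a \<Longrightarrow> integrable tM (\<lambda>t. wsq lam2_w (a t))" by (simp add: Hpath_def)

lemma Hpath_bounded:
  assumes "Hpath a"
  obtains C where "0 \<le> C" "\<And>t. t \<in> {0..T} \<Longrightarrow> wfin one_w (a t)"
    "\<And>t. t \<in> {0..T} \<Longrightarrow> wsq one_w (a t) \<le> C" "\<And>t. t \<in> {0..T} \<Longrightarrow> 0 \<le> wsq one_w (a t)"
proof -
  obtain C where C: "\<forall>t\<in>{0..T}. \<forall>n. wpart one_w (a t) n \<le> C" using assms unfolding Hpath_def by blast
  have f: "wfin one_w (a t)" if "t \<in> {0..T}" for t by (rule wfinI) (use C that in blast)
  show thesis
  proof
    show "0 \<le> \<bar>C\<bar>" by simp
    show "wfin one_w (a t)" if "t \<in> {0..T}" for t by (rule f[OF that])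
    show "wsq one_w (a t) \<le> \<bar>C\<bar>" if "t \<in> {0..T}" for t
      by (rule order_trans[OF wsq_le abs_ge_self]) (use C that in auto)
    show "0 \<le> wsq one_w (a t)" if "t \<in> {0..T}" for t by (rule wsq_nonneg) (use f that in auto)
  qed
qed

lemma integrable_bounded_mult:
  fixes h :: "real \<Rightarrow> real"
  assumes g: "integrable tM g" and h: "h \<in> borel_measurable tM" and b: "\<And>t. t \<in> {0..T} \<Longrightarrow> \<bar>h t\<bar> \<le> C"
  shows "integrable tM (\<lambda>t. g t * h t)"
proof (rule Bochner_Integration.integrable_bound)
  show "integrable tM (\<lambda>t. C * g t)" using g by simp
  show "(\<lambda>t. g t * h t) \<in> borel_measurable tM" using g h by (intro borel_measurable_times) auto
  show "AE t in tM. norm (g t * h t) \<le> norm (C * g t)"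
  proof (rule AE_I2)
    fix t assume "t \<in> space tM"
    then have "\<bar>h t\<bar> \<le> \<bar>C\<bar>" using b by (auto intro: order_trans[OF _ abs_ge_self])
    then have "\<bar>g t\<bar> * \<bar>h t\<bar> \<le> \<bar>g t\<bar> * \<bar>C\<bar>" by (rule mult_left_mono) simp
    then show "norm (g t * h t) \<le> norm (C * g t)" by (simp add: abs_mult mult.commute)
  qed
qed

lemma integrable_const_tM: "integrable tM (\<lambda>t. c :: real)"
  by (rule integrable_continuous_tM) simp

lemma Hpath_integrable_one:
  assumes "Hpath a"
  shows "integrable tM (\<lambda>t. wsq one_w (a t))"
proof -
  obtain C where "\<And>t. t \<in> {0..T} \<Longrightarrow> wsq one_w (a t) \<le> C" "\<And>t. t \<in> {0..T} \<Longrightarrow> 0 \<le> wsq one_w (a t)"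
    using Hpath_bounded[OF assms] by metis
  then have "integrable tM (\<lambda>t. 1 * wsq one_w (a t))"
    by (intro integrable_bounded_mult[where C = C] integrable_const_tM wsq_measurable Hpath_cont assms) auto
  then show ?thesis by simp
qed

lemma Hpath_integrable_lam:
  assumes "Hpath a"
  shows "integrable tM (\<lambda>t. wsq lam_w (a t))" "AE t in tM. wsq lam_w (a t) \<le> wsq one_w (a t) + wsq lam2_w (a t)"
    "AE t in tM. 0 \<le> wsq lam_w (a t)"
proof -
  show 0: "AE t in tM. 0 \<le> wsq lam_w (a t)"
    using Hpath_AE[OF assms] by eventually_elim (intro wsq_nonneg lam_nonneg h2_fin)
  show le: "AE t in tM. wsq lam_w (a t) \<le> wsq one_w (a t) + wsq lam2_w (a t)"
    using Hpath_AE[OF assms]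
  proof eventually_elim
    case (elim t)
    have "wsq lam_w (a t) \<le> 1 * wsq h2_w (a t)"
    proof (rule wsq_mono)
      show "lam k \<le> 1 * (1 + (lam k)\<^sup>2)" for k by (rule lam_le_h2)
    qed (use elim lam_nonneg in auto)
    then show ?case using h2_fin(4)[OF elim] by simp
  qed
  show "integrable tM (\<lambda>t. wsq lam_w (a t))"
  proof (rule Bochner_Integration.integrable_bound)
    show "integrable tM (\<lambda>t. wsq one_w (a t) + wsq lam2_w (a t))"
      using Hpath_integrable_one[OF assms] Hpath_int[OF assms] by simp
    show "AE t in tM. norm (wsq lam_w (a t)) \<le> norm (wsq one_w (a t) + wsq lam2_w (a t))"
      using 0 le by eventually_elim simp
  qed (rule wsq_measurable[OF Hpath_cont[OF assms]])
qed

text \<open>By interpolation the integrand is at most the bounded \<open>wsq one_w\<close> times the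
  integrable \<open>wsq lam2_w\<close>: the gradient lies in L^4 in time with values in L^2.\<close>

lemma Hpath_integrable_lam_sq:
  assumes "Hpath a"
  shows "integrable tM (\<lambda>t. (wsq lam_w (a t))\<^sup>2)"
proof -
  obtain C where C: "0 \<le> C" "\<And>t. t \<in> {0..T} \<Longrightarrow> wsq one_w (a t) \<le> C"
    using Hpath_bounded[OF assms] by metis
  show ?thesis
  proof (rule Bochner_Integration.integrable_bound)
    show "integrable tM (\<lambda>t. C * wsq lam2_w (a t))" using Hpath_int[OF assms] by simp
    show "(\<lambda>t. (wsq lam_w (a t))\<^sup>2) \<in> borel_measurable tM"
      by (intro borel_measurable_power wsq_measurable Hpath_cont assms)
    show "AE t in tM. norm ((wsq lam_w (a t))\<^sup>2) \<le> norm (C * wsq lam2_w (a t))"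
      using Hpath_AE[OF assms] AE_space
    proof eventually_elim
      case (elim t)
      have p: "0 \<le> wsq lam2_w (a t)" by (rule wsq_nonneg) (use h2_fin elim in auto)
      have "(wsq lam_w (a t))\<^sup>2 \<le> wsq one_w (a t) * wsq lam2_w (a t)" by (rule wsq_interp[OF elim(1)])
      also have "\<dots> \<le> C * wsq lam2_w (a t)" using C(2)[of t] elim(2) p by (intro mult_right_mono) auto
      finally show ?case using C(1) p by simp
    qed
  qed
qed

lemma nl_weight_integrable:
  assumes "Hpath b"
  shows "integrable tM (\<lambda>s. (nl_weight (b s))\<^sup>2)"
proof -
  have "(\<lambda>s. (nl_weight (b s))\<^sup>2) = (\<lambda>s. nl_const\<^sup>2 * ((Mb\<^sup>2 * L\<^sup>2)\<^sup>2 + (wsq lam_w (b s))\<^sup>2 + 2 * (Mb\<^sup>2 * L\<^sup>2) * wsq lam_w (b s)))"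
    by (simp add: fun_eq_iff nl_weight_def power_mult_distrib power2_sum)
  moreover have "integrable tM (\<lambda>s. nl_const\<^sup>2 * ((Mb\<^sup>2 * L\<^sup>2)\<^sup>2 + (wsq lam_w (b s))\<^sup>2 + 2 * (Mb\<^sup>2 * L\<^sup>2) * wsq lam_w (b s)))"
    by (intro integrable_mult_right Bochner_Integration.integrable_add integrable_const_tM
        Hpath_integrable_lam_sq Hpath_integrable_lam assms)
  ultimately show ?thesis by simp
qed

lemma Hpath_diff:
  assumes a: "Hpath a" and b: "Hpath b"
  shows "Hpath (\<lambda>t k. a t k - b t k)"
  unfolding Hpath_def
proof (intro conjI)
  show c: "coeff_cont (\<lambda>t k. a t k - b t k)" by (intro coeff_cont_diff Hpath_cont a b)
  obtain Ca where Ca: "\<And>t. t \<in> {0..T} \<Longrightarrow> wfin one_w (a t)" "\<And>t. t \<in> {0..T} \<Longrightarrow> wsq one_w (a t) \<le> Ca"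
    using Hpath_bounded[OF a] by metis
  obtain Cb where Cb: "\<And>t. t \<in> {0..T} \<Longrightarrow> wfin one_w (b t)" "\<And>t. t \<in> {0..T} \<Longrightarrow> wsq one_w (b t) \<le> Cb"
    using Hpath_bounded[OF b] by metis
  have "wpart one_w (\<lambda>k. a t k - b t k) n \<le> 2 * Ca + 2 * Cb" if t: "t \<in> {0..T}" for t n
  proof -
    have "wpart one_w (\<lambda>k. a t k - b t k) n \<le> wsq one_w (\<lambda>k. a t k - b t k)"
      by (rule wpart_le_wsq, simp, rule wfin_diff(1)) (use Ca(1)[OF t] Cb(1)[OF t] in auto)
    also have "\<dots> \<le> 2 * wsq one_w (a t) + 2 * wsq one_w (b t)"
      by (rule wfin_diff(2)) (use Ca(1)[OF t] Cb(1)[OF t] in auto)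
    finally show ?thesis using Ca(2)[OF t] Cb(2)[OF t] by simp
  qed
  then show "\<exists>C. \<forall>t\<in>{0..T}. \<forall>n. wpart one_w (\<lambda>k. a t k - b t k) n \<le> C" by blast
  show ae: "AE t in tM. wfin h2_w (\<lambda>k. a t k - b t k)"
    using Hpath_AE[OF a] Hpath_AE[OF b] by eventually_elim (rule wfin_diff(1), auto)
  show "integrable tM (\<lambda>t. wsq lam2_w (\<lambda>k. a t k - b t k))"
  proof (rule Bochner_Integration.integrable_bound)
    show "integrable tM (\<lambda>t. 2 * wsq lam2_w (a t) + 2 * wsq lam2_w (b t))"
      using Hpath_int[OF a] Hpath_int[OF b] by simp
    show "(\<lambda>t. wsq lam2_w (\<lambda>k. a t k - b t k)) \<in> borel_measurable tM" by (rule wsq_measurable[OF c])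
    show "AE t in tM. norm (wsq lam2_w (\<lambda>k. a t k - b t k)) \<le> norm (2 * wsq lam2_w (a t) + 2 * wsq lam2_w (b t))"
      using Hpath_AE[OF a] Hpath_AE[OF b]
    proof eventually_elim
      case (elim t)
      have f: "wfin lam2_w (a t)" "wfin lam2_w (b t)" using elim by (auto intro: h2_fin)
      have "0 \<le> wsq lam2_w (\<lambda>k. a t k - b t k)"
        by (rule wsq_nonneg, simp, rule wfin_diff(1)) (use f in auto)
      moreover have "wsq lam2_w (\<lambda>k. a t k - b t k) \<le> 2 * wsq lam2_w (a t) + 2 * wsq lam2_w (b t)"
        by (rule wfin_diff(2)) (use f in auto)
      ultimately show ?case by simp
    qed
  qed
qed

section \<open>The nonlinearity along coefficient paths\<close>

lemma NL_continuous_supported: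
  assumes c: "coeff_cont a" and s: "\<And>t k. k \<notin> modes n \<Longrightarrow> a t k = 0"
  shows "continuous_on {0..T} (\<lambda>t. NL (a t) k)"
  unfolding continuous_on_sequentially
proof (intro allI ballI impI, elim conjE)
  fix x and t assume t: "t \<in> {0..T}" and x: "\<forall>n. x n \<in> {0..T}" "x \<longlonglongrightarrow> t"
  have fin: "wfin w (a r)" for r w by (rule wsq_supported(1)[OF s])
  have "(\<lambda>i. \<Sum>l\<in>modes n. lam l * (a (x i) l - a t l)\<^sup>2) \<longlonglongrightarrow> (\<Sum>l\<in>modes n. lam l * (a t l - a t l)\<^sup>2)"
  proof (intro tendsto_intros)
    fix l
    have "continuous_on {0..T} (\<lambda>t. a t l)" by (rule coeff_contD[OF c])
    then show "(\<lambda>i. a (x i) l) \<longlonglongrightarrow> a t l"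
      using t x unfolding continuous_on_sequentially o_def by blast
  qed
  moreover have "wsq lam_w (\<lambda>k. a (x i) k - a t k) = (\<Sum>l\<in>modes n. lam l * (a (x i) l - a t l)\<^sup>2)" for i
    using wsq_supported(2)[of n "\<lambda>k. a (x i) k - a t k" lam_w] s by (simp add: wpart_def)
  ultimately have W: "(\<lambda>i. wsq lam_w (\<lambda>k. a (x i) k - a t k)) \<longlonglongrightarrow> 0" by simp
  have "(\<lambda>i. nl_weight (a t) * wsq lam_w (\<lambda>k. a (x i) k - a t k) * (1 + (lam k)\<^sup>2)) \<longlonglongrightarrow> nl_weight (a t) * 0 * (1 + (lam k)\<^sup>2)"
    by (intro tendsto_intros W)
  then have U: "(\<lambda>i. nl_weight (a t) * wsq lam_w (\<lambda>k. a (x i) k - a t k) * (1 + (lam k)\<^sup>2)) \<longlonglongrightarrow> 0" by simp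
  have "(\<lambda>i. (NL (a (x i)) k - NL (a t) k)\<^sup>2) \<longlonglongrightarrow> 0"
    by (rule tendsto_sandwich[OF _ _ tendsto_const U]) (simp, intro always_eventually allI NL_diff_coeff fin)
  then have "(\<lambda>i. NL (a (x i)) k - NL (a t) k) \<longlonglongrightarrow> 0"
    using tendsto_real_sqrt[of "\<lambda>i. (NL (a (x i)) k - NL (a t) k)\<^sup>2" 0] tendsto_rabs_zero_iff by fastforce
  from tendsto_add[OF this tendsto_const[of "NL (a t) k"]]
  show "((\<lambda>t. NL (a t) k) \<circ> x) \<longlonglongrightarrow> NL (a t) k" by (simp add: o_def)
qed

lemma NL_trunc_tendsto:
  assumes "wfin h2_w a"
  shows "(\<lambda>n. NL (trunc n a) k) \<longlonglongrightarrow> NL a k"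
proof -
  have "(\<lambda>n. nl_weight a * wsq lam_w (\<lambda>k. trunc n a k - a k) * (1 + (lam k)\<^sup>2)) \<longlonglongrightarrow> nl_weight a * 0 * (1 + (lam k)\<^sup>2)"
    by (intro tendsto_intros wsq_tail_tendsto lam_nonneg h2_fin assms)
  then have U: "(\<lambda>n. nl_weight a * wsq lam_w (\<lambda>k. trunc n a k - a k) * (1 + (lam k)\<^sup>2)) \<longlonglongrightarrow> 0" by simp
  have "(\<lambda>n. (NL (trunc n a) k - NL a k)\<^sup>2) \<longlonglongrightarrow> 0"
    by (rule tendsto_sandwich[OF _ _ tendsto_const U]) (simp, intro always_eventually allI NL_diff_coeff wfin_trunc assms)
  then have "(\<lambda>n. NL (trunc n a) k - NL a k) \<longlonglongrightarrow> 0"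
    using tendsto_real_sqrt[of "\<lambda>n. (NL (trunc n a) k - NL a k)\<^sup>2" 0] tendsto_rabs_zero_iff by fastforce
  from tendsto_add[OF this tendsto_const[of "NL a k"]] show ?thesis by simp
qed

text \<open>Measurability comes from truncated paths, along which the nonlinearity is continuous in
  time and converges almost everywhere; \<open>\<bar>x\<bar> \<le> 1 + x\<^sup>2\<close> turns the
  quadratic coefficient bound into an integrable majorant.\<close>

lemma NL_integrable:
  assumes a: "Hpath a"
  shows "integrable tM (\<lambda>t. NL (a t) k)"
proof -
  have m: "(\<lambda>t. NL (a t) k) \<in> borel_measurable tM"
  proof (rule measurable_lebesgue_on_AE_eq)
    have "coeff_cont (\<lambda>t. trunc n (a t))" for n
      unfolding coeff_cont_def
    proof
      fix k show "continuous_on {0..T} (\<lambda>t. trunc n (a t) k)"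
        using coeff_contD[OF Hpath_cont[OF a], of k] by (cases "k \<in> modes n") (simp_all add: trunc_def)
    qed
    then show "(\<lambda>t. lim (\<lambda>n. NL (trunc n (a t)) k)) \<in> borel_measurable tM"
      by (intro borel_measurable_lim_metric measurable_continuous_tM NL_continuous_supported trunc_supported)
    show "AE t in tM. lim (\<lambda>n. NL (trunc n (a t)) k) = NL (a t) k"
      using Hpath_AE[OF a] by eventually_elim (intro limI NL_trunc_tendsto)
  qed
  show ?thesis
  proof (rule Bochner_Integration.integrable_bound[OF _ m])
    show "integrable tM (\<lambda>t. 1 + Mb\<^sup>2 * wsq lam_w (a t))"
      by (intro Bochner_Integration.integrable_add integrable_const_tM integrable_mult_right Hpath_integrable_lam a)
    show "AE t in tM. norm (NL (a t) k) \<le> norm (1 + Mb\<^sup>2 * wsq lam_w (a t))"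
      using Hpath_AE[OF a] Hpath_integrable_lam(3)[OF a]
    proof eventually_elim
      case (elim t)
      have "\<bar>x\<bar> \<le> 1 + x\<^sup>2" for x :: real
        using zero_le_power2[of "\<bar>x\<bar> - 1/2"] by (simp add: power2_diff power_divide)
      then have "\<bar>NL (a t) k\<bar> \<le> 1 + (NL (a t) k)\<^sup>2" .
      also have "\<dots> \<le> 1 + Mb\<^sup>2 * wsq lam_w (a t)" using NL_coeff_bound[OF elim(1)] by simp
      finally show ?case by simp
    qed
  qed
qed

lemma Hpath_coeff_integrable: "Hpath a \<Longrightarrow> integrable tM (\<lambda>t. a t k)"
  by (intro integrable_continuous_tM coeff_contD Hpath_cont)

text \<open>The cubic-type term \<open>\<langle>\<eta>(\<nabla>a)\<cdot>\<nabla>a - \<eta>(\<nabla>b)\<cdot>\<nabla>b, w\<rangle>\<close> is absorbed using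
  \<open>\<parallel>\<nabla>w\<parallel>\<^sup>2 \<le> \<parallel>w\<parallel> \<parallel>\<Delta>w\<parallel>\<close> and Young's inequality.\<close>

lemma absorb_nonlinear:
  fixes X p W0 W1 W2 Y :: real
  assumes X: "X\<^sup>2 \<le> p * W1 * Y" and Y: "0 \<le> Y" "Y \<le> W0 + W2" and nn: "0 \<le> p" "0 \<le> W0" "0 \<le> W1" "0 \<le> W2"
    and W1: "W1\<^sup>2 \<le> W0 * W2"
  shows "\<bar>X\<bar> \<le> W0 / 4 + W2 / 2 + p\<^sup>2 * W0"
proof -
  have amgm: "4 * (y * x) \<le> (x + y)\<^sup>2" for x y :: real
    using zero_le_power2[of "x - y"] by (simp add: power2_sum power2_diff)
  \<comment> \<open>Squares are compared to avoid roots: \<open>p * W1 * Y\<close> is four times the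
    product of \<open>Y / 4\<close> and \<open>p * W1\<close>. This costs \<open>W2 / 4\<close>
    through \<open>Y\<close>, the next step another \<open>W2 / 4\<close>.\<close>
  have 1: "\<bar>X\<bar> \<le> Y / 4 + p * W1"
  proof (rule power2_le_imp_le)
    have "p * W1 * Y \<le> (Y / 4 + p * W1)\<^sup>2" using amgm[of "Y / 4" "p * W1"] by (simp add: mult.commute add.commute)
    then show "\<bar>X\<bar>\<^sup>2 \<le> (Y / 4 + p * W1)\<^sup>2" using X by simp
    show "0 \<le> Y / 4 + p * W1" using Y nn by simp
  qed
  have 2: "p * W1 \<le> p\<^sup>2 * W0 + W2 / 4"
  proof (rule power2_le_imp_le)
    have "(p * W1)\<^sup>2 \<le> p\<^sup>2 * (W0 * W2)" unfolding power_mult_distrib by (intro mult_left_mono W1) simp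
    also have "\<dots> \<le> (p\<^sup>2 * W0 + W2 / 4)\<^sup>2"
      using amgm[of "p\<^sup>2 * W0" "W2 / 4"] by (simp add: mult.commute mult.left_commute add.commute)
    finally show "(p * W1)\<^sup>2 \<le> (p\<^sup>2 * W0 + W2 / 4)\<^sup>2" .
    show "0 \<le> p\<^sup>2 * W0 + W2 / 4" using nn by simp
  qed
  show ?thesis using 1 2 Y(2) by linarith
qed

text \<open>The residual \<open>f\<close> lets one estimate serve several ends: it is 0 for two weak
  solutions and carries the truncation error for Galerkin paths, where \<open>e\<close> bounds its
  pairing with the difference. Squares of single coefficients are summed over
  \<open>modes n\<close>, and the limit in \<open>n\<close> is taken in integrated form.\<close>

lemma energy_estimate:
  assumes a: "Hpath a" and b: "Hpath b"
    and f: "\<And>k. integrable tM (\<lambda>s. f s k)"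
    and ev: "\<And>k t. t \<in> {0..T} \<Longrightarrow> a t k - b t k = (a 0 k - b 0 k) +
      TI (\<lambda>s. (lam k - (lam k)\<^sup>2) * (a s k - b s k) - 1/2 * (NL (a s) k - NL (b s) k) + f s k) t"
    and e: "integrable tM e" "AE s in tM. 0 \<le> e s"
      "AE s in tM. \<forall>n. (\<Sum>k\<in>modes n. f s k * (a s k - b s k)) \<le> e s"
    and N: "(\<integral>s. 3 + (nl_weight (b s))\<^sup>2 \<partial>tM) \<le> real N / 2"
    and A: "wsq one_w (\<lambda>k. a 0 k - b 0 k) + 2 * (\<integral>s. e s \<partial>tM) \<le> A"
  shows "\<And>t. t \<in> {0..T} \<Longrightarrow> wsq one_w (\<lambda>k. a t k - b t k) \<le> 2 ^ N * A"
    "(\<integral>s. wsq lam2_w (\<lambda>k. a s k - b s k) \<partial>tM) \<le> (real N + 1) * 2 ^ N * A"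
proof -
  define w where "w t k = a t k - b t k" for t k
  define W0 where "W0 t = wsq one_w (w t)" for t
  define W2 where "W2 t = wsq lam2_w (w t)" for t
  \<comment> \<open>The 3 covers \<open>2 * P0\<close> from the linear part and the
    \<open>W0 / 4\<close> left by absorbing the nonlinearity.\<close>
  define \<beta> where "\<beta> s = 3 + (nl_weight (b s))\<^sup>2" for s
  have wp: "Hpath w" using Hpath_diff[OF a b] by (simp add: w_def[abs_def])
  note cw = Hpath_cont[OF wp]
  obtain C where C: "0 \<le> C" "\<And>t. t \<in> {0..T} \<Longrightarrow> wfin one_w (w t)" "\<And>t. t \<in> {0..T} \<Longrightarrow> W0 t \<le> C"
     "\<And>t. t \<in> {0..T} \<Longrightarrow> 0 \<le> W0 t"
    unfolding W0_def using Hpath_bounded[OF wp] by metis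
  have iW2: "integrable tM W2" unfolding W2_def[abs_def] by (rule Hpath_int[OF wp])
  have W2nn: "AE s in tM. 0 \<le> W2 s"
    using Hpath_AE[OF wp] unfolding W2_def by eventually_elim (intro wsq_nonneg h2_fin, auto)
  have i\<beta>: "integrable tM \<beta>" unfolding \<beta>_def[abs_def]
    by (intro Bochner_Integration.integrable_add integrable_const_tM nl_weight_integrable b)
  have i\<beta>W: "integrable tM (\<lambda>s. \<beta> s * W0 s)"
  proof (rule integrable_bounded_mult[OF i\<beta>])
    show "W0 \<in> borel_measurable tM" unfolding W0_def[abs_def] by (rule wsq_measurable[OF cw])
    show "\<bar>W0 t\<bar> \<le> C" if "t \<in> {0..T}" for t using C(3,4)[OF that] by simp
  qed
  define g where "g k s = (lam k - (lam k)\<^sup>2) * w s k - 1/2 * (NL (a s) k - NL (b s) k) + f s k" for k s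
  have ig: "integrable tM (g k)" for k
    unfolding g_def[abs_def]
    by (intro Bochner_Integration.integrable_add Bochner_Integration.integrable_diff integrable_mult_right
        Hpath_coeff_integrable wp NL_integrable a b f)
  have evw: "w t k = w 0 k + TI (g k) t" if "t \<in> {0..T}" for t k
    using ev[OF that, of k] by (simp add: w_def g_def[abs_def])
  have cwk: "continuous_on {0..T} (\<lambda>t. w t k)" for k by (rule coeff_contD[OF cw])
  have igw: "integrable tM (\<lambda>s. g k s * w s k)" for k
    by (rule integrable_mult_continuous[OF ig cwk])
  \<comment> \<open>The absorbed term \<open>W2 / 2\<close> is a full norm, while the dissipation
    \<open>3/2 * wpart lam2_w\<close> is truncated; only after \<open>n\<close> tends to infinity do
    they combine to \<open>- W2\<close>.\<close>
  define R where "R s = W2 s / 2 + \<beta> s * W0 s + 2 * e s" for s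
  have iR: "integrable tM R" unfolding R_def[abs_def]
    using iW2 i\<beta>W e(1) by (intro Bochner_Integration.integrable_add) auto
  have sq: "wpart one_w (w t) n = wpart one_w (w 0) n + TI (\<lambda>s. \<Sum>k\<in>modes n. 2 * (g k s * w s k)) t"
    if t: "t \<in> {0..T}" for t n
  proof -
    have "(w t k)\<^sup>2 = (w 0 k)\<^sup>2 + 2 * TI (\<lambda>s. g k s * w s k) t" for k
      by (rule abs_cont_square[OF ig _ t]) (rule evw)
    then have "wpart one_w (w t) n = wpart one_w (w 0) n + (\<Sum>k\<in>modes n. 2 * TI (\<lambda>s. g k s * w s k) t)"
      by (simp add: wpart_def sum.distrib)
    also have "(\<Sum>k\<in>modes n. 2 * TI (\<lambda>s. g k s * w s k) t) = TI (\<lambda>s. \<Sum>k\<in>modes n. 2 * (g k s * w s k)) t"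
      using igw by (subst TI_sum) (auto simp: TI_cmult)
    finally show ?thesis .
  qed
  have pt: "AE s in tM. (\<Sum>k\<in>modes n. 2 * (g k s * w s k)) \<le> R s - 3/2 * wpart lam2_w (w s) n" for n
    using Hpath_AE[OF a] Hpath_AE[OF b] Hpath_AE[OF wp] e(3) AE_space
  proof eventually_elim
    case (elim s)
    define P0 P2 X Y where "P0 = wpart one_w (w s) n" and "P2 = wpart lam2_w (w s) n"
      and "X = (\<Sum>k\<in>modes n. w s k * (NL (a s) k - NL (b s) k))" and "Y = wpart h2_w (w s) n"
    note fin = h2_fin[OF elim(3)]
    have P0: "P0 \<le> W0 s" unfolding P0_def W0_def by (rule wpart_le_wsq) (use fin in auto)
    have Y: "0 \<le> Y" "Y \<le> W0 s + W2 s"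
    proof -
      show "0 \<le> Y" unfolding Y_def by (rule wpart_nonneg) simp
      have "Y \<le> wsq h2_w (w s)" unfolding Y_def by (rule wpart_le_wsq) (use elim in auto)
      then show "Y \<le> W0 s + W2 s" using fin(4) by (simp add: W0_def W2_def)
    qed
    have X: "\<bar>X\<bar> \<le> W0 s / 4 + W2 s / 2 + (nl_weight (b s))\<^sup>2 * W0 s"
    proof (rule absorb_nonlinear[where Y = Y])
      show "X\<^sup>2 \<le> nl_weight (b s) * wsq lam_w (w s) * Y"
        using NL_diff[OF elim(1,2), of "w s" n] by (simp add: X_def Y_def w_def[abs_def])
      show "(wsq lam_w (w s))\<^sup>2 \<le> W0 s * W2 s" unfolding W0_def W2_def by (rule wsq_interp[OF elim(3)])
      show "0 \<le> W0 s" "0 \<le> W2 s" "0 \<le> wsq lam_w (w s)"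
        unfolding W0_def W2_def by (intro wsq_nonneg fin lam_nonneg; simp)+
      have "0 \<le> wsq lam_w (b s)" by (intro wsq_nonneg lam_nonneg h2_fin elim)
      then show "0 \<le> nl_weight (b s)" using nl_const_pos by (simp add: nl_weight_def)
    qed (fact Y)+
    have "(\<Sum>k\<in>modes n. 2 * (g k s * w s k))
        = (\<Sum>k\<in>modes n. 2 * ((lam k - (lam k)\<^sup>2) * (w s k)\<^sup>2)) - X + 2 * (\<Sum>k\<in>modes n. f s k * w s k)"
      unfolding X_def g_def sum_distrib_left sum_subtractf[symmetric] sum.distrib[symmetric]
      by (intro sum.cong) (auto simp: algebra_simps power2_eq_square)
    also have "(\<Sum>k\<in>modes n. 2 * ((lam k - (lam k)\<^sup>2) * (w s k)\<^sup>2))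
        \<le> (\<Sum>k\<in>modes n. 2 * (1 * (w s k)\<^sup>2) - 3/2 * ((lam k)\<^sup>2 * (w s k)\<^sup>2))"
    proof (rule sum_mono)
      fix k
      \<comment> \<open>The destabilizing Laplacian is dominated by a quarter of the bilaplacian
        plus a constant, because \<open>(lam k / 2 - 1)\<^sup>2 \<ge> 0\<close>.\<close>
      have "lam k - (lam k)\<^sup>2 \<le> 1 - 3/4 * (lam k)\<^sup>2"
        using zero_le_power2[of "lam k / 2 - 1"] by (simp add: power2_diff power_divide)
      then have "(lam k - (lam k)\<^sup>2) * (w s k)\<^sup>2 \<le> (1 - 3/4 * (lam k)\<^sup>2) * (w s k)\<^sup>2"
        by (rule mult_right_mono) simp
      then show "2 * ((lam k - (lam k)\<^sup>2) * (w s k)\<^sup>2) \<le> 2 * (1 * (w s k)\<^sup>2) - 3/2 * ((lam k)\<^sup>2 * (w s k)\<^sup>2)"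
        by (simp add: algebra_simps)
    qed
    also have "(\<Sum>k\<in>modes n. 2 * (1 * (w s k)\<^sup>2) - 3/2 * ((lam k)\<^sup>2 * (w s k)\<^sup>2)) = 2 * P0 - 3/2 * P2"
      by (simp add: P0_def P2_def wpart_def sum_subtractf sum_distrib_left)
    finally have "(\<Sum>k\<in>modes n. 2 * (g k s * w s k)) \<le> 2 * P0 - 3/2 * P2 - X + 2 * (\<Sum>k\<in>modes n. f s k * w s k)"
      by simp
    moreover have "(\<Sum>k\<in>modes n. f s k * w s k) \<le> e s" using elim(4) by (simp add: w_def)
    moreover have "0 \<le> W0 s" using C(4) elim(5) by simp
    moreover have "R s = W2 s / 2 + (3 * W0 s + (nl_weight (b s))\<^sup>2 * W0 s) + 2 * e s"
      by (simp add: R_def \<beta>_def distrib_right)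
    ultimately show "(\<Sum>k\<in>modes n. 2 * (g k s * w s k)) \<le> R s - 3/2 * wpart lam2_w (w s) n"
      using P0 X unfolding P2_def by linarith
  qed
  have ip2: "integrable tM (\<lambda>s. wpart lam2_w (w s) n)" for n
    by (intro integrable_continuous_tM wpart_continuous cw)
  have est: "W0 t + TI W2 t \<le> A + TI (\<lambda>s. \<beta> s * W0 s) t" if t: "t \<in> {0..T}" for t
  proof -
    have le: "wpart one_w (w t) n \<le> wpart one_w (w 0) n + TI (\<lambda>s. R s - 3/2 * wpart lam2_w (w s) n) t" for n
      unfolding sq[OF t] using iR ip2 igw
      by (intro add_left_mono TI_mono_AE pt Bochner_Integration.integrable_sum Bochner_Integration.integrable_diff) auto
    have lim: "(\<lambda>n. TI (\<lambda>s. R s - 3/2 * wpart lam2_w (w s) n) t) \<longlonglongrightarrow> TI (\<lambda>s. R s - 3/2 * W2 s) t"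
    proof (rule TI_dominated[where w = "\<lambda>s. \<bar>R s\<bar> + 3/2 * W2 s"])
      show "AE s in tM. (\<lambda>n. R s - 3/2 * wpart lam2_w (w s) n) \<longlonglongrightarrow> R s - 3/2 * W2 s"
        using Hpath_AE[OF wp]
      proof eventually_elim
        case (elim s)
        show ?case unfolding W2_def by (intro tendsto_intros wsq_lim h2_fin elim) simp
      qed
      show "AE s in tM. \<bar>R s - 3/2 * wpart lam2_w (w s) n\<bar> \<le> \<bar>R s\<bar> + 3/2 * W2 s" for n
        using Hpath_AE[OF wp]
      proof eventually_elim
        case (elim s)
        have "0 \<le> wpart lam2_w (w s) n" by (rule wpart_nonneg) simp
        moreover have "wpart lam2_w (w s) n \<le> W2 s"
          unfolding W2_def by (rule wpart_le_wsq) (use h2_fin elim in auto)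
        ultimately show ?case by linarith
      qed
    qed (use iR iW2 ip2 in \<open>auto intro!: borel_measurable_diff borel_measurable_times\<close>)
    have "W0 t \<le> W0 0 + TI (\<lambda>s. R s - 3/2 * W2 s) t"
    proof (rule LIMSEQ_le)
      show "(\<lambda>n. wpart one_w (w t) n) \<longlonglongrightarrow> W0 t" unfolding W0_def by (rule wsq_lim) (use C t in auto)
      show "(\<lambda>n. wpart one_w (w 0) n + TI (\<lambda>s. R s - 3/2 * wpart lam2_w (w s) n) t)
          \<longlonglongrightarrow> W0 0 + TI (\<lambda>s. R s - 3/2 * W2 s) t"
        unfolding W0_def by (intro tendsto_add lim wsq_lim) (use C T_pos in auto)
    qed (use le in auto)
    also have "TI (\<lambda>s. R s - 3/2 * W2 s) t = TI (\<lambda>s. (\<beta> s * W0 s + 2 * e s) - W2 s) t"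
      by (rule arg_cong[where f = "\<lambda>h. TI h t"]) (simp add: fun_eq_iff R_def)
    also have "\<dots> = TI (\<lambda>s. \<beta> s * W0 s) t + 2 * TI e t - TI W2 t"
      using iW2 i\<beta>W e(1) by (simp add: TI_diff_fun TI_add TI_cmult)
    finally have "W0 t + TI W2 t \<le> W0 0 + 2 * TI e t + TI (\<lambda>s. \<beta> s * W0 s) t" by simp
    moreover have "TI e t \<le> (\<integral>s. e s \<partial>tM)" by (rule TI_le_total[OF e(1,2) t])
    moreover have "W0 0 + 2 * (\<integral>s. e s \<partial>tM) \<le> A" using A by (simp add: W0_def w_def[abs_def])
    ultimately show ?thesis by linarith
  qed
  have A0: "0 \<le> A"
  proof -
    have "0 \<le> (\<integral>s. e s \<partial>tM)" by (rule integral_nonneg_AE[OF e(2)])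
    moreover have "0 \<le> W0 0" using C T_pos by simp
    moreover have "W0 0 + 2 * (\<integral>s. e s \<partial>tM) \<le> A" using A by (simp add: W0_def w_def[abs_def])
    ultimately show ?thesis by linarith
  qed
  have \<beta>0: "AE s in tM. 0 \<le> \<beta> s" by (simp add: \<beta>_def)
  have main: "W0 t \<le> 2 ^ N * A" if t: "t \<in> {0..T}" for t
  proof (rule gronwall_doubling[OF i\<beta> \<beta>0 i\<beta>W _ _ A0 _ t])
    show "0 \<le> W0 s" if "s \<in> {0..T}" for s using C that by simp
    show "W0 s \<le> A + TI (\<lambda>s. \<beta> s * W0 s) s" if "s \<in> {0..T}" for s
      using est[OF that] TI_nonneg[OF iW2 W2nn, of s] that by simp
    show "(\<integral>s. \<beta> s \<partial>tM) \<le> real N / 2" using N by (simp add: \<beta>_def)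
  qed
  then show "wsq one_w (\<lambda>k. a t k - b t k) \<le> 2 ^ N * A" if "t \<in> {0..T}" for t
    using that by (simp add: W0_def w_def[abs_def])
  \<comment> \<open>At the final time \<open>W0 T \<ge> 0\<close> is dropped, and the bound on
    \<open>W0\<close> is put under the integral of \<open>\<beta>\<close>, itself at most
    \<open>N / 2\<close>.\<close>
  have "(\<integral>s. W2 s \<partial>tM) = TI W2 T" by (rule TI_T[OF iW2, symmetric])
  also have "\<dots> \<le> A + TI (\<lambda>s. \<beta> s * W0 s) T" using est[of T] C(4)[of T] T_pos by simp
  also have "TI (\<lambda>s. \<beta> s * W0 s) T \<le> TI (\<lambda>s. (2 ^ N * A) * \<beta> s) T"
  proof (rule TI_mono_AE[OF i\<beta>W])
    show "integrable tM (\<lambda>s. (2 ^ N * A) * \<beta> s)" using i\<beta> by simp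
    show "AE s in tM. \<beta> s * W0 s \<le> (2 ^ N * A) * \<beta> s"
      using \<beta>0 AE_space
    proof eventually_elim
      case (elim s)
      then have "\<beta> s * W0 s \<le> \<beta> s * (2 ^ N * A)" using main by (intro mult_left_mono) auto
      then show ?case by (simp add: mult.commute)
    qed
  qed
  also have "\<dots> = (2 ^ N * A) * (\<integral>s. \<beta> s \<partial>tM)" unfolding TI_cmult by (simp add: TI_T[OF i\<beta>])
  also have "\<dots> \<le> (2 ^ N * A) * (real N / 2)"
    using N A0 by (intro mult_left_mono) (auto simp: \<beta>_def)
  finally have "(\<integral>s. W2 s \<partial>tM) \<le> A + (2 ^ N * A) * (real N / 2)" by simp
  also have "\<dots> \<le> 2 ^ N * A + (2 ^ N * A) * real N"
  proof (rule add_mono)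
    have "1 * A \<le> 2 ^ N * A" using A0 by (intro mult_right_mono) auto
    then show "A \<le> 2 ^ N * A" by simp
    show "(2 ^ N * A) * (real N / 2) \<le> (2 ^ N * A) * real N" using A0 by (intro mult_left_mono) auto
  qed
  also have "\<dots> = (real N + 1) * 2 ^ N * A" by (simp add: algebra_simps)
  finally show "(\<integral>s. wsq lam2_w (\<lambda>k. a s k - b s k) \<partial>tM) \<le> (real N + 1) * 2 ^ N * A"
    by (simp add: W2_def w_def[abs_def])
qed

end

section \<open>Smooth bump functions and the du Bois-Reymond lemma\<close>

definition exp_flat :: "real poly \<Rightarrow> real \<Rightarrow> real" where
  "exp_flat p x = (if x > 0 then poly p (1 / x) * exp (- (1 / x)) else 0)"

text \<open>In \<open>y = 1/x\<close> the derivative of \<open>p(y) * exp(-y)\<close> with respect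
  to \<open>x\<close> is \<open>y\<^sup>2 * (p - p')(y) * exp(-y)\<close>; the polynomial
  \<open>[:0, 0, 1:]\<close> is \<open>y\<^sup>2\<close>.\<close>

definition exp_flat_deriv :: "real poly \<Rightarrow> real poly" where
  "exp_flat_deriv p = [:0, 0, 1:] * (p - pderiv p)"

lemma poly_exp_tendsto_0: "((\<lambda>y. poly p y * exp (- y)) \<longlongrightarrow> 0) at_top" for p :: "real poly"
proof -
  have "((\<lambda>y. \<Sum>i\<le>degree p. coeff p i * (y ^ i / exp y)) \<longlongrightarrow> (\<Sum>i\<le>degree p. coeff p i * 0)) at_top"
    by (intro tendsto_intros tendsto_power_div_exp_0)
  moreover have "(\<lambda>y. \<Sum>i\<le>degree p. coeff p i * (y ^ i / exp y)) = (\<lambda>y. poly p y * exp (- y))"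
    by (simp add: fun_eq_iff poly_altdef sum_distrib_right exp_minus divide_inverse mult.assoc)
  ultimately show ?thesis by simp
qed

text \<open>Only the origin is delicate. The right difference quotient there is a polynomial in
  \<open>1/h\<close> times \<open>exp(-1/h)\<close>, the extra factor \<open>1/h\<close> being the
  leading \<open>pCons 0\<close>.\<close>

lemma exp_flat_DERIV: "(exp_flat p has_real_derivative exp_flat (exp_flat_deriv p) x) (at x)"
proof -
  consider "x > 0" | "x < 0" | "x = 0" by linarith
  then show ?thesis
  proof cases
    case 1
    have "((\<lambda>x. poly p (1 / x) * exp (- (1 / x))) has_real_derivative exp_flat (exp_flat_deriv p) x) (at x)"
      using 1 by (auto intro!: derivative_eq_intros poly_DERIV[THEN DERIV_chain2]
          simp: exp_flat_def exp_flat_deriv_def power2_eq_square field_simps)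
    then show ?thesis
      by (rule has_field_derivative_transform_within_open[where S = "{0<..}"])
        (use 1 in \<open>auto simp: exp_flat_def\<close>)
  next
    case 2
    have "((\<lambda>_. 0) has_real_derivative exp_flat (exp_flat_deriv p) x) (at x)"
      using 2 by (simp add: exp_flat_def)
    then show ?thesis
      by (rule has_field_derivative_transform_within_open[where S = "{..<0}"])
        (use 2 in \<open>auto simp: exp_flat_def\<close>)
  next
    case 3
    have r: "((\<lambda>h. exp_flat p h / h) \<longlongrightarrow> 0) (at_right 0)"
    proof (rule Lim_transform_eventually)
      show "((\<lambda>h. poly (pCons 0 p) (inverse h) * exp (- inverse h)) \<longlongrightarrow> 0) (at_right 0)"
        by (rule filterlim_compose[OF poly_exp_tendsto_0 filterlim_inverse_at_top_right])
      show "\<forall>\<^sub>F h in at_right 0. poly (pCons 0 p) (inverse h) * exp (- inverse h) = exp_flat p h / h"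
        unfolding eventually_at_filter by (simp add: exp_flat_def divide_inverse)
    qed
    have "((\<lambda>h. exp_flat p h / h) \<longlongrightarrow> 0) (at_left 0)"
    proof (rule Lim_transform_eventually[OF tendsto_const])
      show "\<forall>\<^sub>F h in at_left 0. 0 = exp_flat p h / h"
        unfolding eventually_at_filter by (simp add: exp_flat_def)
    qed
    with r have "((\<lambda>h. exp_flat p h / h) \<longlongrightarrow> 0) (at 0)" by (simp add: filterlim_split_at_real)
    then show ?thesis using 3 by (simp add: DERIV_def exp_flat_def)
  qed
qed

text \<open>A class containing the bumps and closed under \<open>deriv\<close>, so that
  differentiability of all iterated derivatives, as \<open>time_test\<close> demands, is a plain
  induction.\<close>

inductive bumpish :: "(real \<Rightarrow> real) \<Rightarrow> bool" where
  bumpish_base: "bumpish (\<lambda>x. exp_flat p (x - a) * exp_flat q (b - x))"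
| bumpish_add: "bumpish f \<Longrightarrow> bumpish g \<Longrightarrow> bumpish (\<lambda>x. f x + g x)"

lemma bumpish_DERIV: "bumpish f \<Longrightarrow> \<exists>g. bumpish g \<and> (\<forall>x. (f has_real_derivative g x) (at x))"
proof (induction rule: bumpish.induct)
  case (bumpish_base p a q b)
  have m: "exp_flat (- r) y = - exp_flat r y" for r y by (simp add: exp_flat_def)
  let ?g = "\<lambda>x. exp_flat (exp_flat_deriv p) (x - a) * exp_flat q (b - x)
      + exp_flat p (x - a) * exp_flat (- exp_flat_deriv q) (b - x)"
  have "((\<lambda>x. exp_flat p (x - a) * exp_flat q (b - x)) has_real_derivative ?g x) (at x)" for x
    unfolding m
    by (auto intro!: derivative_eq_intros DERIV_chain2[OF exp_flat_DERIV])
  moreover have "bumpish ?g" by (intro bumpish.intros)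
  ultimately show ?case by blast
next
  case (bumpish_add f g)
  then obtain f' g' where "bumpish f'" "\<forall>x. (f has_real_derivative f' x) (at x)"
    "bumpish g'" "\<forall>x. (g has_real_derivative g' x) (at x)" by blast
  then show ?case
    by (intro exI[of _ "\<lambda>x. f' x + g' x"]) (auto intro: bumpish.bumpish_add DERIV_add)
qed

lemma bumpish_deriv:
  assumes "bumpish f"
  shows "bumpish (deriv f)" "(f has_real_derivative deriv f x) (at x)"
proof -
  obtain g where g: "bumpish g" "\<And>x. (f has_real_derivative g x) (at x)" using bumpish_DERIV[OF assms] by blast
  then have "deriv f = g" using DERIV_imp_deriv by blast
  with g show "bumpish (deriv f)" "(f has_real_derivative deriv f x) (at x)" by auto
qed

lemma bumpish_iter: "bumpish f \<Longrightarrow> bumpish ((deriv ^^ n) f)"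
  by (induction n) (auto intro: bumpish_deriv)

lemma bumpish_differentiable: "bumpish f \<Longrightarrow> f differentiable (at x)"
  using bumpish_deriv(2) real_differentiable_def by blast

lemma bumpish_continuous: "bumpish f \<Longrightarrow> continuous_on S f"
  using bumpish_differentiable differentiable_imp_continuous_within continuous_at_imp_continuous_on by blast

definition bump :: "real \<Rightarrow> real \<Rightarrow> real \<Rightarrow> real" where
  "bump s r x = exp_flat 1 (x - (s - r)) * exp_flat 1 ((s + r) - x)"

lemma bump_bumpish: "bumpish (bump s r)"
  unfolding bump_def[abs_def] by (rule bumpish_base)

lemma bump_pos: "x \<in> {s - r<..<s + r} \<Longrightarrow> bump s r x > 0"
  by (simp add: bump_def exp_flat_def)

lemma bump_zero: "x \<notin> {s - r<..<s + r} \<Longrightarrow> bump s r x = 0"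
  by (auto simp: bump_def exp_flat_def)

lemma bump_nonneg: "bump s r x \<ge> 0"
  using bump_pos[of x s r] bump_zero[of x s r] by (cases "x \<in> {s - r<..<s + r}") auto

lemma bump_time_test:
  assumes "r > 0" "0 < s - r" "s + r < T"
  shows "bump s r \<in> time_test T"
proof -
  have "{t. bump s r t \<noteq> 0} \<subseteq> {s - r..s + r}" 
  proof
    fix t assume "t \<in> {t. bump s r t \<noteq> 0}"
    then have "t \<in> {s - r<..<s + r}" using bump_zero[of t s r] by blast
    then show "t \<in> {s - r..s + r}" by simp
  qed
  then have cl: "closure {t. bump s r t \<noteq> 0} \<subseteq> {s - r..s + r}" by (intro closure_minimal) auto
  then have "bounded (closure {t. bump s r t \<noteq> 0})" by (rule bounded_subset[OF bounded_closed_interval])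
  then have "compact (closure {t. bump s r t \<noteq> 0})" by (simp add: compact_eq_bounded_closed)
  moreover have "closure {t. bump s r t \<noteq> 0} \<subseteq> {0<..<T}"
    using cl assms by (auto simp: subset_iff)
  ultimately show ?thesis
    unfolding time_test_def using bumpish_differentiable[OF bumpish_iter[OF bump_bumpish]] by blast
qed

lemma bump_shift: "bump s r x = bump 0 r (x - s)"
  by (simp add: bump_def algebra_simps)

text \<open>If \<open>h x > h y\<close>, let \<open>m\<close> lie strictly between. The function
  \<open>H s\<close>, the integral of a bump at \<open>s\<close> times \<open>h - m\<close>, has
  zero derivative because the shifted bump is a test function. So \<open>H x = H y\<close>, whereas
  \<open>H y \<le> 0 \<le> H x\<close>; then \<open>H x = 0\<close>, although its nonnegative
  continuous integrand is positive at \<open>x\<close>.\<close>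

lemma du_bois_reymond_le:
  assumes h: "continuous_on {0..T} h"
    and zero: "\<And>\<theta> m. \<theta> \<in> time_test T \<Longrightarrow> integral {0..T} (\<lambda>\<tau>. deriv \<theta> \<tau> * (h \<tau> - m)) = 0"
    and x: "0 < x" "x < T" and y: "0 < y" "y < T"
  shows "h x \<le> h y"
proof (rule ccontr)
  assume "\<not> h x \<le> h y"
  then have hxy: "h y < h x" by simp
  define m where "m = (h x + h y) / 2"
  have m: "h y < m" "m < h x" using hxy by (auto simp: m_def field_simps)
  have ct: "(h \<longlongrightarrow> h z) (at z)" if "0 < z" "z < T" for z
    using continuous_on_interior[OF h, of z] that by (simp add: continuous_at)
  have "\<forall>\<^sub>F \<tau> in at x. m < h \<tau>" using order_tendstoD(1)[OF ct[OF x] m(2)] .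
  then obtain d1 where d1: "d1 > 0" "\<And>\<tau>. \<tau> \<noteq> x \<Longrightarrow> \<bar>\<tau> - x\<bar> < d1 \<Longrightarrow> m < h \<tau>"
    unfolding eventually_at dist_real_def by blast
  have "\<forall>\<^sub>F \<tau> in at y. h \<tau> < m" using order_tendstoD(2)[OF ct[OF y] m(1)] .
  then obtain d2 where d2: "d2 > 0" "\<And>\<tau>. \<tau> \<noteq> y \<Longrightarrow> \<bar>\<tau> - y\<bar> < d2 \<Longrightarrow> h \<tau> < m"
    unfolding eventually_at dist_real_def by blast
  define r where "r = Min {d1, d2, x, y, T - x, T - y} / 2"
  have r0: "r > 0" using d1 d2 x y by (simp add: r_def)
  have "2 * r \<le> d1" "2 * r \<le> d2" "2 * r \<le> x" "2 * r \<le> y" "2 * r \<le> T - x" "2 * r \<le> T - y"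
    by (simp_all add: r_def)
  then have r: "r < d1" "r < d2" "r < x" "r < y" "r < T - x" "r < T - y" using r0 by auto
  have hx: "m < h \<tau>" if "\<tau> \<in> {x - r<..<x + r}" for \<tau>
    using d1(2)[of \<tau>] m(2) that r by (cases "\<tau> = x") auto
  have hy: "h \<tau> < m" if "\<tau> \<in> {y - r<..<y + r}" for \<tau>
    using d2(2)[of \<tau>] m(1) that r by (cases "\<tau> = y") auto
  define H where "H s = integral (cbox 0 T) (\<lambda>\<tau>. bump s r \<tau> * (h \<tau> - m))" for s
  let ?b' = "deriv (bump 0 r)"
  have b'c: "continuous_on UNIV ?b'" by (rule bumpish_continuous[OF bumpish_deriv(1)[OF bump_bumpish]])
  have bc: "continuous_on S (bump s r)" for S s by (rule bumpish_continuous[OF bump_bumpish])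
  have hc: "continuous_on (cbox 0 T) h" using h by simp
  have HD: "(H has_field_derivative integral (cbox 0 T) (\<lambda>\<tau>. - ?b' (\<tau> - s) * (h \<tau> - m))) (at s within UNIV)" for s
    unfolding H_def
  proof (rule leibniz_rule_field_derivative[where fx = "\<lambda>s \<tau>. - ?b' (\<tau> - s) * (h \<tau> - m)"])
    fix s \<tau>
    have "((\<lambda>s. bump 0 r (\<tau> - s)) has_real_derivative ?b' (\<tau> - s) * (-1)) (at s)"
      by (rule DERIV_chain2[OF bumpish_deriv(2)[OF bump_bumpish]]) (auto intro!: derivative_eq_intros)
    then have "((\<lambda>s. bump s r \<tau>) has_real_derivative - ?b' (\<tau> - s)) (at s)"
      by (subst bump_shift) simp
    from DERIV_cmult_right[OF this]
    show "((\<lambda>s. bump s r \<tau> * (h \<tau> - m)) has_real_derivative - ?b' (\<tau> - s) * (h \<tau> - m)) (at s within UNIV)"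
      by simp
  next
    show "(\<lambda>\<tau>. bump s r \<tau> * (h \<tau> - m)) integrable_on cbox 0 T" for s
      by (intro integrable_continuous continuous_intros bc hc)
    show "continuous_on (UNIV \<times> cbox 0 T) (\<lambda>(s, \<tau>). - ?b' (\<tau> - s) * (h \<tau> - m))"
      unfolding split_beta
      by (intro continuous_intros continuous_on_compose2[OF b'c] continuous_on_compose2[OF hc]) auto
  qed auto
  have HD0: "(H has_field_derivative 0) (at s)" if s: "s \<in> {r<..<T - r}" for s
  proof -
    have "deriv (bump s r) \<tau> = ?b' (\<tau> - s)" for \<tau>
    proof -
      have "((\<lambda>\<tau>. bump 0 r (\<tau> - s)) has_real_derivative ?b' (\<tau> - s) * 1) (at \<tau>)"
        by (rule DERIV_chain2[OF bumpish_deriv(2)[OF bump_bumpish]]) (auto intro!: derivative_eq_intros)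
      moreover have "bump s r = (\<lambda>\<tau>. bump 0 r (\<tau> - s))" by (rule ext) (rule bump_shift)
      ultimately show ?thesis using DERIV_imp_deriv by simp
    qed
    moreover have "integral {0..T} (\<lambda>\<tau>. deriv (bump s r) \<tau> * (h \<tau> - m)) = 0"
      by (rule zero[OF bump_time_test]) (use r0 s in auto)
    ultimately have "integral (cbox 0 T) (\<lambda>\<tau>. - (?b' (\<tau> - s) * (h \<tau> - m))) = 0"
      by simp
    then show ?thesis using HD[of s] by simp
  qed
  have Hxy: "H x = H y"
    by (rule DERIV_isconst3[of r "T - r"]) (use r x y r0 HD0 in auto)
  have "0 \<le> integral (cbox 0 T) (\<lambda>\<tau>. - (bump y r \<tau> * (h \<tau> - m)))"
  proof (rule integral_nonneg)
    fix \<tau> show "0 \<le> - (bump y r \<tau> * (h \<tau> - m))"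
      using hy[of \<tau>] bump_nonneg[of y r \<tau>] bump_zero[of \<tau> y r]
      by (cases "\<tau> \<in> {y - r<..<y + r}") (auto intro: mult_nonneg_nonpos)
  qed (intro integrable_continuous continuous_intros bc hc)
  then have "H y \<le> 0" by (simp add: H_def)
  have "0 \<le> H x"
    unfolding H_def
  proof (rule integral_nonneg)
    fix \<tau> show "0 \<le> bump x r \<tau> * (h \<tau> - m)"
      using hx[of \<tau>] bump_nonneg[of x r \<tau>] bump_zero[of \<tau> x r]
      by (cases "\<tau> \<in> {x - r<..<x + r}") auto
  qed (intro integrable_continuous continuous_intros bc hc)
  with Hxy \<open>H y \<le> 0\<close> have "H x = 0" by simp
  moreover have "(\<lambda>\<tau>. bump x r \<tau> * (h \<tau> - m)) integrable_on cbox 0 T"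
    by (intro integrable_continuous continuous_intros bc hc)
  ultimately have i0: "((\<lambda>\<tau>. bump x r \<tau> * (h \<tau> - m)) has_integral 0) (cbox 0 T)"
    unfolding H_def by (metis integrable_integral)
  have "bump x r x * (h x - m) = 0"
  proof (rule has_integral_0_cbox_imp_0[OF _ _ i0])
    show "continuous_on (cbox 0 T) (\<lambda>\<tau>. bump x r \<tau> * (h \<tau> - m))" by (intro continuous_intros bc hc)
    show "0 \<le> bump x r \<tau> * (h \<tau> - m)" for \<tau>
      using hx[of \<tau>] bump_nonneg[of x r \<tau>] bump_zero[of \<tau> x r]
      by (cases "\<tau> \<in> {x - r<..<x + r}") auto
  qed (use x in auto)
  moreover have "bump x r x > 0" by (rule bump_pos) (use r0 in auto)
  ultimately show False using m(2) by simp
qed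

context time_interval
begin

lemma TI_eq_integral:
  assumes f: "integrable tM f" and t: "t \<in> {0..T}"
  shows "TI f t = integral {0..t} f"
proof -
  have "TI f t = integral {0..T} (\<lambda>s. f s * indicat_real {0<..t} s)"
    unfolding TI_def by (rule lebesgue_integral_eq_integral[OF integrable_ind[OF f]]) auto
  also have "\<dots> = integral {0..T} (\<lambda>s. if s \<in> {0..t} then f s else 0)"
    by (rule integral_spike[of "{0}"]) (auto simp: indicator_def)
  also have "\<dots> = integral ({0..t} \<inter> {0..T}) f" by (rule integral_restrict_Int)
  also have "{0..t} \<inter> {0..T} = {0..t}" using t by auto
  finally show ?thesis .
qed

lemma TI_FTC:
  assumes F: "\<And>x. (F has_real_derivative f x) (at x)" and c: "continuous_on {0..T} f" and t: "t \<in> {0..T}"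
  shows "F t = F 0 + TI f t"
proof -
  have "(f has_integral (F t - F 0)) {0..t}"
    by (rule fundamental_theorem_of_calculus)
      (use t F in \<open>auto simp: has_real_derivative_iff_has_vector_derivative[symmetric] intro: has_field_derivative_at_within\<close>)
  then show ?thesis using TI_eq_integral[OF integrable_continuous_tM[OF c] t] by (simp add: integral_unique)
qed

lemma time_test_deriv:
  assumes "\<theta> \<in> time_test T"
  shows "(\<theta> has_real_derivative deriv \<theta> x) (at x)" "continuous_on S (deriv \<theta>)" "\<theta> 0 = 0" "\<theta> T = 0"
proof -
  have d: "(deriv ^^ n) \<theta> differentiable (at t)" for n t using assms by (simp add: time_test_def)
  show "(\<theta> has_real_derivative deriv \<theta> x) (at x)"
    using d[of 0 x] DERIV_deriv_iff_real_differentiable by simp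
  have "deriv \<theta> differentiable (at t)" for t using d[of 1 t] by simp
  then show "continuous_on S (deriv \<theta>)"
    by (meson continuous_at_imp_continuous_on differentiable_imp_continuous_within)
  have z: "\<theta> t = 0" if "t \<notin> {0<..<T}" for t
  proof (rule ccontr)
    assume "\<theta> t \<noteq> 0"
    then have "t \<in> closure {t. \<theta> t \<noteq> 0}" by (intro subsetD[OF closure_subset]) simp
    moreover have "closure {t. \<theta> t \<noteq> 0} \<subseteq> {0<..<T}" using assms by (simp add: time_test_def)
    ultimately show False using that by (rule_tac notE[OF that subsetD])
  qed
  show "\<theta> 0 = 0" "\<theta> T = 0" by (rule z; simp)+
qed

lemma time_test_by_parts:
  assumes \<theta>: "\<theta> \<in> time_test T" and g: "integrable tM g" and x: "\<And>t. t \<in> {0..T} \<Longrightarrow> x t = x0 + TI g t"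
  shows "(\<integral>t. deriv \<theta> t * x t \<partial>tM) = - (\<integral>t. \<theta> t * g t \<partial>tM)"
proof -
  note \<theta>d = time_test_deriv[OF \<theta>]
  have cx: "continuous_on {0..T} x" by (rule abs_cont_continuous[OF g x])
  have c\<theta>: "continuous_on {0..T} \<theta>"
    using \<theta>d(1) by (meson DERIV_isCont continuous_at_imp_continuous_on)
  have i1: "integrable tM (\<lambda>s. deriv \<theta> s * x s)"
    by (intro integrable_continuous_tM continuous_intros \<theta>d cx)
  have i2: "integrable tM (\<lambda>s. g s * \<theta> s)" by (rule integrable_mult_continuous[OF g c\<theta>])
  have "\<theta> T * x T = 0 * x0 + TI (\<lambda>s. deriv \<theta> s * x s + g s * \<theta> s) T"
  proof (rule abs_cont_product[OF integrable_continuous_tM[OF \<theta>d(2)] _ g x])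
    show "\<theta> t = 0 + TI (deriv \<theta>) t" if "t \<in> {0..T}" for t
      using TI_FTC[OF \<theta>d(1) \<theta>d(2) that] \<theta>d(3) by simp
  qed (use T_pos in auto)
  then have "TI (\<lambda>s. deriv \<theta> s * x s + g s * \<theta> s) T = 0" using \<theta>d(4) by simp
  then have "(\<integral>s. deriv \<theta> s * x s \<partial>tM) + (\<integral>s. g s * \<theta> s \<partial>tM) = 0"
    using i1 i2 by (simp add: TI_T)
  then show ?thesis by (simp add: mult.commute)
qed

text \<open>\<open>h = c - TI g\<close> has vanishing distributional derivative, since
  \<open>m + TI g\<close> satisfies the same identity by parts for every constant \<open>m\<close>.
  Applying the inequality both ways makes \<open>h\<close> constant inside, and continuity reaches
  the endpoints.\<close>

lemma du_bois_reymond: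
  assumes c: "continuous_on {0..T} c" and g: "integrable tM g"
    and weak: "\<And>\<theta>. \<theta> \<in> time_test T \<Longrightarrow> (\<integral>t. deriv \<theta> t * c t \<partial>tM) = - (\<integral>t. \<theta> t * g t \<partial>tM)"
    and t: "t \<in> {0..T}"
  shows "c t = c 0 + TI g t"
proof -
  define h where "h t = c t - TI g t" for t
  have hc: "continuous_on {0..T} h" unfolding h_def by (intro continuous_intros c TI_continuous g)
  have zero: "integral {0..T} (\<lambda>\<tau>. deriv \<theta> \<tau> * (h \<tau> - m)) = 0" if \<theta>: "\<theta> \<in> time_test T" for \<theta> m
  proof -
    note \<theta>d = time_test_deriv[OF \<theta>]
    have "(\<integral>t. deriv \<theta> t * (m + TI g t) \<partial>tM) = - (\<integral>t. \<theta> t * g t \<partial>tM)"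
      by (rule time_test_by_parts[OF \<theta> g]) simp
    then have "(\<integral>t. deriv \<theta> t * c t - deriv \<theta> t * (m + TI g t) \<partial>tM) = 0"
      using weak[OF \<theta>]
      by (subst Bochner_Integration.integral_diff)
        (auto intro!: integrable_continuous_tM continuous_intros \<theta>d c TI_continuous g)
    moreover have "(\<lambda>t. deriv \<theta> t * c t - deriv \<theta> t * (m + TI g t)) = (\<lambda>t. deriv \<theta> t * (h t - m))"
      by (simp add: fun_eq_iff h_def algebra_simps)
    ultimately have "(\<integral>t. deriv \<theta> t * (h t - m) \<partial>tM) = 0" by simp
    moreover have "integrable tM (\<lambda>t. deriv \<theta> t * (h t - m))"
      by (intro integrable_continuous_tM continuous_intros \<theta>d hc)
    ultimately show ?thesis by (simp add: lebesgue_integral_eq_integral)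
  qed
  have int: "h x = h (T / 2)" if "0 < x" "x < T" for x
    using du_bois_reymond_le[OF hc zero] that T_pos by (intro antisym) auto
  have cl: "h x = h (T / 2)" if "x \<in> closure {0<..<T}" for x
  proof (rule continuous_constant_on_closure[OF _ _ that])
    show "continuous_on (closure {0<..<T}) h" using hc T_pos by simp
  qed (rule int, auto)
  have "closure {0<..<T} = {0..T}" using T_pos by simp
  then have "h t = h (T / 2)" "h 0 = h (T / 2)" using t T_pos by (intro cl; simp)+
  then have "h t = h 0" by simp
  then show ?thesis by (simp add: h_def TI_0)
qed

end

section \<open>Coefficients of weak solutions\<close>

context torus_side
begin

lemma L2_norm_triangle:
  assumes "u \<in> L2 L" "v \<in> L2 L"
  shows "L2_norm L (\<lambda>x. u x + v x) \<le> L2_norm L u + L2_norm L v"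
proof (rule power2_le_imp_le)
  have "L2_inner L u v \<le> L2_norm L u * L2_norm L v" using L2_Cauchy_Schwarz[OF assms] by simp
  then show "(L2_norm L (\<lambda>x. u x + v x))\<^sup>2 \<le> (L2_norm L u + L2_norm L v)\<^sup>2"
    by (simp add: L2_norm_sq inner_add_self[OF assms] power2_sum)
  show "0 \<le> L2_norm L u + L2_norm L v" by (simp add: L2_norm_nonneg)
qed

lemma L2_norm_hart: "L2_norm L (hart k) = 1"
  by (simp add: L2_norm_def hart_orthonormal)

lemma hat_le_norm: "u \<in> L2 L \<Longrightarrow> \<bar>hat u k\<bar> \<le> L2_norm L u"
  using L2_Cauchy_Schwarz[OF _ hart_L2, of u k] by (simp add: hat_def L2_norm_hart)

lemma bilaplacian_hart:
  assumes u: "u \<in> Hm L 2"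
  shows "bilaplacian L u (hart k) = (lam k)\<^sup>2 * hat u k"
proof -
  note lu = laplacian_Hm2[OF u] and lh = laplacian_Hm2[OF hart_Hm2[of k]]
  obtain m where m: "k \<in> modes m" using in_some_modes by blast
  have "(\<Sum>l\<in>modes n. hat (laplacian L u) l * hat (laplacian L (hart k)) l) = (lam k)\<^sup>2 * hat u k" if "n \<ge> m" for n
  proof -
    have "(\<Sum>l\<in>modes n. hat (laplacian L u) l * hat (laplacian L (hart k)) l)
        = (\<Sum>l\<in>modes n. ((lam l)\<^sup>2 * hat u l) * hat (hart k) l)"
      unfolding lu(2) lh(2) by (intro sum.cong) (auto simp: power2_eq_square)
    also have "\<dots> = (lam k)\<^sup>2 * hat u k" using m modes_mono[OF that] by (intro sum_hat_hart) auto
    finally show ?thesis .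
  qed
  then have "\<forall>\<^sub>F n in sequentially. (\<Sum>l\<in>modes n. hat (laplacian L u) l * hat (laplacian L (hart k)) l) = (lam k)\<^sup>2 * hat u k"
    by (rule eventually_sequentiallyI)
  then have "(\<lambda>n. \<Sum>l\<in>modes n. hat (laplacian L u) l * hat (laplacian L (hart k)) l) \<longlonglongrightarrow> (lam k)\<^sup>2 * hat u k"
    by (rule tendsto_eventually)
  from LIMSEQ_unique[OF Parseval[OF lu(1) lh(1)] this] show ?thesis by (simp add: bilaplacian_def)
qed

end

context calmed_time
begin

section \<open>The integral equations for the coefficients of a weak solution\<close>

definition rhs :: "(int \<times> int \<Rightarrow> real) \<Rightarrow> int \<times> int \<Rightarrow> real" where
  "rhs a k = (lam k - (lam k)\<^sup>2) * a k - 1/2 * NL a k"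

lemma rhs_integrable: "Hpath a \<Longrightarrow> integrable tM (\<lambda>s. rhs (a s) k)"
  unfolding rhs_def
  by (intro Bochner_Integration.integrable_diff integrable_mult_right Hpath_coeff_integrable NL_integrable)

lemma continuous_in_time_bounded:
  assumes "\<phi> \<in> continuous_in_time T (L2 L) (L2_norm L)"
  shows "\<exists>C. \<forall>t\<in>{0..T}. L2_norm L (\<phi> t) \<le> C"
proof -
  have L2: "\<phi> t \<in> L2 L" if "t \<in> {0..T}" for t using assms that by (simp add: continuous_in_time_def)
  have "continuous_on {0..T} (\<lambda>t. L2_norm L (\<phi> t))"
    unfolding continuous_on_def
  proof
    fix t assume t: "t \<in> {0..T}"
    have "((\<lambda>s. L2_norm L (\<phi> s) - L2_norm L (\<phi> t)) \<longlongrightarrow> 0) (at t within {0..T})"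
    proof (rule Lim_null_comparison)
      show "((\<lambda>s. L2_norm L (\<lambda>x. \<phi> s x - \<phi> t x)) \<longlongrightarrow> 0) (at t within {0..T})"
        using assms t by (simp add: continuous_in_time_def)
      have "\<bar>L2_norm L (\<phi> s) - L2_norm L (\<phi> t)\<bar> \<le> L2_norm L (\<lambda>x. \<phi> s x - \<phi> t x)" if s: "s \<in> {0..T}" for s
      proof -
        have "L2_norm L (\<phi> s) \<le> L2_norm L (\<lambda>x. \<phi> s x - \<phi> t x) + L2_norm L (\<phi> t)"
          using L2_norm_triangle[OF L2_diff[OF L2[OF s] L2[OF t]] L2[OF t]] by simp
        moreover have "L2_norm L (\<phi> t) \<le> L2_norm L (\<lambda>x. \<phi> t x - \<phi> s x) + L2_norm L (\<phi> s)"
          using L2_norm_triangle[OF L2_diff[OF L2[OF t] L2[OF s]] L2[OF s]] by simp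
        moreover have "L2_norm L (\<lambda>x. \<phi> t x - \<phi> s x) = L2_norm L (\<lambda>x. \<phi> s x - \<phi> t x)"
          by (simp add: L2_norm_def L2_inner_self power2_commute)
        ultimately show ?thesis by linarith
      qed
      then show "\<forall>\<^sub>F s in at t within {0..T}. norm (L2_norm L (\<phi> s) - L2_norm L (\<phi> t)) \<le> L2_norm L (\<lambda>x. \<phi> s x - \<phi> t x)"
        unfolding eventually_at_filter by (intro always_eventually) simp
    qed
    from tendsto_add[OF this tendsto_const[of "L2_norm L (\<phi> t)"]]
    show "((\<lambda>t. L2_norm L (\<phi> t)) \<longlongrightarrow> L2_norm L (\<phi> t)) (at t within {0..T})" by simp
  qed
  then have "bounded ((\<lambda>t. L2_norm L (\<phi> t)) ` {0..T})"
    by (intro compact_imp_bounded compact_continuous_image compact_Icc)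
  then obtain C where "\<forall>t\<in>{0..T}. \<bar>L2_norm L (\<phi> t)\<bar> \<le> C" unfolding bounded_iff by auto
  then show ?thesis by (meson abs_ge_self order_trans)
qed

text \<open>Measurability of the H^2 part is obtained from the continuous coefficients; from the
  Bochner space only membership almost everywhere and finiteness of the norm are taken.\<close>

lemma weak_solution_Hpath:
  assumes \<phi>: "weak_solution L T \<eta> \<phi>0 \<phi>"
  shows "Hpath (\<lambda>t. hat (\<phi> t))"
  unfolding Hpath_def
proof (intro conjI)
  have ct: "\<phi> \<in> continuous_in_time T (L2 L) (L2_norm L)" and bo: "\<phi> \<in> bochner_L2 T (Hm L 2) (Hm_norm L 2)"
    using \<phi> by (auto simp: weak_solution_def)
  have L2: "\<phi> t \<in> L2 L" if "t \<in> {0..T}" for t using ct that by (simp add: continuous_in_time_def)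
  show cc: "coeff_cont (\<lambda>t. hat (\<phi> t))"
    unfolding coeff_cont_def continuous_on_def
  proof (intro allI ballI)
    fix k t assume t: "t \<in> {0..T}"
    have "((\<lambda>s. hat (\<phi> s) k - hat (\<phi> t) k) \<longlongrightarrow> 0) (at t within {0..T})"
    proof (rule Lim_null_comparison)
      show "((\<lambda>s. L2_norm L (\<lambda>x. \<phi> s x - \<phi> t x)) \<longlongrightarrow> 0) (at t within {0..T})"
        using ct t by (simp add: continuous_in_time_def)
      have "\<bar>hat (\<phi> s) k - hat (\<phi> t) k\<bar> \<le> L2_norm L (\<lambda>x. \<phi> s x - \<phi> t x)" if s: "s \<in> {0..T}" for s
        using hat_le_norm[OF L2_diff[OF L2[OF s] L2[OF t]], of k]
        unfolding hat_diff[OF L2[OF s] L2[OF t]] .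
      then show "\<forall>\<^sub>F s in at t within {0..T}. norm (hat (\<phi> s) k - hat (\<phi> t) k) \<le> L2_norm L (\<lambda>x. \<phi> s x - \<phi> t x)"
        unfolding eventually_at_filter by (intro always_eventually) simp
    qed
    from tendsto_add[OF this tendsto_const[of "hat (\<phi> t) k"]]
    show "((\<lambda>t. hat (\<phi> t) k) \<longlongrightarrow> hat (\<phi> t) k) (at t within {0..T})" by simp
  qed
  obtain C where C: "\<forall>t\<in>{0..T}. L2_norm L (\<phi> t) \<le> C" using continuous_in_time_bounded[OF ct] by blast
  have "wpart one_w (hat (\<phi> t)) n \<le> C\<^sup>2" if t: "t \<in> {0..T}" for t n
  proof -
    have "wpart one_w (hat (\<phi> t)) n \<le> (L2_norm L (\<phi> t))\<^sup>2"
      using Bessel[OF L2[OF t] finite_modes] by (simp add: wpart_def L2_norm_sq)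
    also have "\<dots> \<le> C\<^sup>2" using C t L2_norm_nonneg by (intro power_mono) auto
    finally show ?thesis .
  qed
  then show "\<exists>C. \<forall>t\<in>{0..T}. \<forall>n. wpart one_w (hat (\<phi> t)) n \<le> C" by blast
  have aeH: "AE t in tM. \<phi> t \<in> Hm L 2" using bo by (simp add: bochner_L2_def)
  then show ae: "AE t in tM. wfin h2_w (hat (\<phi> t))" by eventually_elim (rule Hm2_fin)
  have "integrable tM (\<lambda>t. wsq lam2_w (hat (\<phi> t)) / 2)"
  proof (rule integrableI_bounded)
    show "(\<lambda>t. wsq lam2_w (hat (\<phi> t)) / 2) \<in> borel_measurable tM"
      by (intro borel_measurable_divide wsq_measurable cc) simp
    have "(\<integral>\<^sup>+t. ennreal (norm (wsq lam2_w (hat (\<phi> t)) / 2)) \<partial>tM) \<le> (\<integral>\<^sup>+t. ennreal ((Hm_norm L 2 (\<phi> t))\<^sup>2) \<partial>tM)"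
    proof (rule nn_integral_mono_AE)
      show "AE t in tM. ennreal (norm (wsq lam2_w (hat (\<phi> t)) / 2)) \<le> ennreal ((Hm_norm L 2 (\<phi> t))\<^sup>2)"
        using aeH
      proof eventually_elim
        case (elim t)
        note f = h2_fin[OF Hm2_fin[OF elim]]
        have "0 \<le> wsq lam2_w (hat (\<phi> t))" "0 \<le> wsq one_w (hat (\<phi> t))"
          by (intro wsq_nonneg f; simp)+
        then show ?case using Hm2_norm_bounds(2)[OF elim] f(4) by (intro ennreal_leI) simp
      qed
    qed
    also have "\<dots> < \<infinity>" using bo by (simp add: bochner_L2_def bochner_L2_norm_sq_def)
    finally show "(\<integral>\<^sup>+t. ennreal (norm (wsq lam2_w (hat (\<phi> t)) / 2)) \<partial>tM) < \<infinity>" .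
  qed
  from integrable_mult_right[OF this, of 2] show "integrable tM (\<lambda>t. wsq lam2_w (hat (\<phi> t)))" by simp
qed

text \<open>With \<open>hart k\<close> as test function the equation determines
  \<open>\<phi>t t (hart k)\<close> almost everywhere as \<open>rhs\<close>, and the distributional
  derivative becomes scalar.\<close>

lemma weak_solution_evolution:
  assumes \<phi>: "weak_solution L T \<eta> \<phi>0 \<phi>" and t: "t \<in> {0..T}"
  shows "hat (\<phi> t) k = hat (\<phi> 0) k + TI (\<lambda>s. rhs (hat (\<phi> s)) k) t"
proof -
  note Hp = weak_solution_Hpath[OF \<phi>]
  obtain \<phi>t where td: "has_time_deriv L T \<phi> \<phi>t" and eq: "AE t in tM. \<forall>v \<in> Hm L 2.
           \<phi>t t v + 1/2 * L2_inner L (nl (\<phi> t)) v + L2_inner L (laplacian L (\<phi> t)) v + bilaplacian L (\<phi> t) v = 0"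
    using \<phi> by (auto simp: weak_solution_def)
  have aeH: "AE t in tM. \<phi> t \<in> Hm L 2" using \<phi> by (simp add: weak_solution_def bochner_L2_def)
  have val: "AE t in tM. rhs (hat (\<phi> t)) k = \<phi>t t (hart k)"
    using aeH eq
  proof eventually_elim
    case (elim t)
    have "L2_inner L (laplacian L (\<phi> t)) (hart k) = - lam k * hat (\<phi> t) k"
      using laplacian_Hm2(2)[OF elim(1)] by (simp add: hat_def)
    moreover have "L2_inner L (nl (\<phi> t)) (hart k) = NL (hat (\<phi> t)) k"
      using hat_nl[OF elim(1)] by (metis hat_def)
    moreover have "bilaplacian L (\<phi> t) (hart k) = (lam k)\<^sup>2 * hat (\<phi> t) k" by (rule bilaplacian_hart[OF elim(1)])
    moreover have "\<phi>t t (hart k) + 1/2 * L2_inner L (nl (\<phi> t)) (hart k)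
        + L2_inner L (laplacian L (\<phi> t)) (hart k) + bilaplacian L (\<phi> t) (hart k) = 0"
      using elim(2) hart_Hm2 by blast
    ultimately show ?case by (simp add: rhs_def algebra_simps)
  qed
  show ?thesis
  proof (rule du_bois_reymond[OF _ rhs_integrable[OF Hp] _ t])
    show "continuous_on {0..T} (\<lambda>t. hat (\<phi> t) k)" by (rule coeff_contD[OF Hpath_cont[OF Hp]])
    fix \<theta> assume \<theta>: "\<theta> \<in> time_test T"
    have c\<theta>: "continuous_on {0..T} \<theta>"
      using time_test_deriv(1)[OF \<theta>] by (meson DERIV_isCont continuous_at_imp_continuous_on)
    \<comment> \<open>Measurability of the pairing \<open>\<phi>t t (hart k)\<close> is inherited
      from \<open>rhs\<close>, with which it agrees almost everywhere.\<close>
    have m1: "(\<lambda>t. rhs (hat (\<phi> t)) k) \<in> borel_measurable tM" using rhs_integrable[OF Hp] by blast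
    then have m2: "(\<lambda>t. \<phi>t t (hart k)) \<in> borel_measurable tM" by (rule measurable_lebesgue_on_AE_eq[OF _ val])
    have "(\<integral>t. deriv \<theta> t * hat (\<phi> t) k \<partial>tM) = - (\<integral>t. \<theta> t * \<phi>t t (hart k) \<partial>tM)"
      using td \<theta> hart_Hm2 unfolding has_time_deriv_def hat_def by blast
    also have "(\<integral>t. \<theta> t * \<phi>t t (hart k) \<partial>tM) = (\<integral>t. \<theta> t * rhs (hat (\<phi> t)) k \<partial>tM)"
    proof (rule integral_cong_AE)
      show "AE t in tM. \<theta> t * \<phi>t t (hart k) = \<theta> t * rhs (hat (\<phi> t)) k" using val by eventually_elim simp
    qed (intro borel_measurable_times measurable_continuous_tM c\<theta> m1 m2)+
    finally show "(\<integral>t. deriv \<theta> t * hat (\<phi> t) k \<partial>tM) = - (\<integral>t. \<theta> t * rhs (hat (\<phi> t)) k \<partial>tM)" .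
  qed
qed

lemma weak_solution_initial:
  assumes \<phi>: "weak_solution L T \<eta> \<phi>0 \<phi>" and \<phi>0: "\<phi>0 \<in> L2 L"
  shows "hat (\<phi> 0) = hat \<phi>0"
proof (rule AE_eq_hat[OF _ \<phi>0])
  show "\<phi> 0 \<in> L2 L" using \<phi> T_pos by (simp add: weak_solution_def continuous_in_time_def)
  show "AE x in torus L. \<phi> 0 x = \<phi>0 x" using \<phi> by (simp add: weak_solution_def)
qed

text \<open>The energy estimate without residual. \<open>C\<close> is chosen before
  \<open>\<psi>\<close> because the Gronwall weight is evaluated along \<open>\<phi>\<close> only;
  uniqueness and continuous dependence are both read off from this.\<close>

lemma weak_solutions_stability:
  assumes \<phi>: "weak_solution L T \<eta> \<phi>0 \<phi>" and \<phi>0: "\<phi>0 \<in> L2 L"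
  obtains C where "C > 0"
    "\<And>\<psi>0 \<psi> t. weak_solution L T \<eta> \<psi>0 \<psi> \<Longrightarrow> \<psi>0 \<in> L2 L \<Longrightarrow> t \<in> {0..T} \<Longrightarrow>
      (L2_norm L (\<lambda>x. \<psi> t x - \<phi> t x))\<^sup>2 \<le> C * (L2_norm L (\<lambda>x. \<psi>0 x - \<phi>0 x))\<^sup>2"
    "\<And>\<psi>0 \<psi>. weak_solution L T \<eta> \<psi>0 \<psi> \<Longrightarrow> \<psi>0 \<in> L2 L \<Longrightarrow>
      bochner_L2_norm_sq T (Hm_norm L 2) (\<lambda>t x. \<psi> t x - \<phi> t x) \<le> ennreal (C * (L2_norm L (\<lambda>x. \<psi>0 x - \<phi>0 x))\<^sup>2)"
proof -
  note b = weak_solution_Hpath[OF \<phi>]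
  obtain N :: nat where N: "(\<integral>s. 3 + (nl_weight (hat (\<phi> s)))\<^sup>2 \<partial>tM) * 2 \<le> real N"
    using real_arch_simple by blast
  \<comment> \<open>The 6 comes from \<open>Hm2_norm_bounds\<close>, \<open>T\<close> from
    integrating the pointwise L^2 bound in time, and \<open>N + 1\<close> from the bound on the
    Laplacian part.\<close>
  define C where "C = 2 ^ N * (6 * (T + real N + 1))"
  have C: "C > 0" "2 ^ N \<le> C" using T_pos by (simp_all add: C_def)
  have key: "(L2_norm L (\<lambda>x. \<psi> t x - \<phi> t x))\<^sup>2 = wsq one_w (\<lambda>k. hat (\<psi> t) k - hat (\<phi> t) k)"
     "(\<lambda>x. \<psi> t x - \<phi> t x) \<in> L2 L" "hat (\<lambda>x. \<psi> t x - \<phi> t x) = (\<lambda>k. hat (\<psi> t) k - hat (\<phi> t) k)"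
    if \<psi>: "weak_solution L T \<eta> \<psi>0 \<psi>" and t: "t \<in> {0..T}" for \<psi>0 \<psi> t
  proof -
    have l: "\<psi> t \<in> L2 L" "\<phi> t \<in> L2 L" using \<psi> \<phi> t by (auto simp: weak_solution_def continuous_in_time_def)
    show d: "(\<lambda>x. \<psi> t x - \<phi> t x) \<in> L2 L" by (rule L2_diff[OF l])
    show h: "hat (\<lambda>x. \<psi> t x - \<phi> t x) = (\<lambda>k. hat (\<psi> t) k - hat (\<phi> t) k)" using hat_diff[OF l] by auto
    show "(L2_norm L (\<lambda>x. \<psi> t x - \<phi> t x))\<^sup>2 = wsq one_w (\<lambda>k. hat (\<psi> t) k - hat (\<phi> t) k)"
      using wsq_one_hat(2)[OF d] by (simp add: L2_norm_sq h)
  qed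
  have est: "\<And>t. t \<in> {0..T} \<Longrightarrow> wsq one_w (\<lambda>k. hat (\<psi> t) k - hat (\<phi> t) k) \<le> 2 ^ N * (L2_norm L (\<lambda>x. \<psi>0 x - \<phi>0 x))\<^sup>2"
      "(\<integral>s. wsq lam2_w (\<lambda>k. hat (\<psi> s) k - hat (\<phi> s) k) \<partial>tM) \<le> (real N + 1) * 2 ^ N * (L2_norm L (\<lambda>x. \<psi>0 x - \<phi>0 x))\<^sup>2"
    if \<psi>: "weak_solution L T \<eta> \<psi>0 \<psi>" and \<psi>0: "\<psi>0 \<in> L2 L" for \<psi>0 \<psi>
  proof -
    note a = weak_solution_Hpath[OF \<psi>]
    have ev: "hat (\<psi> t) k - hat (\<phi> t) k = (hat (\<psi> 0) k - hat (\<phi> 0) k) +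
        TI (\<lambda>s. (lam k - (lam k)\<^sup>2) * (hat (\<psi> s) k - hat (\<phi> s) k) - 1/2 * (NL (hat (\<psi> s)) k - NL (hat (\<phi> s)) k) + 0) t"
      if t: "t \<in> {0..T}" for k t
    proof -
      have "hat (\<psi> t) k - hat (\<phi> t) k = (hat (\<psi> 0) k - hat (\<phi> 0) k) + (TI (\<lambda>s. rhs (hat (\<psi> s)) k) t - TI (\<lambda>s. rhs (hat (\<phi> s)) k) t)"
        using weak_solution_evolution[OF \<psi> t, of k] weak_solution_evolution[OF \<phi> t, of k] by simp
      also have "TI (\<lambda>s. rhs (hat (\<psi> s)) k) t - TI (\<lambda>s. rhs (hat (\<phi> s)) k) t = TI (\<lambda>s. rhs (hat (\<psi> s)) k - rhs (hat (\<phi> s)) k) t"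
        by (rule TI_diff_fun[symmetric]) (intro rhs_integrable a b)+
      also have "(\<lambda>s. rhs (hat (\<psi> s)) k - rhs (hat (\<phi> s)) k)
          = (\<lambda>s. (lam k - (lam k)\<^sup>2) * (hat (\<psi> s) k - hat (\<phi> s) k) - 1/2 * (NL (hat (\<psi> s)) k - NL (hat (\<phi> s)) k) + 0)"
        by (simp add: fun_eq_iff rhs_def algebra_simps)
      finally show ?thesis .
    qed
    have A: "wsq one_w (\<lambda>k. hat (\<psi> 0) k - hat (\<phi> 0) k) + 2 * (\<integral>s. 0 \<partial>tM) \<le> (L2_norm L (\<lambda>x. \<psi>0 x - \<phi>0 x))\<^sup>2"
    proof -
      have "hat (\<lambda>x. \<psi>0 x - \<phi>0 x) = (\<lambda>k. hat (\<psi> 0) k - hat (\<phi> 0) k)"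
        using hat_diff[OF \<psi>0 \<phi>0] weak_solution_initial[OF \<psi> \<psi>0] weak_solution_initial[OF \<phi> \<phi>0] by auto
      then show ?thesis using wsq_one_hat(2)[OF L2_diff[OF \<psi>0 \<phi>0]] by (simp add: L2_norm_sq)
    qed
    have N': "(\<integral>s. 3 + (nl_weight (hat (\<phi> s)))\<^sup>2 \<partial>tM) \<le> real N / 2" using N by simp
    note E = energy_estimate[OF a b _ ev _ _ _ N' A]
    show "\<And>t. t \<in> {0..T} \<Longrightarrow> wsq one_w (\<lambda>k. hat (\<psi> t) k - hat (\<phi> t) k) \<le> 2 ^ N * (L2_norm L (\<lambda>x. \<psi>0 x - \<phi>0 x))\<^sup>2"
      by (rule E(1)) auto
    show "(\<integral>s. wsq lam2_w (\<lambda>k. hat (\<psi> s) k - hat (\<phi> s) k) \<partial>tM) \<le> (real N + 1) * 2 ^ N * (L2_norm L (\<lambda>x. \<psi>0 x - \<phi>0 x))\<^sup>2"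
      by (rule E(2)) auto
  qed
  show thesis
  proof (rule that[OF C(1)])
    fix \<psi>0 \<psi> t assume \<psi>: "weak_solution L T \<eta> \<psi>0 \<psi>" and \<psi>0: "\<psi>0 \<in> L2 L" and t: "t \<in> {0..T}"
    have "(L2_norm L (\<lambda>x. \<psi> t x - \<phi> t x))\<^sup>2 \<le> 2 ^ N * (L2_norm L (\<lambda>x. \<psi>0 x - \<phi>0 x))\<^sup>2"
      using est(1)[OF \<psi> \<psi>0 t] key(1)[OF \<psi> t] by simp
    also have "\<dots> \<le> C * (L2_norm L (\<lambda>x. \<psi>0 x - \<phi>0 x))\<^sup>2" using C by (intro mult_right_mono) auto
    finally show "(L2_norm L (\<lambda>x. \<psi> t x - \<phi> t x))\<^sup>2 \<le> C * (L2_norm L (\<lambda>x. \<psi>0 x - \<phi>0 x))\<^sup>2" .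
  next
    fix \<psi>0 \<psi> assume \<psi>: "weak_solution L T \<eta> \<psi>0 \<psi>" and \<psi>0: "\<psi>0 \<in> L2 L"
    define D where "D = (L2_norm L (\<lambda>x. \<psi>0 x - \<phi>0 x))\<^sup>2"
    define w where "w s = (\<lambda>k. hat (\<psi> s) k - hat (\<phi> s) k)" for s
    have wp: "Hpath w" unfolding w_def by (rule Hpath_diff[OF weak_solution_Hpath[OF \<psi>] b])
    have ae: "AE t in tM. \<psi> t \<in> Hm L 2" "AE t in tM. \<phi> t \<in> Hm L 2"
      using \<psi> \<phi> by (auto simp: weak_solution_def bochner_L2_def)
    have i: "integrable tM (\<lambda>t. 6 * (wsq one_w (w t) + wsq lam2_w (w t)))"
      using Hpath_integrable_one[OF wp] Hpath_int[OF wp] by simp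
    have "bochner_L2_norm_sq T (Hm_norm L 2) (\<lambda>t x. \<psi> t x - \<phi> t x)
        \<le> (\<integral>\<^sup>+t. ennreal (6 * (wsq one_w (w t) + wsq lam2_w (w t))) \<partial>tM)"
      unfolding bochner_L2_norm_sq_def
    proof (rule nn_integral_mono_AE)
      show "AE t in tM. ennreal ((Hm_norm L 2 (\<lambda>x. \<psi> t x - \<phi> t x))\<^sup>2) \<le> ennreal (6 * (wsq one_w (w t) + wsq lam2_w (w t)))"
        using ae AE_space
      proof eventually_elim
        case (elim t)
        have H: "(\<lambda>x. \<psi> t x - \<phi> t x) \<in> Hm L 2" by (rule Hm2_diff[OF elim(1,2)])
        have "hat (\<lambda>x. \<psi> t x - \<phi> t x) = w t" using key(3)[OF \<psi>, of t] elim(3) by (simp add: w_def)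
        then show ?case using Hm2_norm_bounds(1)[OF H] h2_fin(4)[OF Hm2_fin[OF H]] by (intro ennreal_leI) simp
      qed
    qed
    also have "\<dots> = ennreal (\<integral>t. 6 * (wsq one_w (w t) + wsq lam2_w (w t)) \<partial>tM)"
    proof (rule nn_integral_eq_integral[OF i])
      show "AE t in tM. 0 \<le> 6 * (wsq one_w (w t) + wsq lam2_w (w t))"
        using Hpath_AE[OF wp]
      proof eventually_elim
        case (elim t)
        have "0 \<le> wsq lam2_w (w t)" "0 \<le> wsq one_w (w t)" by (intro wsq_nonneg h2_fin elim; simp)+
        then show ?case by simp
      qed
    qed
    also have "\<dots> \<le> ennreal (C * D)"
    proof (rule ennreal_leI)
      have "(\<integral>t. wsq one_w (w t) \<partial>tM) \<le> (\<integral>t. 2 ^ N * D \<partial>tM)"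
        by (rule integral_mono_AE[OF Hpath_integrable_one[OF wp] integrable_const_tM])
          (use est(1)[OF \<psi> \<psi>0] in \<open>auto intro!: AE_I2 simp: w_def D_def\<close>)
      also have "\<dots> = T * (2 ^ N * D)" using T_pos by (simp add: measure_restrict_space)
      finally have 1: "(\<integral>t. wsq one_w (w t) \<partial>tM) \<le> T * (2 ^ N * D)" .
      have 2: "(\<integral>t. wsq lam2_w (w t) \<partial>tM) \<le> (real N + 1) * 2 ^ N * D"
        using est(2)[OF \<psi> \<psi>0] by (simp add: w_def D_def)
      have "(\<integral>t. 6 * (wsq one_w (w t) + wsq lam2_w (w t)) \<partial>tM)
          = 6 * ((\<integral>t. wsq one_w (w t) \<partial>tM) + (\<integral>t. wsq lam2_w (w t) \<partial>tM))"
        using Hpath_integrable_one[OF wp] Hpath_int[OF wp] by simp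
      also have "\<dots> \<le> 6 * (T * (2 ^ N * D) + (real N + 1) * 2 ^ N * D)" using 1 2 by simp
      also have "\<dots> = C * D" by (simp add: C_def algebra_simps)
      finally show "(\<integral>t. 6 * (wsq one_w (w t) + wsq lam2_w (w t)) \<partial>tM) \<le> C * D" .
    qed
    finally show "bochner_L2_norm_sq T (Hm_norm L 2) (\<lambda>t x. \<psi> t x - \<phi> t x)
        \<le> ennreal (C * (L2_norm L (\<lambda>x. \<psi>0 x - \<phi>0 x))\<^sup>2)" by (simp add: D_def)
  qed
qed

end

section \<open>Picard iteration\<close>

context time_interval
begin

lemma TI_const_mult_le:
  assumes f: "integrable tM f" and b: "AE s in tM. \<bar>f s\<bar> \<le> c" and t: "t \<in> {0..T}"
  shows "\<bar>TI f t\<bar> \<le> c * T"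
proof -
  have fa: "integrable tM (\<lambda>s. \<bar>f s\<bar>)" using f by simp
  have ci: "integrable tM (\<lambda>s. c)" by (rule integrable_continuous_tM) simp
  have "\<bar>TI f t\<bar> \<le> TI (\<lambda>s. \<bar>f s\<bar>) t" using TI_abs_diff[OF f, of 0 t] t by (simp add: TI_0)
  also have "\<dots> \<le> (\<integral>s. \<bar>f s\<bar> \<partial>tM)" by (rule TI_le_total[OF fa _ t]) simp
  also have "\<dots> \<le> (\<integral>s. c \<partial>tM)" by (rule integral_mono_AE[OF fa ci b])
  also have "\<dots> = c * T" using T_pos by (simp add: measure_restrict_space)
  finally show ?thesis .
qed

text \<open>Successive differences are measured against \<open>exp (\<beta> * t)\<close>: for
  \<open>\<beta>\<close> large each iteration halves the weighted distance, so the iteration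
  converges on all of \<open>[0, T]\<close> at once. \<open>F\<close> sees only finitely many
  coordinates, and \<open>u\<close> is controlled only there.\<close>

lemma picard_global:
  fixes F :: "('k \<Rightarrow> real) \<Rightarrow> 'k \<Rightarrow> real" and a0 :: "'k \<Rightarrow> real"
  assumes K: "finite K" and \<Lambda>: "0 \<le> \<Lambda>"
    and lip: "\<And>a b k. k \<in> K \<Longrightarrow> \<bar>F a k - F b k\<bar> \<le> \<Lambda> * (\<Sum>l\<in>K. \<bar>a l - b l\<bar>)"
  shows "\<exists>u. \<forall>k\<in>K. continuous_on {0..T} (\<lambda>t. u t k) \<and> continuous_on {0..T} (\<lambda>t. F (u t) k) \<and>
    (\<forall>t\<in>{0..T}. u t k = a0 k + TI (\<lambda>s. F (u s) k) t)"
proof -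
  have Fc: "continuous_on {0..T} (\<lambda>t. F (v t) k)"
    if v: "\<And>k. k \<in> K \<Longrightarrow> continuous_on {0..T} (\<lambda>t. v t k)" and k: "k \<in> K" for v k
    unfolding continuous_on_def
  proof
    fix t assume t: "t \<in> {0..T}"
    have "((\<lambda>s. F (v s) k - F (v t) k) \<longlongrightarrow> 0) (at t within {0..T})"
    proof (rule Lim_null_comparison)
      show "\<forall>\<^sub>F s in at t within {0..T}. norm (F (v s) k - F (v t) k) \<le> \<Lambda> * (\<Sum>l\<in>K. \<bar>v s l - v t l\<bar>)"
        using lip[OF k] by (intro always_eventually) simp
      have "((\<lambda>s. \<Lambda> * (\<Sum>l\<in>K. \<bar>v s l - v t l\<bar>)) \<longlongrightarrow> \<Lambda> * (\<Sum>l\<in>K. \<bar>v t l - v t l\<bar>)) (at t within {0..T})"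
        by (intro tendsto_intros) (use v t in \<open>simp add: continuous_on_def\<close>)
      then show "((\<lambda>s. \<Lambda> * (\<Sum>l\<in>K. \<bar>v s l - v t l\<bar>)) \<longlongrightarrow> 0) (at t within {0..T})" by simp
    qed
    from tendsto_add[OF this tendsto_const[of "F (v t) k"]]
    show "((\<lambda>t. F (v t) k) \<longlongrightarrow> F (v t) k) (at t within {0..T})" by simp
  qed
  define p where "p = rec_nat (\<lambda>t. a0) (\<lambda>_ v t k. a0 k + TI (\<lambda>s. F (v s) k) t)"
  have p0: "p 0 t k = a0 k" and pS: "p (Suc j) t k = a0 k + TI (\<lambda>s. F (p j s) k) t" for j t k
    by (simp_all add: p_def)
  have pc: "continuous_on {0..T} (\<lambda>t. p j t k)" if "k \<in> K" for j k
    using that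
  proof (induction j arbitrary: k)
    case (Suc j)
    show ?case unfolding pS
      by (intro continuous_intros TI_continuous integrable_continuous_tM Fc Suc)
  qed (simp add: p0)
  have Fi: "integrable tM (\<lambda>s. F (p j s) k)" if "k \<in> K" for j k
    by (intro integrable_continuous_tM Fc pc that)
  \<comment> \<open>Integrating the exponential gains \<open>1 / \<beta>\<close>, which beats the
    loss \<open>\<Lambda> * card K\<close> by a factor 2; the summand 1 keeps \<open>\<beta>\<close>
    positive when that loss is 0.\<close>
  define \<beta> where "\<beta> = 2 * \<Lambda> * real (card K) + 1"
  have \<beta>: "\<beta> > 0" "2 * \<Lambda> * real (card K) \<le> \<beta>" using \<Lambda> by (auto simp: \<beta>_def intro!: add_nonneg_pos)
  define d where "d j t = (\<Sum>k\<in>K. \<bar>p (Suc j) t k - p j t k\<bar>)" for j t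
  have dc: "continuous_on {0..T} (d j)" for j
    unfolding d_def by (intro continuous_intros pc)
  obtain D where D: "D > 0" "\<And>t. t \<in> {0..T} \<Longrightarrow> d 0 t \<le> D"
  proof -
    have "bounded (d 0 ` {0..T})" by (intro compact_imp_bounded compact_continuous_image dc compact_Icc)
    then obtain D where "D > 0" "\<forall>x\<in>d 0 ` {0..T}. norm x \<le> D" unfolding bounded_pos by blast
    then have "d 0 t \<le> D" if "t \<in> {0..T}" for t using that by (metis abs_ge_self image_eqI order_trans real_norm_def)
    then show thesis using that \<open>D > 0\<close> by blast
  qed
  have dj: "d j t \<le> D * (1/2) ^ j * exp (\<beta> * t)" if t: "t \<in> {0..T}" for j t
    using t
  proof (induction j arbitrary: t)
    case 0
    have "1 \<le> exp (\<beta> * t)" using 0 \<beta> by simp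
    then have "D * 1 \<le> D * exp (\<beta> * t)" using D(1) by (intro mult_left_mono) auto
    then show ?case using D(2)[OF 0] by simp
  next
    case (Suc j)
    let ?E = "\<lambda>s. \<Lambda> * (D * (1/2) ^ j) * exp (\<beta> * s)"
    have Ec: "continuous_on {0..T} ?E" by (intro continuous_intros)
    have "\<bar>p (Suc (Suc j)) t k - p (Suc j) t k\<bar> \<le> \<Lambda> * (D * (1/2) ^ j) / \<beta> * exp (\<beta> * t)" if k: "k \<in> K" for k
    proof -
      have "p (Suc (Suc j)) t k - p (Suc j) t k = TI (\<lambda>s. F (p (Suc j) s) k - F (p j s) k) t"
        unfolding pS[of "Suc j"] pS[of j t k] using Fi[OF k] by (simp add: TI_diff_fun)
      then have "\<bar>p (Suc (Suc j)) t k - p (Suc j) t k\<bar> \<le> TI (\<lambda>s. \<bar>F (p (Suc j) s) k - F (p j s) k\<bar>) t"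
        using TI_abs_diff[of "\<lambda>s. F (p (Suc j) s) k - F (p j s) k" 0 t] Fi[OF k] Suc.prems by (simp add: TI_0)
      also have "\<dots> \<le> TI ?E t"
      proof (rule TI_mono_AE)
        show "integrable tM ?E" by (rule integrable_continuous_tM[OF Ec])
        show "AE s in tM. \<bar>F (p (Suc j) s) k - F (p j s) k\<bar> \<le> ?E s"
        proof (rule AE_I2)
          fix s assume "s \<in> space tM"
          then have s: "s \<in> {0..T}" by simp
          have "\<bar>F (p (Suc j) s) k - F (p j s) k\<bar> \<le> \<Lambda> * d j s" unfolding d_def by (rule lip[OF k])
          also have "\<dots> \<le> \<Lambda> * (D * (1/2) ^ j * exp (\<beta> * s))" by (intro mult_left_mono Suc.IH s \<Lambda>)
          finally show "\<bar>F (p (Suc j) s) k - F (p j s) k\<bar> \<le> ?E s" by (simp add: mult.assoc)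
        qed
      qed (use Fi[OF k] in simp)
      also have "TI ?E t = \<Lambda> * (D * (1/2) ^ j) / \<beta> * exp (\<beta> * t) - \<Lambda> * (D * (1/2) ^ j) / \<beta>"
      proof -
        have "\<Lambda> * (D * (1/2) ^ j) / \<beta> * exp (\<beta> * t) = \<Lambda> * (D * (1/2) ^ j) / \<beta> * exp (\<beta> * 0) + TI ?E t"
          by (rule TI_FTC[OF _ Ec Suc.prems]) (use \<beta> in \<open>auto intro!: derivative_eq_intros\<close>)
        then show ?thesis by simp
      qed
      also have "\<dots> \<le> \<Lambda> * (D * (1/2) ^ j) / \<beta> * exp (\<beta> * t)" using \<Lambda> D \<beta> by simp
      finally show ?thesis .
    qed
    then have "d (Suc j) t \<le> (\<Sum>k\<in>K. \<Lambda> * (D * (1/2) ^ j) / \<beta> * exp (\<beta> * t))"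
      unfolding d_def by (rule sum_mono)
    also have "\<dots> = (real (card K) * \<Lambda> / \<beta>) * (D * (1/2) ^ j * exp (\<beta> * t))" by simp
    also have "\<dots> \<le> (1/2) * (D * (1/2) ^ j * exp (\<beta> * t))"
      using D \<beta> by (intro mult_right_mono mult_nonneg_nonneg) (auto simp: field_simps)
    finally show ?case by (simp add: mult_ac)
  qed
  define B where "B = D * exp (\<beta> * T)"
  have step: "\<bar>p (Suc j) t k - p j t k\<bar> \<le> B * (1/2) ^ j" if t: "t \<in> {0..T}" and k: "k \<in> K" for j t k
  proof -
    have "\<bar>p (Suc j) t k - p j t k\<bar> \<le> d j t" unfolding d_def by (rule member_le_sum[OF k _ K]) auto
    also have "\<dots> \<le> D * (1/2) ^ j * exp (\<beta> * t)" by (rule dj[OF t])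
    also have "\<dots> \<le> D * (1/2) ^ j * exp (\<beta> * T)" using t \<beta> D by (intro mult_left_mono) auto
    finally show ?thesis by (simp add: B_def mult_ac)
  qed
  \<comment> \<open>The telescoping series of the iterates, uniformly convergent by the Weierstrass
    test with geometric majorant.\<close>
  define u where "u t k = a0 k + (\<Sum>j. p (Suc j) t k - p j t k)" for t k
  have ul: "uniform_limit {0..T} (\<lambda>n t. p n t k) (\<lambda>t. u t k) sequentially" if k: "k \<in> K" for k
  proof -
    have "uniform_limit {0..T} (\<lambda>n t. \<Sum>j<n. p (Suc j) t k - p j t k) (\<lambda>t. \<Sum>j. p (Suc j) t k - p j t k) sequentially"
      by (rule Weierstrass_m_test[where M = "\<lambda>j. B * (1/2) ^ j"]) (use step k in \<open>auto intro!: summable_mult\<close>)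
    from uniform_limit_add[OF uniform_limit_const[where c = "\<lambda>t. a0 k"] this]
    have "uniform_limit {0..T} (\<lambda>n t. a0 k + (\<Sum>j<n. p (Suc j) t k - p j t k)) (\<lambda>t. u t k) sequentially"
      by (simp add: u_def)
    moreover have "a0 k + (\<Sum>j<n. p (Suc j) t k - p j t k) = p n t k" for n t
      by (simp add: sum_lessThan_telescope[where f = "\<lambda>j. p j t k"] p0)
    ultimately show ?thesis by simp
  qed
  have uc: "continuous_on {0..T} (\<lambda>t. u t k)" if "k \<in> K" for k
    by (rule uniform_limit_theorem[OF _ ul[OF that]]) (use pc that in auto)
  have Fu: "continuous_on {0..T} (\<lambda>t. F (u t) k)" if "k \<in> K" for k by (intro Fc uc that)
  have eq: "u t k = a0 k + TI (\<lambda>s. F (u s) k) t" if k: "k \<in> K" and t: "t \<in> {0..T}" for k t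
  proof -
    have "(\<lambda>n. TI (\<lambda>s. F (p n s) k) t - TI (\<lambda>s. F (u s) k) t) \<longlonglongrightarrow> 0"
    proof (rule LIMSEQ_I)
      fix e :: real assume e: "e > 0"
      define c where "c = \<Lambda> * real (card K) * T + 1"
      have c: "c > 0" using \<Lambda> T_pos by (auto simp: c_def intro!: add_nonneg_pos)
      have "\<forall>\<^sub>F n in sequentially. \<forall>l\<in>K. \<forall>s\<in>{0..T}. dist (p n s l) (u s l) < e / c"
        using ul e c K by (intro eventually_ball_finite) (auto simp: uniform_limit_iff)
      then obtain n0 where n0: "\<And>n l s. n \<ge> n0 \<Longrightarrow> l \<in> K \<Longrightarrow> s \<in> {0..T} \<Longrightarrow> \<bar>p n s l - u s l\<bar> < e / c"
        unfolding eventually_sequentially dist_real_def by blast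
      have "norm (TI (\<lambda>s. F (p n s) k) t - TI (\<lambda>s. F (u s) k) t - 0) < e" if n: "n \<ge> n0" for n
      proof -
        have "\<bar>TI (\<lambda>s. F (p n s) k - F (u s) k) t\<bar> \<le> (\<Lambda> * (real (card K) * (e / c))) * T"
        proof (rule TI_const_mult_le[OF _ _ t])
          show "AE s in tM. \<bar>F (p n s) k - F (u s) k\<bar> \<le> \<Lambda> * (real (card K) * (e / c))"
          proof (rule AE_I2)
            fix s assume "s \<in> space tM"
            then have s: "s \<in> {0..T}" by simp
            have "(\<Sum>l\<in>K. \<bar>p n s l - u s l\<bar>) \<le> (\<Sum>l\<in>K. e / c)"
              by (intro sum_mono less_imp_le n0[OF n _ s])
            then have "\<Lambda> * (\<Sum>l\<in>K. \<bar>p n s l - u s l\<bar>) \<le> \<Lambda> * (real (card K) * (e / c))"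
              using \<Lambda> by (intro mult_left_mono) simp_all
            then show "\<bar>F (p n s) k - F (u s) k\<bar> \<le> \<Lambda> * (real (card K) * (e / c))"
              using lip[OF k] order_trans by blast
          qed
        qed (intro Bochner_Integration.integrable_diff Fi k integrable_continuous_tM Fu)
        also have "\<dots> = (\<Lambda> * real (card K) * T) * (e / c)" by simp
        also have "\<dots> < c * (e / c)" using e c by (intro mult_strict_right_mono) (auto simp: c_def)
        also have "\<dots> = e" using c by simp
        finally show ?thesis
          using TI_diff_fun[OF Fi[OF k] integrable_continuous_tM[OF Fu[OF k]]] by simp
      qed
      then show "\<exists>n0. \<forall>n\<ge>n0. norm (TI (\<lambda>s. F (p n s) k) t - TI (\<lambda>s. F (u s) k) t - 0) < e" by blast
    qed
    from tendsto_add[OF this tendsto_const[of "a0 k + TI (\<lambda>s. F (u s) k) t"]]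
    have "(\<lambda>n. p (Suc n) t k) \<longlonglongrightarrow> a0 k + TI (\<lambda>s. F (u s) k) t" by (simp add: pS add.commute)
    moreover have "(\<lambda>n. p (Suc n) t k) \<longlonglongrightarrow> u t k"
      using tendsto_uniform_limitI[OF ul[OF k] t] LIMSEQ_Suc by blast
    ultimately show ?thesis using LIMSEQ_unique by blast
  qed
  show ?thesis using uc Fu eq by blast
qed

end

section \<open>Galerkin approximations\<close>

context calmed_time
begin

definition clip :: "real \<Rightarrow> real \<Rightarrow> real" where "clip R x = max (- R) (min R x)"

lemma clip_lipschitz: "\<bar>clip R x - clip R y\<bar> \<le> \<bar>x - y\<bar>"
  by (auto simp: clip_def max_def min_def abs_if)

lemma clip_le: "R \<ge> 0 \<Longrightarrow> \<bar>clip R x\<bar> \<le> \<bar>x\<bar>" "R \<ge> 0 \<Longrightarrow> \<bar>clip R x\<bar> \<le> R"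
  by (auto simp: clip_def max_def min_def abs_if)

lemma clip_id: "\<bar>x\<bar> \<le> R \<Longrightarrow> clip R x = x"
  by (auto simp: clip_def max_def min_def abs_if split: if_splits)

lemma sum_sq_le_sq_sum: "finite K \<Longrightarrow> (\<Sum>k\<in>K. (x k)\<^sup>2) \<le> (\<Sum>k\<in>K. \<bar>x k\<bar>)\<^sup>2" for x :: "'b \<Rightarrow> real"
proof (induction K rule: finite_induct)
  case (insert k K)
  have "0 \<le> 2 * \<bar>x k\<bar> * (\<Sum>k\<in>K. \<bar>x k\<bar>)" by (intro mult_nonneg_nonneg sum_nonneg) auto
  from add_increasing2[OF this insert.IH]
  show ?case using insert.hyps by (simp add: power2_sum)
qed simp

definition lam_sum :: "nat \<Rightarrow> real" where "lam_sum n = (\<Sum>k\<in>modes n. lam k)"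

lemma lam_le_sum: "k \<in> modes n \<Longrightarrow> lam k \<le> lam_sum n"
  unfolding lam_sum_def using finite_modes lam_nonneg by (intro member_le_sum) auto

lemma lam_sum_nonneg: "0 \<le> lam_sum n" unfolding lam_sum_def by (intro sum_nonneg lam_nonneg)

lemma wsq_lam_supported_le:
  assumes "\<And>k. k \<notin> modes n \<Longrightarrow> a k = 0" "\<And>k. \<bar>a k\<bar> \<le> \<bar>x k\<bar>"
  shows "wsq lam_w a \<le> lam_sum n * (\<Sum>k\<in>modes n. \<bar>x k\<bar>)\<^sup>2"
proof -
  have "wsq lam_w a = wpart lam_w a n" by (rule wsq_supported(2)[OF assms(1)])
  also have "\<dots> \<le> (\<Sum>k\<in>modes n. lam_sum n * (x k)\<^sup>2)"
    unfolding wpart_def using assms(2)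
    by (intro sum_mono mult_mono lam_le_sum lam_sum_nonneg) (auto simp: abs_le_square_iff)
  also have "\<dots> = lam_sum n * (\<Sum>k\<in>modes n. (x k)\<^sup>2)" by (simp add: sum_distrib_left)
  also have "\<dots> \<le> lam_sum n * (\<Sum>k\<in>modes n. \<bar>x k\<bar>)\<^sup>2"
    by (intro mult_left_mono sum_sq_le_sq_sum finite_modes lam_sum_nonneg)
  finally show ?thesis .
qed

text \<open>The coefficients entering the nonlinearity are clipped at level \<open>R\<close>, since
  the Lipschitz factor of \<open>NL\<close> grows with the gradient of one argument; the clipped
  system is globally Lipschitz and accessible to Picard iteration.\<close>

definition galerkin_rhs :: "nat \<Rightarrow> real \<Rightarrow> (int \<times> int \<Rightarrow> real) \<Rightarrow> int \<times> int \<Rightarrow> real" where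
  "galerkin_rhs n R a k = (lam k - (lam k)\<^sup>2) * a k - 1/2 * NL (trunc n (\<lambda>l. clip R (a l))) k"

lemma lin_coeff_bound:
  assumes "k \<in> modes n"
  shows "\<bar>lam k - (lam k)\<^sup>2\<bar> \<le> lam_sum n + (lam_sum n)\<^sup>2"
proof -
  have "(lam k)\<^sup>2 \<le> (lam_sum n)\<^sup>2" by (intro power_mono lam_le_sum assms lam_nonneg)
  moreover have "\<bar>x - y\<bar> \<le> a + b" if "0 \<le> x" "x \<le> a" "0 \<le> y" "y \<le> b" for x y a b :: real
    using that by simp
  ultimately show ?thesis using lam_le_sum[OF assms] lam_nonneg[of k] zero_le_power2[of "lam k"] by blast
qed

lemma abs_diff_half: "\<bar>x\<bar> \<le> p \<Longrightarrow> \<bar>y\<bar> \<le> q \<Longrightarrow> \<bar>x - 1/2 * y\<bar> \<le> p + q" for x y p q :: real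
  by linarith

lemma galerkin_rhs_lipschitz:
  assumes R: "R \<ge> 0"
  shows "\<exists>\<Lambda>\<ge>0. \<forall>a b. \<forall>k\<in>modes n. \<bar>galerkin_rhs n R a k - galerkin_rhs n R b k\<bar> \<le> \<Lambda> * (\<Sum>l\<in>modes n. \<bar>a l - b l\<bar>)"
proof -
  define s where "s = lam_sum n"
  have s: "s \<ge> 0" by (simp add: s_def lam_sum_nonneg)
  define W where "W = nl_const * (Mb\<^sup>2 * L\<^sup>2 + s * (real (card (modes n)) * R)\<^sup>2)"
  have W: "W \<ge> 0" using s nl_const_pos by (simp add: W_def)
  define c where "c = W * s * (1 + s\<^sup>2)"
  have c: "c \<ge> 0" using W s by (simp add: c_def)
  show ?thesis
  proof (intro exI[of _ "s + s\<^sup>2 + sqrt c"] conjI allI ballI)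
    show "0 \<le> s + s\<^sup>2 + sqrt c" using s c by simp
    fix a b :: "int \<times> int \<Rightarrow> real" and k assume k: "k \<in> modes n"
    define A B S where "A = trunc n (\<lambda>l. clip R (a l))" and "B = trunc n (\<lambda>l. clip R (b l))"
      and "S = (\<Sum>l\<in>modes n. \<bar>a l - b l\<bar>)"
    have S: "\<bar>a k - b k\<bar> \<le> S" "0 \<le> S" unfolding S_def
      using member_le_sum[OF k, of "\<lambda>l. \<bar>a l - b l\<bar>"] finite_modes by (auto intro!: sum_nonneg)
    have fin: "wfin h2_w A" "wfin h2_w B" unfolding A_def B_def by (rule wfin_trunc)+
    have "wsq lam_w B \<le> s * (\<Sum>k\<in>modes n. \<bar>R\<bar>)\<^sup>2"
      unfolding s_def by (rule wsq_lam_supported_le) (use R clip_le(2) in \<open>auto simp: B_def trunc_def\<close>)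
    then have "wsq lam_w B \<le> s * (real (card (modes n)) * R)\<^sup>2" using R by simp
    then have wB: "nl_weight B \<le> W" unfolding nl_weight_def W_def using nl_const_pos by (intro mult_left_mono) auto
    have wd: "wsq lam_w (\<lambda>k. A k - B k) \<le> s * S\<^sup>2"
      unfolding s_def S_def
      by (rule wsq_lam_supported_le) (auto simp: A_def B_def trunc_def clip_lipschitz)
    have wd0: "0 \<le> wsq lam_w (\<lambda>k. A k - B k)"
      by (intro wsq_nonneg lam_nonneg wfin_diff(1) h2_fin fin)
    have "(NL A k - NL B k)\<^sup>2 \<le> nl_weight B * wsq lam_w (\<lambda>k. A k - B k) * (1 + (lam k)\<^sup>2)"
      by (rule NL_diff_coeff[OF fin])
    also have "\<dots> \<le> W * (s * S\<^sup>2) * (1 + s\<^sup>2)"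
    proof (intro mult_mono wB wd wd0 add_left_mono power_mono)
      show "lam k \<le> s" unfolding s_def by (rule lam_le_sum[OF k])
    qed (use W s lam_nonneg wd0 in auto)
    also have "\<dots> = c * S\<^sup>2" by (simp add: c_def)
    finally have "\<bar>NL A k - NL B k\<bar> \<le> sqrt (c * S\<^sup>2)" by (simp add: real_le_rsqrt)
    also have "sqrt (c * S\<^sup>2) = sqrt c * S" using S by (simp add: real_sqrt_mult)
    finally have nl: "\<bar>NL A k - NL B k\<bar> \<le> sqrt c * S" .
    have "\<bar>lam k - (lam k)\<^sup>2\<bar> * \<bar>a k - b k\<bar> \<le> (s + s\<^sup>2) * S"
      using lin_coeff_bound[OF k] S by (intro mult_mono) (auto simp: s_def intro!: add_nonneg_nonneg lam_sum_nonneg)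
    then have lin: "\<bar>(lam k - (lam k)\<^sup>2) * (a k - b k)\<bar> \<le> (s + s\<^sup>2) * S" by (simp add: abs_mult)
    have "galerkin_rhs n R a k - galerkin_rhs n R b k = (lam k - (lam k)\<^sup>2) * (a k - b k) - 1/2 * (NL A k - NL B k)"
      by (simp add: galerkin_rhs_def A_def B_def algebra_simps)
    then have "\<bar>galerkin_rhs n R a k - galerkin_rhs n R b k\<bar> \<le> (s + s\<^sup>2) * S + sqrt c * S"
      using abs_diff_half[OF lin nl] by simp
    then show "\<bar>galerkin_rhs n R a k - galerkin_rhs n R b k\<bar> \<le> (s + s\<^sup>2 + sqrt c) * (\<Sum>l\<in>modes n. \<bar>a l - b l\<bar>)"
      by (simp add: S_def distrib_right)
  qed
qed

text \<open>In contrast to the Lipschitz constant, this linear growth constant is free of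
  \<open>R\<close>, because boundedness of \<eta> gives the nonlinearity linear growth and clipping
  only shrinks coefficients. So \<open>R\<close> can be chosen afterwards without
  circularity.\<close>

lemma galerkin_rhs_growth:
  assumes R: "R \<ge> 0" and k: "k \<in> modes n"
  shows "\<bar>galerkin_rhs n R a k\<bar> \<le> (lam_sum n + (lam_sum n)\<^sup>2 + Mb * sqrt (lam_sum n)) * (\<Sum>l\<in>modes n. \<bar>a l\<bar>)"
proof -
  define s S A where "s = lam_sum n" and "S = (\<Sum>l\<in>modes n. \<bar>a l\<bar>)" and "A = trunc n (\<lambda>l. clip R (a l))"
  have s: "s \<ge> 0" by (simp add: s_def lam_sum_nonneg)
  have S: "\<bar>a k\<bar> \<le> S" "0 \<le> S" unfolding S_def
    using member_le_sum[OF k, of "\<lambda>l. \<bar>a l\<bar>"] finite_modes by (auto intro!: sum_nonneg)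
  have fin: "wfin h2_w A" unfolding A_def by (rule wfin_trunc)
  have "wsq lam_w A \<le> s * S\<^sup>2" unfolding s_def S_def
    by (rule wsq_lam_supported_le) (use clip_le(1)[OF R] in \<open>auto simp: A_def trunc_def\<close>)
  then have "Mb\<^sup>2 * wsq lam_w A \<le> Mb\<^sup>2 * (s * S\<^sup>2)" by (intro mult_left_mono) auto
  then have "(NL A k)\<^sup>2 \<le> Mb\<^sup>2 * (s * S\<^sup>2)" using NL_coeff_bound[OF fin, of k] by linarith
  then have "\<bar>NL A k\<bar> \<le> sqrt (Mb\<^sup>2 * (s * S\<^sup>2))" by (simp add: real_le_rsqrt)
  also have "\<dots> = Mb * sqrt s * S" using S Mb_nonneg by (simp add: real_sqrt_mult)
  finally have nl: "\<bar>NL A k\<bar> \<le> Mb * sqrt s * S" .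
  have "\<bar>lam k - (lam k)\<^sup>2\<bar> * \<bar>a k\<bar> \<le> (s + s\<^sup>2) * S"
    using lin_coeff_bound[OF k] S by (intro mult_mono) (auto simp: s_def intro!: add_nonneg_nonneg lam_sum_nonneg)
  then have lin: "\<bar>(lam k - (lam k)\<^sup>2) * a k\<bar> \<le> (s + s\<^sup>2) * S" by (simp add: abs_mult)
  have "\<bar>galerkin_rhs n R a k\<bar> \<le> (s + s\<^sup>2) * S + Mb * sqrt s * S"
    unfolding galerkin_rhs_def A_def[symmetric] by (rule abs_diff_half[OF lin nl])
  then show ?thesis by (simp add: s_def S_def distrib_right)
qed

definition galerkin :: "(int \<times> int \<Rightarrow> real) \<Rightarrow> nat \<Rightarrow> (real \<Rightarrow> int \<times> int \<Rightarrow> real) \<Rightarrow> bool" where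
  "galerkin a0 n c \<longleftrightarrow> coeff_cont c \<and> (\<forall>t k. k \<notin> modes n \<longrightarrow> c t k = 0) \<and>
    (\<forall>k\<in>modes n. \<forall>t\<in>{0..T}. c t k = a0 k + TI (\<lambda>s. rhs (c s) k) t)"

lemma galerkin_cont: "galerkin a0 n c \<Longrightarrow> coeff_cont c"
  unfolding galerkin_def by blast

lemma galerkin_off: "galerkin a0 n c \<Longrightarrow> k \<notin> modes n \<Longrightarrow> c t k = 0"
  unfolding galerkin_def by blast

lemma galerkin_eq:
  "galerkin a0 n c \<Longrightarrow> k \<in> modes n \<Longrightarrow> t \<in> {0..T} \<Longrightarrow> c t k = a0 k + TI (\<lambda>s. rhs (c s) k) t"
  unfolding galerkin_def by blast

text \<open>\<open>R\<close> is the very bound that Gronwall yields for the clipped solution; along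
  it no coefficient exceeds \<open>R\<close>, clipping does nothing, and the original truncated
  system is solved.\<close>

lemma galerkin_ex: "\<exists>c. galerkin a0 n c"
proof -
  define G where "G = lam_sum n + (lam_sum n)\<^sup>2 + Mb * sqrt (lam_sum n)"
  have G: "G \<ge> 0" using lam_sum_nonneg[of n] Mb_nonneg by (simp add: G_def)
  \<comment> \<open>Chosen so that the constant Gronwall coefficient
    \<open>card (modes n) * G\<close> has integral at most \<open>N / 2\<close> over
    \<open>[0, T]\<close>.\<close>
  define N where "N = nat \<lceil>2 * (real (card (modes n)) * G * T)\<rceil>"
  define A where "A = (\<Sum>k\<in>modes n. \<bar>a0 k\<bar>)"
  define R where "R = 2 ^ N * A"
  have A: "A \<ge> 0" by (simp add: A_def sum_nonneg)
  then have R: "R \<ge> 0" by (simp add: R_def)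
  obtain \<Lambda> where \<Lambda>: "0 \<le> \<Lambda>"
    "\<And>a b k. k \<in> modes n \<Longrightarrow> \<bar>galerkin_rhs n R a k - galerkin_rhs n R b k\<bar> \<le> \<Lambda> * (\<Sum>l\<in>modes n. \<bar>a l - b l\<bar>)"
    using galerkin_rhs_lipschitz[OF R, of n] by blast
  obtain u where uc: "\<And>k. k \<in> modes n \<Longrightarrow> continuous_on {0..T} (\<lambda>t. u t k)"
    and Fc: "\<And>k. k \<in> modes n \<Longrightarrow> continuous_on {0..T} (\<lambda>t. galerkin_rhs n R (u t) k)"
    and ueq: "\<And>k t. k \<in> modes n \<Longrightarrow> t \<in> {0..T} \<Longrightarrow> u t k = a0 k + TI (\<lambda>s. galerkin_rhs n R (u s) k) t"
    using picard_global[where F = "galerkin_rhs n R" and ?a0.0 = a0, OF finite_modes \<Lambda>] by blast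
  define y where "y t = (\<Sum>k\<in>modes n. \<bar>u t k\<bar>)" for t
  have yc: "continuous_on {0..T} y" unfolding y_def by (intro continuous_intros uc)
  have y0: "0 \<le> y t" for t by (simp add: y_def sum_nonneg)
  have Gi: "integrable tM (\<lambda>s. G * y s)" by (intro integrable_continuous_tM continuous_intros yc)
  have uk: "\<bar>u t k\<bar> \<le> \<bar>a0 k\<bar> + TI (\<lambda>s. G * y s) t" if k: "k \<in> modes n" and t: "t \<in> {0..T}" for k t
  proof -
    have Fi: "integrable tM (\<lambda>s. galerkin_rhs n R (u s) k)" by (rule integrable_continuous_tM[OF Fc[OF k]])
    have "\<bar>TI (\<lambda>s. galerkin_rhs n R (u s) k) t\<bar> \<le> TI (\<lambda>s. \<bar>galerkin_rhs n R (u s) k\<bar>) t"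
      using TI_abs_diff[OF Fi, of 0 t] t by (simp add: TI_0)
    also have "\<dots> \<le> TI (\<lambda>s. G * y s) t"
      by (rule TI_mono_AE[OF _ Gi]) (use Fi galerkin_rhs_growth[OF R k] in \<open>auto simp: G_def y_def\<close>)
    finally show ?thesis using ueq[OF k t] by linarith
  qed
  have ybound: "y t \<le> R" if t: "t \<in> {0..T}" for t
    unfolding R_def
  proof (rule gronwall_doubling[where b = "\<lambda>s. real (card (modes n)) * G" and f = y, OF _ _ _ _ _ A _ t])
    show "integrable tM (\<lambda>s. real (card (modes n)) * G)" by (rule integrable_const_tM)
    show "AE s in tM. 0 \<le> real (card (modes n)) * G" using G by simp
    show "integrable tM (\<lambda>s. real (card (modes n)) * G * y s)"
      by (intro integrable_continuous_tM continuous_intros yc)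
    show "0 \<le> y s" for s by (rule y0)
    show "y s \<le> A + TI (\<lambda>s. real (card (modes n)) * G * y s) s" if s: "s \<in> {0..T}" for s
    proof -
      have "y s \<le> (\<Sum>k\<in>modes n. \<bar>a0 k\<bar> + TI (\<lambda>s. G * y s) s)" unfolding y_def[of s] by (intro sum_mono uk s)
      also have "\<dots> = A + real (card (modes n)) * TI (\<lambda>s. G * y s) s" by (simp add: sum.distrib A_def)
      finally show ?thesis by (simp add: TI_cmult[symmetric] mult.assoc)
    qed
    have "2 * (real (card (modes n)) * G * T) \<le> real N" unfolding N_def using real_nat_ceiling_ge by blast
    then show "(\<integral>s. real (card (modes n)) * G \<partial>tM) \<le> real N / 2"
      using T_pos by (simp add: measure_restrict_space mult_ac)
  qed
  define c where "c t = trunc n (u t)" for t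
  have cs: "c t k = 0" if "k \<notin> modes n" for t k using that by (simp add: c_def trunc_def)
  have "coeff_cont c" unfolding coeff_cont_def
  proof
    fix k show "continuous_on {0..T} (\<lambda>t. c t k)"
      using uc[of k] by (cases "k \<in> modes n") (simp_all add: c_def trunc_def)
  qed
  moreover have "c t k = a0 k + TI (\<lambda>s. rhs (c s) k) t" if k: "k \<in> modes n" and t: "t \<in> {0..T}" for t k
  proof -
    have e: "galerkin_rhs n R (u s) k = rhs (c s) k" if s: "s \<in> {0..T}" for s
    proof -
      have "trunc n (\<lambda>l. clip R (u s l)) = c s"
      proof
        fix l show "trunc n (\<lambda>l. clip R (u s l)) l = c s l"
        proof (cases "l \<in> modes n")
          case True
          have "\<bar>u s l\<bar> \<le> y s" unfolding y_def by (rule member_le_sum[OF True _ finite_modes]) simp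
          then have "clip R (u s l) = u s l" using ybound[OF s] by (intro clip_id) simp
          then show ?thesis by (simp add: c_def trunc_def)
        qed (simp add: c_def trunc_def)
      qed
      then show ?thesis using k by (simp add: galerkin_rhs_def rhs_def c_def trunc_def)
    qed
    have "c t k = a0 k + TI (\<lambda>s. galerkin_rhs n R (u s) k) t" using ueq[OF k t] k by (simp add: c_def trunc_def)
    also have "TI (\<lambda>s. galerkin_rhs n R (u s) k) t = TI (\<lambda>s. rhs (c s) k) t"
      unfolding TI_def by (intro Bochner_Integration.integral_cong refl) (use e in simp)
    finally show ?thesis .
  qed
  ultimately have "galerkin a0 n c" unfolding galerkin_def using cs by blast
  then show ?thesis by blast
qed

end

section \<open>Convergence of the Galerkin approximations\<close>

text \<open>First \<open>\<delta>\<close> is fixed to make \<open>\<delta> * P\<close> small, then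
  \<open>n\<close> is taken large. Together with \<open>abs_le_AMGM\<close> this replaces
  Cauchy-Schwarz in time for an integrand bounded by the root of a product.\<close>

lemma small_if_AMGM_bound:
  fixes x r q :: "nat \<Rightarrow> real"
  assumes r: "r \<longlonglongrightarrow> 0" and q: "q \<longlonglongrightarrow> 0" and P: "0 \<le> P"
    and x: "\<And>n. 0 \<le> x n" "\<And>n \<delta>. \<delta> > 0 \<Longrightarrow> x n \<le> r n + (\<delta> * P + q n / \<delta>)"
  shows "x \<longlonglongrightarrow> 0"
proof (rule LIMSEQ_I)
  fix e :: real assume e: "e > 0"
  define \<delta> where "\<delta> = e / (3 * (P + 1))"
  have \<delta>: "\<delta> > 0" using e P by (simp add: \<delta>_def)
  have dP: "\<delta> * P < e / 3"
  proof -
    have "\<delta> * P < \<delta> * (P + 1)" using \<delta> by simp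
    also have "\<dots> = e / 3" using P by (simp add: \<delta>_def field_simps)
    finally show ?thesis .
  qed
  have "\<forall>\<^sub>F n in sequentially. r n < e / 3" using order_tendstoD(2)[OF r, of "e / 3"] e by simp
  moreover have "\<forall>\<^sub>F n in sequentially. q n < \<delta> * (e / 3)" using order_tendstoD(2)[OF q, of "\<delta> * (e / 3)"] e \<delta> by simp
  ultimately have "\<forall>\<^sub>F n in sequentially. norm (x n - 0) < e"
  proof eventually_elim
    case (elim n)
    have "q n / \<delta> < e / 3" using elim(2) \<delta> by (simp add: field_simps)
    then have "x n < e" using x(2)[OF \<delta>, of n] elim(1) dP by linarith
    then show ?case using x(1)[of n] by simp
  qed
  then show "\<exists>N. \<forall>n\<ge>N. norm (x n - 0) < e" by (simp add: eventually_sequentially)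
qed

lemma abs_le_AMGM:
  fixes x P Q \<delta> :: real
  assumes "x\<^sup>2 \<le> P * Q" "0 \<le> P" "0 \<le> Q" "\<delta> > 0"
  shows "\<bar>x\<bar> \<le> \<delta> * P + Q / \<delta>"
proof (rule power2_le_imp_le)
  have amgm: "4 * (y * z) \<le> (y + z)\<^sup>2" for y z :: real
    using zero_le_power2[of "y - z"] by (simp add: power2_sum power2_diff)
  have "4 * ((\<delta> * P) * (Q / \<delta>)) \<le> (\<delta> * P + Q / \<delta>)\<^sup>2" by (rule amgm)
  moreover have "(\<delta> * P) * (Q / \<delta>) = P * Q" using assms by simp
  moreover have "0 \<le> P * Q" using assms by simp
  ultimately show "\<bar>x\<bar>\<^sup>2 \<le> (\<delta> * P + Q / \<delta>)\<^sup>2" using assms(1) unfolding power2_abs by linarith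
  show "0 \<le> \<delta> * P + Q / \<delta>" using assms by simp
qed

context torus_side
begin

lemma wpart_mono_coeff: "(\<And>k. \<bar>a k\<bar> \<le> \<bar>b k\<bar>) \<Longrightarrow> (\<And>k. 0 \<le> w k) \<Longrightarrow> wpart w a n \<le> wpart w b n"
  unfolding wpart_def by (intro sum_mono mult_left_mono) (auto simp: abs_le_square_iff)

lemma wsq_mono_coeff:
  assumes "\<And>k. \<bar>a k\<bar> \<le> \<bar>b k\<bar>" "\<And>k. 0 \<le> w k" "wfin w b"
  shows "wsq w a \<le> wsq w b"
  by (rule wsq_le[OF assms(2)])
    (rule order_trans[OF wpart_mono_coeff[OF assms(1,2)] wpart_le_wsq[OF assms(2,3)]])

text \<open>The smallest eigenvalue outside \<open>modes m\<close>, attained with one index equal to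
  \<open>m + 1\<close> in modulus and the other 0.\<close>

definition gap :: "nat \<Rightarrow> real" where "gap m = freq\<^sup>2 * (real m + 1)\<^sup>2"

lemma gap_pos: "gap m > 0" using freq_pos by (simp add: gap_def)

lemma gap_le_lam:
  assumes "k \<notin> modes m"
  shows "gap m \<le> lam k"
proof -
  have "fst k > int m \<or> - fst k > int m \<or> snd k > int m \<or> - snd k > int m"
    using assms by (cases k) (auto simp: modes_def)
  then have "real_of_int \<bar>fst k\<bar> \<ge> real m + 1 \<or> real_of_int \<bar>snd k\<bar> \<ge> real m + 1" by linarith
  then have "(real m + 1)\<^sup>2 \<le> (real_of_int \<bar>fst k\<bar>)\<^sup>2 \<or> (real m + 1)\<^sup>2 \<le> (real_of_int \<bar>snd k\<bar>)\<^sup>2"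
    using power_mono[of "real m + 1" _ 2] by (meson add_nonneg_nonneg of_nat_0_le_iff zero_le_one)
  then have "(real m + 1)\<^sup>2 \<le> (real_of_int (fst k))\<^sup>2 \<or> (real m + 1)\<^sup>2 \<le> (real_of_int (snd k))\<^sup>2" by simp
  then have "(real m + 1)\<^sup>2 \<le> (idx 1 k)\<^sup>2 + (idx 2 k)\<^sup>2"
    unfolding idx_def by (auto intro: order_trans)
  then show ?thesis unfolding gap_def lam_def by (intro mult_left_mono) auto
qed

lemma inverse_gap_tendsto: "(\<lambda>m. 1 / gap m) \<longlonglongrightarrow> 0"
proof -
  have "(\<lambda>m. 1 / (real m + 1)) \<longlonglongrightarrow> 0"
    using LIMSEQ_inverse_real_of_nat by (simp add: divide_inverse add.commute)
  then have "(\<lambda>m. 1 / freq\<^sup>2 * (1 / (real m + 1))\<^sup>2) \<longlonglongrightarrow> 1 / freq\<^sup>2 * 0\<^sup>2" by (intro tendsto_intros)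
  then show ?thesis by (simp add: gap_def power_divide)
qed

end

context calmed_time
begin

lemma supported_Hpath:
  assumes c: "coeff_cont c" and s: "\<And>t k. k \<notin> modes n \<Longrightarrow> c t k = 0"
  shows "Hpath c"
  unfolding Hpath_def
proof (intro conjI)
  have "bounded ((\<lambda>t. wpart one_w (c t) n) ` {0..T})"
    by (intro compact_imp_bounded compact_continuous_image wpart_continuous c compact_Icc)
  then obtain C where C: "\<forall>t\<in>{0..T}. \<bar>wpart one_w (c t) n\<bar> \<le> C" unfolding bounded_iff by auto
  have "wpart one_w (c t) m \<le> C" if t: "t \<in> {0..T}" for t m
  proof -
    have "wpart one_w (c t) m \<le> wpart one_w (c t) n" by (rule wpart_supported_le[OF s]) auto
    also have "\<dots> \<le> C" using C t by (meson abs_le_D1)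
    finally show ?thesis .
  qed
  then show "\<exists>C. \<forall>t\<in>{0..T}. \<forall>n. wpart one_w (c t) n \<le> C" by blast
  show "AE t in tM. wfin h2_w (c t)" by (intro AE_I2 wsq_supported(1)[OF s])
  have "wsq lam2_w (c t) = wpart lam2_w (c t) n" for t by (rule wsq_supported(2)[OF s])
  then show "integrable tM (\<lambda>t. wsq lam2_w (c t))"
    using integrable_continuous_tM[OF wpart_continuous[OF c]] by simp
qed (rule c)

lemma Hpath_zero: "Hpath (\<lambda>t k. 0)"
  by (rule supported_Hpath[of _ 0]) (auto simp: coeff_cont_def)

text \<open>Monotone convergence in the mode cutoff. It is run first with extended nonnegative
  values, which yields finiteness almost everywhere; only then is \<open>wsq lam2_w\<close> a
  meaningful limit.\<close>

lemma Hpath_of_bounded_parts: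
  assumes c: "coeff_cont w" and one: "\<And>t n. t \<in> {0..T} \<Longrightarrow> wpart one_w (w t) n \<le> C0"
    and two: "\<And>j. (\<integral>t. wpart lam2_w (w t) j \<partial>tM) \<le> C2"
  shows "Hpath w" "(\<integral>t. wsq lam2_w (w t) \<partial>tM) \<le> C2"
proof -
  define g where "g j t = wpart lam2_w (w t) j" for j t
  have gi: "integrable tM (g j)" for j
    unfolding g_def by (intro integrable_continuous_tM wpart_continuous c)
  have g0: "0 \<le> g j t" for j t unfolding g_def by (rule wpart_nonneg) simp
  have gmono: "incseq (\<lambda>j. g j t)" for t
    unfolding g_def by (rule wpart_incseq) simp
  have "(\<integral>\<^sup>+t. (SUP j. ennreal (g j t)) \<partial>tM) = (SUP j. \<integral>\<^sup>+t. ennreal (g j t) \<partial>tM)"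
  proof (rule nn_integral_monotone_convergence_SUP)
    show "incseq (\<lambda>j t. ennreal (g j t))"
      using gmono by (auto simp: incseq_def le_fun_def intro: ennreal_leI)
    show "(\<lambda>t. ennreal (g j t)) \<in> borel_measurable tM" for j using gi[of j] by simp
  qed
  also have "\<dots> \<le> ennreal C2"
  proof (rule SUP_least)
    fix j
    have "(\<integral>\<^sup>+t. ennreal (g j t) \<partial>tM) = ennreal (\<integral>t. g j t \<partial>tM)"
      by (rule nn_integral_eq_integral[OF gi]) (use g0 in auto)
    also have "\<dots> \<le> ennreal C2" using two[of j] by (intro ennreal_leI) (simp add: g_def)
    finally show "(\<integral>\<^sup>+t. ennreal (g j t) \<partial>tM) \<le> ennreal C2" .
  qed
  also have "\<dots> < \<infinity>" by simp
  finally have fin: "(\<integral>\<^sup>+t. (SUP j. ennreal (g j t)) \<partial>tM) < \<infinity>" .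
  have "AE t in tM. (SUP j. ennreal (g j t)) \<noteq> \<infinity>"
  proof (rule nn_integral_PInf_AE)
    show "(\<lambda>t. SUP j. ennreal (g j t)) \<in> borel_measurable tM"
      by (intro borel_measurable_SUP) (use gi in auto)
  qed (use fin in auto)
  then have f2: "AE t in tM. wfin lam2_w (w t)"
  proof eventually_elim
    case (elim t)
    show ?case
    proof (rule wfinI)
      fix j
      have "ennreal (g j t) \<le> (SUP j. ennreal (g j t))" by (rule SUP_upper) simp
      then have "enn2real (ennreal (g j t)) \<le> enn2real (SUP j. ennreal (g j t))"
        using elim by (intro enn2real_mono) (metis infinity_ennreal_def top.not_eq_extremum)+
      then show "wpart lam2_w (w t) j \<le> enn2real (SUP j. ennreal (g j t))"
        using g0[of j t] by (simp add: g_def)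
    qed
  qed
  have f1: "wfin one_w (w t)" if "t \<in> {0..T}" for t by (rule wfinI[OF one[OF that]])
  have fh: "AE t in tM. wfin h2_w (w t)"
    using f2 AE_space
  proof eventually_elim
    case (elim t)
    show ?case by (rule wsq_add_weight(1)) (use elim f1 in auto)
  qed
  have "incseq (\<lambda>j. \<integral>t. g j t \<partial>tM)"
    by (intro monoI integral_mono gi) (use gmono in \<open>auto simp: incseq_def\<close>)
  then obtain x where x: "(\<lambda>j. \<integral>t. g j t \<partial>tM) \<longlonglongrightarrow> x"
    using incseq_convergent[of "\<lambda>j. \<integral>t. g j t \<partial>tM" C2] two unfolding g_def by blast
  have lim: "AE t in tM. (\<lambda>j. g j t) \<longlonglongrightarrow> wsq lam2_w (w t)"
    using f2 unfolding g_def by eventually_elim (rule wsq_lim, auto)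
  have m: "(\<lambda>t. wsq lam2_w (w t)) \<in> borel_measurable tM" by (rule wsq_measurable[OF c])
  have mono: "AE t in tM. mono (\<lambda>j. g j t)" using gmono by simp
  note mc = gi mono lim x m
  have "integrable tM (\<lambda>t. wsq lam2_w (w t))" by (rule integrable_monotone_convergence[OF mc])
  then show "Hpath w" unfolding Hpath_def using c one fh by blast
  have "(\<integral>t. wsq lam2_w (w t) \<partial>tM) = x" by (rule integral_monotone_convergence[OF mc])
  also have "x \<le> C2" by (rule LIMSEQ_le_const2[OF x]) (use two in \<open>auto simp: g_def\<close>)
  finally show "(\<integral>t. wsq lam2_w (w t) \<partial>tM) \<le> C2" .
qed

text \<open>The bound depends on \<open>b\<close> only through \<open>C1\<close> and
  \<open>C2\<close>, so that one Gronwall exponent serves the whole Galerkin sequence.\<close>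

lemma nl_weight_integral_bound:
  assumes b: "Hpath b" and C1: "\<And>t. t \<in> {0..T} \<Longrightarrow> wsq one_w (b t) \<le> C1"
    and C2: "(\<integral>s. wsq lam2_w (b s) \<partial>tM) \<le> C2" and C10: "0 \<le> C1"
  shows "(\<integral>s. 3 + (nl_weight (b s))\<^sup>2 \<partial>tM) \<le> 3 * T + 2 * nl_const\<^sup>2 * ((Mb\<^sup>2 * L\<^sup>2)\<^sup>2 * T + C1 * C2)"
proof -
  let ?x = "Mb\<^sup>2 * L\<^sup>2"
  let ?g = "\<lambda>s. (3 + 2 * nl_const\<^sup>2 * ?x\<^sup>2) + (2 * nl_const\<^sup>2 * C1) * wsq lam2_w (b s)"
  have gi: "integrable tM ?g"
    by (intro Bochner_Integration.integrable_add integrable_const_tM integrable_mult_right Hpath_int b)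
  have "(\<integral>s. 3 + (nl_weight (b s))\<^sup>2 \<partial>tM) \<le> (\<integral>s. ?g s \<partial>tM)"
  proof (rule integral_mono_AE[OF _ gi])
    show "integrable tM (\<lambda>s. 3 + (nl_weight (b s))\<^sup>2)"
      by (intro Bochner_Integration.integrable_add integrable_const_tM nl_weight_integrable b)
    show "AE s in tM. 3 + (nl_weight (b s))\<^sup>2 \<le> ?g s"
      using Hpath_AE[OF b] AE_space
    proof eventually_elim
      case (elim s)
      have w2: "0 \<le> wsq lam2_w (b s)" by (rule wsq_nonneg) (use h2_fin elim in auto)
      have "(wsq lam_w (b s))\<^sup>2 \<le> wsq one_w (b s) * wsq lam2_w (b s)" by (rule wsq_interp[OF elim(1)])
      also have "\<dots> \<le> C1 * wsq lam2_w (b s)" using C1 elim(2) w2 by (intro mult_right_mono) auto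
      finally have i: "(wsq lam_w (b s))\<^sup>2 \<le> C1 * wsq lam2_w (b s)" .
      have "(?x + wsq lam_w (b s))\<^sup>2 \<le> 2 * (?x\<^sup>2 + (wsq lam_w (b s))\<^sup>2)"
        using sum_squares_bound[of ?x "wsq lam_w (b s)"] by (simp add: power2_sum)
      also have "\<dots> \<le> 2 * (?x\<^sup>2 + C1 * wsq lam2_w (b s))" using i by simp
      finally have "nl_const\<^sup>2 * (?x + wsq lam_w (b s))\<^sup>2 \<le> nl_const\<^sup>2 * (2 * (?x\<^sup>2 + C1 * wsq lam2_w (b s)))"
        by (rule mult_left_mono) simp
      then show ?case unfolding nl_weight_def power_mult_distrib[of nl_const] by (simp add: algebra_simps)
    qed
  qed
  also have "\<dots> = (3 + 2 * nl_const\<^sup>2 * ?x\<^sup>2) * T + (2 * nl_const\<^sup>2 * C1) * (\<integral>s. wsq lam2_w (b s) \<partial>tM)"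
    using Hpath_int[OF b] integrable_const_tM T_pos by (simp add: measure_restrict_space)
  also have "\<dots> \<le> (3 + 2 * nl_const\<^sup>2 * ?x\<^sup>2) * T + (2 * nl_const\<^sup>2 * C1) * C2"
    using C2 C10 by (intro add_left_mono mult_left_mono) auto
  also have "\<dots> = 3 * T + 2 * nl_const\<^sup>2 * (?x\<^sup>2 * T + C1 * C2)" by (simp add: algebra_simps)
  finally show ?thesis .
qed

lemma galerkin_Hpath: "galerkin a0 n c \<Longrightarrow> Hpath c"
  by (rule supported_Hpath[OF galerkin_cont galerkin_off])

lemma galerkin_initial:
  assumes "galerkin a0 n c"
  shows "c 0 = trunc n a0"
proof
  fix k show "c 0 k = trunc n a0 k"
    using T_pos galerkin_eq[OF assms, of k 0] galerkin_off[OF assms, of k 0]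
    by (cases "k \<in> modes n") (simp_all add: trunc_def TI_0)
qed

lemma TI_zero_fun: "TI (\<lambda>s. 0) t = 0" by (simp add: TI_def)

text \<open>The energy estimate against the zero path, for which \<open>NL\<close> vanishes. The
  constants do not depend on \<open>n\<close>.\<close>

lemma galerkin_a_priori:
  assumes g: "galerkin a0 n c" and a0: "wfin one_w a0"
    and N: "(\<integral>s. 3 + (nl_weight (\<lambda>k. 0))\<^sup>2 \<partial>tM) \<le> real N / 2"
  shows "\<And>t. t \<in> {0..T} \<Longrightarrow> wsq one_w (c t) \<le> 2 ^ N * wsq one_w a0"
    "(\<integral>s. wsq lam2_w (c s) \<partial>tM) \<le> (real N + 1) * 2 ^ N * wsq one_w a0"
proof -
  note Hp = galerkin_Hpath[OF g]
  \<comment> \<open>Outside \<open>modes n\<close> the path stays 0, so the residual cancels the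
    nonlinear output there; its pairing with \<open>c\<close> vanishes mode by mode.\<close>
  define f where "f s k = (if k \<in> modes n then 0 else 1/2 * NL (c s) k)" for s k
  have fi: "integrable tM (\<lambda>s. f s k)" for k
    using NL_integrable[OF Hp] by (cases "k \<in> modes n") (auto simp: f_def)
  have ev: "c t k - 0 = (c 0 k - 0) + TI (\<lambda>s. (lam k - (lam k)\<^sup>2) * (c s k - 0) - 1/2 * (NL (c s) k - NL (\<lambda>k. 0) k) + f s k) t"
    if t: "t \<in> {0..T}" for t k
  proof (cases "k \<in> modes n")
    case True
    have "c t k = a0 k + TI (\<lambda>s. rhs (c s) k) t" by (rule galerkin_eq[OF g True t])
    moreover have "c 0 k = a0 k" using galerkin_initial[OF g] True by (simp add: trunc_def)
    moreover have "(\<lambda>s. rhs (c s) k) = (\<lambda>s. (lam k - (lam k)\<^sup>2) * (c s k - 0) - 1/2 * (NL (c s) k - NL (\<lambda>k. 0) k) + f s k)"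
      using True by (simp add: rhs_def f_def NL_zero)
    ultimately show ?thesis by simp
  next
    case False
    then have c0: "c t k = 0" for t by (rule galerkin_off[OF g])
    have "(\<lambda>s. (lam k - (lam k)\<^sup>2) * (c s k - 0) - 1/2 * (NL (c s) k - NL (\<lambda>k. 0) k) + f s k) = (\<lambda>s. 0)"
      using False by (simp add: c0 f_def NL_zero)
    then show ?thesis by (simp add: c0 TI_zero_fun)
  qed
  have e3: "AE s in tM. \<forall>n. (\<Sum>k\<in>modes n. f s k * (c s k - 0)) \<le> 0"
  proof (intro AE_I2 allI)
    fix s m
    have "f s k * (c s k - 0) = 0" for k using galerkin_off[OF g, of k s] by (simp add: f_def)
    then have "(\<Sum>k\<in>modes m. f s k * (c s k - 0)) = 0" by (intro sum.neutral ballI)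
    then show "(\<Sum>k\<in>modes m. f s k * (c s k - 0)) \<le> 0" by simp
  qed
  have A: "wsq one_w (\<lambda>k. c 0 k - 0) + 2 * (\<integral>s. 0 \<partial>tM) \<le> wsq one_w a0"
  proof -
    have "wsq one_w (c 0) \<le> wsq one_w a0"
      unfolding galerkin_initial[OF g] by (rule wsq_mono_coeff) (auto simp: trunc_def a0)
    then show ?thesis by simp
  qed
  have e1: "integrable tM (\<lambda>s. 0::real)" by simp
  have e2: "AE s in tM. (0::real) \<le> 0" by simp
  note E = energy_estimate[OF Hp Hpath_zero fi ev e1 e2 e3 N A]
  show "\<And>t. t \<in> {0..T} \<Longrightarrow> wsq one_w (c t) \<le> 2 ^ N * wsq one_w a0" using E(1) by simp
  show "(\<integral>s. wsq lam2_w (c s) \<partial>tM) \<le> (real N + 1) * 2 ^ N * wsq one_w a0" using E(2) by simp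
qed

text \<open>The truncation error of the nonlinearity only involves modes outside \<open>modes m\<close>, where
  \<open>\<lambda> \<ge> gap m\<close>; this makes the Galerkin sequence Cauchy without a compactness argument.\<close>

lemma galerkin_cauchy:
  assumes gc: "galerkin a0 n c" and gd: "galerkin a0 m d" and mn: "m \<le> n" and a0: "wfin one_w a0"
    and N: "(\<integral>s. 3 + (nl_weight (d s))\<^sup>2 \<partial>tM) \<le> real N / 2"
    and C: "Mb\<^sup>2 * (\<integral>s. wsq lam_w (d s) \<partial>tM) + (\<integral>s. wsq lam2_w (c s) \<partial>tM) \<le> C"
    and A: "A = wsq one_w a0 - wpart one_w a0 m + 2 * (C / gap m)"
  shows "\<And>t. t \<in> {0..T} \<Longrightarrow> wsq one_w (\<lambda>k. c t k - d t k) \<le> 2 ^ N * A"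
    "(\<integral>s. wsq lam2_w (\<lambda>k. c s k - d s k) \<partial>tM) \<le> (real N + 1) * 2 ^ N * A"
proof -
  note Hc = galerkin_Hpath[OF gc] and Hd = galerkin_Hpath[OF gd]
  have sub: "modes m \<subseteq> modes n" by (rule modes_mono[OF mn])
  \<comment> \<open>Three ranges of modes: both paths solve their equations; only \<open>c\<close>
    evolves and the output of \<open>d\<close> must be removed; both are 0 and the entire nonlinear
    difference is cancelled. Only the middle range contributes to the pairing.\<close>
  define f where "f s k = (if k \<in> modes m then 0 else if k \<in> modes n then - (1/2 * NL (d s) k)
      else 1/2 * (NL (c s) k - NL (d s) k))" for s k
  have fi: "integrable tM (\<lambda>s. f s k)" for k
    using NL_integrable[OF Hc, of k] NL_integrable[OF Hd, of k]
    by (cases "k \<in> modes m"; cases "k \<in> modes n") (auto simp: f_def)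
  have cn: "c t k = 0" if "k \<notin> modes n" for t k by (rule galerkin_off[OF gc that])
  have dm: "d t k = 0" if "k \<notin> modes m" for t k by (rule galerkin_off[OF gd that])
  have ceq: "c t k = c 0 k + TI (\<lambda>s. rhs (c s) k) t" if "k \<in> modes n" "t \<in> {0..T}" for t k
    using galerkin_eq[OF gc that] galerkin_initial[OF gc] that by (simp add: trunc_def)
  have deq: "d t k = d 0 k + TI (\<lambda>s. rhs (d s) k) t" if "k \<in> modes m" "t \<in> {0..T}" for t k
    using galerkin_eq[OF gd that] galerkin_initial[OF gd] that by (simp add: trunc_def)
  have ev: "c t k - d t k = (c 0 k - d 0 k) +
      TI (\<lambda>s. (lam k - (lam k)\<^sup>2) * (c s k - d s k) - 1/2 * (NL (c s) k - NL (d s) k) + f s k) t"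
    (is "_ = _ + TI ?h t") if t: "t \<in> {0..T}" for t k
  proof -
    consider "k \<in> modes m" | "k \<notin> modes m" "k \<in> modes n" | "k \<notin> modes n" by blast
    then show ?thesis
    proof cases
      case 1
      have "?h = (\<lambda>s. rhs (c s) k - rhs (d s) k)" using 1 by (simp add: fun_eq_iff rhs_def f_def algebra_simps)
      moreover have "TI (\<lambda>s. rhs (c s) k - rhs (d s) k) t = TI (\<lambda>s. rhs (c s) k) t - TI (\<lambda>s. rhs (d s) k) t"
        by (rule TI_diff_fun) (intro rhs_integrable Hc Hd)+
      ultimately show ?thesis using ceq[of k t] deq[of k t] 1 sub t by auto
    next
      case 2
      have "?h = (\<lambda>s. rhs (c s) k)" using 2 by (simp add: fun_eq_iff rhs_def f_def dm algebra_simps)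
      then show ?thesis using ceq[of k t] 2 t by (simp add: dm)
    next
      case 3
      then have k: "k \<notin> modes m" using sub by blast
      have "?h = (\<lambda>s. 0)" using 3 k by (simp add: fun_eq_iff f_def dm cn)
      then show ?thesis using cn[OF 3] dm[OF k] by (simp only: TI_zero_fun)
    qed
  qed
  define e where "e s = (Mb\<^sup>2 * wsq lam_w (d s) + wsq lam2_w (c s)) / gap m" for s
  have ei: "integrable tM e" unfolding e_def[abs_def]
    using Hpath_integrable_lam(1)[OF Hd] Hpath_int[OF Hc] by simp
  have e0: "AE s in tM. 0 \<le> e s"
    using Hpath_AE[OF Hc] Hpath_AE[OF Hd]
  proof eventually_elim
    case (elim s)
    have "0 \<le> wsq lam_w (d s)" by (intro wsq_nonneg lam_nonneg h2_fin elim)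
    moreover have "0 \<le> wsq lam2_w (c s)" by (rule wsq_nonneg) (use h2_fin elim in auto)
    ultimately show ?case using gap_pos by (simp add: e_def less_imp_le)
  qed
  have e3: "AE s in tM. \<forall>j. (\<Sum>k\<in>modes j. f s k * (c s k - d s k)) \<le> e s"
    using Hpath_AE[OF Hc] Hpath_AE[OF Hd]
  proof eventually_elim
    case (elim s)
    show ?case
    proof
      fix j
      \<comment> \<open>After multiplication by \<open>gap m\<close> the factor
        \<open>gap m * \<bar>c s k\<bar>\<close> is at most
        \<open>lam k * \<bar>c s k\<bar>\<close>, so one power of the gap is paid for by the
        Laplacian norm of \<open>c\<close>.\<close>
      have pt: "f s k * (c s k - d s k) \<le> ((NL (d s) k)\<^sup>2 + (lam k)\<^sup>2 * (c s k)\<^sup>2) / gap m" for k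
      proof (cases "k \<notin> modes m \<and> k \<in> modes n")
        case True
        have l: "gap m * \<bar>c s k\<bar> \<le> lam k * \<bar>c s k\<bar>" using gap_le_lam True by (intro mult_right_mono) auto
        have "(gap m * \<bar>c s k\<bar>)\<^sup>2 \<le> (lam k * \<bar>c s k\<bar>)\<^sup>2" by (rule power_mono[OF l]) (use gap_pos[of m] in auto)
        then have l2: "(gap m * c s k)\<^sup>2 \<le> (lam k)\<^sup>2 * (c s k)\<^sup>2" by (simp add: power_mult_distrib)
        have am: "- (1/2 * x) * y \<le> x\<^sup>2 + y\<^sup>2" for x y :: real
        proof -
          have "0 \<le> x\<^sup>2 / 16 + y\<^sup>2 + x * y / 2"
            using zero_le_power2[of "x / 4 + y"] by (simp add: power2_sum power_divide)
          moreover have "0 \<le> x\<^sup>2" by simp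
          ultimately have "- (x * y / 2) \<le> x\<^sup>2 + y\<^sup>2" by linarith
          then show ?thesis by simp
        qed
        have "gap m * (f s k * (c s k - d s k)) = - (1/2 * NL (d s) k) * (gap m * c s k)"
          using True by (simp add: f_def dm)
        also have "\<dots> \<le> (NL (d s) k)\<^sup>2 + (gap m * c s k)\<^sup>2" by (rule am)
        also have "\<dots> \<le> (NL (d s) k)\<^sup>2 + (lam k)\<^sup>2 * (c s k)\<^sup>2" using l2 by simp
        finally show ?thesis using gap_pos[of m] by (simp add: field_simps)
      next
        case False
        then have z: "f s k * (c s k - d s k) = 0" using cn dm sub by (auto simp: f_def)
        have "0 \<le> ((NL (d s) k)\<^sup>2 + (lam k)\<^sup>2 * (c s k)\<^sup>2) / gap m"
          using gap_pos[of m] by simp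
        then show ?thesis by (simp only: z)
      qed
      have "(\<Sum>k\<in>modes j. f s k * (c s k - d s k)) \<le> (\<Sum>k\<in>modes j. ((NL (d s) k)\<^sup>2 + (lam k)\<^sup>2 * (c s k)\<^sup>2) / gap m)"
        by (intro sum_mono pt)
      also have "\<dots> = ((\<Sum>k\<in>modes j. (NL (d s) k)\<^sup>2) + wpart lam2_w (c s) j) / gap m"
        by (simp add: wpart_def sum_divide_distrib[symmetric] sum.distrib)
      also have "\<dots> \<le> e s" unfolding e_def
        using NL_bound[OF elim(2), of j] wpart_le_wsq[OF _ h2_fin(3)[OF elim(1)], of j] gap_pos[of m]
        by (intro divide_right_mono add_mono) auto
      finally show "(\<Sum>k\<in>modes j. f s k * (c s k - d s k)) \<le> e s" .
    qed
  qed
  have "wsq one_w (\<lambda>k. c 0 k - d 0 k) \<le> wsq one_w (\<lambda>k. a0 k - trunc m a0 k)"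
    unfolding galerkin_initial[OF gc] galerkin_initial[OF gd]
  proof (rule wsq_mono_coeff)
    show "\<bar>trunc n a0 k - trunc m a0 k\<bar> \<le> \<bar>a0 k - trunc m a0 k\<bar>" for k
      using sub by (auto simp: trunc_def)
    show "wfin one_w (\<lambda>k. a0 k - trunc m a0 k)" by (rule wfin_diff(1)) (auto simp: a0 wfin_trunc)
  qed simp
  also have "\<dots> = wsq one_w a0 - wpart one_w a0 m" by (rule wsq_tail[OF _ a0]) simp
  finally have i0: "wsq one_w (\<lambda>k. c 0 k - d 0 k) \<le> wsq one_w a0 - wpart one_w a0 m" .
  have "(\<integral>s. e s \<partial>tM) = (Mb\<^sup>2 * (\<integral>s. wsq lam_w (d s) \<partial>tM) + (\<integral>s. wsq lam2_w (c s) \<partial>tM)) / gap m"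
    unfolding e_def using Hpath_integrable_lam(1)[OF Hd] Hpath_int[OF Hc] by simp
  also have "\<dots> \<le> C / gap m" using C gap_pos[of m] by (intro divide_right_mono) auto
  finally have A': "wsq one_w (\<lambda>k. c 0 k - d 0 k) + 2 * (\<integral>s. e s \<partial>tM) \<le> A" using i0 unfolding A by simp
  note E = energy_estimate[OF Hc Hd fi ev ei e0 e3 N A']
  show "\<And>t. t \<in> {0..T} \<Longrightarrow> wsq one_w (\<lambda>k. c t k - d t k) \<le> 2 ^ N * A" by (rule E(1))
  show "(\<integral>s. wsq lam2_w (\<lambda>k. c s k - d s k) \<partial>tM) \<le> (real N + 1) * 2 ^ N * A" by (rule E(2))
qed

text \<open>Uniform a priori bounds give one exponent \<open>N2\<close> for all Galerkin pairs,
  hence a common modulus \<open>E m\<close> tending to 0. The limit inherits continuity in L^2, and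
  convergence of the nonlinearity needs only the smallness of \<open>c n - a\<close> in the gradient
  norm, integrated over time.\<close>

lemma coefficient_solution_exists:
  assumes a0: "wfin one_w a0"
  obtains a where "Hpath a" "a 0 = a0"
    "\<And>t k. t \<in> {0..T} \<Longrightarrow> a t k = a0 k + TI (\<lambda>s. rhs (a s) k) t"
    "\<And>t. t \<in> {0..T} \<Longrightarrow> ((\<lambda>s. wsq one_w (\<lambda>k. a s k - a t k)) \<longlongrightarrow> 0) (at t within {0..T})"
proof -
  obtain c where c: "\<And>n. galerkin a0 n (c n)" using galerkin_ex by metis
  note Hc = galerkin_Hpath[OF c]
  have cc: "coeff_cont (c n)" for n by (rule Hpath_cont[OF Hc])
  obtain N1 :: nat where N1: "(\<integral>s. 3 + (nl_weight (\<lambda>k. 0))\<^sup>2 \<partial>tM) * 2 \<le> real N1" using real_arch_simple by blast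
  define C1 C2 where "C1 = 2 ^ N1 * wsq one_w a0" and "C2 = (real N1 + 1) * 2 ^ N1 * wsq one_w a0"
  have w0: "0 \<le> wsq one_w a0" by (rule wsq_nonneg) (use a0 in auto)
  have C: "0 \<le> C1" "0 \<le> C2" using w0 by (simp_all add: C1_def C2_def)
  have N1': "(\<integral>s. 3 + (nl_weight (\<lambda>k. 0))\<^sup>2 \<partial>tM) \<le> real N1 / 2" using N1 by simp
  have b1: "wsq one_w (c n t) \<le> C1" if "t \<in> {0..T}" for n t
    unfolding C1_def by (rule galerkin_a_priori(1)[OF c a0 N1' that])
  have b2: "(\<integral>s. wsq lam2_w (c n s) \<partial>tM) \<le> C2" for n
    unfolding C2_def by (rule galerkin_a_priori(2)[OF c a0 N1'])
  define B where "B = 3 * T + 2 * nl_const\<^sup>2 * ((Mb\<^sup>2 * L\<^sup>2)\<^sup>2 * T + C1 * C2)"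
  obtain N2 :: nat where N2: "B * 2 \<le> real N2"
    using real_arch_simple by blast
  have N2': "(\<integral>s. 3 + (nl_weight (c n s))\<^sup>2 \<partial>tM) \<le> real N2 / 2" for n
  proof -
    have "(\<integral>s. 3 + (nl_weight (c n s))\<^sup>2 \<partial>tM) \<le> B"
      unfolding B_def by (rule nl_weight_integral_bound[OF Hc _ b2 C(1)]) (rule b1)
    then show ?thesis using N2 by linarith
  qed
  define C3 where "C3 = Mb\<^sup>2 * (C1 * T + C2) + C2"
  have b3: "Mb\<^sup>2 * (\<integral>s. wsq lam_w (c m s) \<partial>tM) + (\<integral>s. wsq lam2_w (c n s) \<partial>tM) \<le> C3" for m n
  proof -
    have "(\<integral>s. wsq lam_w (c m s) \<partial>tM) \<le> (\<integral>s. wsq one_w (c m s) + wsq lam2_w (c m s) \<partial>tM)"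
      using Hpath_integrable_lam[OF Hc] Hpath_integrable_one[OF Hc] Hpath_int[OF Hc]
      by (intro integral_mono_AE) auto
    also have "\<dots> = (\<integral>s. wsq one_w (c m s) \<partial>tM) + (\<integral>s. wsq lam2_w (c m s) \<partial>tM)"
      using Hpath_integrable_one[OF Hc] Hpath_int[OF Hc] by simp
    also have "(\<integral>s. wsq one_w (c m s) \<partial>tM) \<le> (\<integral>s. C1 \<partial>tM)"
      by (rule integral_mono_AE[OF Hpath_integrable_one[OF Hc] integrable_const_tM]) (use b1 in \<open>auto intro!: AE_I2\<close>)
    also have "(\<integral>s. C1 \<partial>tM) = C1 * T" using T_pos by (simp add: measure_restrict_space)
    finally have "(\<integral>s. wsq lam_w (c m s) \<partial>tM) \<le> C1 * T + C2" using b2[of m] by linarith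
    then have "Mb\<^sup>2 * (\<integral>s. wsq lam_w (c m s) \<partial>tM) \<le> Mb\<^sup>2 * (C1 * T + C2)" by (rule mult_left_mono) simp
    then show ?thesis using b2[of n] unfolding C3_def by linarith
  qed
  \<comment> \<open>A single bound for all \<open>n \<ge> m\<close>: it contains the tail of the
    initial data and the truncation error \<open>C3 / gap m\<close>.\<close>
  define E where "E m = 2 ^ N2 * (wsq one_w a0 - wpart one_w a0 m + 2 * (C3 / gap m))" for m
  have E1: "wsq one_w (\<lambda>k. c n t k - c m t k) \<le> E m" if "m \<le> n" "t \<in> {0..T}" for m n t
    unfolding E_def by (rule galerkin_cauchy(1)[OF c c that(1) a0 N2' b3 refl that(2)])
  have E2: "(\<integral>s. wsq lam2_w (\<lambda>k. c n s k - c m s k) \<partial>tM) \<le> (real N2 + 1) * E m" if "m \<le> n" for m n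
    using galerkin_cauchy(2)[OF c c that a0 N2' b3 refl] by (simp add: E_def mult.assoc)
  have Elim: "E \<longlonglongrightarrow> 0"
  proof -
    have "(\<lambda>m. 2 ^ N2 * (wsq one_w a0 - wpart one_w a0 m + 2 * (C3 * (1 / gap m)))) \<longlonglongrightarrow> 2 ^ N2 * (wsq one_w a0 - wsq one_w a0 + 2 * (C3 * 0))"
      by (intro tendsto_intros inverse_gap_tendsto wsq_lim a0) simp
    then show ?thesis by (simp add: E_def[abs_def])
  qed
  have wpE: "wpart one_w (\<lambda>k. c n t k - c m t k) j \<le> E m" if mn: "m \<le> n" and t: "t \<in> {0..T}" for m n t j
  proof -
    have "wfin one_w (\<lambda>k. c n t k - c m t k)"
      using Hpath_bounded[OF Hpath_diff[OF Hc Hc]] t by metis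
    then have "wpart one_w (\<lambda>k. c n t k - c m t k) j \<le> wsq one_w (\<lambda>k. c n t k - c m t k)"
      by (rule wpart_le_wsq[rotated]) simp
    then show ?thesis using E1[OF mn t] by simp
  qed
  have E0: "0 \<le> E m" for m
  proof -
    have "0 \<le> wpart one_w (\<lambda>k. c m 0 k - c m 0 k) 0" by (rule wpart_nonneg) simp
    also have "\<dots> \<le> E m" using T_pos by (intro wpE) auto
    finally show ?thesis .
  qed
  have cE: "\<bar>c n t k - c m t k\<bar> \<le> sqrt (E m)" if mn: "m \<le> n" and t: "t \<in> {0..T}" for m n t k
  proof -
    obtain j where j: "k \<in> modes j" using in_some_modes by blast
    have "(c n t k - c m t k)\<^sup>2 \<le> wpart one_w (\<lambda>k. c n t k - c m t k) j"
      unfolding wpart_def using j finite_modes[of j] member_le_sum[of k "modes j" "\<lambda>k. (c n t k - c m t k)\<^sup>2"] by simp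
    then have "(c n t k - c m t k)\<^sup>2 \<le> E m" using wpE[OF mn t, of j] by simp
    then show ?thesis using real_sqrt_le_mono by fastforce
  qed
  have sE: "(\<lambda>m. sqrt (E m)) \<longlonglongrightarrow> 0" using tendsto_real_sqrt[OF Elim] by simp
  define a where "a t k = lim (\<lambda>n. c n t k)" for t k
  have lim: "(\<lambda>n. c n t k) \<longlonglongrightarrow> a t k" if t: "t \<in> {0..T}" for t k
  proof -
    have "Cauchy (\<lambda>n. c n t k)"
    proof (rule CauchyI)
      fix e :: real assume "e > 0"
      then have "\<forall>\<^sub>F m in sequentially. sqrt (E m) < e / 2" using order_tendstoD(2)[OF sE, of "e / 2"] by simp
      then obtain m where m: "sqrt (E m) < e / 2" by (auto simp: eventually_sequentially)
      have "norm (c i t k - c j t k) < e" if "i \<ge> m" "j \<ge> m" for i j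
        using cE[OF that(1) t, of k] cE[OF that(2) t, of k] m by simp
      then show "\<exists>M. \<forall>i\<ge>M. \<forall>j\<ge>M. norm (c i t k - c j t k) < e" by blast
    qed
    then show ?thesis unfolding a_def by (simp add: Cauchy_convergent_iff convergent_LIMSEQ_iff)
  qed
  have aE: "\<bar>c m t k - a t k\<bar> \<le> sqrt (E m)" if t: "t \<in> {0..T}" for m t k
  proof (rule LIMSEQ_le_const2)
    show "(\<lambda>n. \<bar>c m t k - c n t k\<bar>) \<longlonglongrightarrow> \<bar>c m t k - a t k\<bar>" by (intro tendsto_intros lim t)
    have "\<bar>c m t k - c n t k\<bar> \<le> sqrt (E m)" if "n \<ge> m" for n
      using cE[OF that t, of k] by (simp add: abs_minus_commute)
    then show "\<exists>N. \<forall>n\<ge>N. \<bar>c m t k - c n t k\<bar> \<le> sqrt (E m)" by blast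
  qed
  have ac: "coeff_cont a" unfolding coeff_cont_def
  proof
    fix k
    have "uniform_limit {0..T} (\<lambda>n t. c n t k) (\<lambda>t. a t k) sequentially"
    proof (rule uniform_limitI)
      fix e :: real assume "e > 0"
      then have "\<forall>\<^sub>F m in sequentially. sqrt (E m) < e" using order_tendstoD(2)[OF sE] by simp
      then show "\<forall>\<^sub>F n in sequentially. \<forall>t\<in>{0..T}. dist (c n t k) (a t k) < e"
      proof eventually_elim
        case (elim n)
        then show ?case using aE unfolding dist_real_def by (meson le_less_trans)
      qed
    qed
    then show "continuous_on {0..T} (\<lambda>t. a t k)"
      by (rule uniform_limit_theorem[rotated]) (use coeff_contD[OF cc] in auto)
  qed
  have dc: "coeff_cont (\<lambda>t k. c m t k - a t k)" for m by (rule coeff_cont_diff[OF cc ac])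
  have plim: "(\<lambda>n. wpart w (\<lambda>k. c n t k - c m t k) j) \<longlonglongrightarrow> wpart w (\<lambda>k. c m t k - a t k) j"
    if t: "t \<in> {0..T}" for w m t j
  proof -
    have "(\<lambda>n. wpart w (\<lambda>k. c n t k - c m t k) j) \<longlonglongrightarrow> wpart w (\<lambda>k. a t k - c m t k) j"
      unfolding wpart_def by (intro tendsto_intros lim t)
    then show ?thesis by (simp add: wpart_def power2_commute)
  qed
  have d1: "wpart one_w (\<lambda>k. c m t k - a t k) j \<le> E m" if t: "t \<in> {0..T}" for m t j
    by (rule LIMSEQ_le_const2[OF plim[OF t]]) (use wpE t in blast)
  \<comment> \<open>The limit in \<open>n\<close> is taken at a fixed mode cutoff \<open>j\<close>,
    where \<open>(lam_sum j)\<^sup>2 * E m\<close> is a constant majorant; the cutoff is removed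
    afterwards by \<open>Hpath_of_bounded_parts\<close>.\<close>
  have d2: "(\<integral>t. wpart lam2_w (\<lambda>k. c m t k - a t k) j \<partial>tM) \<le> (real N2 + 1) * E m" for m j
  proof (rule LIMSEQ_le_const2)
    let ?S = "(lam_sum j)\<^sup>2 * E m"
    show "(\<lambda>n. \<integral>t. wpart lam2_w (\<lambda>k. c (n + m) t k - c m t k) j \<partial>tM)
        \<longlonglongrightarrow> (\<integral>t. wpart lam2_w (\<lambda>k. c m t k - a t k) j \<partial>tM)"
    proof (rule integral_dominated_convergence[where w = "\<lambda>t. ?S"])
      show "(\<lambda>t. wpart lam2_w (\<lambda>k. c m t k - a t k) j) \<in> borel_measurable tM" by (rule wpart_measurable[OF dc])
      show "(\<lambda>t. wpart lam2_w (\<lambda>k. c (n + m) t k - c m t k) j) \<in> borel_measurable tM" for n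
        by (rule wpart_measurable[OF coeff_cont_diff[OF cc cc]])
      show "AE t in tM. (\<lambda>n. wpart lam2_w (\<lambda>k. c (n + m) t k - c m t k) j) \<longlonglongrightarrow> wpart lam2_w (\<lambda>k. c m t k - a t k) j"
      proof (rule AE_I2)
        fix t assume "t \<in> space tM"
        then have t: "t \<in> {0..T}" by simp
        show "(\<lambda>n. wpart lam2_w (\<lambda>k. c (n + m) t k - c m t k) j) \<longlonglongrightarrow> wpart lam2_w (\<lambda>k. c m t k - a t k) j"
          using LIMSEQ_ignore_initial_segment[OF plim[OF t, of lam2_w m j], of m] .
      qed
      show "AE t in tM. norm (wpart lam2_w (\<lambda>k. c (n + m) t k - c m t k) j) \<le> ?S" for n
      proof (rule AE_I2)
        fix t assume "t \<in> space tM"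
        then have t: "t \<in> {0..T}" by simp
        let ?w = "\<lambda>k. c (n + m) t k - c m t k"
        have "wpart lam2_w ?w j \<le> (\<Sum>k\<in>modes j. (lam_sum j)\<^sup>2 * (?w k)\<^sup>2)"
          unfolding wpart_def by (intro sum_mono mult_right_mono power_mono lam_le_sum lam_nonneg) auto
        also have "\<dots> = (lam_sum j)\<^sup>2 * wpart one_w ?w j" by (simp add: wpart_def sum_distrib_left)
        also have "\<dots> \<le> ?S" using wpE[of m "n + m" t j] t by (intro mult_left_mono) auto
        finally show "norm (wpart lam2_w ?w j) \<le> ?S" using wpart_nonneg[of lam2_w ?w j] by simp
      qed
    qed (rule integrable_const_tM)
    have "(\<integral>t. wpart lam2_w (\<lambda>k. c (n + m) t k - c m t k) j \<partial>tM) \<le> (real N2 + 1) * E m" for n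
    proof -
      note Hd = Hpath_diff[OF Hc Hc]
      have "(\<integral>t. wpart lam2_w (\<lambda>k. c (n + m) t k - c m t k) j \<partial>tM) \<le> (\<integral>t. wsq lam2_w (\<lambda>k. c (n + m) t k - c m t k) \<partial>tM)"
      proof (rule integral_mono_AE[OF _ Hpath_int[OF Hd]])
        show "integrable tM (\<lambda>t. wpart lam2_w (\<lambda>k. c (n + m) t k - c m t k) j)"
          by (intro integrable_continuous_tM wpart_continuous coeff_cont_diff cc)
        show "AE t in tM. wpart lam2_w (\<lambda>k. c (n + m) t k - c m t k) j \<le> wsq lam2_w (\<lambda>k. c (n + m) t k - c m t k)"
          using Hpath_AE[OF Hd[of "n + m" m]] by eventually_elim (intro wpart_le_wsq h2_fin, auto)
      qed
      then show ?thesis using E2[of m "n + m"] by simp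
    qed
    then show "\<exists>N. \<forall>n\<ge>N. (\<integral>t. wpart lam2_w (\<lambda>k. c (n + m) t k - c m t k) j \<partial>tM) \<le> (real N2 + 1) * E m" by blast
  qed
  have Hd: "Hpath (\<lambda>t k. c m t k - a t k)"
    and Id: "(\<integral>t. wsq lam2_w (\<lambda>k. c m t k - a t k) \<partial>tM) \<le> (real N2 + 1) * E m" for m
    by (rule Hpath_of_bounded_parts[OF dc d1 d2]; simp)+
  have d1': "wsq one_w (\<lambda>k. c m t k - a t k) \<le> E m" if t: "t \<in> {0..T}" for m t
    by (rule wsq_le[OF _ d1[OF t]]) simp
  have Ha: "Hpath a" using Hpath_diff[OF Hc[of 0] Hd[of 0]] by simp
  have a_init: "a 0 = a0"
  proof
    fix k
    obtain m where m: "k \<in> modes m" using in_some_modes by blast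
    have "c n 0 k = a0 k" if "n \<ge> m" for n
      using m modes_mono[OF that] galerkin_initial[OF c] by (auto simp: trunc_def)
    then have "\<forall>\<^sub>F n in sequentially. c n 0 k = a0 k" by (rule eventually_sequentiallyI)
    then have "(\<lambda>n. c n 0 k) \<longlonglongrightarrow> a0 k" by (rule tendsto_eventually)
    then show "a 0 k = a0 k" using LIMSEQ_unique lim[of 0 k] T_pos by fastforce
  qed
  have evol: "a t k = a0 k + TI (\<lambda>s. rhs (a s) k) t" if t: "t \<in> {0..T}" for t k
  proof -
    \<comment> \<open>The squared difference of nonlinear coefficients is at most
      \<open>P s * Q n s\<close>, where \<open>P\<close> is integrable and independent of
      \<open>n\<close>, and \<open>Q n\<close> tends to 0 in L^1. The weight is taken along the
      limit \<open>a\<close>, not along \<open>c n\<close>.\<close>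
    define P where "P s = nl_weight (a s) * (1 + (lam k)\<^sup>2)" for s
    define Q where "Q n s = wsq lam_w (\<lambda>k. c n s k - a s k)" for n s
    have iP: "integrable tM P" unfolding P_def nl_weight_def
      by (intro integrable_mult_left integrable_mult_right Bochner_Integration.integrable_add integrable_const_tM Hpath_integrable_lam Ha)
    have iQ: "integrable tM (Q n)" for n unfolding Q_def by (rule Hpath_integrable_lam(1)[OF Hd])
    have P0: "AE s in tM. 0 \<le> P s"
      using Hpath_integrable_lam(3)[OF Ha]
    proof eventually_elim
      case (elim s)
      then show ?case unfolding P_def nl_weight_def
        using nl_const_pos by (intro mult_nonneg_nonneg add_nonneg_nonneg) auto
    qed
    have Q0: "AE s in tM. 0 \<le> Q n s" for n unfolding Q_def by (rule Hpath_integrable_lam(3)[OF Hd])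
    define x where "x n = \<bar>TI (\<lambda>s. rhs (c n s) k) t - TI (\<lambda>s. rhs (a s) k) t\<bar>" for n
    define r where "r n = \<bar>lam k - (lam k)\<^sup>2\<bar> * sqrt (E n) * T" for n
    define q where "q n = E n * T + (real N2 + 1) * E n" for n
    have "x \<longlonglongrightarrow> 0"
    proof (rule small_if_AMGM_bound)
      have "(\<lambda>n. \<bar>lam k - (lam k)\<^sup>2\<bar> * sqrt (E n) * T) \<longlonglongrightarrow> \<bar>lam k - (lam k)\<^sup>2\<bar> * 0 * T"
        by (intro tendsto_intros sE)
      then show "r \<longlonglongrightarrow> 0" by (simp add: r_def[abs_def])
      have "(\<lambda>n. E n * T + (real N2 + 1) * E n) \<longlonglongrightarrow> 0 * T + (real N2 + 1) * 0"
        by (intro tendsto_intros Elim)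
      then show "q \<longlonglongrightarrow> 0" by (simp add: q_def[abs_def])
      show "0 \<le> (\<integral>s. P s \<partial>tM)" by (rule integral_nonneg_AE[OF P0])
      show "0 \<le> x n" for n by (simp add: x_def)
      fix n and \<delta> :: real assume \<delta>: "\<delta> > 0"
      let ?D = "\<lambda>s. rhs (c n s) k - rhs (a s) k"
      let ?B = "\<lambda>s. \<bar>lam k - (lam k)\<^sup>2\<bar> * sqrt (E n) + (\<delta> * P s + Q n s / \<delta>)"
      have iD: "integrable tM ?D" by (intro Bochner_Integration.integrable_diff rhs_integrable Hc Ha)
      have iB: "integrable tM ?B" using iP iQ integrable_const_tM by simp
      have "x n = \<bar>TI ?D t\<bar>" unfolding x_def by (simp add: TI_diff_fun rhs_integrable Hc Ha)
      also have "\<dots> \<le> TI (\<lambda>s. \<bar>?D s\<bar>) t" using TI_abs_diff[OF iD, of 0 t] t by (simp add: TI_0)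
      also have "\<dots> \<le> (\<integral>s. \<bar>?D s\<bar> \<partial>tM)" by (rule TI_le_total[OF _ _ t]) (use iD in auto)
      also have "\<dots> \<le> (\<integral>s. ?B s \<partial>tM)"
      proof (rule integral_mono_AE[OF _ iB])
        show "integrable tM (\<lambda>s. \<bar>?D s\<bar>)" using iD by simp
        show "AE s in tM. \<bar>?D s\<bar> \<le> ?B s"
          using Hpath_AE[OF Hc[of n]] Hpath_AE[OF Ha] P0 Q0[of n] AE_space
        proof eventually_elim
          case (elim s)
          have "(NL (c n s) k - NL (a s) k)\<^sup>2 \<le> P s * Q n s"
            using NL_diff_coeff[OF elim(1,2), of k] by (simp add: P_def Q_def mult_ac)
          then have nl: "\<bar>NL (c n s) k - NL (a s) k\<bar> \<le> \<delta> * P s + Q n s / \<delta>"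
            by (rule abs_le_AMGM[OF _ elim(3,4) \<delta>])
          have "\<bar>lam k - (lam k)\<^sup>2\<bar> * \<bar>c n s k - a s k\<bar> \<le> \<bar>lam k - (lam k)\<^sup>2\<bar> * sqrt (E n)"
            using aE elim(5) by (intro mult_left_mono) auto
          then have "\<bar>(lam k - (lam k)\<^sup>2) * (c n s k - a s k)\<bar> \<le> \<bar>lam k - (lam k)\<^sup>2\<bar> * sqrt (E n)"
            by (simp add: abs_mult)
          from abs_diff_half[OF this nl] show ?case by (simp add: rhs_def algebra_simps)
        qed
      qed
      also have "\<dots> = r n + (\<delta> * (\<integral>s. P s \<partial>tM) + (\<integral>s. Q n s \<partial>tM) / \<delta>)"
        using iP iQ integrable_const_tM T_pos by (simp add: r_def measure_restrict_space)
      also have "\<dots> \<le> r n + (\<delta> * (\<integral>s. P s \<partial>tM) + q n / \<delta>)"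
      proof -
        have "(\<integral>s. Q n s \<partial>tM) \<le> (\<integral>s. wsq one_w (\<lambda>k. c n s k - a s k) + wsq lam2_w (\<lambda>k. c n s k - a s k) \<partial>tM)"
          unfolding Q_def
          by (intro integral_mono_AE Bochner_Integration.integrable_add Hpath_integrable_lam(1,2)[OF Hd]
            Hpath_integrable_one[OF Hd] Hpath_int[OF Hd])
        also have "\<dots> = (\<integral>s. wsq one_w (\<lambda>k. c n s k - a s k) \<partial>tM) + (\<integral>s. wsq lam2_w (\<lambda>k. c n s k - a s k) \<partial>tM)"
          by (intro Bochner_Integration.integral_add Hpath_integrable_one[OF Hd] Hpath_int[OF Hd])
        also have "\<dots> \<le> (\<integral>s. E n \<partial>tM) + (real N2 + 1) * E n"
          by (intro add_mono Id integral_mono_AE[OF Hpath_integrable_one[OF Hd] integrable_const_tM])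
            (use d1' in \<open>auto intro!: AE_I2\<close>)
        also have "\<dots> = q n" using T_pos by (simp add: q_def measure_restrict_space mult.commute)
        finally show ?thesis using \<delta> by (simp add: divide_right_mono)
      qed
      finally show "x n \<le> r n + (\<delta> * (\<integral>s. P s \<partial>tM) + q n / \<delta>)" .
    qed
    then have "(\<lambda>n. TI (\<lambda>s. rhs (c n s) k) t - TI (\<lambda>s. rhs (a s) k) t) \<longlonglongrightarrow> 0"
      unfolding x_def by (simp add: tendsto_rabs_zero_iff)
    from tendsto_add[OF this tendsto_const[of "a0 k + TI (\<lambda>s. rhs (a s) k) t"]]
    have l1: "(\<lambda>n. a0 k + TI (\<lambda>s. rhs (c n s) k) t) \<longlonglongrightarrow> a0 k + TI (\<lambda>s. rhs (a s) k) t"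
      by (simp add: add.commute)
    obtain m where m: "k \<in> modes m" using in_some_modes by blast
    have "c n t k = a0 k + TI (\<lambda>s. rhs (c n s) k) t" if "n \<ge> m" for n
      using m modes_mono[OF that] by (intro galerkin_eq[OF c _ t]) blast
    then have "\<forall>\<^sub>F n in sequentially. c n t k = a0 k + TI (\<lambda>s. rhs (c n s) k) t" by (rule eventually_sequentiallyI)
    from Lim_transform_eventually[OF lim[OF t] this] have "(\<lambda>n. a0 k + TI (\<lambda>s. rhs (c n s) k) t) \<longlonglongrightarrow> a t k" .
    from LIMSEQ_unique[OF this l1] show ?thesis .
  qed
  have cont: "((\<lambda>s. wsq one_w (\<lambda>k. a s k - a t k)) \<longlongrightarrow> 0) (at t within {0..T})" if t: "t \<in> {0..T}" for t
  proof (rule tendstoI)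
    fix e :: real assume e: "e > 0"
    \<comment> \<open>\<open>a s - a t\<close> is compared with \<open>c m s - c m t\<close>. Using
      \<open>wfin_diff\<close> twice costs \<open>2 * (e / 4)\<close> for the Galerkin path and
      \<open>8 * E m\<close> for the two errors, together less than \<open>e\<close>.\<close>
    have "\<forall>\<^sub>F m in sequentially. E m < e / 16" using order_tendstoD(2)[OF Elim, of "e / 16"] e by simp
    then obtain m where m: "E m < e / 16" by (auto simp: eventually_sequentially)
    have cs: "c m s k = 0" if "k \<notin> modes m" for s k by (rule galerkin_off[OF c that])
    have "((\<lambda>s. wpart one_w (\<lambda>k. c m s k - c m t k) m) \<longlongrightarrow> wpart one_w (\<lambda>k. c m t k - c m t k) m) (at t within {0..T})"
      unfolding wpart_def
      by (intro tendsto_intros) (use coeff_contD[OF cc] t in \<open>simp add: continuous_on_def\<close>)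
    then have "((\<lambda>s. wpart one_w (\<lambda>k. c m s k - c m t k) m) \<longlongrightarrow> 0) (at t within {0..T})" by (simp add: wpart_def)
    then have "\<forall>\<^sub>F s in at t within {0..T}. wpart one_w (\<lambda>k. c m s k - c m t k) m < e / 4"
      by (rule order_tendstoD(2)) (use e in simp)
    moreover have "\<forall>\<^sub>F s in at t within {0..T}. s \<in> {0..T}" unfolding eventually_at_filter by simp
    ultimately show "\<forall>\<^sub>F s in at t within {0..T}. dist (wsq one_w (\<lambda>k. a s k - a t k)) 0 < e"
    proof eventually_elim
      case (elim s)
      have f: "wfin one_w (\<lambda>k. c m r k - a r k)" if "r \<in> {0..T}" for r by (rule wfinI[OF d1[OF that]])
      have fc: "wfin one_w (\<lambda>k. c m s k - c m t k)" by (rule wsq_supported(1)[of m]) (simp add: cs)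
      have fd: "wfin one_w (\<lambda>k. (c m s k - a s k) - (c m t k - a t k))"
        "wsq one_w (\<lambda>k. (c m s k - a s k) - (c m t k - a t k)) \<le> 2 * wsq one_w (\<lambda>k. c m s k - a s k) + 2 * wsq one_w (\<lambda>k. c m t k - a t k)"
        by (rule wfin_diff; use f elim t in simp)+
      have fe: "wfin one_w (\<lambda>k. (c m s k - c m t k) - ((c m s k - a s k) - (c m t k - a t k)))"
        "wsq one_w (\<lambda>k. (c m s k - c m t k) - ((c m s k - a s k) - (c m t k - a t k)))
          \<le> 2 * wsq one_w (\<lambda>k. c m s k - c m t k) + 2 * wsq one_w (\<lambda>k. (c m s k - a s k) - (c m t k - a t k))"
        by (rule wfin_diff; use fc fd in simp)+
      have i: "(\<lambda>k. (c m s k - c m t k) - ((c m s k - a s k) - (c m t k - a t k))) = (\<lambda>k. a s k - a t k)"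
        by (simp add: fun_eq_iff)
      have "wsq one_w (\<lambda>k. c m s k - c m t k) = wpart one_w (\<lambda>k. c m s k - c m t k) m"
        by (rule wsq_supported(2)) (simp add: cs)
      then have "wsq one_w (\<lambda>k. a s k - a t k) < e"
        using fe(2) fd(2) d1'[OF elim(2), of m] d1'[OF t, of m] elim(1) m unfolding i by linarith
      moreover have "0 \<le> wsq one_w (\<lambda>k. a s k - a t k)"
        by (rule wsq_nonneg) (use fe(1) in \<open>simp_all add: i\<close>)
      ultimately show ?case by simp
    qed
  qed
  show thesis by (rule that[OF Ha a_init evol cont])
qed

end

section \<open>From coefficients to weak solutions\<close>

text \<open>A simple function here takes finitely many values that are themselves functions.
  Restriction to the finite \<open>K\<close> makes the value constant elsewhere, so the range stays
  finite.\<close>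

lemma simple_function_restrict:
  assumes "finite K" "\<And>k. k \<in> K \<Longrightarrow> simple_function M (f k)"
  shows "simple_function M (\<lambda>t. restrict (\<lambda>k. f k t) K)"
  using assms
proof (induction K rule: finite_induct)
  case empty
  show ?case by simp
next
  case (insert k K)
  have "simple_function M (\<lambda>t. (f k t, restrict (\<lambda>k. f k t) K))"
  proof (rule simple_function_Pair)
    show "simple_function M (f k)" by (rule insert.prems) simp
    show "simple_function M (\<lambda>t. restrict (\<lambda>k. f k t) K)" by (rule insert.IH) (rule insert.prems, simp)
  qed
  from simple_function_compose1[OF this, of "\<lambda>p. (snd p)(k := fst p)"]
  have "simple_function M (\<lambda>t. (restrict (\<lambda>k. f k t) K)(k := f k t))" by (simp only: fst_conv snd_conv)
  moreover have "(\<lambda>t. (restrict (\<lambda>k. f k t) K)(k := f k t)) = (\<lambda>t. restrict (\<lambda>k. f k t) (insert k K))"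
    by (auto simp: fun_eq_iff restrict_def)
  ultimately show ?case by (simp only:)
qed

context torus_side
begin

text \<open>The linear relation is assumed for coefficients only, since Laplacians of chosen
  representatives depend linearly on the function merely almost everywhere.\<close>

lemma L2_inner_lincomb:
  assumes "x \<in> L2 L" "z \<in> L2 L" "y \<in> L2 L" "y' \<in> L2 L" "\<And>k. hat z k = a * hat y k + b * hat y' k"
  shows "L2_inner L x z = a * L2_inner L x y + b * L2_inner L x y'"
proof -
  have "(\<lambda>n. a * (\<Sum>k\<in>modes n. hat x k * hat y k) + b * (\<Sum>k\<in>modes n. hat x k * hat y' k))
      \<longlonglongrightarrow> a * L2_inner L x y + b * L2_inner L x y'"
    by (intro tendsto_intros Parseval assms)
  moreover have "a * (\<Sum>k\<in>modes n. hat x k * hat y k) + b * (\<Sum>k\<in>modes n. hat x k * hat y' k)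
      = (\<Sum>k\<in>modes n. hat x k * hat z k)" for n
    unfolding assms(5) sum_distrib_left sum.distrib[symmetric] by (intro sum.cong) (auto simp: algebra_simps)
  ultimately have "(\<lambda>n. \<Sum>k\<in>modes n. hat x k * hat z k) \<longlonglongrightarrow> a * L2_inner L x y + b * L2_inner L x y'" by simp
  from LIMSEQ_unique[OF Parseval[OF assms(1,2)] this] show ?thesis .
qed

lemma L2_norm_hat:
  assumes "u \<in> L2 L"
  shows "L2_norm L u = sqrt (wsq one_w (hat u))"
  using wsq_one_hat(2)[OF assms] by (simp add: L2_norm_def)

lemma wsq_lam_mult: "wsq one_w (\<lambda>k. - lam k * a k) = wsq lam2_w a"
proof -
  have "wpart one_w (\<lambda>k. - lam k * a k) = wpart lam2_w a"
    by (simp add: fun_eq_iff wpart_def power_mult_distrib)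
  then show ?thesis by (simp add: wsq_def)
qed

lemma h2_parts:
  assumes "wfin h2_w a"
  shows "0 \<le> wsq one_w a" "0 \<le> wsq lam2_w a" "0 \<le> wsq lam_w a" "wsq one_w a \<le> wsq h2_w a"
    "wsq lam2_w a \<le> wsq h2_w a" "wsq lam_w a \<le> wsq h2_w a" "0 \<le> wsq h2_w a"
proof -
  note f = h2_fin[OF assms]
  show 1: "0 \<le> wsq one_w a" and 2: "0 \<le> wsq lam2_w a" by (intro wsq_nonneg f; simp)+
  show "0 \<le> wsq lam_w a" by (intro wsq_nonneg f lam_nonneg)
  show "wsq one_w a \<le> wsq h2_w a" "wsq lam2_w a \<le> wsq h2_w a" "0 \<le> wsq h2_w a" using f(4) 1 2 by simp_all
  have "wsq lam_w a \<le> 1 * wsq h2_w a"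
    by (rule wsq_mono) (use lam_le_h2 lam_nonneg assms in auto)
  then show "wsq lam_w a \<le> wsq h2_w a" by simp
qed

lemma Hm2_norm_controls:
  assumes v: "v \<in> Hm L 2"
  shows "L2_norm L v \<le> 2 * Hm_norm L 2 v" "L2_norm L (laplacian L v) \<le> 2 * Hm_norm L 2 v"
    "sqrt (wsq h2_w (hat v)) \<le> 2 * Hm_norm L 2 v"
proof -
  note p = h2_parts[OF Hm2_fin[OF v]]
  have n0: "0 \<le> Hm_norm L 2 v" unfolding Hm_norm_def by (intro real_sqrt_ge_zero sum_nonneg) simp
  have "wsq h2_w (hat v) \<le> 2 * (Hm_norm L 2 v)\<^sup>2" by (rule Hm2_norm_bounds(2)[OF v])
  also have "\<dots> \<le> (2 * Hm_norm L 2 v)\<^sup>2" by (simp add: power_mult_distrib)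
  finally have "sqrt (wsq h2_w (hat v)) \<le> sqrt ((2 * Hm_norm L 2 v)\<^sup>2)" by (rule real_sqrt_le_mono)
  also have "\<dots> = 2 * Hm_norm L 2 v" using n0 by (simp add: real_sqrt_mult)
  finally show h: "sqrt (wsq h2_w (hat v)) \<le> 2 * Hm_norm L 2 v" .
  have "L2_norm L v \<le> sqrt (wsq h2_w (hat v))"
    unfolding L2_norm_hat[OF Hm2_L2[OF v]] using p by (intro real_sqrt_le_mono)
  then show "L2_norm L v \<le> 2 * Hm_norm L 2 v" using h by simp
  have "hat (laplacian L v) = (\<lambda>k. - lam k * hat v k)" using laplacian_Hm2(2)[OF v] by auto
  then have "L2_norm L (laplacian L v) = sqrt (wsq lam2_w (hat v))"
    unfolding L2_norm_hat[OF laplacian_Hm2(1)[OF v]] by (simp add: wsq_lam_mult[symmetric])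
  also have "\<dots> \<le> sqrt (wsq h2_w (hat v))" using p by (intro real_sqrt_le_mono)
  finally show "L2_norm L (laplacian L v) \<le> 2 * Hm_norm L 2 v" using h by simp
qed

text \<open>The supremum is one of reals, so the zero function is exhibited to make the unit ball
  nonempty, and \<open>K\<close> supplies boundedness.\<close>

lemma Hneg2_norm_le:
  assumes "\<And>v. v \<in> Hm L 2 \<Longrightarrow> Hm_norm L 2 v \<le> 1 \<Longrightarrow> \<bar>F v\<bar> \<le> K"
  shows "Hneg2_norm L F \<le> K" "0 \<le> Hneg2_norm L F"
proof -
  let ?S = "{v \<in> Hm L 2. Hm_norm L 2 v \<le> 1}"
  have z: "(\<lambda>x. 0) \<in> Hm L 2" using Hm2_diff[OF hart_Hm2 hart_Hm2, of 0 0] by simp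
  have "hat (\<lambda>x. 0) = (\<lambda>k. 0)" by (simp add: fun_eq_iff hat_def L2_inner_def)
  moreover have "wpart h2_w (\<lambda>k. 0) = (\<lambda>n. 0)" by (simp add: fun_eq_iff wpart_def)
  then have "wsq h2_w (\<lambda>k. 0) = 0" by (simp add: wsq_def limI)
  ultimately have "(Hm_norm L 2 (\<lambda>x. 0))\<^sup>2 \<le> 0" using Hm2_norm_bounds(1)[OF z] by simp
  then have "Hm_norm L 2 (\<lambda>x. 0) = 0" by simp
  with z have m: "(\<lambda>x. 0) \<in> ?S" by simp
  then show "Hneg2_norm L F \<le> K" unfolding Hneg2_norm_def using assms by (intro cSUP_least) auto
  have "bdd_above ((\<lambda>v. \<bar>F v\<bar>) ` ?S)" using assms by (intro bdd_aboveI[of _ K]) auto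
  from cSUP_upper[OF m this] show "0 \<le> Hneg2_norm L F"
    unfolding Hneg2_norm_def using abs_ge_zero order_trans by blast
qed

end

context calmed
begin

text \<open>The time derivative that the equation prescribes, so that the equation itself becomes a
  matter of unfolding and the work lies in showing that this is the distributional
  derivative.\<close>

definition ks_functional :: "(real^2 \<Rightarrow> real) \<Rightarrow> (real^2 \<Rightarrow> real) \<Rightarrow> real" where
  "ks_functional u v = - (1/2 * L2_inner L (nl u) v + L2_inner L (laplacian L u) v + bilaplacian L u v)"

lemma ks_functional_linear:
  assumes u: "u \<in> Hm L 2" and v: "v \<in> Hm L 2" and w: "w \<in> Hm L 2"
  shows "ks_functional u (\<lambda>x. a * v x + b * w x) = a * ks_functional u v + b * ks_functional u w"
proof -
  note z = Hm2_lincomb[OF v w, of a b]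
  have hz: "hat (\<lambda>x. a * v x + b * w x) k = a * hat v k + b * hat w k" for k
    using hat_add[OF L2_cmult L2_cmult, OF Hm2_L2 Hm2_L2, OF v w] by (simp add: hat_cmult)
  have 1: "L2_inner L x (\<lambda>x. a * v x + b * w x) = a * L2_inner L x v + b * L2_inner L x w" if "x \<in> L2 L" for x
    by (rule L2_inner_lincomb[OF that Hm2_L2[OF z] Hm2_L2[OF v] Hm2_L2[OF w] hz])
  have 2: "bilaplacian L u (\<lambda>x. a * v x + b * w x) = a * bilaplacian L u v + b * bilaplacian L u w"
    unfolding bilaplacian_def
    by (rule L2_inner_lincomb[OF laplacian_Hm2(1)[OF u] laplacian_Hm2(1)[OF z] laplacian_Hm2(1)[OF v] laplacian_Hm2(1)[OF w]])
      (simp add: laplacian_Hm2(2)[OF z] laplacian_Hm2(2)[OF v] laplacian_Hm2(2)[OF w] hz algebra_simps)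
  show ?thesis
    unfolding ks_functional_def 2 1[OF nl_L2(1)[OF u]] 1[OF laplacian_Hm2(1)[OF u]] by (simp add: algebra_simps)
qed

lemma ks_functional_bound:
  assumes u: "u \<in> Hm L 2" and v: "v \<in> Hm L 2"
  shows "\<bar>ks_functional u v\<bar> \<le> (Mb + 6) * sqrt (wsq h2_w (hat u)) * Hm_norm L 2 v"
proof -
  note p = h2_parts[OF Hm2_fin[OF u]] and c = Hm2_norm_controls[OF v]
  let ?W = "sqrt (wsq h2_w (hat u))" and ?n = "Hm_norm L 2 v"
  have n0: "0 \<le> ?n" unfolding Hm_norm_def by (intro real_sqrt_ge_zero sum_nonneg) simp
  have lapn: "L2_norm L (laplacian L u) \<le> ?W"
  proof -
    have "hat (laplacian L u) = (\<lambda>k. - lam k * hat u k)" using laplacian_Hm2(2)[OF u] by auto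
    then have "L2_norm L (laplacian L u) = sqrt (wsq lam2_w (hat u))"
      unfolding L2_norm_hat[OF laplacian_Hm2(1)[OF u]] by (simp add: wsq_lam_mult[symmetric])
    then show ?thesis using p by simp
  qed
  have nln: "L2_norm L (nl u) \<le> Mb * ?W"
  proof -
    have "L2_inner L (nl u) (nl u) \<le> Mb\<^sup>2 * wsq h2_w (hat u)"
      using nl_L2(2)[OF u] mult_left_mono[OF p(6), of "Mb\<^sup>2"] by simp
    then have "L2_norm L (nl u) \<le> sqrt (Mb\<^sup>2 * wsq h2_w (hat u))"
      unfolding L2_norm_def by (rule real_sqrt_le_mono)
    then show ?thesis using Mb_nonneg by (simp add: real_sqrt_mult)
  qed
  have W0: "0 \<le> ?W" using p by simp
  have "\<bar>L2_inner L (nl u) v\<bar> \<le> L2_norm L (nl u) * L2_norm L v"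
    by (rule L2_Cauchy_Schwarz[OF nl_L2(1)[OF u] Hm2_L2[OF v]])
  also have "\<dots> \<le> (Mb * ?W) * (2 * ?n)" using nln c L2_norm_nonneg Mb_nonneg W0 by (intro mult_mono) auto
  finally have 1: "\<bar>L2_inner L (nl u) v\<bar> \<le> (Mb * ?W) * (2 * ?n)" .
  have "\<bar>L2_inner L (laplacian L u) v\<bar> \<le> L2_norm L (laplacian L u) * L2_norm L v"
    by (rule L2_Cauchy_Schwarz[OF laplacian_Hm2(1)[OF u] Hm2_L2[OF v]])
  also have "\<dots> \<le> ?W * (2 * ?n)" using lapn c L2_norm_nonneg W0 by (intro mult_mono) auto
  finally have 2: "\<bar>L2_inner L (laplacian L u) v\<bar> \<le> ?W * (2 * ?n)" .
  have "\<bar>bilaplacian L u v\<bar> \<le> L2_norm L (laplacian L u) * L2_norm L (laplacian L v)"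
    unfolding bilaplacian_def by (rule L2_Cauchy_Schwarz[OF laplacian_Hm2(1)[OF u] laplacian_Hm2(1)[OF v]])
  also have "\<dots> \<le> ?W * (2 * ?n)" using lapn c L2_norm_nonneg W0 by (intro mult_mono) auto
  finally have 3: "\<bar>bilaplacian L u v\<bar> \<le> ?W * (2 * ?n)" .
  have "\<bar>- (1/2 * x + y + z)\<bar> \<le> 1/2 * A + B + D" if "\<bar>x\<bar> \<le> A" "\<bar>y\<bar> \<le> B" "\<bar>z\<bar> \<le> D" for x y z A B D :: real
    using that by linarith
  from this[OF 1 2 3] have "\<bar>ks_functional u v\<bar> \<le> (Mb + 4) * ?W * ?n"
    unfolding ks_functional_def by (simp add: algebra_simps)
  also have "\<dots> \<le> (Mb + 6) * ?W * ?n" using W0 n0 by (intro mult_right_mono) auto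
  finally show ?thesis .
qed

lemma ks_functional_Hneg2: "u \<in> Hm L 2 \<Longrightarrow> ks_functional u \<in> Hneg2 L"
  unfolding Hneg2_def using ks_functional_linear ks_functional_bound by blast

text \<open>Continuity of the functional in H^-2 with respect to \<open>u\<close> in H^2, the weight
  being taken at the fixed \<open>u'\<close>. It carries simple approximations of the solution over
  to its time derivative.\<close>

lemma ks_functional_diff:
  assumes u: "u \<in> Hm L 2" and u': "u' \<in> Hm L 2" and v: "v \<in> Hm L 2" "Hm_norm L 2 v \<le> 1"
  shows "\<bar>ks_functional u v - ks_functional u' v\<bar>
    \<le> (sqrt (nl_weight (hat u')) + 4) * sqrt (wsq h2_w (\<lambda>k. hat u k - hat u' k))"
proof -
  let ?w = "\<lambda>k. hat u k - hat u' k"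
  let ?W = "sqrt (wsq h2_w ?w)"
  have fw: "wfin h2_w ?w" by (rule wfin_diff(1)) (use u u' Hm2_fin in auto)
  note p = h2_parts[OF fw] and c = Hm2_norm_controls[OF v(1)]
  have W0: "0 \<le> ?W" using p by simp
  have p': "0 \<le> nl_weight (hat u')"
    unfolding nl_weight_def using nl_const_pos h2_parts(3)[OF Hm2_fin[OF u']]
    by (intro mult_nonneg_nonneg add_nonneg_nonneg) auto
  define X where "X = L2_inner L (nl u) v - L2_inner L (nl u') v"
  have "X\<^sup>2 \<le> nl_weight (hat u') * wsq lam_w ?w * wsq h2_w (hat v)"
  proof (rule LIMSEQ_le_const2)
    have "(\<lambda>n. (\<Sum>k\<in>modes n. hat (nl u) k * hat v k) - (\<Sum>k\<in>modes n. hat (nl u') k * hat v k)) \<longlonglongrightarrow> X"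
      unfolding X_def by (intro tendsto_diff Parseval nl_L2 u u' Hm2_L2 v)
    moreover have "(\<Sum>k\<in>modes n. hat (nl u) k * hat v k) - (\<Sum>k\<in>modes n. hat (nl u') k * hat v k)
        = (\<Sum>k\<in>modes n. hat v k * (hat (nl u) k - hat (nl u') k))" for n
      unfolding sum_subtractf[symmetric] by (intro sum.cong) (auto simp: algebra_simps)
    ultimately show "(\<lambda>n. (\<Sum>k\<in>modes n. hat v k * (hat (nl u) k - hat (nl u') k))\<^sup>2) \<longlonglongrightarrow> X\<^sup>2"
      by (intro tendsto_power) simp
    have "(\<Sum>k\<in>modes n. hat v k * (hat (nl u) k - hat (nl u') k))\<^sup>2 \<le> nl_weight (hat u') * wsq lam_w ?w * wsq h2_w (hat v)" for n
    proof -
      have "(\<Sum>k\<in>modes n. hat v k * (hat (nl u) k - hat (nl u') k))\<^sup>2 \<le> nl_weight (hat u') * wsq lam_w ?w * wpart h2_w (hat v) n"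
        by (rule nl_hat_diff[OF u u'])
      also have "\<dots> \<le> nl_weight (hat u') * wsq lam_w ?w * wsq h2_w (hat v)"
        using p p' by (intro mult_left_mono wpart_le_wsq Hm2_fin v mult_nonneg_nonneg) auto
      finally show ?thesis .
    qed
    then show "\<exists>N. \<forall>n\<ge>N. (\<Sum>k\<in>modes n. hat v k * (hat (nl u) k - hat (nl u') k))\<^sup>2 \<le> nl_weight (hat u') * wsq lam_w ?w * wsq h2_w (hat v)"
      by blast
  qed
  also have "\<dots> \<le> nl_weight (hat u') * wsq h2_w ?w * 2\<^sup>2"
  proof (intro mult_mono mult_left_mono p(6) p')
    have "wsq h2_w (hat v) \<le> 2 * (Hm_norm L 2 v)\<^sup>2" by (rule Hm2_norm_bounds(2)[OF v(1)])
    also have "(Hm_norm L 2 v)\<^sup>2 \<le> 1\<^sup>2"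
      by (rule power_mono[OF v(2)]) (simp add: Hm_norm_def sum_nonneg)
    finally show "wsq h2_w (hat v) \<le> 2\<^sup>2" by simp
  qed (use p p' h2_parts[OF Hm2_fin[OF v(1)]] in auto)
  finally have "sqrt (X\<^sup>2) \<le> sqrt (nl_weight (hat u') * wsq h2_w ?w * 2\<^sup>2)" by (rule real_sqrt_le_mono)
  then have 1: "\<bar>X\<bar> \<le> 2 * (sqrt (nl_weight (hat u')) * ?W)" by (simp add: real_sqrt_mult)
  define d where "d = (\<lambda>x. laplacian L u x - laplacian L u' x)"
  have dL: "d \<in> L2 L" unfolding d_def by (intro L2_diff laplacian_Hm2 u u')
  have "hat d = (\<lambda>k. - lam k * ?w k)"
    unfolding d_def using hat_diff[OF laplacian_Hm2(1) laplacian_Hm2(1), OF u u'] laplacian_Hm2(2)[OF u] laplacian_Hm2(2)[OF u']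
    by (auto simp: algebra_simps)
  then have "L2_norm L d = sqrt (wsq lam2_w ?w)"
    unfolding L2_norm_hat[OF dL] using wsq_lam_mult[of ?w] by simp
  then have dn: "L2_norm L d \<le> ?W" using p by simp
  have "\<bar>L2_inner L d v\<bar> \<le> L2_norm L d * L2_norm L v" by (rule L2_Cauchy_Schwarz[OF dL Hm2_L2[OF v(1)]])
  also have "\<dots> \<le> ?W * 2" using dn c(1) v(2) W0 L2_norm_nonneg by (intro mult_mono) auto
  finally have 2: "\<bar>L2_inner L (laplacian L u) v - L2_inner L (laplacian L u') v\<bar> \<le> ?W * 2"
    unfolding d_def by (simp add: L2_inner_diff_left laplacian_Hm2 u u' Hm2_L2 v)
  have "\<bar>L2_inner L d (laplacian L v)\<bar> \<le> L2_norm L d * L2_norm L (laplacian L v)"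
    by (rule L2_Cauchy_Schwarz[OF dL laplacian_Hm2(1)[OF v(1)]])
  also have "\<dots> \<le> ?W * 2" using dn c(2) v(2) W0 L2_norm_nonneg by (intro mult_mono) auto
  finally have 3: "\<bar>bilaplacian L u v - bilaplacian L u' v\<bar> \<le> ?W * 2"
    unfolding d_def bilaplacian_def by (simp add: L2_inner_diff_left laplacian_Hm2 u u' v)
  have "\<bar>- (1/2 * x + y + z) - - (1/2 * x' + y' + z')\<bar> \<le> 1/2 * A + B + D"
    if "\<bar>x - x'\<bar> \<le> A" "\<bar>y - y'\<bar> \<le> B" "\<bar>z - z'\<bar> \<le> D" for x y z x' y' z' A B D :: real
    using that by linarith
  from this[OF 1[unfolded X_def] 2 3] show ?thesis
    unfolding ks_functional_def by (simp add: algebra_simps)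
qed

end

context calmed_time
begin

text \<open>The mesh \<open>1 / disc_level n\<close> is fine enough for the rounding errors over all
  of \<open>modes n\<close>, weighted as in H^2, to sum to at most
  \<open>1 / (n + 1)\<close>.\<close>

definition disc_level :: "nat \<Rightarrow> real" where
  "disc_level n = (real n + 1) * (1 + (\<Sum>k\<in>modes n. 1 + (lam k)\<^sup>2))"

definition disc :: "nat \<Rightarrow> real \<Rightarrow> real" where
  "disc n x = of_int \<lfloor>disc_level n * x\<rfloor> / disc_level n"

lemma disc_level_pos: "disc_level n > 0"
proof -
  have "0 \<le> (\<Sum>k\<in>modes n. 1 + (lam k)\<^sup>2)" by (intro sum_nonneg) simp
  then show ?thesis unfolding disc_level_def by (intro mult_pos_pos) simp_all
qed

lemma disc_error: "\<bar>disc n x - x\<bar> \<le> 1 / disc_level n"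
proof -
  have "\<bar>of_int \<lfloor>disc_level n * x\<rfloor> - disc_level n * x\<bar> \<le> 1" by linarith
  moreover have "disc n x - x = (of_int \<lfloor>disc_level n * x\<rfloor> - disc_level n * x) / disc_level n"
    using disc_level_pos[of n] by (simp add: disc_def diff_divide_distrib)
  ultimately show ?thesis using disc_level_pos[of n] by (simp add: abs_divide divide_right_mono)
qed

lemma simple_function_disc:
  assumes c: "continuous_on {0..T} f"
  shows "simple_function tM (\<lambda>t. disc n (f t))"
proof (rule simple_function_borel_measurable)
  have m: "f \<in> borel_measurable tM" by (rule measurable_continuous_tM[OF c])
  show "(\<lambda>t. disc n (f t)) \<in> borel_measurable tM"
    unfolding disc_def by (intro borel_measurable_divide measurable_compose[OF _ borel_measurable_real_floor] borel_measurable_times m) auto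
  have "bounded (f ` {0..T})" by (intro compact_imp_bounded compact_continuous_image c compact_Icc)
  then obtain C where C: "\<forall>t\<in>{0..T}. \<bar>f t\<bar> \<le> C" unfolding bounded_iff by auto
  let ?I = "{\<lfloor>- (disc_level n * C)\<rfloor>..\<lfloor>disc_level n * C\<rfloor>}"
  have "\<lfloor>disc_level n * f t\<rfloor> \<in> ?I" if "t \<in> {0..T}" for t
  proof -
    have "\<bar>f t\<bar> \<le> C" using C that by blast
    then have "- C \<le> f t" "f t \<le> C" by linarith+
    then have "disc_level n * (- C) \<le> disc_level n * f t" "disc_level n * f t \<le> disc_level n * C"
      using disc_level_pos[of n] by (intro mult_left_mono; simp)+
    then show ?thesis by (auto intro!: floor_mono)
  qed
  then have "(\<lambda>t. disc n (f t)) ` space tM \<subseteq> (\<lambda>i. of_int i / disc_level n) ` ?I"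
    unfolding disc_def by auto
  then show "finite ((\<lambda>t. disc n (f t)) ` space tM)" by (rule finite_subset) simp
qed

text \<open>Truncate to \<open>modes n\<close> and round each coefficient. The H^2 error splits into
  the rounding error, at most \<open>1 / (n + 1)\<close>, and the tail of the series, which vanishes
  for almost every time.\<close>

lemma simple_approximation:
  assumes a: "Hpath a"
  obtains s where "\<And>n. simple_function tM (s n)" "\<And>n t. s n t \<in> Hm L 2"
    "AE t in tM. (\<lambda>n. wsq h2_w (\<lambda>k. hat (s n t) k - a t k)) \<longlonglongrightarrow> 0"
proof -
  define s where "s n t = tpoly (modes n) (restrict (\<lambda>k. disc n (a t k)) (modes n))" for n t
  have "simple_function tM (\<lambda>t. restrict (\<lambda>k. disc n (a t k)) (modes n))" for n
    by (intro simple_function_restrict finite_modes simple_function_disc coeff_contD Hpath_cont a)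
  then have s1: "simple_function tM (s n)" for n
    unfolding s_def by (rule simple_function_compose1)
  have s2: "s n t \<in> Hm L 2" for n t unfolding s_def by (rule tpoly_Hm2[OF finite_modes])
  have hs: "hat (s n t) = trunc n (\<lambda>k. disc n (a t k))" for n t
    unfolding s_def by (simp add: fun_eq_iff hat_tpoly[OF finite_modes] trunc_def)
  have "AE t in tM. (\<lambda>n. wsq h2_w (\<lambda>k. hat (s n t) k - a t k)) \<longlonglongrightarrow> 0"
    using Hpath_AE[OF a]
  proof eventually_elim
    case (elim t)
    have up: "wsq h2_w (\<lambda>k. hat (s n t) k - a t k) \<le> 2 * (1 / (real n + 1)) + 2 * wsq h2_w (\<lambda>k. trunc n (a t) k - a t k)" for n
    proof -
      let ?x = "\<lambda>k. trunc n (\<lambda>k. disc n (a t k)) k - trunc n (a t) k" and ?y = "\<lambda>k. a t k - trunc n (a t) k"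
      have sx: "?x k = 0" if "k \<notin> modes n" for k using that by (simp add: trunc_def)
      have fy: "wfin h2_w ?y" by (rule wfin_diff(1)) (use elim wfin_trunc in auto)
      have "wsq h2_w (\<lambda>k. ?x k - ?y k) \<le> 2 * wsq h2_w ?x + 2 * wsq h2_w ?y"
        by (rule wfin_diff(2)) (use fy wsq_supported(1)[OF sx] in auto)
      moreover have "(\<lambda>k. ?x k - ?y k) = (\<lambda>k. hat (s n t) k - a t k)" by (simp add: hs fun_eq_iff)
      moreover have "wsq h2_w ?x \<le> 1 / (real n + 1)"
      proof -
        have "wsq h2_w ?x = wpart h2_w ?x n" by (rule wsq_supported(2)[OF sx])
        also have "\<dots> \<le> (\<Sum>k\<in>modes n. (1 + (lam k)\<^sup>2) * (1 / disc_level n)\<^sup>2)"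
          unfolding wpart_def
        proof (intro sum_mono mult_left_mono)
          fix k assume k: "k \<in> modes n"
          have "\<bar>?x k\<bar>\<^sup>2 \<le> (1 / disc_level n)\<^sup>2"
            using k disc_error[of n "a t k"] by (intro power_mono) (auto simp: trunc_def)
          then show "(?x k)\<^sup>2 \<le> (1 / disc_level n)\<^sup>2" by (simp only: power2_abs)
        qed simp
        also have "\<dots> = (\<Sum>k\<in>modes n. 1 + (lam k)\<^sup>2) * (1 / disc_level n)\<^sup>2" by (simp add: sum_distrib_right)
        also have "\<dots> \<le> 1 / (real n + 1)"
        proof -
          define S where "S = (\<Sum>k\<in>modes n. 1 + (lam k)\<^sup>2)"
          have S: "S \<ge> 0" unfolding S_def by (intro sum_nonneg) auto
          have dl: "disc_level n = (real n + 1) * (1 + S)" by (simp add: disc_level_def S_def)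
          have "S * (1 / disc_level n)\<^sup>2 = (S / (1 + S)) * (1 / (1 + S)) * ((1 / (real n + 1)) * (1 / (real n + 1)))"
            unfolding dl by (simp add: power2_eq_square)
          also have "\<dots> \<le> 1 * 1 * (1 * (1 / (real n + 1)))"
            using S by (intro mult_mono) auto
          finally show ?thesis by (simp add: S_def)
        qed
        finally show ?thesis .
      qed
      moreover have "wsq h2_w ?y = wsq h2_w (\<lambda>k. trunc n (a t) k - a t k)" by (rule wsq_uminus)
      ultimately show ?thesis by simp
    qed
    have lo: "0 \<le> wsq h2_w (\<lambda>k. hat (s n t) k - a t k)" for n
      by (rule wsq_nonneg, simp, rule wfin_diff(1)) (use elim in \<open>auto simp: hs wfin_trunc\<close>)
    have "(\<lambda>n. 1 / (real n + 1)) \<longlonglongrightarrow> 0"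
      using LIMSEQ_inverse_real_of_nat by (simp add: divide_inverse add.commute)
    then have "(\<lambda>n. 2 * (1 / (real n + 1)) + 2 * wsq h2_w (\<lambda>k. trunc n (a t) k - a t k)) \<longlonglongrightarrow> 2 * 0 + 2 * 0"
      by (intro tendsto_intros wsq_tail_tendsto elim) auto
    then have u0: "(\<lambda>n. 2 * (1 / (real n + 1)) + 2 * wsq h2_w (\<lambda>k. trunc n (a t) k - a t k)) \<longlonglongrightarrow> 0" by simp
    show ?case
      by (rule tendsto_sandwich[OF _ _ tendsto_const u0]) (use lo up in auto)
  qed
  then show thesis using that s1 s2 by blast
qed

section \<open>The weak solution synthesized from a coefficient path\<close>

context
  fixes a :: "real \<Rightarrow> int \<times> int \<Rightarrow> real"
  assumes a: "Hpath a"
    and evol: "\<And>t k. t \<in> {0..T} \<Longrightarrow> a t k = a 0 k + TI (\<lambda>s. rhs (a s) k) t"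
    and cont: "\<And>t. t \<in> {0..T} \<Longrightarrow> ((\<lambda>s. wsq one_w (\<lambda>k. a s k - a t k)) \<longlongrightarrow> 0) (at t within {0..T})"
begin

definition sol :: "real \<Rightarrow> real^2 \<Rightarrow> real" where "sol t = synth (a t)"

lemma sol_L2:
  assumes "t \<in> {0..T}"
  shows "sol t \<in> L2 L" "hat (sol t) = a t"
proof -
  have "wfin one_w (a t)" using Hpath_bounded[OF a] assms by metis
  then show "sol t \<in> L2 L" "hat (sol t) = a t" unfolding sol_def by (auto intro: synth)
qed

lemma sol_Hm2: "AE t in tM. sol t \<in> Hm L 2 \<and> hat (sol t) = a t"
  using Hpath_AE[OF a] unfolding sol_def by eventually_elim (rule synth_Hm2)

lemma sol_continuous: "sol \<in> continuous_in_time T (L2 L) (L2_norm L)"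
  unfolding continuous_in_time_def
proof (intro CollectI conjI ballI)
  show "sol t \<in> L2 L" if "t \<in> {0..T}" for t by (rule sol_L2[OF that])
  fix t assume t: "t \<in> {0..T}"
  have e: "L2_norm L (\<lambda>x. sol s x - sol t x) = sqrt (wsq one_w (\<lambda>k. a s k - a t k))" if s: "s \<in> {0..T}" for s
  proof -
    have "hat (\<lambda>x. sol s x - sol t x) = (\<lambda>k. a s k - a t k)"
      using hat_diff[OF sol_L2(1)[OF s] sol_L2(1)[OF t]] sol_L2(2)[OF s] sol_L2(2)[OF t] by auto
    then show ?thesis using L2_norm_hat[OF L2_diff[OF sol_L2(1)[OF s] sol_L2(1)[OF t]]] by simp
  qed
  have "((\<lambda>s. sqrt (wsq one_w (\<lambda>k. a s k - a t k))) \<longlongrightarrow> sqrt 0) (at t within {0..T})"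
    by (intro tendsto_real_sqrt cont t)
  then have "((\<lambda>s. sqrt (wsq one_w (\<lambda>k. a s k - a t k))) \<longlongrightarrow> 0) (at t within {0..T})" by simp
  then show "((\<lambda>s. L2_norm L (\<lambda>x. sol s x - sol t x)) \<longlongrightarrow> 0) (at t within {0..T})"
  proof (rule Lim_transform_eventually)
    show "\<forall>\<^sub>F s in at t within {0..T}. sqrt (wsq one_w (\<lambda>k. a s k - a t k)) = L2_norm L (\<lambda>x. sol s x - sol t x)"
      unfolding eventually_at_filter by (intro always_eventually) (simp add: e)
  qed
qed

lemma nn_integral_h2_finite: "(\<integral>\<^sup>+t. ennreal (c * wsq h2_w (a t)) \<partial>tM) < \<infinity>" if c: "0 \<le> c"
proof -
  have i: "integrable tM (\<lambda>t. c * (wsq one_w (a t) + wsq lam2_w (a t)))"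
    using Hpath_integrable_one[OF a] Hpath_int[OF a] by simp
  have "(\<integral>\<^sup>+t. ennreal (c * wsq h2_w (a t)) \<partial>tM) = (\<integral>\<^sup>+t. ennreal (c * (wsq one_w (a t) + wsq lam2_w (a t))) \<partial>tM)"
    by (rule nn_integral_cong_AE) (use Hpath_AE[OF a] in \<open>eventually_elim, simp add: h2_fin(4)\<close>)
  also have "\<dots> = ennreal (\<integral>t. c * (wsq one_w (a t) + wsq lam2_w (a t)) \<partial>tM)"
  proof (rule nn_integral_eq_integral[OF i])
    show "AE t in tM. 0 \<le> c * (wsq one_w (a t) + wsq lam2_w (a t))"
      using Hpath_AE[OF a] by eventually_elim (intro mult_nonneg_nonneg add_nonneg_nonneg h2_parts c)
  qed
  also have "\<dots> < \<infinity>" by simp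
  finally show ?thesis .
qed

lemma sol_bochner: "sol \<in> bochner_L2 T (Hm L 2) (Hm_norm L 2)"
proof -
  obtain s where s: "\<And>n. simple_function tM (s n)" "\<And>n t. s n t \<in> Hm L 2"
    "AE t in tM. (\<lambda>n. wsq h2_w (\<lambda>k. hat (s n t) k - a t k)) \<longlonglongrightarrow> 0"
    by (rule simple_approximation[OF a]) blast
  have "AE t in tM. (\<lambda>n. Hm_norm L 2 (\<lambda>x. s n t x - sol t x)) \<longlonglongrightarrow> 0"
    using s(3) sol_Hm2
  proof eventually_elim
    case (elim t)
    have b: "Hm_norm L 2 (\<lambda>x. s n t x - sol t x) \<le> sqrt (6 * wsq h2_w (\<lambda>k. hat (s n t) k - a t k))" for n
    proof -
      have H: "(\<lambda>x. s n t x - sol t x) \<in> Hm L 2" using Hm2_diff[OF s(2)] elim(2) by blast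
      have "hat (\<lambda>x. s n t x - sol t x) = (\<lambda>k. hat (s n t) k - a t k)"
        using hat_diff[OF Hm2_L2[OF s(2)[of n t]] Hm2_L2] elim(2) by auto
      then have "(Hm_norm L 2 (\<lambda>x. s n t x - sol t x))\<^sup>2 \<le> 6 * wsq h2_w (\<lambda>k. hat (s n t) k - a t k)"
        using Hm2_norm_bounds(1)[OF H] by simp
      then show ?thesis by (rule real_le_rsqrt)
    qed
    have "(\<lambda>n. sqrt (6 * wsq h2_w (\<lambda>k. hat (s n t) k - a t k))) \<longlonglongrightarrow> sqrt (6 * 0)"
      by (intro tendsto_intros elim)
    then have u: "(\<lambda>n. sqrt (6 * wsq h2_w (\<lambda>k. hat (s n t) k - a t k))) \<longlonglongrightarrow> 0" by simp
    show ?case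
      by (rule tendsto_sandwich[OF _ _ tendsto_const u])
        (use b in \<open>auto simp: Hm_norm_def sum_nonneg\<close>)
  qed
  then have sm: "strongly_measurable T (Hm L 2) (Hm_norm L 2) sol"
    unfolding strongly_measurable_def using s(1,2) by blast
  have "bochner_L2_norm_sq T (Hm_norm L 2) sol \<le> (\<integral>\<^sup>+t. ennreal (6 * wsq h2_w (a t)) \<partial>tM)"
    unfolding bochner_L2_norm_sq_def
  proof (rule nn_integral_mono_AE)
    show "AE t in tM. ennreal ((Hm_norm L 2 (sol t))\<^sup>2) \<le> ennreal (6 * wsq h2_w (a t))"
      using sol_Hm2
    proof eventually_elim
      case (elim t)
      then show ?case using Hm2_norm_bounds(1)[of "sol t"] by (intro ennreal_leI) auto
    qed
  qed
  also have "\<dots> < \<infinity>" by (rule nn_integral_h2_finite) simp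
  finally show ?thesis using sm sol_Hm2 unfolding bochner_L2_def by (auto elim: eventually_mono)
qed

lemma sol_deriv_bochner: "(\<lambda>t. ks_functional (sol t)) \<in> bochner_L2 T (Hneg2 L) (Hneg2_norm L)"
proof -
  obtain s where s: "\<And>n. simple_function tM (s n)" "\<And>n t. s n t \<in> Hm L 2"
    "AE t in tM. (\<lambda>n. wsq h2_w (\<lambda>k. hat (s n t) k - a t k)) \<longlonglongrightarrow> 0"
    by (rule simple_approximation[OF a]) blast
  have "AE t in tM. (\<lambda>n. Hneg2_norm L (\<lambda>v. ks_functional (s n t) v - ks_functional (sol t) v)) \<longlonglongrightarrow> 0"
    using s(3) sol_Hm2
  proof eventually_elim
    case (elim t)
    let ?K = "\<lambda>n. (sqrt (nl_weight (a t)) + 4) * sqrt (wsq h2_w (\<lambda>k. hat (s n t) k - a t k))"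
    have d: "\<bar>ks_functional (s n t) v - ks_functional (sol t) v\<bar> \<le> ?K n" if "v \<in> Hm L 2" "Hm_norm L 2 v \<le> 1" for n v
      using ks_functional_diff[OF s(2) _ that, of "sol t" n t] elim(2) by simp
    have "?K \<longlonglongrightarrow> (sqrt (nl_weight (a t)) + 4) * sqrt 0" by (intro tendsto_intros elim)
    then have u: "?K \<longlonglongrightarrow> 0" by simp
    show ?case
      by (rule tendsto_sandwich[OF _ _ tendsto_const u]; intro always_eventually allI Hneg2_norm_le[OF d])
  qed
  moreover have "simple_function tM (\<lambda>t. ks_functional (s n t))" for n
    by (rule simple_function_compose1[OF s(1)])
  ultimately have sm: "strongly_measurable T (Hneg2 L) (Hneg2_norm L) (\<lambda>t. ks_functional (sol t))"
    unfolding strongly_measurable_def using ks_functional_Hneg2[OF s(2)]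
    by (intro exI[of _ "\<lambda>n t. ks_functional (s n t)"]) blast
  have "bochner_L2_norm_sq T (Hneg2_norm L) (\<lambda>t. ks_functional (sol t)) \<le> (\<integral>\<^sup>+t. ennreal ((Mb + 6)\<^sup>2 * wsq h2_w (a t)) \<partial>tM)"
    unfolding bochner_L2_norm_sq_def
  proof (rule nn_integral_mono_AE)
    show "AE t in tM. ennreal ((Hneg2_norm L (ks_functional (sol t)))\<^sup>2) \<le> ennreal ((Mb + 6)\<^sup>2 * wsq h2_w (a t))"
      using sol_Hm2 Hpath_AE[OF a]
    proof eventually_elim
      case (elim t)
      let ?K = "(Mb + 6) * sqrt (wsq h2_w (a t))"
      have w: "0 \<le> wsq h2_w (a t)" by (rule h2_parts[OF elim(2)])
      have "\<bar>ks_functional (sol t) v\<bar> \<le> ?K" if v: "v \<in> Hm L 2" "Hm_norm L 2 v \<le> 1" for v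
      proof -
        have "\<bar>ks_functional (sol t) v\<bar> \<le> ?K * Hm_norm L 2 v"
          using ks_functional_bound[OF _ v(1), of "sol t"] elim(1) by simp
        also have "\<dots> \<le> ?K * 1" using v(2) w Mb_nonneg by (intro mult_left_mono) auto
        finally show ?thesis by simp
      qed
      from Hneg2_norm_le[of "ks_functional (sol t)", OF this]
      have "(Hneg2_norm L (ks_functional (sol t)))\<^sup>2 \<le> ?K\<^sup>2" by (intro power_mono)
      then show ?case using w by (intro ennreal_leI) (simp add: power_mult_distrib)
    qed
  qed
  also have "\<dots> < \<infinity>" by (rule nn_integral_h2_finite) simp
  finally show ?thesis
    using sm sol_Hm2 ks_functional_Hneg2 unfolding bochner_L2_def by (auto elim: eventually_mono)
qed

text \<open>The scalar identities by parts are summed with the coefficients of \<open>v\<close> over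
  \<open>modes n\<close>; dominated convergence in \<open>n\<close> then yields the pairings with
  \<open>v\<close> on both sides.\<close>

lemma sol_time_deriv: "has_time_deriv L T sol (\<lambda>t. ks_functional (sol t))"
  unfolding has_time_deriv_def
proof (intro ballI)
  fix \<theta> v assume \<theta>: "\<theta> \<in> time_test T" and v: "v \<in> Hm L 2"
  note \<theta>d = time_test_deriv[OF \<theta>]
  have c\<theta>: "continuous_on {0..T} \<theta>" using \<theta>d(1) by (meson DERIV_isCont continuous_at_imp_continuous_on)
  have bdd: "\<exists>B. \<forall>t\<in>{0..T}. \<bar>h t\<bar> \<le> B" if "continuous_on {0..T} h" for h :: "real \<Rightarrow> real"
    using compact_imp_bounded[OF compact_continuous_image[OF that compact_Icc]] unfolding bounded_iff by auto
  obtain B0 where B0: "\<forall>t\<in>{0..T}. \<bar>\<theta> t\<bar> \<le> B0" using bdd[OF c\<theta>] by blast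
  obtain B1 where B1: "\<forall>t\<in>{0..T}. \<bar>deriv \<theta> t\<bar> \<le> B1" using bdd[OF \<theta>d(2)] by blast
  obtain C where C: "0 \<le> C" "\<And>t. t \<in> {0..T} \<Longrightarrow> wfin one_w (a t)" "\<And>t. t \<in> {0..T} \<Longrightarrow> wsq one_w (a t) \<le> C"
    using Hpath_bounded[OF a] by metis
  note hv = h2_fin[OF Hm2_fin[OF v]] and pv = h2_parts[OF Hm2_fin[OF v]]
  have am: "\<bar>x * y\<bar> \<le> x\<^sup>2 + y\<^sup>2" for x y :: real
    using sum_squares_bound[of x y] sum_squares_bound[of x "-y"] by (auto simp: abs_if)
  have sum_am: "\<bar>\<Sum>k\<in>modes n. x k * y k\<bar> \<le> (\<Sum>k\<in>modes n. (x k)\<^sup>2) + (\<Sum>k\<in>modes n. (y k)\<^sup>2)" for x y :: "int \<times> int \<Rightarrow> real" and n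
    unfolding sum.distrib[symmetric] by (rule order_trans[OF sum_abs]) (intro sum_mono am)
  have ak: "continuous_on {0..T} (\<lambda>t. a t k)" for k by (rule coeff_contD[OF Hpath_cont[OF a]])
  have ri: "integrable tM (\<lambda>t. rhs (a t) k)" for k by (rule rhs_integrable[OF a])
  have ri\<theta>: "integrable tM (\<lambda>t. rhs (a t) k * \<theta> t)" for k by (rule integrable_mult_continuous[OF ri c\<theta>])
  have eqn: "(\<integral>t. deriv \<theta> t * (\<Sum>k\<in>modes n. a t k * hat v k) \<partial>tM) = - (\<integral>t. \<theta> t * (\<Sum>k\<in>modes n. rhs (a t) k * hat v k) \<partial>tM)" for n
  proof -
    have "(\<integral>t. deriv \<theta> t * (\<Sum>k\<in>modes n. a t k * hat v k) \<partial>tM) = (\<Sum>k\<in>modes n. (\<integral>t. deriv \<theta> t * a t k \<partial>tM) * hat v k)"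
    proof -
      have "(\<integral>t. deriv \<theta> t * (\<Sum>k\<in>modes n. a t k * hat v k) \<partial>tM) = (\<integral>t. (\<Sum>k\<in>modes n. deriv \<theta> t * a t k * hat v k) \<partial>tM)"
        by (simp add: sum_distrib_left mult.assoc)
      also have "\<dots> = (\<Sum>k\<in>modes n. \<integral>t. deriv \<theta> t * a t k * hat v k \<partial>tM)"
        by (intro Bochner_Integration.integral_sum integrable_continuous_tM continuous_intros \<theta>d ak)
      finally show ?thesis by simp
    qed
    also have "\<dots> = (\<Sum>k\<in>modes n. - (\<integral>t. \<theta> t * rhs (a t) k \<partial>tM) * hat v k)"
      using time_test_by_parts[OF \<theta> ri evol] by simp
    also have "\<dots> = - (\<integral>t. \<theta> t * (\<Sum>k\<in>modes n. rhs (a t) k * hat v k) \<partial>tM)"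
    proof -
      have i: "integrable tM (\<lambda>t. \<theta> t * rhs (a t) k * hat v k)" for k
        using integrable_mult_left[OF ri\<theta>[of k], of "hat v k"] by (simp add: mult.commute)
      have "(\<integral>t. \<theta> t * (\<Sum>k\<in>modes n. rhs (a t) k * hat v k) \<partial>tM) = (\<integral>t. (\<Sum>k\<in>modes n. \<theta> t * rhs (a t) k * hat v k) \<partial>tM)"
        by (simp add: sum_distrib_left mult.assoc)
      also have "\<dots> = (\<Sum>k\<in>modes n. \<integral>t. \<theta> t * rhs (a t) k * hat v k \<partial>tM)"
        by (intro Bochner_Integration.integral_sum i)
      finally show ?thesis by (simp add: sum_negf)
    qed
    finally show ?thesis .
  qed
  have L1: "(\<lambda>n. \<integral>t. deriv \<theta> t * (\<Sum>k\<in>modes n. a t k * hat v k) \<partial>tM) \<longlonglongrightarrow> (\<integral>t. deriv \<theta> t * L2_inner L (sol t) v \<partial>tM)"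
  proof (rule integral_dominated_convergence[where w = "\<lambda>t. B1 * (C + wsq one_w (hat v))"])
    have lim: "(\<lambda>n. \<Sum>k\<in>modes n. a t k * hat v k) \<longlonglongrightarrow> L2_inner L (sol t) v" if t: "t \<in> {0..T}" for t
      using Parseval[OF sol_L2(1)[OF t] Hm2_L2[OF v]] unfolding sol_L2(2)[OF t] .
    have lim': "(\<lambda>n. deriv \<theta> t * (\<Sum>k\<in>modes n. a t k * hat v k)) \<longlonglongrightarrow> deriv \<theta> t * L2_inner L (sol t) v" if "t \<in> space tM" for t
      using that by (intro tendsto_mult tendsto_const lim) simp
    have m: "(\<lambda>t. deriv \<theta> t * (\<Sum>k\<in>modes n. a t k * hat v k)) \<in> borel_measurable tM" for n
      by (intro measurable_continuous_tM continuous_intros \<theta>d ak)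
    then show "(\<lambda>t. deriv \<theta> t * (\<Sum>k\<in>modes n. a t k * hat v k)) \<in> borel_measurable tM" for n .
    show "(\<lambda>t. deriv \<theta> t * L2_inner L (sol t) v) \<in> borel_measurable tM"
      by (rule borel_measurable_LIMSEQ_real[OF lim' m])
    show "AE t in tM. (\<lambda>n. deriv \<theta> t * (\<Sum>k\<in>modes n. a t k * hat v k)) \<longlonglongrightarrow> deriv \<theta> t * L2_inner L (sol t) v"
      by (rule AE_I2) (rule lim')
    show "AE t in tM. norm (deriv \<theta> t * (\<Sum>k\<in>modes n. a t k * hat v k)) \<le> B1 * (C + wsq one_w (hat v))" for n
    proof (rule AE_I2)
      fix t assume "t \<in> space tM"
      then have t: "t \<in> {0..T}" by simp
      have "\<bar>\<Sum>k\<in>modes n. a t k * hat v k\<bar> \<le> wpart one_w (a t) n + wpart one_w (hat v) n"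
        using sum_am[of "a t" "hat v" n] by (simp add: wpart_def)
      also have "\<dots> \<le> C + wsq one_w (hat v)"
      proof (rule add_mono)
        have "wpart one_w (a t) n \<le> wsq one_w (a t)" by (rule wpart_le_wsq) (use C(2)[OF t] in auto)
        then show "wpart one_w (a t) n \<le> C" using C(3)[OF t] by simp
        show "wpart one_w (hat v) n \<le> wsq one_w (hat v)" by (rule wpart_le_wsq) (use hv in auto)
      qed
      finally have "\<bar>deriv \<theta> t\<bar> * \<bar>\<Sum>k\<in>modes n. a t k * hat v k\<bar> \<le> B1 * (C + wsq one_w (hat v))"
        using B1 t by (intro mult_mono) auto
      then show "norm (deriv \<theta> t * (\<Sum>k\<in>modes n. a t k * hat v k)) \<le> B1 * (C + wsq one_w (hat v))"
        by (simp add: abs_mult)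
    qed
  qed (rule integrable_const_tM)
  \<comment> \<open>A majorant independent of \<open>n\<close>: each of the linear, biharmonic and
    nonlinear sums is bounded by \<open>\<bar>x * y\<bar> \<le> x\<^sup>2 + y\<^sup>2\<close>, and
    the bounds are added.\<close>
  let ?g = "\<lambda>t. 2 * wsq lam2_w (a t) + Mb\<^sup>2 * wsq lam_w (a t) + (2 * wsq one_w (hat v) + wsq lam2_w (hat v))"
  have gi: "integrable tM ?g"
    by (intro Bochner_Integration.integrable_add integrable_mult_right Hpath_int Hpath_integrable_lam a integrable_const_tM)
  have L2: "(\<lambda>n. \<integral>t. \<theta> t * (\<Sum>k\<in>modes n. rhs (a t) k * hat v k) \<partial>tM) \<longlonglongrightarrow> (\<integral>t. \<theta> t * ks_functional (sol t) v \<partial>tM)"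
  proof (rule integral_dominated_convergence[where w = "\<lambda>t. B0 * ?g t"])
    have m: "(\<lambda>t. \<theta> t * (\<Sum>k\<in>modes n. rhs (a t) k * hat v k)) \<in> borel_measurable tM" for n
      using ri by (intro borel_measurable_times measurable_continuous_tM[OF c\<theta>] borel_measurable_sum) auto
    then show "(\<lambda>t. \<theta> t * (\<Sum>k\<in>modes n. rhs (a t) k * hat v k)) \<in> borel_measurable tM" for n .
    show lim: "AE t in tM. (\<lambda>n. \<theta> t * (\<Sum>k\<in>modes n. rhs (a t) k * hat v k)) \<longlonglongrightarrow> \<theta> t * ks_functional (sol t) v"
      using sol_Hm2
    proof eventually_elim
      case (elim t)
      then have H: "sol t \<in> Hm L 2" and h: "hat (sol t) = a t" by auto
      note lap = laplacian_Hm2[OF H] and lapv = laplacian_Hm2[OF v]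
      have "(\<lambda>n. - (1/2 * (\<Sum>k\<in>modes n. hat (nl (sol t)) k * hat v k) + (\<Sum>k\<in>modes n. hat (laplacian L (sol t)) k * hat v k)
          + (\<Sum>k\<in>modes n. hat (laplacian L (sol t)) k * hat (laplacian L v) k))) \<longlonglongrightarrow> ks_functional (sol t) v"
        unfolding ks_functional_def bilaplacian_def
        by (intro tendsto_intros Parseval nl_L2 lap lapv Hm2_L2 H v)
      moreover have "- (1/2 * (\<Sum>k\<in>modes n. hat (nl (sol t)) k * hat v k) + (\<Sum>k\<in>modes n. hat (laplacian L (sol t)) k * hat v k)
          + (\<Sum>k\<in>modes n. hat (laplacian L (sol t)) k * hat (laplacian L v) k)) = (\<Sum>k\<in>modes n. rhs (a t) k * hat v k)" for n
        unfolding lap(2) lapv(2) hat_nl[OF H] h sum_distrib_left sum.distrib[symmetric] sum_negf[symmetric]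
        by (intro sum.cong) (auto simp: rhs_def power2_eq_square algebra_simps)
      ultimately have "(\<lambda>n. \<Sum>k\<in>modes n. rhs (a t) k * hat v k) \<longlonglongrightarrow> ks_functional (sol t) v" by simp
      then show ?case by (intro tendsto_intros)
    qed
    \<comment> \<open>\<open>sol t\<close> lies in H^2 only for almost every \<open>t\<close>, so
      measurability is obtained from the limit of the truncated sums, to which the pairing is equal
      almost everywhere.\<close>
    show "(\<lambda>t. \<theta> t * ks_functional (sol t) v) \<in> borel_measurable tM"
    proof (rule measurable_lebesgue_on_AE_eq)
      show "(\<lambda>t. lim (\<lambda>n. \<theta> t * (\<Sum>k\<in>modes n. rhs (a t) k * hat v k))) \<in> borel_measurable tM"
        by (rule borel_measurable_lim_metric[OF m])
      show "AE t in tM. lim (\<lambda>n. \<theta> t * (\<Sum>k\<in>modes n. rhs (a t) k * hat v k)) = \<theta> t * ks_functional (sol t) v"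
        using lim by eventually_elim (rule limI)
    qed
    show "AE t in tM. norm (\<theta> t * (\<Sum>k\<in>modes n. rhs (a t) k * hat v k)) \<le> B0 * ?g t" for n
      using Hpath_AE[OF a] AE_space
    proof eventually_elim
      case (elim t)
      have f: "wpart lam2_w (a t) n \<le> wsq lam2_w (a t)" "wpart one_w (hat v) n \<le> wsq one_w (hat v)"
        "wpart lam2_w (hat v) n \<le> wsq lam2_w (hat v)"
        by (rule wpart_le_wsq; use h2_fin[OF elim(1)] hv in simp)+
      have 1: "\<bar>\<Sum>k\<in>modes n. (lam k * a t k) * hat v k\<bar> \<le> wsq lam2_w (a t) + wsq one_w (hat v)"
        using sum_am[of "\<lambda>k. lam k * a t k" "hat v" n] f by (simp add: wpart_def power_mult_distrib)
      have 2: "\<bar>\<Sum>k\<in>modes n. (lam k * a t k) * (lam k * hat v k)\<bar> \<le> wsq lam2_w (a t) + wsq lam2_w (hat v)"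
        using sum_am[of "\<lambda>k. lam k * a t k" "\<lambda>k. lam k * hat v k" n] f by (simp add: wpart_def power_mult_distrib)
      have 3: "\<bar>\<Sum>k\<in>modes n. NL (a t) k * hat v k\<bar> \<le> Mb\<^sup>2 * wsq lam_w (a t) + wsq one_w (hat v)"
        using sum_am[of "NL (a t)" "hat v" n] NL_bound[OF elim(1), of n] f by (simp add: wpart_def)
      have "(\<Sum>k\<in>modes n. rhs (a t) k * hat v k) = (\<Sum>k\<in>modes n. (lam k * a t k) * hat v k)
          - (\<Sum>k\<in>modes n. (lam k * a t k) * (lam k * hat v k)) - 1/2 * (\<Sum>k\<in>modes n. NL (a t) k * hat v k)"
        unfolding sum_distrib_left sum_subtractf[symmetric]
        by (intro sum.cong) (auto simp: rhs_def power2_eq_square algebra_simps)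
      then have "\<bar>\<Sum>k\<in>modes n. rhs (a t) k * hat v k\<bar> \<le> ?g t" using 1 2 3 by linarith
      then have "\<bar>\<theta> t\<bar> * \<bar>\<Sum>k\<in>modes n. rhs (a t) k * hat v k\<bar> \<le> B0 * ?g t"
        using B0 elim(2) by (intro mult_mono) auto
      then show ?case by (simp add: abs_mult)
    qed
  qed (use gi in simp)
  from LIMSEQ_unique[OF L1[unfolded eqn] tendsto_minus[OF L2]]
  show "(\<integral>t. deriv \<theta> t * L2_inner L (sol t) v \<partial>tM) = - (\<integral>t. \<theta> t * ks_functional (sol t) v \<partial>tM)" .
qed

lemma sol_weak_solution:
  assumes \<phi>0: "\<phi>0 \<in> L2 L" and a0: "a 0 = hat \<phi>0"
  shows "weak_solution L T \<eta> \<phi>0 sol"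
  unfolding weak_solution_def
proof (intro conjI exI[of _ "\<lambda>t. ks_functional (sol t)"])
  show "AE t in tM. \<forall>v\<in>Hm L 2. ks_functional (sol t) v + 1 / 2 * L2_inner L (nl (sol t)) v +
      L2_inner L (laplacian L (sol t)) v + bilaplacian L (sol t) v = 0"
    by (simp add: ks_functional_def)
  have z: "0 \<in> {0..T}" using T_pos by simp
  show "AE x in torus L. sol 0 x = \<phi>0 x"
    by (rule AE_eq_if_hat_eq[OF sol_L2(1)[OF z] \<phi>0]) (simp add: sol_L2(2)[OF z] a0)
qed (rule sol_bochner sol_continuous sol_deriv_bochner sol_time_deriv)+

end

section \<open>Existence, uniqueness and continuous dependence\<close>

lemma weak_solution_exists:
  assumes \<phi>0: "\<phi>0 \<in> L2 L"
  shows "\<exists>\<phi>. weak_solution L T \<eta> \<phi>0 \<phi>"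
proof -
  obtain a where a: "Hpath a" "a 0 = hat \<phi>0"
    "\<And>t k. t \<in> {0..T} \<Longrightarrow> a t k = hat \<phi>0 k + TI (\<lambda>s. rhs (a s) k) t"
    "\<And>t. t \<in> {0..T} \<Longrightarrow> ((\<lambda>s. wsq one_w (\<lambda>k. a s k - a t k)) \<longlongrightarrow> 0) (at t within {0..T})"
    by (rule coefficient_solution_exists[OF wsq_one_hat(1)[OF \<phi>0]]) blast
  have ev: "a t k = a 0 k + TI (\<lambda>s. rhs (a s) k) t" if "t \<in> {0..T}" for t k
    using a(3)[OF that, of k] by (simp add: a(2))
  show ?thesis using sol_weak_solution[OF a(1) ev a(4) \<phi>0 a(2)] by blast
qed

text \<open>Stability with equal data makes the L^2 distance 0 at every time, hence all coefficients
  agree and completeness applies.\<close>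

lemma weak_solution_unique:
  assumes \<phi>0: "\<phi>0 \<in> L2 L" and \<phi>: "weak_solution L T \<eta> \<phi>0 \<phi>" and \<psi>: "weak_solution L T \<eta> \<phi>0 \<psi>" and t: "t \<in> {0..T}"
  shows "AE x in torus L. \<phi> t x = \<psi> t x"
proof -
  obtain C where C: "\<And>\<psi>0 \<psi> t. weak_solution L T \<eta> \<psi>0 \<psi> \<Longrightarrow> \<psi>0 \<in> L2 L \<Longrightarrow> t \<in> {0..T} \<Longrightarrow>
      (L2_norm L (\<lambda>x. \<psi> t x - \<phi> t x))\<^sup>2 \<le> C * (L2_norm L (\<lambda>x. \<psi>0 x - \<phi>0 x))\<^sup>2"
    by (rule weak_solutions_stability[OF \<phi> \<phi>0]) blast
  have "(L2_norm L (\<lambda>x. \<psi> t x - \<phi> t x))\<^sup>2 \<le> C * (L2_norm L (\<lambda>x. \<phi>0 x - \<phi>0 x))\<^sup>2" by (rule C[OF \<psi> \<phi>0 t])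
  moreover have "L2_norm L (\<lambda>x. \<phi>0 x - \<phi>0 x) = 0" by (simp add: L2_norm_def L2_inner_def)
  ultimately have "(L2_norm L (\<lambda>x. \<psi> t x - \<phi> t x))\<^sup>2 \<le> 0" by simp
  then have z: "L2_norm L (\<lambda>x. \<psi> t x - \<phi> t x) = 0" by simp
  have l: "\<phi> t \<in> L2 L" "\<psi> t \<in> L2 L" using \<phi> \<psi> t by (auto simp: weak_solution_def continuous_in_time_def)
  have "hat (\<psi> t) k - hat (\<phi> t) k = 0" for k
    using hat_le_norm[OF L2_diff[OF l(2,1)], of k] unfolding hat_diff[OF l(2,1)] z by simp
  then have "hat (\<phi> t) = hat (\<psi> t)" by (auto simp: fun_eq_iff)
  then show ?thesis by (rule AE_eq_if_hat_eq[OF l])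
qed

lemma weak_solution_continuous_dependence:
  assumes \<phi>0: "\<phi>0 \<in> L2 L" and \<phi>: "weak_solution L T \<eta> \<phi>0 \<phi>" and e: "e > 0"
  shows "\<exists>\<delta>>0. \<forall>\<psi>0 \<psi>. \<psi>0 \<in> L2 L \<and> weak_solution L T \<eta> \<psi>0 \<psi> \<and> L2_norm L (\<lambda>x. \<psi>0 x - \<phi>0 x) < \<delta> \<longrightarrow>
    bochner_Linf_norm T (L2_norm L) (\<lambda>t x. \<psi> t x - \<phi> t x) < ereal e \<and>
    bochner_L2_norm_sq T (Hm_norm L 2) (\<lambda>t x. \<psi> t x - \<phi> t x) < ennreal (e\<^sup>2)"
proof -
  obtain C where C: "C > 0" "\<And>\<psi>0 \<psi> t. weak_solution L T \<eta> \<psi>0 \<psi> \<Longrightarrow> \<psi>0 \<in> L2 L \<Longrightarrow> t \<in> {0..T} \<Longrightarrow>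
      (L2_norm L (\<lambda>x. \<psi> t x - \<phi> t x))\<^sup>2 \<le> C * (L2_norm L (\<lambda>x. \<psi>0 x - \<phi>0 x))\<^sup>2"
    "\<And>\<psi>0 \<psi>. weak_solution L T \<eta> \<psi>0 \<psi> \<Longrightarrow> \<psi>0 \<in> L2 L \<Longrightarrow>
      bochner_L2_norm_sq T (Hm_norm L 2) (\<lambda>t x. \<psi> t x - \<phi> t x) \<le> ennreal (C * (L2_norm L (\<lambda>x. \<psi>0 x - \<phi>0 x))\<^sup>2)"
    by (rule weak_solutions_stability[OF \<phi> \<phi>0]) blast
  \<comment> \<open>Aims at \<open>e / 2\<close>, because bounds holding for each time yield only a
    weak inequality for the essential supremum.\<close>
  define \<delta> where "\<delta> = e / (2 * sqrt C)"
  have \<delta>: "\<delta> > 0" using e C(1) by (simp add: \<delta>_def)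
  have C\<delta>: "C * \<delta>\<^sup>2 = (e / 2)\<^sup>2" using C(1) by (simp add: \<delta>_def power_divide power_mult_distrib)
  show ?thesis
  proof (intro exI[of _ \<delta>] conjI allI impI, fact \<delta>, goal_cases)
    case (1 \<psi>0 \<psi>)
    then have \<psi>0: "\<psi>0 \<in> L2 L" and \<psi>: "weak_solution L T \<eta> \<psi>0 \<psi>" and d: "L2_norm L (\<lambda>x. \<psi>0 x - \<phi>0 x) < \<delta>" by auto
    have d2: "C * (L2_norm L (\<lambda>x. \<psi>0 x - \<phi>0 x))\<^sup>2 \<le> (e / 2)\<^sup>2"
      unfolding C\<delta>[symmetric] using C(1) d L2_norm_nonneg by (intro mult_left_mono power_mono) auto
    have b: "L2_norm L (\<lambda>x. \<psi> t x - \<phi> t x) \<le> e / 2" if t: "t \<in> {0..T}" for t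
      by (rule power2_le_imp_le[OF order_trans[OF C(2)[OF \<psi> \<psi>0 t] d2]]) (use e in simp)
    have n: "L2_norm L (\<lambda>x. \<psi> t x - \<phi> t x) = sqrt (wsq one_w (\<lambda>k. hat (\<psi> t) k - hat (\<phi> t) k))" if t: "t \<in> {0..T}" for t
    proof -
      have l: "\<psi> t \<in> L2 L" "\<phi> t \<in> L2 L" using \<psi> \<phi> t by (auto simp: weak_solution_def continuous_in_time_def)
      have "hat (\<lambda>x. \<psi> t x - \<phi> t x) = (\<lambda>k. hat (\<psi> t) k - hat (\<phi> t) k)" using hat_diff[OF l] by auto
      then show ?thesis using L2_norm_hat[OF L2_diff[OF l]] by simp
    qed
    \<comment> \<open>\<open>esssup_I\<close> asks for a measurable function; in terms of
      coefficients the norm of the difference is visibly measurable in time.\<close>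
    have "(\<lambda>t. ereal (sqrt (wsq one_w (\<lambda>k. hat (\<psi> t) k - hat (\<phi> t) k)))) \<in> borel_measurable tM"
      by (intro borel_measurable_ereal borel_measurable_sqrt[THEN measurable_compose[rotated]] wsq_measurable Hpath_cont
          Hpath_diff weak_solution_Hpath[OF \<psi>] weak_solution_Hpath[OF \<phi>])
    then have "(\<lambda>t. ereal (L2_norm L (\<lambda>x. \<psi> t x - \<phi> t x))) \<in> borel_measurable tM"
      by (subst measurable_cong[where g = "\<lambda>t. ereal (sqrt (wsq one_w (\<lambda>k. hat (\<psi> t) k - hat (\<phi> t) k)))"]) (simp_all add: n)
    then have "bochner_Linf_norm T (L2_norm L) (\<lambda>t x. \<psi> t x - \<phi> t x) \<le> ereal (e / 2)"
      unfolding bochner_Linf_norm_def by (rule esssup_I) (use b in \<open>auto intro!: AE_I2\<close>)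
    also have "\<dots> < ereal e" using e by simp
    finally show ?case .
  next
    case (2 \<psi>0 \<psi>)
    then have \<psi>0: "\<psi>0 \<in> L2 L" and \<psi>: "weak_solution L T \<eta> \<psi>0 \<psi>" and d: "L2_norm L (\<lambda>x. \<psi>0 x - \<phi>0 x) < \<delta>" by auto
    have d2: "C * (L2_norm L (\<lambda>x. \<psi>0 x - \<phi>0 x))\<^sup>2 \<le> (e / 2)\<^sup>2"
      unfolding C\<delta>[symmetric] using C(1) d L2_norm_nonneg by (intro mult_left_mono power_mono) auto
    have "bochner_L2_norm_sq T (Hm_norm L 2) (\<lambda>t x. \<psi> t x - \<phi> t x) \<le> ennreal ((e / 2)\<^sup>2)"
      using C(3)[OF \<psi> \<psi>0] ennreal_leI[OF d2] by (rule order_trans)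
    also have "\<dots> < ennreal (e\<^sup>2)" using e by (intro ennreal_lessI) (auto simp: power_divide)
    finally show ?case .
  qed
qed

end

theorem theorem1p10:
  fixes L T \<epsilon> :: real
    and \<eta> :: "real \<Rightarrow> real^2 \<Rightarrow> real^2"
    and \<phi>0 :: "real^2 \<Rightarrow> real"
  assumes "L > 0" and "T > 0" and "\<epsilon> > 0"
    and "\<phi>0 \<in> L2 L"
    and "bounded (range (\<eta> \<epsilon>))"
    and "1-lipschitz_on UNIV (\<eta> \<epsilon>)"
  shows "(\<exists>\<phi>. weak_solution L T (\<eta> \<epsilon>) \<phi>0 \<phi>) \<and>
    (\<forall>\<phi> \<psi>. weak_solution L T (\<eta> \<epsilon>) \<phi>0 \<phi> \<and> weak_solution L T (\<eta> \<epsilon>) \<phi>0 \<psi> \<longrightarrow>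
        (\<forall>t\<in>{0..T}. AE x in torus L. \<phi> t x = \<psi> t x)) \<and>
    (\<forall>\<phi>. weak_solution L T (\<eta> \<epsilon>) \<phi>0 \<phi> \<longrightarrow>
        (\<forall>e>0. \<exists>\<delta>>0. \<forall>\<psi>0 \<psi>.
           \<psi>0 \<in> L2 L \<and> weak_solution L T (\<eta> \<epsilon>) \<psi>0 \<psi> \<and> L2_norm L (\<lambda>x. \<psi>0 x - \<phi>0 x) < \<delta> \<longrightarrow>
             bochner_Linf_norm T (L2_norm L) (\<lambda>t x. \<psi> t x - \<phi> t x) < ereal e \<and>
             bochner_L2_norm_sq T (Hm_norm L 2) (\<lambda>t x. \<psi> t x - \<phi> t x) < ennreal (e\<^sup>2)))"
proof -
  obtain Mb where Mb: "\<And>p. norm (\<eta> \<epsilon> p) \<le> Mb"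
    using \<open>bounded (range (\<eta> \<epsilon>))\<close> unfolding bounded_iff by auto
  interpret calmed_time L "\<eta> \<epsilon>" Mb T
  proof
    show "norm (\<eta> \<epsilon> p - \<eta> \<epsilon> q) \<le> norm (p - q)" for p q
      using lipschitz_onD[OF \<open>1-lipschitz_on UNIV (\<eta> \<epsilon>)\<close>, of p q] by (simp add: dist_norm)
  qed (use assms Mb in auto)
  show ?thesis
    using weak_solution_exists[OF \<open>\<phi>0 \<in> L2 L\<close>] weak_solution_unique[OF \<open>\<phi>0 \<in> L2 L\<close>]
      weak_solution_continuous_dependence[OF \<open>\<phi>0 \<in> L2 L\<close>]
    by blast
qed

end
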